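(* Let $H$ be a quasi-Hopf algebra, $\mathcal A$ an $H$-bimodule algebra, $(\mathfrak A,\rho,\Phi_\rho)$ a right $H$-comodule algebra and $(\mathfrak B,\lambda,\Phi_\lambda)$ a left $H$-comodule algebra. Then the generalized two-sided crossed product $\mathfrak A>\!\!\triangleleft\,\mathcal A\,\triangleright\!\!<\mathfrak B$ is isomorphic as an algebra to the generalized left diagonal crossed product $\mathcal A\bowtie(\mathfrak A\otimes\mathfrak B)$.
   Context: All algebras and spaces are over a field $k$, $\otimes=\otimes_k$; summation is understood. A quasi-bialgebra $(H,\Delta,\varepsilon,\Phi)$: a unital associative algebra $H$, algebra maps $\Delta:H\to H\otimes H$ ($\Delta(h)=h_1\otimes h_2$), $\varepsilon:H\to k$, and an invertible $\Phi=X^1\otimes X^2\otimes X^3\in H^{\otimes3}$, $\Phi^{-1}=x^1\otimes x^2\otimes x^3$, with $(id\otimes\Delta)(\Delta(h))=\Phi(\Delta\otimes id)(\Delta(h))\Phi^{-1}$, $(id\otimes\varepsilon)\Delta=id=(\varepsilon\otimes id)\Delta$, $(1\otimes\Phi)(id\otimes\Delta\otimes id)(\Phi)(\Phi\otimes1)=(id\otimes id\otimes\Delta)(\Phi)(\Delta\otimes id\otimes id)(\Phi)$, $(id\otimes\varepsilon\otimes id)(\Phi)=1\otimes1$. A quasi-Hopf algebra is a quasi-bialgebra with an algebra anti-automorphism $S$ (so $S$ is bijective) and $\alpha,\beta\in H$ such that $S(h_1)\alpha h_2=\varepsilon(h)\alpha$, $h_1\beta S(h_2)=\varepsilon(h)\beta$,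 $X^1\beta S(X^2)\alpha X^3=1$, $S(x^1)\alpha x^2\beta S(x^3)=1$; by rescaling one assumes $\varepsilon(\alpha)=\varepsilon(\beta)=1$ and $\varepsilon\circ S=\varepsilon$. Drinfeld twist: $f=f^1\otimes f^2=(S\otimes S)(\Delta^{cop}(x^1))\,\gamma\,\Delta(x^2\beta S(x^3))\in H\otimes H$, where $\Delta^{cop}(h)=h_2\otimes h_1$, $\gamma=S(A^2)\alpha A^3\otimes S(A^1)\alpha A^4$, $A^1\otimes A^2\otimes A^3\otimes A^4=(\Phi\otimes1)(\Delta\otimes id\otimes id)(\Phi^{-1})$; it is invertible. An $H$-bimodule algebra: an $H$-bimodule $\mathcal A$ with a bilinear multiplication and a two-sided unit $1_{\mathcal A}$ such that $(\varphi\varphi')\varphi''=(X^1\cdot\varphi\cdot x^1)[(X^2\cdot\varphi'\cdot x^2)(X^3\cdot\varphi''\cdot x^3)]$, $h\cdot(\varphi\varphi')=(h_1\cdot\varphi)(h_2\cdot\varphi')$, $(\varphi\varphi')\cdot h=(\varphi\cdot h_1)(\varphi'\cdot h_2)$, $h\cdot1_{\mathcal A}=\varepsilon(h)1_{\mathcal A}=1_{\mathcal A}\cdot h$. A right $H$-comodule algebra: a unital associative algebra $\mathfrak A$, an algebra map $\rho:\mathfrak A\to\mathfrak A\otimes H$, $\rho(a)=a_{\langle0\rangle}\otimes a_{\langle1\rangle}$, and an invertible $\Phi_\rho=\tilde X^1_\rho\otimes\tilde X^2_\rho\otimes\tilde X^3_\rho\in\mathfrak A\otimes H\otimes H$, $\Phi_\rho^{-1}=\tilde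 x^1_\rho\otimes\tilde x^2_\rho\otimes\tilde x^3_\rho$, with $\Phi_\rho(\rho\otimes id)(\rho(a))=(id\otimes\Delta)(\rho(a))\Phi_\rho$, $(1\otimes\Phi)(id\otimes\Delta\otimes id)(\Phi_\rho)(\Phi_\rho\otimes1)=(id\otimes id\otimes\Delta)(\Phi_\rho)(\rho\otimes id\otimes id)(\Phi_\rho)$, $(id\otimes\varepsilon)\rho=id$, $(id\otimes\varepsilon\otimes id)(\Phi_\rho)=(id\otimes id\otimes\varepsilon)(\Phi_\rho)=1\otimes1$. A left $H$-comodule algebra: a unital associative algebra $\mathfrak B$, an algebra map $\lambda:\mathfrak B\to H\otimes\mathfrak B$, $\lambda(b)=b_{[-1]}\otimes b_{[0]}$, and an invertible $\Phi_\lambda=\tilde X^1_\lambda\otimes\tilde X^2_\lambda\otimes\tilde X^3_\lambda\in H\otimes H\otimes\mathfrak B$, $\Phi_\lambda^{-1}=\tilde x^1_\lambda\otimes\tilde x^2_\lambda\otimes\tilde x^3_\lambda$, with $(id\otimes\lambda)(\lambda(b))\Phi_\lambda=\Phi_\lambda(\Delta\otimes id)(\lambda(b))$, $(1\otimes\Phi_\lambda)(id\otimes\Delta\otimes id)(\Phi_\lambda)(\Phi\otimes1)=(id\otimes id\otimes\lambda)(\Phi_\lambda)(\Delta\otimes id\otimes id)(\Phi_\lambda)$, $(\varepsilon\otimes id)\lambda=id$, $(id\otimes\varepsilon\otimes id)(\Phi_\lambda)=(\varepsilon\otimes id\otimes id)(\Phi_\lambda)=1\otimes1$. An $H$-bicomodule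 algebra $(\mathbb A,\lambda,\rho,\Phi_\lambda,\Phi_\rho,\Phi_{\lambda,\rho})$: $(\mathbb A,\lambda,\Phi_\lambda)$ is a left and $(\mathbb A,\rho,\Phi_\rho)$ a right $H$-comodule algebra, and $\Phi_{\lambda,\rho}\in H\otimes\mathbb A\otimes H$ is invertible, $\Phi_{\lambda,\rho}^{-1}=\theta^1\otimes\theta^2\otimes\theta^3$, with $\Phi_{\lambda,\rho}(\lambda\otimes id)(\rho(u))=(id\otimes\rho)(\lambda(u))\Phi_{\lambda,\rho}$, $(1\otimes\Phi_{\lambda,\rho})(id\otimes\lambda\otimes id)(\Phi_{\lambda,\rho})(\Phi_\lambda\otimes1)=(id\otimes id\otimes\rho)(\Phi_\lambda)(\Delta\otimes id\otimes id)(\Phi_{\lambda,\rho})$, $(1\otimes\Phi_\rho)(id\otimes\rho\otimes id)(\Phi_{\lambda,\rho})(\Phi_{\lambda,\rho}\otimes1)=(id\otimes id\otimes\Delta)(\Phi_{\lambda,\rho})(\lambda\otimes id\otimes id)(\Phi_\rho)$. Iterated indices mean successive application of $\lambda,\rho,\Delta$. Generalized left diagonal crossed product: for an $H$-bicomodule algebra $\mathbb A$ put $\Omega=\Omega^1\otimes\cdots\otimes\Omega^5=(\tilde X^1_\rho)_{[-1]_1}\tilde x^1_\lambda\theta^1\otimes(\tilde X^1_\rho)_{[-1]_2}\tilde x^2_\lambda\theta^2_{[-1]}\otimes(\tilde X^1_\rho)_{[0]}\tilde x^3_\lambda\theta^2_{[0]}\otimes S^{-1}(f^1\tilde X^2_\rho\theta^3)\otimes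 S^{-1}(f^2\tilde X^3_\rho)$; then $\mathcal A\bowtie\mathbb A$ is $\mathcal A\otimes\mathbb A$ with the (associative, unital) multiplication $(\varphi\bowtie u)(\varphi'\bowtie u')=(\Omega^1\cdot\varphi\cdot\Omega^5)(\Omega^2u_{\langle0\rangle_{[-1]}}\cdot\varphi'\cdot S^{-1}(u_{\langle1\rangle})\Omega^4)\bowtie\Omega^3u_{\langle0\rangle_{[0]}}u'$. $\mathfrak A\otimes\mathfrak B$ is an $H$-bicomodule algebra with $\rho(a\otimes b)=(a_{\langle0\rangle}\otimes b)\otimes a_{\langle1\rangle}$, $\lambda(a\otimes b)=b_{[-1]}\otimes(a\otimes b_{[0]})$, $\Phi_\rho=(\tilde X^1_\rho\otimes1_{\mathfrak B})\otimes\tilde X^2_\rho\otimes\tilde X^3_\rho$, $\Phi_\lambda=\tilde X^1_\lambda\otimes\tilde X^2_\lambda\otimes(1_{\mathfrak A}\otimes\tilde X^3_\lambda)$, $\Phi_{\lambda,\rho}=1_H\otimes(1_{\mathfrak A}\otimes1_{\mathfrak B})\otimes1_H$. Generalized two-sided crossed product: $\mathfrak A>\!\!\triangleleft\,\mathcal A\,\triangleright\!\!<\mathfrak B$ is $\mathfrak A\otimes\mathcal A\otimes\mathfrak B$ with the (associative, unital) multiplication $(a>\!\!\triangleleft\varphi\triangleright\!\!<b)(a'>\!\!\triangleleft\varphi'\triangleright\!\!<b')=aa'_{\langle0\rangle}\tilde x^1_\rho>\!\!\triangleleft(\tilde x^1_\lambda\cdot\varphi\cdot a'_{\langle1\rangle}\tilde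 x^2_\rho)(\tilde x^2_\lambda b_{[-1]}\cdot\varphi'\cdot\tilde x^3_\rho)\triangleright\!\!<\tilde x^3_\lambda b_{[0]}b'$. *)

theory Defs
  imports Complex_Main "HOL-Algebra.Group"
begin

section \<open>Vector spaces, algebras and tensor products over a field\<close>

text \<open>
  A space over the field \<open>'k\<close> is a subspace (the carrier) of an ambient \<open>'k\<close>-vector space, which
  is a whole type; addition is that of the type.  Carriers are needed because the tensor product of
  two spaces depends on their scalar multiplications, so it cannot be a type constructor.  The
  records carry a multiplication and a unit; no axiom (not even associativity) is part of the record.
\<close>

record ('k, 'a) kalg = "'a monoid" +
  scl :: "'k \<Rightarrow> 'a \<Rightarrow> 'a"

definition kspace :: "('k::field, 'a::ab_group_add, 'm) kalg_scheme \<Rightarrow> bool" where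
  "kspace A \<longleftrightarrow> vector_space (scl A) \<and> module.subspace (scl A) (carrier A)"

definition klin ::
  "('k::field, 'a::ab_group_add, 'm) kalg_scheme \<Rightarrow> ('k, 'b::ab_group_add, 'n) kalg_scheme \<Rightarrow> ('a \<Rightarrow> 'b) \<Rightarrow> bool" where
  "klin A B f \<longleftrightarrow> f \<in> carrier A \<rightarrow> carrier B \<and>
     (\<forall>x\<in>carrier A. \<forall>y\<in>carrier A. f (x + y) = f x + f y) \<and>
     (\<forall>c. \<forall>x\<in>carrier A. f (scl A c x) = scl B c (f x))"

definition kbilin ::
  "('k::field, 'a::ab_group_add, 'm) kalg_scheme \<Rightarrow> ('k, 'b::ab_group_add, 'n) kalg_scheme \<Rightarrow>
   ('k, 'c::ab_group_add, 'o) kalg_scheme \<Rightarrow> ('a \<Rightarrow> 'b \<Rightarrow> 'c) \<Rightarrow> bool" where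
  "kbilin A B C f \<longleftrightarrow>
     (\<forall>x\<in>carrier A. klin B C (f x)) \<and> (\<forall>y\<in>carrier B. klin A C (\<lambda>x. f x y))"

definition kalgebra :: "('k::field, 'a::ab_group_add, 'm) kalg_scheme \<Rightarrow> bool" where
  "kalgebra A \<longleftrightarrow> kspace A \<and> monoid A \<and> kbilin A A A (mult A)"

definition kalg_hom ::
  "('k::field, 'a::ab_group_add, 'm) kalg_scheme \<Rightarrow> ('k, 'b::ab_group_add, 'n) kalg_scheme \<Rightarrow> ('a \<Rightarrow> 'b) set" where
  "kalg_hom A B = {f \<in> hom A B. klin A B f \<and> f \<one>\<^bsub>A\<^esub> = \<one>\<^bsub>B\<^esub>}"

definition kalg_isomorphic ::
  "('k::field, 'a::ab_group_add, 'm) kalg_scheme \<Rightarrow> ('k, 'b::ab_group_add, 'n) kalg_scheme \<Rightarrow> bool" where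
  "kalg_isomorphic A B \<longleftrightarrow> (\<exists>f \<in> kalg_hom A B. bij_betw f (carrier A) (carrier B))"

definition base_field :: "('k::field, 'k) kalg" where
  "base_field = \<lparr>carrier = UNIV, mult = (*), one = 1, scl = (*)\<rparr>"

text \<open>
  The element \<open>\<Sum> x\<^sub>i \<otimes> y\<^sub>i\<close> of the tensor product is realized as the functional
  \<open>b \<mapsto> \<Sum> b x\<^sub>i y\<^sub>i\<close> on bilinear forms (over a field these functionals separate the elements of the
  tensor product).  The theorem \<open>tensor_universal\<close> below confirms the universal property.
\<close>

typedef ('a, 'b, 'k) tens = "UNIV :: (('a \<Rightarrow> 'b \<Rightarrow> 'k) \<Rightarrow> 'k) set"
  morphisms teval Tens ..

lemma teval_Tens [simp]: "teval (Tens f) b = f b"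
  by (simp add: Tens_inverse)

lemma tens_eq_iff: "s = t \<longleftrightarrow> (\<forall>b. teval s b = teval t b)"
  by (metis teval_inject ext)

instantiation tens :: (type, type, ab_group_add) ab_group_add
begin

definition "0 = Tens (\<lambda>b. 0)"
definition "s + t = Tens (\<lambda>b. teval s b + teval t b)"
definition "- t = Tens (\<lambda>b. - teval t b)"
definition "(s :: ('a, 'b, 'c) tens) - t = Tens (\<lambda>b. teval s b - teval t b)"

instance
  by standard
    (simp_all add: zero_tens_def plus_tens_def uminus_tens_def minus_tens_def tens_eq_iff)

end

lemma teval_simps [simp]:
  "teval 0 b = 0" "teval (s + t) b = teval s b + teval t b"
  by (simp_all add: zero_tens_def plus_tens_def)

lemma teval_sum_list: "teval (\<Sum>x\<leftarrow>xs. F x) b = (\<Sum>x\<leftarrow>xs. teval (F x) b)"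
  by (induction xs) simp_all

definition pt ::
  "('k::field, 'a::ab_group_add, 'm) kalg_scheme \<Rightarrow> ('k, 'b::ab_group_add, 'n) kalg_scheme \<Rightarrow>
   'a \<Rightarrow> 'b \<Rightarrow> ('a, 'b, 'k) tens" where
  "pt A B x y = Tens (\<lambda>b. if kbilin A B base_field b then b x y else 0)"

definition trep ::
  "('k::field, 'a::ab_group_add, 'm) kalg_scheme \<Rightarrow> ('k, 'b::ab_group_add, 'n) kalg_scheme \<Rightarrow>
   ('a, 'b, 'k) tens \<Rightarrow> ('a \<times> 'b) list \<Rightarrow> bool" where
  "trep A B t xys \<longleftrightarrow>
     set xys \<subseteq> carrier A \<times> carrier B \<and> t = (\<Sum>(x, y)\<leftarrow>xys. pt A B x y)"

text \<open>
  Sweedler-type notation with the summation made explicit: for \<open>t = \<Sum> x\<^sub>i \<otimes> y\<^sub>i\<close> and bilinear \<open>F\<close>,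
  \<open>sw A B t F = \<Sum> F x\<^sub>i y\<^sub>i\<close>; by \<open>tensor_universal\<close> the choice of the representation is immaterial.
\<close>

definition sw ::
  "('k::field, 'a::ab_group_add, 'm) kalg_scheme \<Rightarrow> ('k, 'b::ab_group_add, 'n) kalg_scheme \<Rightarrow>
   ('a, 'b, 'k) tens \<Rightarrow> ('a \<Rightarrow> 'b \<Rightarrow> 'c::ab_group_add) \<Rightarrow> 'c" where
  "sw A B t F = (\<Sum>(x, y)\<leftarrow>(SOME xys. trep A B t xys). F x y)"

definition tensor ::
  "('k::field, 'a::ab_group_add, 'm) kalg_scheme \<Rightarrow> ('k, 'b::ab_group_add, 'n) kalg_scheme \<Rightarrow>
   ('k, ('a, 'b, 'k) tens) kalg"  (infixl "\<boxtimes>" 70) where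
  "A \<boxtimes> B = \<lparr>carrier = {t. \<exists>xys. trep A B t xys},
     mult = (\<lambda>s t. sw A B s (\<lambda>x y. sw A B t (\<lambda>x' y'. pt A B (x \<otimes>\<^bsub>A\<^esub> x') (y \<otimes>\<^bsub>B\<^esub> y')))),
     one = pt A B \<one>\<^bsub>A\<^esub> \<one>\<^bsub>B\<^esub>,
     scl = (\<lambda>c t. Tens (\<lambda>b. c * teval t b))\<rparr>"

lemma base_field_simps [simp]:
  "carrier base_field = UNIV" "mult base_field = (*)" "one base_field = 1" "scl base_field = (*)"
  by (simp_all add: base_field_def)

lemma tensor_simps:
  "t \<in> carrier (A \<boxtimes> B) \<longleftrightarrow> (\<exists>xys. trep A B t xys)"
  "scl (A \<boxtimes> B) c t = Tens (\<lambda>b. c * teval t b)"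
  by (simp_all add: tensor_def)

lemma trep_eval:
  assumes "trep A B t xys" "kbilin A B base_field b"
  shows "teval t b = (\<Sum>(x, y)\<leftarrow>xys. b x y)"
  using assms by (auto simp: trep_def teval_sum_list pt_def case_prod_unfold)

lemma trep_eval0:
  assumes "trep A B t xys" "\<not> kbilin A B base_field b"
  shows "teval t b = 0"
  using assms by (auto simp: trep_def teval_sum_list pt_def case_prod_unfold)

lemma kspaceD:
  assumes "kspace A"
  shows "vector_space (scl A)" "0 \<in> carrier A"
    "x \<in> carrier A \<Longrightarrow> y \<in> carrier A \<Longrightarrow> x + y \<in> carrier A"
    "x \<in> carrier A \<Longrightarrow> scl A c x \<in> carrier A"
proof -
  interpret vector_space "scl A" using assms by (simp add: kspace_def)
  show "vector_space (scl A)" by unfold_locales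
  show "0 \<in> carrier A" "x \<in> carrier A \<Longrightarrow> y \<in> carrier A \<Longrightarrow> x + y \<in> carrier A"
    "x \<in> carrier A \<Longrightarrow> scl A c x \<in> carrier A"
    using assms by (auto simp: kspace_def subspace_def)
qed

lemma separating_form:
  fixes s :: "'k::field \<Rightarrow> 'a::ab_group_add \<Rightarrow> 'a"
  assumes "vector_space s" "x \<noteq> 0"
  obtains g :: "'a \<Rightarrow> 'k" where "\<And>u v. g (u + v) = g u + g v" "\<And>c u. g (s c u) = c * g u" "g x = 1"
proof -
  interpret V: vector_space s by fact
  interpret K: vector_space "(*) :: 'k \<Rightarrow> 'k \<Rightarrow> 'k"
    by unfold_locales (simp_all add: algebra_simps)
  interpret vector_space_pair s "(*) :: 'k \<Rightarrow> 'k \<Rightarrow> 'k" ..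
  have "V.independent {x}" using assms(2) by simp
  from linear_independent_extend[OF this, of "\<lambda>_. 1"]
  obtain g where g: "Vector_Spaces.linear s (*) g" "g x = 1" by auto
  interpret g: Vector_Spaces.linear s "(*)" g by (fact g(1))
  show ?thesis using that[of g] g.add g.scale g(2) by blast
qed

lemma sum_list_linear:
  fixes h :: "'a::ab_group_add \<Rightarrow> 'b::ab_group_add"
  assumes "\<And>u v. h (u + v) = h u + h v"
  shows "h (\<Sum>x\<leftarrow>xs. F x) = (\<Sum>x\<leftarrow>xs. h (F x))"
proof -
  have "h 0 = 0" using assms[of 0 0] by simp
  then show ?thesis by (induction xs) (simp_all add: assms)
qed

lemma kbilin_compose_form:
  assumes "kbilin A B P b" "\<And>u v. g (u + v) = g u + g v" "\<And>c u. g (scl P c u) = c * g u"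
  shows "kbilin A B base_field (\<lambda>x y. g (b x y))"
  using assms unfolding kbilin_def klin_def by simp

lemma trep_unique_sum:
  assumes "kspace P" "kbilin A B P b" "trep A B t xys" "trep A B t xys'"
  shows "(\<Sum>(x, y)\<leftarrow>xys. b x y) = (\<Sum>(x, y)\<leftarrow>xys'. b x y)"
proof (rule ccontr)
  let ?p = "\<Sum>(x, y)\<leftarrow>xys. b x y" and ?q = "\<Sum>(x, y)\<leftarrow>xys'. b x y"
  assume "?p \<noteq> ?q"
  then have "?p - ?q \<noteq> 0" by simp
  then obtain g where g: "\<And>u v. g (u + v) = g u + g v" "\<And>c u. g (scl P c u) = c * g u" "g (?p - ?q) = 1"
    using separating_form[OF kspaceD(1)[OF assms(1)]] by blast
  have b: "kbilin A B base_field (\<lambda>x y. g (b x y))"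
    by (rule kbilin_compose_form[OF assms(2) g(1,2)])
  have "g ?p = g ?q"
    using trep_eval[OF assms(3) b] trep_eval[OF assms(4) b]
    by (simp add: sum_list_linear[OF g(1)] case_prod_unfold)
  moreover have "g ?p = g (?p - ?q) + g ?q" using g(1)[of "?p - ?q" ?q] by simp
  ultimately show False using g(3) by simp
qed

lemma sw_eq:
  assumes "kspace P" "kbilin A B P b" "trep A B t xys"
  shows "sw A B t b = (\<Sum>(x, y)\<leftarrow>xys. b x y)"
  unfolding sw_def by (rule trep_unique_sum[OF assms(1,2) _ assms(3)]) (rule someI, fact assms(3))

lemma trep_append:
  assumes "trep A B s xs" "trep A B t ys"
  shows "trep A B (s + t) (xs @ ys)"
  using assms by (auto simp: trep_def)

lemma trep_scale:
  assumes "kspace A" "trep A B t xys"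
  shows "trep A B (Tens (\<lambda>b. c * teval t b)) (map (\<lambda>(x, y). (scl A c x, y)) xys)"
proof -
  have "c * teval t b = (\<Sum>(x, y)\<leftarrow>xys. teval (pt A B (scl A c x) y) b)" for b
  proof (cases "kbilin A B base_field b")
    case True
    have "set xys \<subseteq> carrier A \<times> carrier B" using assms(2) by (simp add: trep_def)
    then have "c * (\<Sum>(x, y)\<leftarrow>xys. b x y) = (\<Sum>(x, y)\<leftarrow>xys. b (scl A c x) y)"
      using True by (induction xys) (auto simp: kbilin_def klin_def distrib_left)
    then show ?thesis using True trep_eval[OF assms(2) True] by (simp add: pt_def)
  next
    case False
    then show ?thesis using trep_eval0[OF assms(2) False] by (simp add: pt_def case_prod_unfold)
  qed
  then show ?thesis
    using assms kspaceD(4)[OF assms(1)]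
    by (auto simp: trep_def tens_eq_iff teval_sum_list case_prod_unfold o_def)
qed

lemma trep_pt:
  assumes "x \<in> carrier A" "y \<in> carrier B"
  shows "trep A B (pt A B x y) [(x, y)]"
  using assms by (simp add: trep_def)

lemma kspace_tensor:
  assumes "kspace A"
  shows "kspace (A \<boxtimes> B)"
proof -
  interpret vector_space "scl (A \<boxtimes> B)"
    by unfold_locales (simp_all add: tensor_simps tens_eq_iff algebra_simps)
  have "trep A B 0 []" by (simp add: trep_def)
  then have "subspace (carrier (A \<boxtimes> B))"
    unfolding subspace_def using trep_append trep_scale[OF assms] by (fastforce simp: tensor_simps)
  then show ?thesis by (simp add: kspace_def vector_space_axioms)
qed

theorem kbilin_pt:
  assumes "kspace A" "kspace B"
  shows "kbilin A B (A \<boxtimes> B) (pt A B)"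
proof -
  note A = kspaceD(3,4)[OF assms(1)] and B = kspaceD(3,4)[OF assms(2)]
  have "pt A B x y \<in> carrier (A \<boxtimes> B)" if "x \<in> carrier A" "y \<in> carrier B" for x y
    using trep_pt[OF that] by (auto simp: tensor_simps)
  moreover have "pt A B x (y + y') = pt A B x y + pt A B x y'"
    "pt A B x (scl B c y) = scl (A \<boxtimes> B) c (pt A B x y)"
    if "x \<in> carrier A" "y \<in> carrier B" "y' \<in> carrier B" for x y y' c
    using that A B by (auto simp: pt_def tens_eq_iff tensor_simps kbilin_def klin_def)
  moreover have "pt A B (x + x') y = pt A B x y + pt A B x' y"
    "pt A B (scl A c x) y = scl (A \<boxtimes> B) c (pt A B x y)"
    if "x \<in> carrier A" "x' \<in> carrier A" "y \<in> carrier B" for x x' y c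
    using that A B by (auto simp: pt_def tens_eq_iff tensor_simps kbilin_def klin_def)
  ultimately show ?thesis by (simp add: kbilin_def klin_def Pi_def)
qed

theorem tensor_universal:
  assumes "kspace A" "kspace B" "kspace P" "kbilin A B P b"
  shows "klin (A \<boxtimes> B) P (\<lambda>t. sw A B t b)"
    and "\<And>x y. x \<in> carrier A \<Longrightarrow> y \<in> carrier B \<Longrightarrow> sw A B (pt A B x y) b = b x y"
    and "\<And>h t. klin (A \<boxtimes> B) P h \<Longrightarrow> (\<And>x y. x \<in> carrier A \<Longrightarrow> y \<in> carrier B \<Longrightarrow> h (pt A B x y) = b x y)
           \<Longrightarrow> t \<in> carrier (A \<boxtimes> B) \<Longrightarrow> h t = sw A B t b"
proof -
  note sw = sw_eq[OF assms(3,4)]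
  have sum_mem: "(\<Sum>(x, y)\<leftarrow>xys. b x y) \<in> carrier P" if "set xys \<subseteq> carrier A \<times> carrier B" for xys
  proof -
    have "b x y \<in> carrier P" if "x \<in> carrier A" "y \<in> carrier B" for x y
      using that assms(4) by (auto simp: kbilin_def klin_def)
    then show ?thesis using that kspaceD(2,3)[OF assms(3)] by (induction xys) auto
  qed
  interpret P: vector_space "scl P" by (rule kspaceD(1)[OF assms(3)])
  show "klin (A \<boxtimes> B) P (\<lambda>t. sw A B t b)"
    unfolding klin_def
  proof (intro conjI ballI allI)
    show "(\<lambda>t. sw A B t b) \<in> carrier (A \<boxtimes> B) \<rightarrow> carrier P"
      using sw sum_mem by (auto simp: tensor_simps trep_def)
  next
    fix s t assume "s \<in> carrier (A \<boxtimes> B)" "t \<in> carrier (A \<boxtimes> B)"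
    then obtain xs ys where "trep A B s xs" "trep A B t ys" by (auto simp: tensor_simps)
    then show "sw A B (s + t) b = sw A B s b + sw A B t b"
      using trep_append[of A B s xs t ys] by (simp add: sw)
  next
    fix c t assume "t \<in> carrier (A \<boxtimes> B)"
    then obtain xs where xs: "trep A B t xs" by (auto simp: tensor_simps)
    have "(\<Sum>(x, y)\<leftarrow>xs. b (scl A c x) y) = scl P c (\<Sum>(x, y)\<leftarrow>xs. b x y)"
      if "set xs \<subseteq> carrier A \<times> carrier B"
      using that assms(4) by (induction xs) (auto simp: kbilin_def klin_def P.scale_right_distrib)
    then show "sw A B (scl (A \<boxtimes> B) c t) b = scl P c (sw A B t b)"
      using sw[OF trep_scale[OF assms(1) xs, of c]] sw[OF xs] xs[unfolded trep_def, THEN conjunct1]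
      by (simp add: tensor_simps case_prod_unfold o_def)
  qed
  show "sw A B (pt A B x y) b = b x y" if "x \<in> carrier A" "y \<in> carrier B" for x y
    using sw[OF trep_pt[OF that]] by simp
  show "h t = sw A B t b"
    if h: "klin (A \<boxtimes> B) P h" and hp: "\<And>x y. x \<in> carrier A \<Longrightarrow> y \<in> carrier B \<Longrightarrow> h (pt A B x y) = b x y"
      and t: "t \<in> carrier (A \<boxtimes> B)" for h t
  proof -
    obtain xys where xys: "trep A B t xys" using t by (auto simp: tensor_simps)
    have h0: "h 0 = 0"
    proof -
      have "0 \<in> carrier (A \<boxtimes> B)" by (rule kspaceD(2)[OF kspace_tensor[OF assms(1)]])
      then have "h (0 + 0) = h 0 + h 0" using h unfolding klin_def by blast
      then show ?thesis by simp
    qed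
    have "set xs \<subseteq> carrier A \<times> carrier B \<Longrightarrow>
        h (\<Sum>(x, y)\<leftarrow>xs. pt A B x y) = (\<Sum>(x, y)\<leftarrow>xs. b x y)" for xs
    proof (induction xs)
      case Nil
      then show ?case by (simp add: h0)
    next
      case (Cons p xs)
      obtain x y where p: "p = (x, y)" by (cases p)
      have "pt A B x y \<in> carrier (A \<boxtimes> B)"
        using Cons.prems p trep_pt[of x A y B] by (auto simp: tensor_simps)
      moreover have "(\<Sum>(x, y)\<leftarrow>xs. pt A B x y) \<in> carrier (A \<boxtimes> B)"
        using Cons.prems by (auto simp: tensor_simps trep_def)
      ultimately have "h (pt A B x y + (\<Sum>(x, y)\<leftarrow>xs. pt A B x y)) =
          h (pt A B x y) + h (\<Sum>(x, y)\<leftarrow>xs. pt A B x y)"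
        using h unfolding klin_def by blast
      then show ?case using Cons p hp by simp
    qed
    then show ?thesis using xys sw[OF xys] by (simp add: trep_def)
  qed
qed

subsection \<open>Iterated tensor products\<close>

text \<open>
  Tensor products of several factors are nested to the left: \<open>A \<boxtimes> B \<boxtimes> C = (A \<boxtimes> B) \<boxtimes> C\<close>, etc.
  Maps such as \<open>id \<otimes> \<Delta>\<close> below land in the left-nested product.
\<close>

definition "pt3 A B C x y z = pt (A \<boxtimes> B) C (pt A B x y) z"
definition "pt4 A B C D x y z u = pt (A \<boxtimes> B \<boxtimes> C) D (pt3 A B C x y z) u"
definition "pt5 A B C D E x y z u v = pt (A \<boxtimes> B \<boxtimes> C \<boxtimes> D) E (pt4 A B C D x y z u) v"

definition "sw3 A B C t F = sw (A \<boxtimes> B) C t (\<lambda>s z. sw A B s (\<lambda>x y. F x y z))"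
definition "sw4 A B C D t F = sw (A \<boxtimes> B \<boxtimes> C) D t (\<lambda>s u. sw3 A B C s (\<lambda>x y z. F x y z u))"
definition "sw5 A B C D E t F =
  sw (A \<boxtimes> B \<boxtimes> C \<boxtimes> D) E t (\<lambda>s v. sw4 A B C D s (\<lambda>x y z u. F x y z u v))"

text \<open>
  \<open>splitIofN\<close> applies a map from the \<open>I\<close>-th of \<open>N\<close> tensor factors to a tensor product \<open>P \<boxtimes> Q\<close>, e.g.
  \<open>split2of3 A B C P Q f\<close> is \<open>id \<otimes> f \<otimes> id : A \<boxtimes> B \<boxtimes> C \<rightarrow> A \<boxtimes> P \<boxtimes> Q \<boxtimes> C\<close>.
\<close>

definition "split1of2 A B P Q f t = sw A B t (\<lambda>x y. sw P Q (f x) (\<lambda>p q. pt3 P Q B p q y))"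
definition "split2of2 A B P Q f t = sw A B t (\<lambda>x y. sw P Q (f y) (\<lambda>p q. pt3 A P Q x p q))"
definition "split1of3 A B C P Q f t =
  sw3 A B C t (\<lambda>x y z. sw P Q (f x) (\<lambda>p q. pt4 P Q B C p q y z))"
definition "split2of3 A B C P Q f t =
  sw3 A B C t (\<lambda>x y z. sw P Q (f y) (\<lambda>p q. pt4 A P Q C x p q z))"
definition "split3of3 A B C P Q f t =
  sw3 A B C t (\<lambda>x y z. sw P Q (f z) (\<lambda>p q. pt4 A B P Q x y p q))"

definition "one_l A B C D t = sw3 B C D t (\<lambda>x y z. pt4 A B C D \<one>\<^bsub>A\<^esub> x y z)"  \<comment> \<open>\<open>1 \<otimes> t\<close>\<close>
definition "one_r A B C D t = pt (A \<boxtimes> B \<boxtimes> C) D t \<one>\<^bsub>D\<^esub>"  \<comment> \<open>\<open>t \<otimes> 1\<close>\<close>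

section \<open>Quasi-Hopf algebras\<close>

record ('k, 'h) qbialg = "('k, 'h) kalg" +
  comul :: "'h \<Rightarrow> ('h, 'h, 'k) tens"
  counit :: "'h \<Rightarrow> 'k"
  reassoc :: "(('h, 'h, 'k) tens, 'h, 'k) tens"

definition quasi_bialgebra :: "('k::field, 'h::ab_group_add, 'm) qbialg_scheme \<Rightarrow> bool" where
  "quasi_bialgebra H \<longleftrightarrow>
     (let \<Delta> = comul H; \<epsilon> = counit H; \<Phi> = reassoc H; H3 = H \<boxtimes> H \<boxtimes> H; H4 = H3 \<boxtimes> H in
      kalgebra H \<and> \<Delta> \<in> kalg_hom H (H \<boxtimes> H) \<and> \<epsilon> \<in> kalg_hom H base_field \<and> \<Phi> \<in> Units H3 \<and>
      (\<forall>h\<in>carrier H. split2of2 H H H H \<Delta> (\<Delta> h) =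
         \<Phi> \<otimes>\<^bsub>H3\<^esub> split1of2 H H H H \<Delta> (\<Delta> h) \<otimes>\<^bsub>H3\<^esub> inv\<^bsub>H3\<^esub> \<Phi>) \<and>
      (\<forall>h\<in>carrier H. sw H H (\<Delta> h) (\<lambda>h1 h2. scl H (\<epsilon> h2) h1) = h) \<and>
      (\<forall>h\<in>carrier H. sw H H (\<Delta> h) (\<lambda>h1 h2. scl H (\<epsilon> h1) h2) = h) \<and>
      one_l H H H H \<Phi> \<otimes>\<^bsub>H4\<^esub> split2of3 H H H H H \<Delta> \<Phi> \<otimes>\<^bsub>H4\<^esub> one_r H H H H \<Phi> =
        split3of3 H H H H H \<Delta> \<Phi> \<otimes>\<^bsub>H4\<^esub> split1of3 H H H H H \<Delta> \<Phi> \<and>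
      sw3 H H H \<Phi> (\<lambda>x y z. scl (H \<boxtimes> H) (\<epsilon> y) (pt H H x z)) = \<one>\<^bsub>H \<boxtimes> H\<^esub>)"

record ('k, 'h) qhopf = "('k, 'h) qbialg" +
  antipode :: "'h \<Rightarrow> 'h"
  alpha :: 'h
  beta :: 'h

text \<open>The last line contains the usual normalization, achieved by rescaling \<open>\<alpha>\<close> and \<open>\<beta>\<close>.\<close>

definition quasi_hopf_algebra :: "('k::field, 'h::ab_group_add, 'm) qhopf_scheme \<Rightarrow> bool" where
  "quasi_hopf_algebra H \<longleftrightarrow>
     (let \<Delta> = comul H; \<epsilon> = counit H; \<Phi> = reassoc H; S = antipode H; \<alpha> = alpha H; \<beta> = beta H in
      quasi_bialgebra H \<and>
      klin H H S \<and> bij_betw S (carrier H) (carrier H) \<and> S \<one>\<^bsub>H\<^esub> = \<one>\<^bsub>H\<^esub> \<and>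
      (\<forall>g\<in>carrier H. \<forall>h\<in>carrier H. S (g \<otimes>\<^bsub>H\<^esub> h) = S h \<otimes>\<^bsub>H\<^esub> S g) \<and>
      \<alpha> \<in> carrier H \<and> \<beta> \<in> carrier H \<and>
      (\<forall>h\<in>carrier H. sw H H (\<Delta> h) (\<lambda>h1 h2. S h1 \<otimes>\<^bsub>H\<^esub> \<alpha> \<otimes>\<^bsub>H\<^esub> h2) = scl H (\<epsilon> h) \<alpha>) \<and>
      (\<forall>h\<in>carrier H. sw H H (\<Delta> h) (\<lambda>h1 h2. h1 \<otimes>\<^bsub>H\<^esub> \<beta> \<otimes>\<^bsub>H\<^esub> S h2) = scl H (\<epsilon> h) \<beta>) \<and>
      sw3 H H H \<Phi> (\<lambda>X1 X2 X3. X1 \<otimes>\<^bsub>H\<^esub> \<beta> \<otimes>\<^bsub>H\<^esub> S X2 \<otimes>\<^bsub>H\<^esub> \<alpha> \<otimes>\<^bsub>H\<^esub> X3) = \<one>\<^bsub>H\<^esub> \<and>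
      sw3 H H H (inv\<^bsub>H \<boxtimes> H \<boxtimes> H\<^esub> \<Phi>)
        (\<lambda>x1 x2 x3. S x1 \<otimes>\<^bsub>H\<^esub> \<alpha> \<otimes>\<^bsub>H\<^esub> x2 \<otimes>\<^bsub>H\<^esub> \<beta> \<otimes>\<^bsub>H\<^esub> S x3) = \<one>\<^bsub>H\<^esub> \<and>
      \<epsilon> \<alpha> = 1 \<and> \<epsilon> \<beta> = 1 \<and> (\<forall>h\<in>carrier H. \<epsilon> (S h) = \<epsilon> h))"

definition antipode_inv :: "('k, 'h, 'm) qhopf_scheme \<Rightarrow> 'h \<Rightarrow> 'h" where
  "antipode_inv H = inv_into (carrier H) (antipode H)"

definition drinfeld_gamma ::
  "('k::field, 'h::ab_group_add, 'm) qhopf_scheme \<Rightarrow> ('h, 'h, 'k) tens" where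
  "drinfeld_gamma H =
     (let H3 = H \<boxtimes> H \<boxtimes> H; \<Phi> = reassoc H; S = antipode H; \<alpha> = alpha H in
      sw4 H H H H
        (one_r H H H H \<Phi> \<otimes>\<^bsub>H3 \<boxtimes> H\<^esub> split1of3 H H H H H (comul H) (inv\<^bsub>H3\<^esub> \<Phi>))
        (\<lambda>A1 A2 A3 A4. pt H H (S A2 \<otimes>\<^bsub>H\<^esub> \<alpha> \<otimes>\<^bsub>H\<^esub> A3) (S A1 \<otimes>\<^bsub>H\<^esub> \<alpha> \<otimes>\<^bsub>H\<^esub> A4)))"

definition drinfeld_twist ::
  "('k::field, 'h::ab_group_add, 'm) qhopf_scheme \<Rightarrow> ('h, 'h, 'k) tens" where
  "drinfeld_twist H =
     (let \<Delta> = comul H; S = antipode H in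
      sw3 H H H (inv\<^bsub>H \<boxtimes> H \<boxtimes> H\<^esub> (reassoc H)) (\<lambda>x1 x2 x3.
        sw H H (\<Delta> x1) (\<lambda>h1 h2. pt H H (S h2) (S h1))
          \<otimes>\<^bsub>H \<boxtimes> H\<^esub> drinfeld_gamma H
          \<otimes>\<^bsub>H \<boxtimes> H\<^esub> \<Delta> (x2 \<otimes>\<^bsub>H\<^esub> beta H \<otimes>\<^bsub>H\<^esub> S x3)))"

section \<open>Bimodule, comodule and bicomodule algebras\<close>

record ('k, 'p, 'h) bimod_alg = "('k, 'p) kalg" +
  lact :: "'h \<Rightarrow> 'p \<Rightarrow> 'p"
  ract :: "'p \<Rightarrow> 'h \<Rightarrow> 'p"

definition bimodule_algebra ::
  "('k::field, 'h::ab_group_add, 'm) qbialg_scheme \<Rightarrow> ('k, 'p::ab_group_add, 'h, 'n) bimod_alg_scheme \<Rightarrow> bool" where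
  "bimodule_algebra H P \<longleftrightarrow>
     (let \<Delta> = comul H; \<epsilon> = counit H; \<Phi> = reassoc H; L = lact P; R = ract P in
      kspace P \<and> kbilin H P P L \<and> kbilin P H P R \<and>
      (\<forall>x\<in>carrier P. L \<one>\<^bsub>H\<^esub> x = x \<and> R x \<one>\<^bsub>H\<^esub> = x) \<and>
      (\<forall>g\<in>carrier H. \<forall>h\<in>carrier H. \<forall>x\<in>carrier P.
         L g (L h x) = L (g \<otimes>\<^bsub>H\<^esub> h) x \<and> R (R x g) h = R x (g \<otimes>\<^bsub>H\<^esub> h) \<and>
         R (L g x) h = L g (R x h)) \<and>
      kbilin P P P (mult P) \<and> \<one>\<^bsub>P\<^esub> \<in> carrier P \<and>
      (\<forall>x\<in>carrier P. \<one>\<^bsub>P\<^esub> \<otimes>\<^bsub>P\<^esub> x = x \<and> x \<otimes>\<^bsub>P\<^esub> \<one>\<^bsub>P\<^esub> = x) \<and>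
      (\<forall>x\<in>carrier P. \<forall>y\<in>carrier P. \<forall>z\<in>carrier P.
         (x \<otimes>\<^bsub>P\<^esub> y) \<otimes>\<^bsub>P\<^esub> z =
         sw3 H H H \<Phi> (\<lambda>X1 X2 X3. sw3 H H H (inv\<^bsub>H \<boxtimes> H \<boxtimes> H\<^esub> \<Phi>) (\<lambda>x1 x2 x3.
           R (L X1 x) x1 \<otimes>\<^bsub>P\<^esub> (R (L X2 y) x2 \<otimes>\<^bsub>P\<^esub> R (L X3 z) x3)))) \<and>
      (\<forall>h\<in>carrier H. \<forall>x\<in>carrier P. \<forall>y\<in>carrier P.
         L h (x \<otimes>\<^bsub>P\<^esub> y) = sw H H (\<Delta> h) (\<lambda>h1 h2. L h1 x \<otimes>\<^bsub>P\<^esub> L h2 y) \<and>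
         R (x \<otimes>\<^bsub>P\<^esub> y) h = sw H H (\<Delta> h) (\<lambda>h1 h2. R x h1 \<otimes>\<^bsub>P\<^esub> R y h2)) \<and>
      (\<forall>h\<in>carrier H. L h \<one>\<^bsub>P\<^esub> = scl P (\<epsilon> h) \<one>\<^bsub>P\<^esub> \<and> R \<one>\<^bsub>P\<^esub> h = scl P (\<epsilon> h) \<one>\<^bsub>P\<^esub>))"

definition right_comodule_algebra ::
  "('k::field, 'h::ab_group_add, 'm) qbialg_scheme \<Rightarrow> ('k, 'a::ab_group_add, 'n) kalg_scheme \<Rightarrow>
   ('a \<Rightarrow> ('a, 'h, 'k) tens) \<Rightarrow> (('a, 'h, 'k) tens, 'h, 'k) tens \<Rightarrow> bool" where
  "right_comodule_algebra H A \<rho> \<Phi>\<rho> \<longleftrightarrow>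
     (let \<Delta> = comul H; \<epsilon> = counit H; \<Phi> = reassoc H; T3 = A \<boxtimes> H \<boxtimes> H; T4 = T3 \<boxtimes> H in
      kalgebra A \<and> \<rho> \<in> kalg_hom A (A \<boxtimes> H) \<and> \<Phi>\<rho> \<in> Units T3 \<and>
      (\<forall>a\<in>carrier A. \<Phi>\<rho> \<otimes>\<^bsub>T3\<^esub> split1of2 A H A H \<rho> (\<rho> a) = split2of2 A H H H \<Delta> (\<rho> a) \<otimes>\<^bsub>T3\<^esub> \<Phi>\<rho>) \<and>
      one_l A H H H \<Phi> \<otimes>\<^bsub>T4\<^esub> split2of3 A H H H H \<Delta> \<Phi>\<rho> \<otimes>\<^bsub>T4\<^esub> one_r A H H H \<Phi>\<rho> =
        split3of3 A H H H H \<Delta> \<Phi>\<rho> \<otimes>\<^bsub>T4\<^esub> split1of3 A H H A H \<rho> \<Phi>\<rho> \<and>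
      (\<forall>a\<in>carrier A. sw A H (\<rho> a) (\<lambda>a0 a1. scl A (\<epsilon> a1) a0) = a) \<and>
      sw3 A H H \<Phi>\<rho> (\<lambda>x y z. scl (A \<boxtimes> H) (\<epsilon> y) (pt A H x z)) = \<one>\<^bsub>A \<boxtimes> H\<^esub> \<and>
      sw3 A H H \<Phi>\<rho> (\<lambda>x y z. scl (A \<boxtimes> H) (\<epsilon> z) (pt A H x y)) = \<one>\<^bsub>A \<boxtimes> H\<^esub>)"

definition left_comodule_algebra ::
  "('k::field, 'h::ab_group_add, 'm) qbialg_scheme \<Rightarrow> ('k, 'b::ab_group_add, 'n) kalg_scheme \<Rightarrow>
   ('b \<Rightarrow> ('h, 'b, 'k) tens) \<Rightarrow> (('h, 'h, 'k) tens, 'b, 'k) tens \<Rightarrow> bool" where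
  "left_comodule_algebra H B lam \<Phi>l \<longleftrightarrow>
     (let \<Delta> = comul H; \<epsilon> = counit H; \<Phi> = reassoc H; T3 = H \<boxtimes> H \<boxtimes> B; T4 = H \<boxtimes> H \<boxtimes> H \<boxtimes> B in
      kalgebra B \<and> lam \<in> kalg_hom B (H \<boxtimes> B) \<and> \<Phi>l \<in> Units T3 \<and>
      (\<forall>b\<in>carrier B. split2of2 H B H B lam (lam b) \<otimes>\<^bsub>T3\<^esub> \<Phi>l = \<Phi>l \<otimes>\<^bsub>T3\<^esub> split1of2 H B H H \<Delta> (lam b)) \<and>
      one_l H H H B \<Phi>l \<otimes>\<^bsub>T4\<^esub> split2of3 H H B H H \<Delta> \<Phi>l \<otimes>\<^bsub>T4\<^esub> one_r H H H B \<Phi> =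
        split3of3 H H B H B lam \<Phi>l \<otimes>\<^bsub>T4\<^esub> split1of3 H H B H H \<Delta> \<Phi>l \<and>
      (\<forall>b\<in>carrier B. sw H B (lam b) (\<lambda>b1 b0. scl B (\<epsilon> b1) b0) = b) \<and>
      sw3 H H B \<Phi>l (\<lambda>x y z. scl (H \<boxtimes> B) (\<epsilon> y) (pt H B x z)) = \<one>\<^bsub>H \<boxtimes> B\<^esub> \<and>
      sw3 H H B \<Phi>l (\<lambda>x y z. scl (H \<boxtimes> B) (\<epsilon> x) (pt H B y z)) = \<one>\<^bsub>H \<boxtimes> B\<^esub>)"

definition bicomodule_algebra ::
  "('k::field, 'h::ab_group_add, 'm) qbialg_scheme \<Rightarrow> ('k, 'u::ab_group_add, 'n) kalg_scheme \<Rightarrow>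
   ('u \<Rightarrow> ('h, 'u, 'k) tens) \<Rightarrow> ('u \<Rightarrow> ('u, 'h, 'k) tens) \<Rightarrow>
   (('h, 'h, 'k) tens, 'u, 'k) tens \<Rightarrow> (('u, 'h, 'k) tens, 'h, 'k) tens \<Rightarrow>
   (('h, 'u, 'k) tens, 'h, 'k) tens \<Rightarrow> bool" where
  "bicomodule_algebra H U lam \<rho> \<Phi>l \<Phi>\<rho> \<Phi>l\<rho> \<longleftrightarrow>
     (let \<Delta> = comul H; T3 = H \<boxtimes> U \<boxtimes> H; L4 = H \<boxtimes> H \<boxtimes> U \<boxtimes> H; R4 = H \<boxtimes> U \<boxtimes> H \<boxtimes> H in
      left_comodule_algebra H U lam \<Phi>l \<and> right_comodule_algebra H U \<rho> \<Phi>\<rho> \<and> \<Phi>l\<rho> \<in> Units T3 \<and>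
      (\<forall>u\<in>carrier U. \<Phi>l\<rho> \<otimes>\<^bsub>T3\<^esub> split1of2 U H H U lam (\<rho> u) = split2of2 H U U H \<rho> (lam u) \<otimes>\<^bsub>T3\<^esub> \<Phi>l\<rho>) \<and>
      one_l H H U H \<Phi>l\<rho> \<otimes>\<^bsub>L4\<^esub> split2of3 H U H H U lam \<Phi>l\<rho> \<otimes>\<^bsub>L4\<^esub> one_r H H U H \<Phi>l =
        split3of3 H H U U H \<rho> \<Phi>l \<otimes>\<^bsub>L4\<^esub> split1of3 H U H H H \<Delta> \<Phi>l\<rho> \<and>
      one_l H U H H \<Phi>\<rho> \<otimes>\<^bsub>R4\<^esub> split2of3 H U H U H \<rho> \<Phi>l\<rho> \<otimes>\<^bsub>R4\<^esub> one_r H U H H \<Phi>l\<rho> =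
        split3of3 H U H H H \<Delta> \<Phi>l\<rho> \<otimes>\<^bsub>R4\<^esub> split1of3 U H H H U lam \<Phi>\<rho>)"

section \<open>The bicomodule algebra \<open>A \<otimes> B\<close>\<close>

text \<open>\<open>A \<boxtimes> B\<close> enters the iterated tensor products as a single factor.\<close>

definition tensor_lcoact ::
  "('k::field, 'h::ab_group_add, 'm) kalg_scheme \<Rightarrow> ('k, 'a::ab_group_add, 'n) kalg_scheme \<Rightarrow>
   ('k, 'b::ab_group_add, 'o) kalg_scheme \<Rightarrow> ('b \<Rightarrow> ('h, 'b, 'k) tens) \<Rightarrow>
   ('a, 'b, 'k) tens \<Rightarrow> ('h, ('a, 'b, 'k) tens, 'k) tens" where
  "tensor_lcoact H A B lam t =
     sw A B t (\<lambda>a b. sw H B (lam b) (\<lambda>b1 b0. pt H (A \<boxtimes> B) b1 (pt A B a b0)))"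

definition tensor_rcoact ::
  "('k::field, 'h::ab_group_add, 'm) kalg_scheme \<Rightarrow> ('k, 'a::ab_group_add, 'n) kalg_scheme \<Rightarrow>
   ('k, 'b::ab_group_add, 'o) kalg_scheme \<Rightarrow> ('a \<Rightarrow> ('a, 'h, 'k) tens) \<Rightarrow>
   ('a, 'b, 'k) tens \<Rightarrow> (('a, 'b, 'k) tens, 'h, 'k) tens" where
  "tensor_rcoact H A B \<rho> t =
     sw A B t (\<lambda>a b. sw A H (\<rho> a) (\<lambda>a0 a1. pt (A \<boxtimes> B) H (pt A B a0 b) a1))"

definition tensor_lreassoc ::
  "('k::field, 'h::ab_group_add, 'm) kalg_scheme \<Rightarrow> ('k, 'a::ab_group_add, 'n) kalg_scheme \<Rightarrow>
   ('k, 'b::ab_group_add, 'o) kalg_scheme \<Rightarrow> (('h, 'h, 'k) tens, 'b, 'k) tens \<Rightarrow>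
   (('h, 'h, 'k) tens, ('a, 'b, 'k) tens, 'k) tens" where
  "tensor_lreassoc H A B \<Phi>l =
     sw3 H H B \<Phi>l (\<lambda>X1 X2 X3. pt3 H H (A \<boxtimes> B) X1 X2 (pt A B \<one>\<^bsub>A\<^esub> X3))"

definition tensor_rreassoc ::
  "('k::field, 'h::ab_group_add, 'm) kalg_scheme \<Rightarrow> ('k, 'a::ab_group_add, 'n) kalg_scheme \<Rightarrow>
   ('k, 'b::ab_group_add, 'o) kalg_scheme \<Rightarrow> (('a, 'h, 'k) tens, 'h, 'k) tens \<Rightarrow>
   ((('a, 'b, 'k) tens, 'h, 'k) tens, 'h, 'k) tens" where
  "tensor_rreassoc H A B \<Phi>\<rho> =
     sw3 A H H \<Phi>\<rho> (\<lambda>X1 X2 X3. pt3 (A \<boxtimes> B) H H (pt A B X1 \<one>\<^bsub>B\<^esub>) X2 X3)"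

definition tensor_lrreassoc ::
  "('k::field, 'h::ab_group_add, 'm) kalg_scheme \<Rightarrow> ('k, 'a::ab_group_add, 'n) kalg_scheme \<Rightarrow>
   ('k, 'b::ab_group_add, 'o) kalg_scheme \<Rightarrow> (('h, ('a, 'b, 'k) tens, 'k) tens, 'h, 'k) tens" where
  "tensor_lrreassoc H A B = pt3 H (A \<boxtimes> B) H \<one>\<^bsub>H\<^esub> (pt A B \<one>\<^bsub>A\<^esub> \<one>\<^bsub>B\<^esub>) \<one>\<^bsub>H\<^esub>"

section \<open>The two crossed products\<close>

definition diag_Omega ::
  "('k::field, 'h::ab_group_add, 'm) qhopf_scheme \<Rightarrow> ('k, 'u::ab_group_add, 'n) kalg_scheme \<Rightarrow>
   ('u \<Rightarrow> ('h, 'u, 'k) tens) \<Rightarrow> ('u \<Rightarrow> ('u, 'h, 'k) tens) \<Rightarrow>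
   (('h, 'h, 'k) tens, 'u, 'k) tens \<Rightarrow> (('u, 'h, 'k) tens, 'h, 'k) tens \<Rightarrow>
   (('h, 'u, 'k) tens, 'h, 'k) tens \<Rightarrow>
   (((('h, 'h, 'k) tens, 'u, 'k) tens, 'h, 'k) tens, 'h, 'k) tens" where
  "diag_Omega H U lam \<rho> \<Phi>l \<Phi>\<rho> \<Phi>l\<rho> =
     (let S' = antipode_inv H in
      sw3 U H H \<Phi>\<rho> (\<lambda>X1 X2 X3. sw H U (lam X1) (\<lambda>h u. sw H H (comul H h) (\<lambda>h1 h2.
      sw3 H H U (inv\<^bsub>H \<boxtimes> H \<boxtimes> U\<^esub> \<Phi>l) (\<lambda>x1 x2 x3.
      sw3 H U H (inv\<^bsub>H \<boxtimes> U \<boxtimes> H\<^esub> \<Phi>l\<rho>) (\<lambda>\<theta>1 \<theta>2 \<theta>3. sw H U (lam \<theta>2) (\<lambda>g v.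
      sw H H (drinfeld_twist H) (\<lambda>f1 f2.
        pt5 H H U H H
          (h1 \<otimes>\<^bsub>H\<^esub> x1 \<otimes>\<^bsub>H\<^esub> \<theta>1)
          (h2 \<otimes>\<^bsub>H\<^esub> x2 \<otimes>\<^bsub>H\<^esub> g)
          (u \<otimes>\<^bsub>U\<^esub> x3 \<otimes>\<^bsub>U\<^esub> v)
          (S' (f1 \<otimes>\<^bsub>H\<^esub> X2 \<otimes>\<^bsub>H\<^esub> \<theta>3))
          (S' (f2 \<otimes>\<^bsub>H\<^esub> X3))))))))))"

definition diag_crossed_product ::
  "('k::field, 'h::ab_group_add, 'm) qhopf_scheme \<Rightarrow> ('k, 'p::ab_group_add, 'h, 'o) bimod_alg_scheme \<Rightarrow>
   ('k, 'u::ab_group_add, 'n) kalg_scheme \<Rightarrow>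
   ('u \<Rightarrow> ('h, 'u, 'k) tens) \<Rightarrow> ('u \<Rightarrow> ('u, 'h, 'k) tens) \<Rightarrow>
   (('h, 'h, 'k) tens, 'u, 'k) tens \<Rightarrow> (('u, 'h, 'k) tens, 'h, 'k) tens \<Rightarrow>
   (('h, 'u, 'k) tens, 'h, 'k) tens \<Rightarrow> ('k, ('p, 'u, 'k) tens) kalg" where
  "diag_crossed_product H P U lam \<rho> \<Phi>l \<Phi>\<rho> \<Phi>l\<rho> =
     (P \<boxtimes> U)\<lparr>
       one := pt P U \<one>\<^bsub>P\<^esub> \<one>\<^bsub>U\<^esub>,
       mult := (\<lambda>s t. sw P U s (\<lambda>x u. sw P U t (\<lambda>x' u'.
         sw5 H H U H H (diag_Omega H U lam \<rho> \<Phi>l \<Phi>\<rho> \<Phi>l\<rho>) (\<lambda>\<Omega>1 \<Omega>2 \<Omega>3 \<Omega>4 \<Omega>5.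
         sw U H (\<rho> u) (\<lambda>u0 u1. sw H U (lam u0) (\<lambda>u0m u00.
           pt P U
             (ract P (lact P \<Omega>1 x) \<Omega>5 \<otimes>\<^bsub>P\<^esub>
              ract P (lact P (\<Omega>2 \<otimes>\<^bsub>H\<^esub> u0m) x') (antipode_inv H u1 \<otimes>\<^bsub>H\<^esub> \<Omega>4))
             (\<Omega>3 \<otimes>\<^bsub>U\<^esub> u00 \<otimes>\<^bsub>U\<^esub> u')))))))\<rparr>"

definition two_sided_crossed_product ::
  "('k::field, 'h::ab_group_add, 'm) kalg_scheme \<Rightarrow>
   ('k, 'a::ab_group_add, 'n) kalg_scheme \<Rightarrow> ('a \<Rightarrow> ('a, 'h, 'k) tens) \<Rightarrow> (('a, 'h, 'k) tens, 'h, 'k) tens \<Rightarrow>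
   ('k, 'p::ab_group_add, 'h, 'o) bimod_alg_scheme \<Rightarrow>
   ('k, 'b::ab_group_add, 'q) kalg_scheme \<Rightarrow> ('b \<Rightarrow> ('h, 'b, 'k) tens) \<Rightarrow> (('h, 'h, 'k) tens, 'b, 'k) tens \<Rightarrow>
   ('k, (('a, 'p, 'k) tens, 'b, 'k) tens) kalg" where
  "two_sided_crossed_product H A \<rho> \<Phi>\<rho> P B lam \<Phi>l =
     (A \<boxtimes> P \<boxtimes> B)\<lparr>
       one := pt3 A P B \<one>\<^bsub>A\<^esub> \<one>\<^bsub>P\<^esub> \<one>\<^bsub>B\<^esub>,
       mult := (\<lambda>s t. sw3 A P B s (\<lambda>a x b. sw3 A P B t (\<lambda>a' x' b'.
         sw A H (\<rho> a') (\<lambda>a'0 a'1. sw H B (lam b) (\<lambda>b1 b0.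
         sw3 A H H (inv\<^bsub>A \<boxtimes> H \<boxtimes> H\<^esub> \<Phi>\<rho>) (\<lambda>r1 r2 r3. sw3 H H B (inv\<^bsub>H \<boxtimes> H \<boxtimes> B\<^esub> \<Phi>l) (\<lambda>l1 l2 l3.
           pt3 A P B
             (a \<otimes>\<^bsub>A\<^esub> a'0 \<otimes>\<^bsub>A\<^esub> r1)
             (ract P (lact P l1 x) (a'1 \<otimes>\<^bsub>H\<^esub> r2) \<otimes>\<^bsub>P\<^esub> ract P (lact P (l2 \<otimes>\<^bsub>H\<^esub> b1) x') r3)
             (l3 \<otimes>\<^bsub>B\<^esub> b0 \<otimes>\<^bsub>B\<^esub> b'))))))))\<rparr>"

end

theory Submission
  imports Defs
begin

text \<open>
  Write \<open>t = t\<^sup>1 \<otimes> t\<^sup>2 \<otimes> t\<^sup>3\<close> for the inverse of \<open>\<Phi>\<rho> = X\<^sup>1 \<otimes> X\<^sup>2 \<otimes> X\<^sup>3\<close>. The isomorphism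
  sends \<open>a \<otimes> \<phi> \<otimes> b\<close> to \<open>\<phi> \<cdot> S\<^sup>-\<^sup>1(a\<^sub>1 t\<^sup>2 \<beta> S(t\<^sup>3)) \<otimes> (a\<^sub>0 t\<^sup>1 \<otimes> b)\<close>, and its inverse sends
  \<open>\<phi> \<otimes> (a \<otimes> b)\<close> to \<open>X\<^sup>1 a\<^sub>0 \<otimes> \<phi> \<cdot> S\<^sup>-\<^sup>1(S(X\<^sup>2 a\<^sub>1) \<alpha> X\<^sup>3) \<otimes> b\<close>. That they are mutually inverse
  follows from the relations between \<open>p = t\<^sup>1 \<otimes> t\<^sup>2 \<beta> S(t\<^sup>3)\<close> and \<open>q = X\<^sup>1 \<otimes> S(X\<^sup>2) \<alpha> X\<^sup>3\<close>,
  which generalise those for the antipode. For multiplicativity, acting with \<open>S\<^sup>-\<^sup>1(\<dots>)\<close> on a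
  product produces its coproduct, while the product of \<open>\<A> \<bowtie> (\<AA> \<otimes> \<BB>)\<close> contains the Drinfeld
  twist \<open>f\<close>. The two are matched by \<open>f \<Delta>(h) = (S \<otimes> S)(\<Delta>\<^sup>c\<^sup>o\<^sup>p(S\<^sup>-\<^sup>1 h)) f\<close> and
  \<open>f \<delta> = (S \<otimes> S)(\<Delta>\<^sup>c\<^sup>o\<^sup>p(S\<^sup>-\<^sup>1 \<beta>))\<close>, where \<open>\<delta> = B\<^sup>1 \<beta> S(B\<^sup>4) \<otimes> B\<^sup>2 \<beta> S(B\<^sup>3)\<close> and
  \<open>B = (\<Delta> \<otimes> id \<otimes> id)(\<Phi>) (\<Phi>\<^sup>-\<^sup>1 \<otimes> 1)\<close>; neither of them needs the invertibility of \<open>f\<close>.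
\<close>

section \<open>Sums over tensors\<close>

text \<open>In the two-sided product, a \<otimes> \<phi> \<otimes> b is the product of a, \<phi> and
  b in this order, whereas the diagonal product keeps the element of the comodule algebra to the
  right of \<phi>. Moving a there makes its coaction act on \<phi>; a left multiplication must
  become a right action, whence S^{-1}. The element p compensates for a coaction that is
  coassociative only up to conjugation: for a Hopf algebra with trivial reassociators and \<alpha> =
  \<beta> = 1, all of p, q, f and \<delta> equal 1.

  The left side is inert. Since \<Phi>_{\<lambda>,\<rho>} is 1 and \<lambda> moves only the leg in
  B, \<Omega> involves just \<Phi>\<rho>, f and the inverse of \<Phi>l, and the last enters both
  products in the same way. The bimodule algebra and B become parameters of a trilinear map on A, H
  and H, and multiplicativity turns into an identity about \<rho>, \<Phi>\<rho>, p and f.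

  Every axiom is used in evaluated form: an equation of tensors becomes an equation of sums for an
  arbitrary multilinear F. Taking the surrounding expression as F, it applies deep inside a longer
  sum.\<close>

abbreviation lin where "lin \<equiv> Vector_Spaces.linear"

text \<open>In contrast to \<open>kbilin\<close>, linearity is demanded on the whole types, and the
  parameters are scalar multiplications instead of records. The target may then be any vector space,
  whether or not it carries a product.\<close>

definition bilin where
  "bilin s1 s2 s f \<longleftrightarrow> (\<forall>x. lin s2 s (f x)) \<and> (\<forall>y. lin s1 s (\<lambda>x. f x y))"

definition trilin where
  "trilin s1 s2 s3 s f \<longleftrightarrow> (\<forall>x y. lin s3 s (f x y)) \<and> (\<forall>x z. lin s2 s (\<lambda>y. f x y z)) \<and>
     (\<forall>y z. lin s1 s (\<lambda>x. f x y z))"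

definition quadlin where
  "quadlin s1 s2 s3 s4 s f \<longleftrightarrow> (\<forall>x y z. lin s4 s (f x y z)) \<and> (\<forall>x y u. lin s3 s (\<lambda>z. f x y z u)) \<and>
     (\<forall>x z u. lin s2 s (\<lambda>y. f x y z u)) \<and> (\<forall>y z u. lin s1 s (\<lambda>x. f x y z u))"

lemma linI:
  assumes "vector_space s1" "vector_space s2"
    "\<And>x y. f (x + y) = f x + f y" "\<And>c x. f (s1 c x) = s2 c (f x)"
  shows "lin s1 s2 f"
  using assms by (simp add: Vector_Spaces.linear_iff)

lemma linD:
  assumes "lin s1 s2 f"
  shows "vector_space s1" "vector_space s2"
    "\<And>x y. f (x + y) = f x + f y" "\<And>c x. f (s1 c x) = s2 c (f x)"
  using assms by (simp_all add: Vector_Spaces.linear_iff)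

lemma bilinI:
  assumes "\<And>x. lin s2 s (f x)" "\<And>y. lin s1 s (\<lambda>x. f x y)"
  shows "bilin s1 s2 s f"
  using assms by (simp add: bilin_def)

lemma trilinI:
  assumes "\<And>x y. lin s3 s (f x y)" "\<And>x z. lin s2 s (\<lambda>y. f x y z)" "\<And>y z. lin s1 s (\<lambda>x. f x y z)"
  shows "trilin s1 s2 s3 s f"
  using assms by (simp add: trilin_def)

lemma quadlinI:
  assumes "\<And>x y z. lin s4 s (f x y z)" "\<And>x y u. lin s3 s (\<lambda>z. f x y z u)"
    "\<And>x z u. lin s2 s (\<lambda>y. f x y z u)" "\<And>y z u. lin s1 s (\<lambda>x. f x y z u)"
  shows "quadlin s1 s2 s3 s4 s f"
  using assms by (simp add: quadlin_def)

text \<open>Each rule peels off one operation of an expression, so that the multilinearity of a long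
  Sweedler sum is proved by resolving with these rules until no goal is left.\<close>

named_theorems lins

lemmas [lins] = bilinI trilinI quadlinI

lemma lin_id [lins]: "vector_space s \<Longrightarrow> lin s s (\<lambda>x. x)"
  by (rule linI) simp_all

lemma lin_comp:
  assumes "lin s2 s3 f" "lin s1 s2 g"
  shows "lin s1 s3 (\<lambda>x. f (g x))"
  using assms by (simp add: Vector_Spaces.linear_iff)

lemma lin_scale [lins]:
  assumes "lin s1 s2 f"
  shows "lin s1 s2 (\<lambda>x. s2 c (f x))"
proof -
  interpret vector_space s2 by (rule linD(2)[OF assms])
  show ?thesis
    by (rule linI) (use linD[OF assms] in \<open>simp_all add: scale_right_distrib scale_left_commute\<close>)
qed

lemma lin_scale_left [lins]:
  assumes "lin s1 (*) f" "vector_space s2"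
  shows "lin s1 s2 (\<lambda>x. s2 (f x) v)"
proof -
  interpret vector_space s2 by fact
  show ?thesis
    by (rule linI) (use linD[OF assms(1)] assms(2) in \<open>simp_all add: scale_left_distrib\<close>)
qed

lemma lin_add:
  assumes "lin s1 s2 f" "lin s1 s2 g"
  shows "lin s1 s2 (\<lambda>x. f x + g x)"
proof -
  interpret vector_space s2 by (rule linD(2)[OF assms(1)])
  show ?thesis
    by (rule linI[OF linD(1,2)[OF assms(1)]])
      (simp_all add: linD(3,4)[OF assms(1)] linD(3,4)[OF assms(2)] scale_right_distrib)
qed

lemma lin_sum_list:
  assumes "vector_space s1" "vector_space s2" "\<And>u. lin s1 s2 (\<lambda>x. f x u)"
  shows "lin s1 s2 (\<lambda>x. \<Sum>u\<leftarrow>us. f x u)"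
proof -
  interpret vector_space s2 by fact
  show ?thesis
  proof (induction us)
    case Nil
    show ?case by (simp add: linI assms(1,2))
  next
    case (Cons u us)
    then show ?case using lin_add[OF assms(3)] by simp
  qed
qed

text \<open>The list of representatives chosen by \<open>sw\<close> depends on \<open>t\<close>
  alone and not on the summand. A linear map therefore passes through the same finite list term by
  term.\<close>

lemma lin_out:
  assumes "lin s1 s2 h"
  shows "h (sw A B t F) = sw A B t (\<lambda>x y. h (F x y))"
  unfolding sw_def by (subst sum_list_linear) (use linD(3)[OF assms] in \<open>auto simp: case_prod_unfold\<close>)

lemma lin_sw [lins]:
  assumes "\<And>u v. lin s1 s2 (\<lambda>x. F x u v)"
  shows "lin s1 s2 (\<lambda>x. sw A B t (F x))"
  unfolding sw_def case_prod_unfold by (rule lin_sum_list) (use assms linD in blast)+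

lemma lin_sw3 [lins]:
  assumes "\<And>u v w. lin s1 s2 (\<lambda>x. F x u v w)"
  shows "lin s1 s2 (\<lambda>x. sw3 A B C t (F x))"
  unfolding sw3_def by (intro lin_sw assms)

lemma lin_out3:
  assumes "lin s1 s2 h"
  shows "h (sw3 A B C t F) = sw3 A B C t (\<lambda>x y z. h (F x y z))"
  by (simp add: sw3_def lin_out[OF assms])

lemma scale_sw:
  assumes "vector_space s"
  shows "s c (sw A B t F) = sw A B t (\<lambda>x y. s c (F x y))"
  by (rule lin_out[of s s]) (intro lin_scale lin_id assms)

lemma scale_sw3:
  assumes "vector_space s"
  shows "s c (sw3 A B C t F) = sw3 A B C t (\<lambda>x y z. s c (F x y z))"
  by (rule lin_out3[of s s]) (intro lin_scale lin_id assms)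

lemma sum_list_swap:
  fixes f :: "'a \<Rightarrow> 'b \<Rightarrow> 'c::comm_monoid_add"
  shows "(\<Sum>x\<leftarrow>xs. \<Sum>y\<leftarrow>ys. f x y) = (\<Sum>y\<leftarrow>ys. \<Sum>x\<leftarrow>xs. f x y)"
  by (induction xs) (simp_all add: sum_list_addf)

text \<open>Both sums run over fixed finite lists. The exchange is formal, but it is available only
  if \<open>t\<close> does not mention the variables bound by the sum over \<open>s\<close>; this
  restriction dictates the order of the rearrangements in the long computations.\<close>

lemma sw_swap:
  "sw A B s (\<lambda>x y. sw C D t (\<lambda>u v. F x y u v)) = sw C D t (\<lambda>u v. sw A B s (\<lambda>x y. F x y u v))"
  unfolding sw_def case_prod_unfold by (rule sum_list_swap)

lemma sw_sw3_swap:
  "sw A B s (\<lambda>x y. sw3 C D E t (\<lambda>u v w. F x y u v w)) =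
   sw3 C D E t (\<lambda>u v w. sw A B s (\<lambda>x y. F x y u v w))"
proof -
  have "sw A B s (\<lambda>x y. sw3 C D E t (\<lambda>u v w. F x y u v w)) =
    sw (C \<boxtimes> D) E t (\<lambda>r w. sw A B s (\<lambda>x y. sw C D r (\<lambda>u v. F x y u v w)))"
    unfolding sw3_def by (rule sw_swap)
  also have "\<dots> = sw3 C D E t (\<lambda>u v w. sw A B s (\<lambda>x y. F x y u v w))"
    unfolding sw3_def by (subst sw_swap) rule
  finally show ?thesis .
qed

lemma sw3_swap:
  "sw3 A B G s (\<lambda>x y z. sw3 C D E t (\<lambda>u v w. F x y z u v w)) =
   sw3 C D E t (\<lambda>u v w. sw3 A B G s (\<lambda>x y z. F x y z u v w))"
  unfolding sw3_def[of A B G] by (simp add: sw_sw3_swap)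

text \<open>Dresses a whole type with scalar multiplication \<open>s\<close> as a record, so that
  \<open>tensor_universal\<close> applies to maps whose target is given only as a vector
  space.\<close>

definition tgt :: "('k \<Rightarrow> 'c \<Rightarrow> 'c) \<Rightarrow> ('k, 'c) kalg" where
  "tgt s = \<lparr>carrier = UNIV, mult = undefined, one = undefined, scl = s\<rparr>"

lemma tgt_simps [simp]: "carrier (tgt s) = UNIV" "scl (tgt s) = s"
  by (simp_all add: tgt_def)

lemma kspace_tgt: "vector_space s \<Longrightarrow> kspace (tgt s)"
  unfolding kspace_def by (simp add: module.subspace_UNIV module_iff_vector_space)

lemma bilinD:
  assumes "bilin s1 s2 s f"
  shows "vector_space s1" "vector_space s2" "vector_space s" "lin s2 s (f x)" "lin s1 s (\<lambda>x. f x y)"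
  using assms linD unfolding bilin_def by blast+

lemma bilin_kbilin: "bilin (scl A) (scl B) s f \<Longrightarrow> kbilin A B (tgt s) f"
  unfolding bilin_def kbilin_def klin_def by (simp add: Vector_Spaces.linear_iff)

section \<open>Sweedler sums: congruence, closure and substitution\<close>

lemma trep_some:
  assumes "t \<in> carrier (A \<boxtimes> B)"
  shows "trep A B t (SOME xys. trep A B t xys)"
  using assms by (auto simp: tensor_simps intro: someI)

text \<open>The chosen representatives lie in the carriers, so membership may be assumed under the
  summation sign. This is the gate through which the operations of the records are exchanged for
  total ones.\<close>

lemma sw_cong:
  assumes "t \<in> carrier (A \<boxtimes> B)" "\<And>x y. x \<in> carrier A \<Longrightarrow> y \<in> carrier B \<Longrightarrow> F x y = G x y"
  shows "sw A B t F = sw A B t G"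
proof -
  have "set (SOME xys. trep A B t xys) \<subseteq> carrier A \<times> carrier B"
    using trep_some[OF assms(1)] unfolding trep_def[of A B t] by blast
  then show ?thesis
    unfolding sw_def by (intro arg_cong[where f = sum_list] map_cong refl) (use assms(2) in auto)
qed

lemma sw3_cong:
  assumes "t \<in> carrier (A \<boxtimes> B \<boxtimes> C)"
    "\<And>x y z. x \<in> carrier A \<Longrightarrow> y \<in> carrier B \<Longrightarrow> z \<in> carrier C \<Longrightarrow> F x y z = G x y z"
  shows "sw3 A B C t F = sw3 A B C t G"
  unfolding sw3_def by (intro sw_cong assms)

lemma sw_closed:
  assumes "kspace P" "t \<in> carrier (A \<boxtimes> B)"
    "\<And>x y. x \<in> carrier A \<Longrightarrow> y \<in> carrier B \<Longrightarrow> F x y \<in> carrier P"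
  shows "sw A B t F \<in> carrier P"
proof -
  have "set xs \<subseteq> carrier A \<times> carrier B \<Longrightarrow> (\<Sum>(x, y)\<leftarrow>xs. F x y) \<in> carrier P" for xs
    using kspaceD(2,3)[OF assms(1)] assms(3) by (induction xs) auto
  then show ?thesis using trep_some[OF assms(2)] by (simp add: sw_def trep_def)
qed

lemma sw3_closed:
  assumes "kspace P" "t \<in> carrier (A \<boxtimes> B \<boxtimes> C)"
    "\<And>x y z. x \<in> carrier A \<Longrightarrow> y \<in> carrier B \<Longrightarrow> z \<in> carrier C \<Longrightarrow> F x y z \<in> carrier P"
  shows "sw3 A B C t F \<in> carrier P"
  unfolding sw3_def by (intro sw_closed assms)

lemma sw_id: "t \<in> carrier (A \<boxtimes> B) \<Longrightarrow> sw A B t (pt A B) = t"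
  using trep_some[of t A B] by (simp add: sw_def trep_def)

lemma pt_closed: "x \<in> carrier A \<Longrightarrow> y \<in> carrier B \<Longrightarrow> pt A B x y \<in> carrier (A \<boxtimes> B)"
  using trep_pt[of x A y B] by (auto simp: tensor_simps)

lemma pt3_closed:
  "x \<in> carrier A \<Longrightarrow> y \<in> carrier B \<Longrightarrow> z \<in> carrier C \<Longrightarrow> pt3 A B C x y z \<in> carrier (A \<boxtimes> B \<boxtimes> C)"
  by (simp add: pt3_def pt_closed)

lemma pt4_closed:
  "x \<in> carrier A \<Longrightarrow> y \<in> carrier B \<Longrightarrow> z \<in> carrier C \<Longrightarrow> u \<in> carrier D \<Longrightarrow>
   pt4 A B C D x y z u \<in> carrier (A \<boxtimes> B \<boxtimes> C \<boxtimes> D)"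
  by (simp add: pt4_def pt_closed pt3_closed)

context
  fixes A :: "('k::field, 'a::ab_group_add, 'm) kalg_scheme" and B :: "('k, 'b::ab_group_add, 'n) kalg_scheme"
  assumes A: "kspace A" and B: "kspace B"
begin

lemma sw_klin:
  assumes "bilin (scl A) (scl B) s F"
  shows "klin (A \<boxtimes> B) (tgt s) (\<lambda>t. sw A B t F)"
  by (rule tensor_universal(1)[OF A B kspace_tgt bilin_kbilin]) (use assms bilinD in blast)+

lemma sw_pt:
  assumes "bilin (scl A) (scl B) s F" "x \<in> carrier A" "y \<in> carrier B"
  shows "sw A B (pt A B x y) F = F x y"
  by (rule tensor_universal(2)[OF A B kspace_tgt bilin_kbilin]) (use assms bilinD in blast)+

lemma lin_sw_arg:
  assumes "lin s1 (scl (A \<boxtimes> B)) g" "\<And>x. g x \<in> carrier (A \<boxtimes> B)" "bilin (scl A) (scl B) s F"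
  shows "lin s1 s (\<lambda>x. sw A B (g x) F)"
  using sw_klin[OF assms(3)] assms(2) linD[OF assms(1)] bilinD(3)[OF assms(3)]
  by (intro linI) (auto simp: klin_def)

text \<open>A representation of the inner sum is chosen anew and need not be the concatenation of
  those of its terms. Bilinearity of \<open>F\<close> makes the outer sum a linear function of its
  tensor, hence compatible with the inner sum.\<close>

lemma sw_sw:
  assumes F: "bilin (scl A) (scl B) s F" and t: "t \<in> carrier (C \<boxtimes> D)"
    and G: "\<And>x y. x \<in> carrier C \<Longrightarrow> y \<in> carrier D \<Longrightarrow> G x y \<in> carrier (A \<boxtimes> B)"
  shows "sw A B (sw C D t G) F = sw C D t (\<lambda>x y. sw A B (G x y) F)"
proof -
  note h = sw_klin[OF F, unfolded klin_def, THEN conjunct2, THEN conjunct1, rule_format]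
  have 0: "0 \<in> carrier (A \<boxtimes> B)" by (rule kspaceD(2)[OF kspace_tensor[OF A]])
  have "sw A B 0 F = 0" using h[OF 0 0] by simp
  moreover have "set xs \<subseteq> carrier C \<times> carrier D \<Longrightarrow> (\<Sum>(x, y)\<leftarrow>xs. G x y) \<in> carrier (A \<boxtimes> B)" for xs
    using kspaceD(2,3)[OF kspace_tensor[OF A, of B]] G by (induction xs) auto
  ultimately have "set xs \<subseteq> carrier C \<times> carrier D \<Longrightarrow>
    sw A B (\<Sum>(x, y)\<leftarrow>xs. G x y) F = (\<Sum>(x, y)\<leftarrow>xs. sw A B (G x y) F)" for xs
    using G by (induction xs) (auto simp: h)
  then show ?thesis using trep_some[OF t] by (simp add: sw_def[of C D] trep_def)
qed

lemma sw_sw3: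
  assumes "bilin (scl A) (scl B) s F" "t \<in> carrier (C \<boxtimes> D \<boxtimes> E)"
    and G: "\<And>x y z. x \<in> carrier C \<Longrightarrow> y \<in> carrier D \<Longrightarrow> z \<in> carrier E \<Longrightarrow> G x y z \<in> carrier (A \<boxtimes> B)"
  shows "sw A B (sw3 C D E t G) F = sw3 C D E t (\<lambda>x y z. sw A B (G x y z) F)"
proof -
  have "sw A B (sw (C \<boxtimes> D) E t (\<lambda>r z. sw C D r (\<lambda>x y. G x y z))) F =
    sw (C \<boxtimes> D) E t (\<lambda>r z. sw A B (sw C D r (\<lambda>x y. G x y z)) F)"
    by (rule sw_sw[OF assms(1,2)]) (intro sw_closed[OF kspace_tensor[OF A]] G)
  also have "\<dots> = sw (C \<boxtimes> D) E t (\<lambda>r z. sw C D r (\<lambda>x y. sw A B (G x y z) F))"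
    by (rule sw_cong[OF assms(2)]) (rule sw_sw[OF assms(1)], assumption, rule G)
  finally show ?thesis unfolding sw3_def .
qed

end

lemma sw_addF: "sw A B t (\<lambda>x y. F x y + G x y) = sw A B t F + sw A B t G"
  by (simp add: sw_def case_prod_unfold sum_list_addf)

text \<open>
  A linear projection of the type onto the carrier. Precomposing the structure maps with it makes
  them linear on the whole type, so that identities between Sweedler sums hold without membership
  conditions and linearity in each argument is decided by the rules \<open>lins\<close>.
\<close>

definition pr :: "('k::field, 'a::ab_group_add, 'm) kalg_scheme \<Rightarrow> 'a \<Rightarrow> 'a" where
  "pr A = (SOME p. lin (scl A) (scl A) p \<and> range p \<subseteq> carrier A \<and> (\<forall>x\<in>carrier A. p x = x))"

lemma pr_spec:
  assumes "kspace A"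
  shows "lin (scl A) (scl A) (pr A)" "pr A x \<in> carrier A" "x \<in> carrier A \<Longrightarrow> pr A x = x"
proof -
  interpret V: vector_space_pair "scl A" "scl A"
    using kspaceD(1)[OF assms] by (simp add: vector_space_pair_def)
  have "lin (scl A) (scl A) id" by (rule V.vs1.linear_id)
  \<comment> \<open>A left inverse of the identity on the subspace, with range in that subspace, is
    a projection onto it.\<close>
  from V.linear_exists_left_inverse_on[OF this, of "carrier A"] assms
  have "\<exists>p. lin (scl A) (scl A) p \<and> range p \<subseteq> carrier A \<and> (\<forall>x\<in>carrier A. p x = x)"
    by (auto simp: kspace_def)
  from someI_ex[OF this] show "lin (scl A) (scl A) (pr A)" "pr A x \<in> carrier A"
    "x \<in> carrier A \<Longrightarrow> pr A x = x"
    unfolding pr_def[symmetric] by auto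
qed

lemma pr_lin [lins]: "kspace A \<Longrightarrow> lin s (scl A) f \<Longrightarrow> lin s (scl A) (\<lambda>x. pr A (f x))"
  by (rule lin_comp[OF pr_spec(1)])

lemma pr_pr: "kspace A \<Longrightarrow> pr A (pr A x) = pr A x"
  by (simp add: pr_spec)

section \<open>Total versions of products, pure tensors and linear maps\<close>

definition tmul :: "('k::field, 'a::ab_group_add, 'm) kalg_scheme \<Rightarrow> 'a \<Rightarrow> 'a \<Rightarrow> 'a"  (infixl "\<odot>\<index>" 70)
  where "x \<odot>\<^bsub>A\<^esub> y = pr A x \<otimes>\<^bsub>A\<^esub> pr A y"

definition tpt ::
  "('k::field, 'a::ab_group_add, 'm) kalg_scheme \<Rightarrow> ('k, 'b::ab_group_add, 'n) kalg_scheme \<Rightarrow>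
   'a \<Rightarrow> 'b \<Rightarrow> ('a, 'b, 'k) tens" where
  "tpt A B x y = pt A B (pr A x) (pr B y)"

lemma klin_tot:
  assumes "kspace A" "kspace B" "klin A B f" "lin s (scl A) g"
  shows "lin s (scl B) (\<lambda>x. f (pr A (g x)))"
  using assms linD[OF pr_lin[OF assms(1,4)]] pr_spec(2)[OF assms(1)]
  by (intro linI) (simp_all add: klin_def kspaceD)

lemma kbilin_tot:
  assumes "kspace A" "kspace B" "kspace C" "kbilin A B C f"
  shows "bilin (scl A) (scl B) (scl C) (\<lambda>x y. f (pr A x) (pr B y))"
  by (rule bilinI; rule klin_tot[where f = "f _"] klin_tot[where f = "\<lambda>x. f x _"])
    (use assms pr_spec[OF assms(1)] pr_spec[OF assms(2)] in
      \<open>auto simp: kbilin_def intro: lin_id dest: kspaceD\<close>)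

lemma lin_bilin:
  assumes "bilin s1 s2 s3 b"
  shows "lin s s1 f \<Longrightarrow> lin s s3 (\<lambda>x. b (f x) c)" "lin s s2 g \<Longrightarrow> lin s s3 (\<lambda>x. b d (g x))"
  using lin_comp[OF bilinD(5)[OF assms]] lin_comp[OF bilinD(4)[OF assms]] by blast+

lemma kalgebraD:
  assumes "kalgebra A"
  shows "kspace A" "monoid A" "kbilin A A A (mult A)"
  using assms by (simp_all add: kalgebra_def)

lemma vs_scl [lins]: "kspace A \<Longrightarrow> vector_space (scl A)"
  by (rule kspaceD)

lemma kspace_kalgebra: "kalgebra A \<Longrightarrow> kspace A"
  by (rule kalgebraD)

context
  fixes A :: "('k::field, 'a::ab_group_add, 'm) kalg_scheme"
  assumes A: "kalgebra A"
begin

interpretation monoid A using A by (rule kalgebraD)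

private lemmas p = pr_spec[OF kalgebraD(1)[OF A]]

lemma tmul_closed: "x \<odot>\<^bsub>A\<^esub> y \<in> carrier A"
  by (simp add: tmul_def p)

lemma tmul_mult: "x \<in> carrier A \<Longrightarrow> y \<in> carrier A \<Longrightarrow> x \<otimes>\<^bsub>A\<^esub> y = x \<odot>\<^bsub>A\<^esub> y"
  by (simp add: tmul_def p)

lemma pr_one: "pr A \<one>\<^bsub>A\<^esub> = \<one>\<^bsub>A\<^esub>"
  by (simp add: p)

lemma tmul_assoc: "(x \<odot>\<^bsub>A\<^esub> y) \<odot>\<^bsub>A\<^esub> z = x \<odot>\<^bsub>A\<^esub> (y \<odot>\<^bsub>A\<^esub> z)"
  by (simp add: tmul_def p m_assoc)

lemma tmul_pr:
  "pr A x \<odot>\<^bsub>A\<^esub> y = x \<odot>\<^bsub>A\<^esub> y" "x \<odot>\<^bsub>A\<^esub> pr A y = x \<odot>\<^bsub>A\<^esub> y" "pr A (x \<odot>\<^bsub>A\<^esub> y) = x \<odot>\<^bsub>A\<^esub> y"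
  by (simp_all add: tmul_def p)

lemma tmul_one: "\<one>\<^bsub>A\<^esub> \<odot>\<^bsub>A\<^esub> x = pr A x" "x \<odot>\<^bsub>A\<^esub> \<one>\<^bsub>A\<^esub> = pr A x"
  by (simp_all add: tmul_def p)

lemma tmul_bilin: "bilin (scl A) (scl A) (scl A) (tmul A)"
  using kbilin_tot[OF _ _ _ kalgebraD(3)[OF A]] kalgebraD(1)[OF A] by (simp add: tmul_def[abs_def])

lemma tmul_lin:
  "lin s (scl A) f \<Longrightarrow> lin s (scl A) (\<lambda>x. f x \<odot>\<^bsub>A\<^esub> c)"
  "lin s (scl A) f \<Longrightarrow> lin s (scl A) (\<lambda>x. c \<odot>\<^bsub>A\<^esub> f x)"
  by (rule lin_bilin[OF tmul_bilin]; assumption)+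

end

lemmas [lins] = tmul_lin

lemma tpt_bilin:
  assumes "kspace A" "kspace B"
  shows "bilin (scl A) (scl B) (scl (A \<boxtimes> B)) (tpt A B)"
  using kbilin_tot[OF assms kspace_tensor[OF assms(1)] kbilin_pt[OF assms]] by (simp add: tpt_def[abs_def])

lemma tpt_lin [lins]:
  assumes "kspace A" "kspace B"
  shows "lin s (scl A) f \<Longrightarrow> lin s (scl (A \<boxtimes> B)) (\<lambda>x. tpt A B (f x) c)"
    "lin s (scl B) g \<Longrightarrow> lin s (scl (A \<boxtimes> B)) (\<lambda>x. tpt A B d (g x))"
  by (rule lin_bilin[OF tpt_bilin[OF assms]]; assumption)+

lemma tpt_closed:
  assumes "kspace A" "kspace B"
  shows "tpt A B x y \<in> carrier (A \<boxtimes> B)"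
  by (simp add: tpt_def pt_closed pr_spec assms)

lemma tpt_pr:
  "kspace A \<Longrightarrow> tpt A B (pr A x) y = tpt A B x y" "kspace B \<Longrightarrow> tpt A B x (pr B y) = tpt A B x y"
  by (simp_all add: tpt_def pr_pr)

lemma tpt_pt:
  assumes "kspace A" "kspace B" "x \<in> carrier A" "y \<in> carrier B"
  shows "pt A B x y = tpt A B x y"
  using assms by (simp add: tpt_def pr_spec)

lemma sw_tpt_id:
  assumes "kspace A" "kspace B" "t \<in> carrier (A \<boxtimes> B)"
  shows "sw A B t (tpt A B) = t"
proof -
  have "sw A B t (tpt A B) = sw A B t (pt A B)"
    by (rule sw_cong[OF assms(3)]) (simp add: tpt_pt assms(1,2))
  then show ?thesis using sw_id[OF assms(3)] by simp
qed

text \<open>Summing \<open>tpt\<close> over a tensor returns the tensor, so two tensors are equal as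
  soon as they agree on this one universal bilinear map. Evaluation rules thereby become sufficient
  for proving equations of tensors.\<close>

lemma tens_eqI:
  assumes "kspace A" "kspace B" "s \<in> carrier (A \<boxtimes> B)" "t \<in> carrier (A \<boxtimes> B)"
    "sw A B s (tpt A B) = sw A B t (tpt A B)"
  shows "s = t"
  using assms by (simp add: sw_tpt_id)

lemma sw_tpt:
  assumes "kspace A" "kspace B" "bilin (scl A) (scl B) s F"
  shows "sw A B (tpt A B x y) F = F (pr A x) (pr B y)"
  using assms by (simp add: tpt_def sw_pt pr_spec)

section \<open>The tensor product of two algebras\<close>

context
  fixes A :: "('k::field, 'a::ab_group_add, 'm) kalg_scheme" and B :: "('k, 'b::ab_group_add, 'n) kalg_scheme"
  assumes A: "kalgebra A" and B: "kalgebra B"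
begin

private lemmas kA = kalgebraD(1)[OF A] and kB = kalgebraD(1)[OF B]
private lemmas mA = kalgebraD(2)[OF A] and mB = kalgebraD(2)[OF B]

lemma tensor_mult:
  assumes "s \<in> carrier (A \<boxtimes> B)" "t \<in> carrier (A \<boxtimes> B)"
  shows "s \<otimes>\<^bsub>A \<boxtimes> B\<^esub> t = sw A B s (\<lambda>x y. sw A B t (\<lambda>x' y'. tpt A B (x \<odot>\<^bsub>A\<^esub> x') (y \<odot>\<^bsub>B\<^esub> y')))"
proof -
  have "s \<otimes>\<^bsub>A \<boxtimes> B\<^esub> t = sw A B s (\<lambda>x y. sw A B t (\<lambda>x' y'. pt A B (x \<otimes>\<^bsub>A\<^esub> x') (y \<otimes>\<^bsub>B\<^esub> y')))"
    by (simp add: tensor_def)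
  also have "\<dots> = sw A B s (\<lambda>x y. sw A B t (\<lambda>x' y'. tpt A B (x \<odot>\<^bsub>A\<^esub> x') (y \<odot>\<^bsub>B\<^esub> y')))"
    by (intro sw_cong assms) (simp add: tmul_mult A B tpt_pt[OF kA kB] tmul_closed)
  finally show ?thesis .
qed

lemma tensor_mult_closed:
  assumes "s \<in> carrier (A \<boxtimes> B)" "t \<in> carrier (A \<boxtimes> B)"
  shows "s \<otimes>\<^bsub>A \<boxtimes> B\<^esub> t \<in> carrier (A \<boxtimes> B)"
  by (simp only: tensor_mult[OF assms])
    (intro sw_closed[OF kspace_tensor[OF kA]] assms tpt_closed kA kB)

text \<open>The rule that turns an axiom about products of tensors into an identity of nested sums:
  evaluated at a bilinear map, a product is multiplied leg by leg.\<close>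

lemma sw_mult:
  assumes st: "s \<in> carrier (A \<boxtimes> B)" "t \<in> carrier (A \<boxtimes> B)" and F: "bilin (scl A) (scl B) r F"
  shows "sw A B (s \<otimes>\<^bsub>A \<boxtimes> B\<^esub> t) F =
    sw A B s (\<lambda>x y. sw A B t (\<lambda>x' y'. F (x \<odot>\<^bsub>A\<^esub> x') (y \<odot>\<^bsub>B\<^esub> y')))"
proof -
  have "sw A B (s \<otimes>\<^bsub>A \<boxtimes> B\<^esub> t) F =
    sw A B s (\<lambda>x y. sw A B (sw A B t (\<lambda>x' y'. tpt A B (x \<odot>\<^bsub>A\<^esub> x') (y \<odot>\<^bsub>B\<^esub> y'))) F)"
    unfolding tensor_mult[OF st]
    by (rule sw_sw[OF kA kB F st(1)]) (intro sw_closed[OF kspace_tensor[OF kA]] st tpt_closed kA kB)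
  also have "\<dots> = sw A B s (\<lambda>x y. sw A B t (\<lambda>x' y'. F (x \<odot>\<^bsub>A\<^esub> x') (y \<odot>\<^bsub>B\<^esub> y')))"
    by (simp add: sw_sw[OF kA kB F st(2) tpt_closed[OF kA kB]] sw_tpt[OF kA kB F] tmul_pr A B)
  finally show ?thesis .
qed

lemma sw_one:
  assumes "bilin (scl A) (scl B) r F"
  shows "sw A B \<one>\<^bsub>A \<boxtimes> B\<^esub> F = F \<one>\<^bsub>A\<^esub> \<one>\<^bsub>B\<^esub>"
  using sw_pt[OF kA kB assms monoid.one_closed[OF mA] monoid.one_closed[OF mB]] by (simp add: tensor_def)

lemma one_tensor_closed: "\<one>\<^bsub>A \<boxtimes> B\<^esub> \<in> carrier (A \<boxtimes> B)"
  using pt_closed[OF monoid.one_closed[OF mA] monoid.one_closed[OF mB]] by (simp add: tensor_def)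

lemma monoid_tensor: "monoid (A \<boxtimes> B)"
proof
  note b = tpt_bilin[OF kA kB]
  have l: "bilin (scl A) (scl B) (scl (A \<boxtimes> B)) (\<lambda>u v. tpt A B (u \<odot>\<^bsub>A\<^esub> x) (v \<odot>\<^bsub>B\<^esub> y))"
    "bilin (scl A) (scl B) (scl (A \<boxtimes> B)) (\<lambda>u v. tpt A B (x \<odot>\<^bsub>A\<^esub> u) (y \<odot>\<^bsub>B\<^esub> v))" for x y
    by (intro lins kA kB A B)+
  have l2: "bilin (scl A) (scl B) (scl (A \<boxtimes> B))
      (\<lambda>u v. sw A B t (\<lambda>x y. tpt A B (u \<odot>\<^bsub>A\<^esub> x) (v \<odot>\<^bsub>B\<^esub> y)))" for t
    by (intro lins kA kB A B)+
  fix s t u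
  assume s: "s \<in> carrier (A \<boxtimes> B)" and t: "t \<in> carrier (A \<boxtimes> B)"
  show st: "s \<otimes>\<^bsub>A \<boxtimes> B\<^esub> t \<in> carrier (A \<boxtimes> B)" by (rule tensor_mult_closed[OF s t])
  assume u: "u \<in> carrier (A \<boxtimes> B)"
  show "s \<otimes>\<^bsub>A \<boxtimes> B\<^esub> t \<otimes>\<^bsub>A \<boxtimes> B\<^esub> u = s \<otimes>\<^bsub>A \<boxtimes> B\<^esub> (t \<otimes>\<^bsub>A \<boxtimes> B\<^esub> u)"
    by (rule tens_eqI[OF kA kB])
      (use s t u in \<open>simp_all add: tensor_mult_closed sw_mult[OF _ _ b] sw_mult[OF _ _ l(2)]
        sw_mult[OF _ _ l2] tmul_assoc A B\<close>)
next
  show "\<one>\<^bsub>A \<boxtimes> B\<^esub> \<in> carrier (A \<boxtimes> B)" by (rule one_tensor_closed)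
next
  fix t assume t: "t \<in> carrier (A \<boxtimes> B)"
  note b = tpt_bilin[OF kA kB]
  have l: "bilin (scl A) (scl B) (scl (A \<boxtimes> B))
      (\<lambda>u v. sw A B t (\<lambda>x y. tpt A B (u \<odot>\<^bsub>A\<^esub> x) (v \<odot>\<^bsub>B\<^esub> y)))"
    "bilin (scl A) (scl B) (scl (A \<boxtimes> B)) (\<lambda>u v. tpt A B (x \<odot>\<^bsub>A\<^esub> u) (y \<odot>\<^bsub>B\<^esub> v))" for x y
    by (intro lins kA kB A B)+
  show "\<one>\<^bsub>A \<boxtimes> B\<^esub> \<otimes>\<^bsub>A \<boxtimes> B\<^esub> t = t" "t \<otimes>\<^bsub>A \<boxtimes> B\<^esub> \<one>\<^bsub>A \<boxtimes> B\<^esub> = t"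
    by (rule tens_eqI[OF kA kB];
        simp add: t one_tensor_closed tensor_mult_closed sw_mult[OF _ _ b] sw_one[OF l(1)] sw_one[OF l(2)]
        tmul_one A B tpt_pr kA kB)+
qed

lemma kalgebra_tensor: "kalgebra (A \<boxtimes> B)"
  unfolding kalgebra_def kbilin_def
proof (intro conjI ballI)
  note k = kspace_tensor[OF kA, of B]
  have l: "bilin (scl A) (scl B) (scl (A \<boxtimes> B)) (\<lambda>u v. tpt A B (x \<odot>\<^bsub>A\<^esub> u) (y \<odot>\<^bsub>B\<^esub> v))"
    "bilin (scl A) (scl B) (scl (A \<boxtimes> B))
      (\<lambda>u v. sw A B t (\<lambda>x y. tpt A B (u \<odot>\<^bsub>A\<^esub> x) (v \<odot>\<^bsub>B\<^esub> y)))" for x y t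
    by (intro lins kA kB A B)+
  show "kspace (A \<boxtimes> B)" "monoid (A \<boxtimes> B)" by (rule k, rule monoid_tensor)
  fix s assume s: "s \<in> carrier (A \<boxtimes> B)"
  note h = sw_klin[OF kA kB l(1), unfolded klin_def tgt_simps, THEN conjunct2]
  show "klin (A \<boxtimes> B) (A \<boxtimes> B) (mult (A \<boxtimes> B) s)"
    unfolding klin_def
    using h kspaceD(3,4)[OF k] tensor_mult_closed[OF s]
    by (auto simp: s tensor_mult sw_addF scale_sw[OF vs_scl[OF k]])
  note h = sw_klin[OF kA kB l(2), unfolded klin_def tgt_simps, THEN conjunct2]
  show "klin (A \<boxtimes> B) (A \<boxtimes> B) (\<lambda>x. x \<otimes>\<^bsub>A \<boxtimes> B\<^esub> s)"
    unfolding klin_def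
    using h kspaceD(3,4)[OF k] tensor_mult_closed[OF _ s] by (auto simp: s tensor_mult)
qed

end

lemmas [lins] = kspace_tensor

section \<open>Threefold tensor products\<close>

definition tpt3 where "tpt3 A B C x y z = tpt (A \<boxtimes> B) C (tpt A B x y) z"
definition tpt4 where "tpt4 A B C D x y z u = tpt (A \<boxtimes> B \<boxtimes> C) D (tpt3 A B C x y z) u"

definition tap :: "('k::field, 'a::ab_group_add, 'm) kalg_scheme \<Rightarrow> ('a \<Rightarrow> 'b) \<Rightarrow> 'a \<Rightarrow> 'b" where
  "tap A f x = f (pr A x)"

lemma tap_pr: "kspace A \<Longrightarrow> tap A f (pr A x) = tap A f x"
  by (simp add: tap_def pr_pr)

lemma tap_eq: "kspace A \<Longrightarrow> x \<in> carrier A \<Longrightarrow> tap A f x = f x"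
  by (simp add: tap_def pr_spec)

context
  fixes A :: "('k::field, 'a::ab_group_add, 'm) kalg_scheme" and B :: "('k, 'b::ab_group_add, 'n) kalg_scheme"
    and C :: "('k, 'c::ab_group_add, 'o) kalg_scheme"
  assumes A: "kspace A" and B: "kspace B" and C: "kspace C"
begin

private lemmas AB1 = kspace_tensor[OF A, of B]

lemma tpt3_closed: "tpt3 A B C x y z \<in> carrier (A \<boxtimes> B \<boxtimes> C)"
  by (simp add: tpt3_def tpt_closed A B C AB1)

lemma tpt3_trilin: "trilin (scl A) (scl B) (scl C) (scl (A \<boxtimes> B \<boxtimes> C)) (tpt3 A B C)"
  unfolding tpt3_def[abs_def] by (intro lins A B C AB1)

text \<open>Inserting \<open>pr\<close> makes the inner sum linear in the tensor \<open>r\<close> on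
  the whole type. A threefold sum is then a twofold one with a bilinear summand, and the rules for
  \<open>sw\<close> carry over.\<close>

lemma sw3_eq:
  assumes "t \<in> carrier (A \<boxtimes> B \<boxtimes> C)"
  shows "sw3 A B C t F = sw (A \<boxtimes> B) C t (\<lambda>r z. sw A B (pr (A \<boxtimes> B) r) (\<lambda>x y. F x y z))"
  unfolding sw3_def by (rule sw_cong[OF assms]) (simp add: pr_spec[OF AB1])

lemma trilinD:
  assumes "trilin s1 s2 s3 s F"
  shows "bilin s1 s2 s (\<lambda>x y. F x y z)" "lin s3 s (F x y)"
    "lin s2 s (\<lambda>y. F x y z)" "lin s1 s (\<lambda>x. F x y z)"
  using assms by (simp_all add: trilin_def bilin_def)

lemma sw3_bilin:
  assumes "trilin (scl A) (scl B) (scl C) s F"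
  shows "bilin (scl (A \<boxtimes> B)) (scl C) s (\<lambda>r z. sw A B (pr (A \<boxtimes> B) r) (\<lambda>x y. F x y z))"
  by (rule bilinI, rule lin_sw, rule trilinD(2)[OF assms],
      rule lin_sw_arg[OF A B pr_spec(1)[OF AB1] pr_spec(2)[OF AB1] trilinD(1)[OF assms]])

lemma sw3_sw:
  assumes "trilin (scl A) (scl B) (scl C) s F" "t \<in> carrier (P \<boxtimes> Q)"
    "\<And>x y. x \<in> carrier P \<Longrightarrow> y \<in> carrier Q \<Longrightarrow> G x y \<in> carrier (A \<boxtimes> B \<boxtimes> C)"
  shows "sw3 A B C (sw P Q t G) F = sw P Q t (\<lambda>x y. sw3 A B C (G x y) F)"
proof -
  have c: "sw P Q t G \<in> carrier (A \<boxtimes> B \<boxtimes> C)"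
    by (rule sw_closed[OF kspace_tensor[OF AB1] assms(2)]) (rule assms(3))
  show ?thesis
    unfolding sw3_eq[OF c]
    by (rule trans[OF sw_sw[OF AB1 C sw3_bilin[OF assms(1)] assms(2,3)] sw_cong[OF assms(2)]]) (simp_all add: sw3_eq assms(3))
qed

lemma sw3_sw3:
  assumes "trilin (scl A) (scl B) (scl C) s F" "t \<in> carrier (P \<boxtimes> Q \<boxtimes> R)"
    "\<And>x y z. x \<in> carrier P \<Longrightarrow> y \<in> carrier Q \<Longrightarrow> z \<in> carrier R \<Longrightarrow> G x y z \<in> carrier (A \<boxtimes> B \<boxtimes> C)"
  shows "sw3 A B C (sw3 P Q R t G) F = sw3 P Q R t (\<lambda>x y z. sw3 A B C (G x y z) F)"
proof -
  have c: "sw3 P Q R t G \<in> carrier (A \<boxtimes> B \<boxtimes> C)"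
    by (rule sw3_closed[OF kspace_tensor[OF AB1] assms(2)]) (rule assms(3))
  show ?thesis
    unfolding sw3_eq[OF c]
    by (rule trans[OF sw_sw3[OF AB1 C sw3_bilin[OF assms(1)] assms(2,3)] sw3_cong[OF assms(2)]]) (simp_all add: sw3_eq assms(3))
qed

lemma sw3_tpt3:
  assumes "trilin (scl A) (scl B) (scl C) s F"
  shows "sw3 A B C (tpt3 A B C x y z) F = F (pr A x) (pr B y) (pr C z)"
proof -
  have "sw3 A B C (tpt3 A B C x y z) F = sw A B (tpt A B x y) (\<lambda>x y. F x y (pr C z))"
    by (simp only: sw3_eq[OF tpt3_closed])
      (simp add: tpt3_def sw_tpt[OF AB1 C sw3_bilin[OF assms]] pr_spec[OF AB1] tpt_closed[OF A B])
  then show ?thesis by (simp add: sw_tpt[OF A B trilinD(1)[OF assms]])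
qed

lemma sw3_pt3:
  assumes "trilin (scl A) (scl B) (scl C) s F" "x \<in> carrier A" "y \<in> carrier B" "z \<in> carrier C"
  shows "sw3 A B C (pt3 A B C x y z) F = F x y z"
  using sw3_tpt3[OF assms(1), of x y z] assms(2-)
  by (simp add: tpt3_def pt3_def tpt_def pr_spec A B C AB1 pt_closed)

lemma lin_sw3_arg:
  assumes "lin s1 (scl (A \<boxtimes> B \<boxtimes> C)) g" "\<And>x. g x \<in> carrier (A \<boxtimes> B \<boxtimes> C)"
    "trilin (scl A) (scl B) (scl C) s F"
  shows "lin s1 s (\<lambda>x. sw3 A B C (g x) F)"
  unfolding sw3_eq[OF assms(2)] by (rule lin_sw_arg[OF AB1 C assms(1,2) sw3_bilin[OF assms(3)]])

lemma sw3_tpt3_id: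
  assumes "t \<in> carrier (A \<boxtimes> B \<boxtimes> C)"
  shows "sw3 A B C t (tpt3 A B C) = t"
proof -
  have "sw A B (pr (A \<boxtimes> B) r) (\<lambda>x y. tpt (A \<boxtimes> B) C (tpt A B x y) z) = tpt (A \<boxtimes> B) C (pr (A \<boxtimes> B) r) z" for r z
  proof -
    have "lin (scl (A \<boxtimes> B)) (scl (A \<boxtimes> B \<boxtimes> C)) (\<lambda>r. tpt (A \<boxtimes> B) C r z)"
      by (intro lins AB1 C)
    from lin_out[OF this, of A B "pr (A \<boxtimes> B) r" "tpt A B"]
    show ?thesis by (simp add: sw_tpt_id[OF A B] pr_spec[OF AB1])
  qed
  then show ?thesis
    by (simp add: sw3_eq[OF assms] tpt3_def sw_tpt_id[OF AB1 C assms] tpt_pr[OF AB1])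
qed

lemma tens3_eqI:
  assumes "s \<in> carrier (A \<boxtimes> B \<boxtimes> C)" "t \<in> carrier (A \<boxtimes> B \<boxtimes> C)"
    "sw3 A B C s (tpt3 A B C) = sw3 A B C t (tpt3 A B C)"
  shows "s = t"
  using assms by (simp add: sw3_tpt3_id)

end

context
  fixes A :: "('k::field, 'a::ab_group_add, 'm) kalg_scheme" and B :: "('k, 'b::ab_group_add, 'n) kalg_scheme"
    and C :: "('k, 'c::ab_group_add, 'o) kalg_scheme"
  assumes A: "kalgebra A" and B: "kalgebra B" and C: "kalgebra C"
begin

private lemmas k2 = kspace_kalgebra[OF A] kspace_kalgebra[OF B] kspace_kalgebra[OF C]
private lemmas AB2 = kalgebra_tensor[OF A B]

lemma sw3_mult:
  assumes s: "s \<in> carrier (A \<boxtimes> B \<boxtimes> C)" and t: "t \<in> carrier (A \<boxtimes> B \<boxtimes> C)"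
    and F: "trilin (scl A) (scl B) (scl C) r F"
  shows "sw3 A B C (s \<otimes>\<^bsub>A \<boxtimes> B \<boxtimes> C\<^esub> t) F = sw3 A B C s (\<lambda>x y z. sw3 A B C t (\<lambda>x' y' z'.
    F (x \<odot>\<^bsub>A\<^esub> x') (y \<odot>\<^bsub>B\<^esub> y') (z \<odot>\<^bsub>C\<^esub> z')))"
proof -
  let ?AB = "A \<boxtimes> B"
  have "sw3 A B C (s \<otimes>\<^bsub>?AB \<boxtimes> C\<^esub> t) F = sw ?AB C s (\<lambda>r z. sw ?AB C t (\<lambda>r' z'.
      sw A B (pr ?AB (r \<odot>\<^bsub>?AB\<^esub> r')) (\<lambda>x y. F x y (z \<odot>\<^bsub>C\<^esub> z'))))"
    by (simp add: sw3_eq k2 tensor_mult_closed[OF AB2 C s t] sw_mult[OF AB2 C s t sw3_bilin[OF k2 F]])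
  also have "\<dots> = sw ?AB C s (\<lambda>r z. sw ?AB C t (\<lambda>r' z'.
      sw A B r (\<lambda>x y. sw A B r' (\<lambda>x' y'. F (x \<odot>\<^bsub>A\<^esub> x') (y \<odot>\<^bsub>B\<^esub> y') (z \<odot>\<^bsub>C\<^esub> z')))))"
    by (intro sw_cong[OF s] sw_cong[OF t])
      (simp add: tmul_pr AB2 tmul_mult[OF AB2, symmetric] pr_spec[OF kspace_kalgebra[OF AB2]]
        tensor_mult_closed[OF A B] sw_mult[OF A B _ _ trilinD(1)[OF k2 F]])
  also have "\<dots> = sw3 A B C s (\<lambda>x y z. sw3 A B C t (\<lambda>x' y' z'.
    F (x \<odot>\<^bsub>A\<^esub> x') (y \<odot>\<^bsub>B\<^esub> y') (z \<odot>\<^bsub>C\<^esub> z')))"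
    unfolding sw3_def by (subst (2) sw_swap) (rule refl)
  finally show ?thesis .
qed

lemma sw3_one:
  assumes "trilin (scl A) (scl B) (scl C) s F"
  shows "sw3 A B C \<one>\<^bsub>A \<boxtimes> B \<boxtimes> C\<^esub> F = F \<one>\<^bsub>A\<^esub> \<one>\<^bsub>B\<^esub> \<one>\<^bsub>C\<^esub>"
  using sw3_pt3[OF k2 assms] A B C by (simp add: pt3_def tensor_def kalgebraD monoid.one_closed)

end

section \<open>Fourfold tensor products\<close>

lemma sw4_eq: "sw4 A B C D t F = sw3 (A \<boxtimes> B) C D t (\<lambda>r z u. sw A B r (\<lambda>x y. F x y z u))"
  by (simp add: sw4_def sw3_def)

context
  fixes A :: "('k::field, 'a::ab_group_add, 'm) kalg_scheme" and B :: "('k, 'b::ab_group_add, 'n) kalg_scheme"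
    and C :: "('k, 'c::ab_group_add, 'o) kalg_scheme" and D :: "('k, 'd::ab_group_add, 'q) kalg_scheme"
  assumes A: "kspace A" and B: "kspace B" and C: "kspace C" and D: "kspace D"
begin

private lemmas AB3 = kspace_tensor[OF A, of B]
private lemmas ABC3 = kspace_tensor[OF AB3, of C]

lemma sw4_eq':
  assumes "t \<in> carrier (A \<boxtimes> B \<boxtimes> C \<boxtimes> D)"
  shows "sw4 A B C D t F = sw3 (A \<boxtimes> B) C D t (\<lambda>r z u. sw A B (pr (A \<boxtimes> B) r) (\<lambda>x y. F x y z u))"
  unfolding sw4_eq by (rule sw3_cong[OF assms]) (simp add: pr_spec[OF AB3])

lemma quadlinD:
  assumes "quadlin s1 s2 s3 s4 s F"
  shows "bilin s1 s2 s (\<lambda>x y. F x y z u)" "lin s4 s (F x y z)" "lin s3 s (\<lambda>z. F x y z u)"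
    "lin s2 s (\<lambda>y. F x y z u)" "lin s1 s (\<lambda>x. F x y z u)"
  using assms by (simp_all add: quadlin_def bilin_def)

text \<open>Because products are nested to the left, a fourfold sum is a threefold one whose first
  leg lies in \<open>A \<boxtimes> B\<close>. This multilinearity is what the rules for
  \<open>sw3\<close> require of its summand.\<close>

lemma sw4_trilin:
  assumes "quadlin (scl A) (scl B) (scl C) (scl D) s F"
  shows "trilin (scl (A \<boxtimes> B)) (scl C) (scl D) s (\<lambda>r z u. sw A B (pr (A \<boxtimes> B) r) (\<lambda>x y. F x y z u))"
  by (rule trilinI, rule lin_sw, rule quadlinD(2)[OF assms], rule lin_sw, rule quadlinD(3)[OF assms],
      rule lin_sw_arg[OF A B pr_spec(1)[OF AB3] pr_spec(2)[OF AB3] quadlinD(1)[OF assms]])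

lemma sw4_sw:
  assumes "quadlin (scl A) (scl B) (scl C) (scl D) s F" "t \<in> carrier (P \<boxtimes> Q)"
    "\<And>x y. x \<in> carrier P \<Longrightarrow> y \<in> carrier Q \<Longrightarrow> G x y \<in> carrier (A \<boxtimes> B \<boxtimes> C \<boxtimes> D)"
  shows "sw4 A B C D (sw P Q t G) F = sw P Q t (\<lambda>x y. sw4 A B C D (G x y) F)"
proof -
  have c: "sw P Q t G \<in> carrier (A \<boxtimes> B \<boxtimes> C \<boxtimes> D)"
    by (rule sw_closed[OF kspace_tensor[OF ABC3] assms(2)]) (rule assms(3))
  show ?thesis
    unfolding sw4_eq'[OF c]
    by (rule trans[OF sw3_sw[OF AB3 C D sw4_trilin[OF assms(1)] assms(2,3)] sw_cong[OF assms(2)]]) (simp_all add: sw4_eq' assms(3))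
qed

lemma sw4_sw3:
  assumes "quadlin (scl A) (scl B) (scl C) (scl D) s F" "t \<in> carrier (P \<boxtimes> Q \<boxtimes> R)"
    "\<And>x y z. x \<in> carrier P \<Longrightarrow> y \<in> carrier Q \<Longrightarrow> z \<in> carrier R \<Longrightarrow> G x y z \<in> carrier (A \<boxtimes> B \<boxtimes> C \<boxtimes> D)"
  shows "sw4 A B C D (sw3 P Q R t G) F = sw3 P Q R t (\<lambda>x y z. sw4 A B C D (G x y z) F)"
proof -
  have c: "sw3 P Q R t G \<in> carrier (A \<boxtimes> B \<boxtimes> C \<boxtimes> D)"
    by (rule sw3_closed[OF kspace_tensor[OF ABC3] assms(2)]) (rule assms(3))
  show ?thesis
    unfolding sw4_eq'[OF c]
    by (rule trans[OF sw3_sw3[OF AB3 C D sw4_trilin[OF assms(1)] assms(2,3)] sw3_cong[OF assms(2)]]) (simp_all add: sw4_eq' assms(3))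
qed

lemma sw4_pt4:
  assumes "quadlin (scl A) (scl B) (scl C) (scl D) s F"
    "x \<in> carrier A" "y \<in> carrier B" "z \<in> carrier C" "u \<in> carrier D"
  shows "sw4 A B C D (pt4 A B C D x y z u) F = F x y z u"
proof -
  have "pt4 A B C D x y z u = pt3 (A \<boxtimes> B) C D (pt A B x y) z u"
    by (simp add: pt4_def pt3_def)
  then show ?thesis
    using sw3_pt3[OF AB3 C D sw4_trilin[OF assms(1)] pt_closed[OF assms(2,3)] assms(4,5)]
      sw_pt[OF A B quadlinD(1)[OF assms(1)] assms(2,3)] assms(2-)
    by (simp add: sw4_eq' pt3_closed pr_spec[OF AB3] pt_closed)
qed

lemma tpt4_quadlin: "quadlin (scl A) (scl B) (scl C) (scl D) (scl (A \<boxtimes> B \<boxtimes> C \<boxtimes> D)) (tpt4 A B C D)"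
  unfolding tpt4_def[abs_def] tpt3_def by (rule A B C D AB3 ABC3 lins)+

lemma sw4_tpt4_id:
  assumes t: "t \<in> carrier (A \<boxtimes> B \<boxtimes> C \<boxtimes> D)"
  shows "sw4 A B C D t (tpt4 A B C D) = t"
proof -
  have "sw4 A B C D t (tpt4 A B C D) = sw3 (A \<boxtimes> B) C D t (tpt3 (A \<boxtimes> B) C D)"
    unfolding sw4_eq
  proof (rule sw3_cong[OF t])
    fix r z u assume r: "r \<in> carrier (A \<boxtimes> B)"
    have "lin (scl (A \<boxtimes> B)) (scl (A \<boxtimes> B \<boxtimes> C \<boxtimes> D)) (\<lambda>r. tpt3 (A \<boxtimes> B) C D r z u)"
      unfolding tpt3_def by (rule AB3 ABC3 C D lins)+
    from lin_out[OF this, of A B r "tpt A B"]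
    show "sw A B r (\<lambda>x y. tpt4 A B C D x y z u) = tpt3 (A \<boxtimes> B) C D r z u"
      by (simp add: sw_tpt_id[OF A B r] tpt4_def tpt3_def)
  qed
  then show ?thesis by (simp add: sw3_tpt3_id[OF AB3 C D t])
qed

lemma tens4_eqI:
  assumes "s \<in> carrier (A \<boxtimes> B \<boxtimes> C \<boxtimes> D)" "t \<in> carrier (A \<boxtimes> B \<boxtimes> C \<boxtimes> D)"
    "sw4 A B C D s (tpt4 A B C D) = sw4 A B C D t (tpt4 A B C D)"
  shows "s = t"
  using assms by (simp add: sw4_tpt4_id)

end

context
  fixes A :: "('k::field, 'a::ab_group_add, 'm) kalg_scheme" and B :: "('k, 'b::ab_group_add, 'n) kalg_scheme"
    and C :: "('k, 'c::ab_group_add, 'o) kalg_scheme" and D :: "('k, 'd::ab_group_add, 'q) kalg_scheme"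
  assumes A: "kalgebra A" and B: "kalgebra B" and C: "kalgebra C" and D: "kalgebra D"
begin

private lemmas k4 = kspace_kalgebra[OF A] kspace_kalgebra[OF B] kspace_kalgebra[OF C] kspace_kalgebra[OF D]
private lemmas AB4 = kalgebra_tensor[OF A B]

lemma sw4_mult:
  assumes s: "s \<in> carrier (A \<boxtimes> B \<boxtimes> C \<boxtimes> D)" and t: "t \<in> carrier (A \<boxtimes> B \<boxtimes> C \<boxtimes> D)"
    and F: "quadlin (scl A) (scl B) (scl C) (scl D) r F"
  shows "sw4 A B C D (s \<otimes>\<^bsub>A \<boxtimes> B \<boxtimes> C \<boxtimes> D\<^esub> t) F = sw4 A B C D s (\<lambda>x y z u. sw4 A B C D t (\<lambda>x' y' z' u'.
    F (x \<odot>\<^bsub>A\<^esub> x') (y \<odot>\<^bsub>B\<^esub> y') (z \<odot>\<^bsub>C\<^esub> z') (u \<odot>\<^bsub>D\<^esub> u')))"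
proof -
  let ?AB = "A \<boxtimes> B"
  have "sw4 A B C D (s \<otimes>\<^bsub>?AB \<boxtimes> C \<boxtimes> D\<^esub> t) F = sw3 ?AB C D s (\<lambda>r z u. sw3 ?AB C D t (\<lambda>r' z' u'.
      sw A B (pr ?AB (r \<odot>\<^bsub>?AB\<^esub> r')) (\<lambda>x y. F x y (z \<odot>\<^bsub>C\<^esub> z') (u \<odot>\<^bsub>D\<^esub> u'))))"
    by (simp add: sw4_eq' k4 tensor_mult_closed[OF kalgebra_tensor[OF AB4 C] D s t] sw3_mult[OF AB4 C D s t sw4_trilin[OF k4 F]])
  also have "\<dots> = sw3 ?AB C D s (\<lambda>r z u. sw3 ?AB C D t (\<lambda>r' z' u'.
      sw A B r (\<lambda>x y. sw A B r' (\<lambda>x' y'. F (x \<odot>\<^bsub>A\<^esub> x') (y \<odot>\<^bsub>B\<^esub> y') (z \<odot>\<^bsub>C\<^esub> z') (u \<odot>\<^bsub>D\<^esub> u')))))"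
    by (intro sw3_cong[OF s] sw3_cong[OF t])
      (simp add: tmul_pr AB4 tmul_mult[OF AB4, symmetric] pr_spec[OF kspace_kalgebra[OF AB4]]
        tensor_mult_closed[OF A B] sw_mult[OF A B _ _ quadlinD(1)[OF k4 F]])
  also have "\<dots> = sw4 A B C D s (\<lambda>x y z u. sw4 A B C D t (\<lambda>x' y' z' u'.
    F (x \<odot>\<^bsub>A\<^esub> x') (y \<odot>\<^bsub>B\<^esub> y') (z \<odot>\<^bsub>C\<^esub> z') (u \<odot>\<^bsub>D\<^esub> u')))"
    unfolding sw4_eq by (simp add: sw_sw3_swap)
  finally show ?thesis .
qed

lemma sw4_one:
  assumes "quadlin (scl A) (scl B) (scl C) (scl D) s F"
  shows "sw4 A B C D \<one>\<^bsub>A \<boxtimes> B \<boxtimes> C \<boxtimes> D\<^esub> F = F \<one>\<^bsub>A\<^esub> \<one>\<^bsub>B\<^esub> \<one>\<^bsub>C\<^esub> \<one>\<^bsub>D\<^esub>"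
  using sw4_pt4[OF k4 assms] A B C D by (simp add: pt4_def pt3_def tensor_def kalgebraD monoid.one_closed)

end

lemma lin_tri:
  assumes "trilin s1 s2 s3 s F"
  shows "lin r s1 f \<Longrightarrow> lin r s (\<lambda>x. F (f x) b c)" "lin r s2 g \<Longrightarrow> lin r s (\<lambda>x. F a (g x) c)"
    "lin r s3 h \<Longrightarrow> lin r s (\<lambda>x. F a b (h x))"
  using assms lin_comp[of s1 s "\<lambda>x. F x b c" r f] lin_comp[of s2 s "\<lambda>y. F a y c" r g]
    lin_comp[of s3 s "F a b" r h] by (simp_all add: trilin_def)

lemma lin_quad:
  assumes "quadlin s1 s2 s3 s4 s F"
  shows "lin r s1 f \<Longrightarrow> lin r s (\<lambda>x. F (f x) b c d)" "lin r s2 g \<Longrightarrow> lin r s (\<lambda>x. F a (g x) c d)"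
    "lin r s3 h \<Longrightarrow> lin r s (\<lambda>x. F a b (h x) d)" "lin r s4 i \<Longrightarrow> lin r s (\<lambda>x. F a b c (i x))"
  using assms lin_comp[of s1 s "\<lambda>x. F x b c d" r f] lin_comp[of s2 s "\<lambda>y. F a y c d" r g]
    lin_comp[of s3 s "\<lambda>z. F a b z d" r h] lin_comp[of s4 s "F a b c" r i] by (simp_all add: quadlin_def)

lemma lin_sw4 [lins]:
  assumes "\<And>u v w y. lin s1 s2 (\<lambda>x. F x u v w y)"
  shows "lin s1 s2 (\<lambda>x. sw4 A B C D t (F x))"
  unfolding sw4_def by (intro lin_sw lin_sw3 assms)

lemma kspace_base_field: "kspace base_field"
proof -
  interpret vector_space "(*) :: 'a::field \<Rightarrow> 'a \<Rightarrow> 'a" by unfold_locales (simp_all add: algebra_simps)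
  show ?thesis by (simp add: kspace_def vector_space_axioms)
qed

section \<open>Algebra maps and their application to a single tensor leg\<close>

context
  fixes B :: "('k::field, 'b::ab_group_add, 'n) kalg_scheme" and C :: "('k, 'c::ab_group_add, 'o) kalg_scheme" and f
  assumes f: "f \<in> kalg_hom B C" and B: "kspace B"
begin

lemma tap_closed: "tap B f x \<in> carrier C"
  using f pr_spec(2)[OF B] by (auto simp: kalg_hom_def klin_def tap_def)

lemma tap_lin: "kspace C \<Longrightarrow> lin s (scl B) g \<Longrightarrow> lin s (scl C) (\<lambda>x. tap B f (g x))"
  unfolding tap_def by (rule klin_tot[OF B]) (use f in \<open>auto simp: kalg_hom_def\<close>)

lemma tap_mult:
  assumes "kalgebra B" "kalgebra C"
  shows "tap B f (x \<odot>\<^bsub>B\<^esub> y) = tap B f x \<odot>\<^bsub>C\<^esub> tap B f y"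
proof -
  have "tap B f (x \<odot>\<^bsub>B\<^esub> y) = f (pr B x \<otimes>\<^bsub>B\<^esub> pr B y)"
    by (simp add: tap_def tmul_pr[OF assms(1)]) (simp add: tmul_def)
  then show ?thesis using f pr_spec(2)[OF B] tap_closed tmul_mult[OF assms(2)]
    by (simp add: kalg_hom_def hom_def tap_def)
qed

lemma tap_one: "kalgebra B \<Longrightarrow> tap B f \<one>\<^bsub>B\<^esub> = \<one>\<^bsub>C\<^esub>"
  using f by (simp add: tap_def pr_one kalg_hom_def)

end

lemma sw_tap_mult:
  assumes "f \<in> kalg_hom B (P \<boxtimes> Q)" "kalgebra B" "kalgebra P" "kalgebra Q" "bilin (scl P) (scl Q) s F"
  shows "sw P Q (tap B f (x \<odot>\<^bsub>B\<^esub> y)) F =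
    sw P Q (tap B f x) (\<lambda>p q. sw P Q (tap B f y) (\<lambda>p' q'. F (p \<odot>\<^bsub>P\<^esub> p') (q \<odot>\<^bsub>Q\<^esub> q')))"
  using assms by (simp add: tap_mult kspace_kalgebra kalgebra_tensor tmul_mult[symmetric] tap_closed sw_mult)

lemma sw_tap_one:
  assumes "f \<in> kalg_hom B (P \<boxtimes> Q)" "kalgebra B" "kalgebra P" "kalgebra Q" "bilin (scl P) (scl Q) s F"
  shows "sw P Q (tap B f \<one>\<^bsub>B\<^esub>) F = F \<one>\<^bsub>P\<^esub> \<one>\<^bsub>Q\<^esub>"
  using assms by (simp add: tap_one[OF assms(1)] kspace_kalgebra sw_one)

lemma lin_sw_tap [lins]:
  assumes "f \<in> kalg_hom B (P \<boxtimes> Q)" "kspace B" "kspace P" "kspace Q" "lin r (scl B) g"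
    "bilin (scl P) (scl Q) s F"
  shows "lin r s (\<lambda>x. sw P Q (tap B f (g x)) F)"
  by (rule lin_sw_arg[OF assms(3,4) _ _ assms(6)])
    (use assms in \<open>simp_all add: tap_lin tap_closed kspace_tensor\<close>)

context
  fixes A :: "('k::field, 'a::ab_group_add, 'm) kalg_scheme" and B :: "('k, 'b::ab_group_add, 'n) kalg_scheme"
    and P :: "('k, 'p::ab_group_add, 'q) kalg_scheme" and Q :: "('k, 'r::ab_group_add, 's) kalg_scheme"
  assumes A: "kalgebra A" and B: "kalgebra B" and P: "kalgebra P" and Q: "kalgebra Q"
begin

private lemmas k5 = kspace_kalgebra[OF A] kspace_kalgebra[OF B] kspace_kalgebra[OF P] kspace_kalgebra[OF Q]

lemma split1of2_closed:
  assumes "f \<in> kalg_hom A (P \<boxtimes> Q)" "t \<in> carrier (A \<boxtimes> B)"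
  shows "split1of2 A B P Q f t \<in> carrier (P \<boxtimes> Q \<boxtimes> B)"
  unfolding split1of2_def
  by (intro sw_closed sw_closed kspace_tensor[OF kspace_tensor[OF k5(3)]] pt3_closed assms tap_closed[OF assms(1), unfolded tap_def])
    (use assms in \<open>auto simp: kalg_hom_def klin_def\<close>)

lemma sw3_split1of2:
  assumes f: "f \<in> kalg_hom A (P \<boxtimes> Q)" and t: "t \<in> carrier (A \<boxtimes> B)" and F: "trilin (scl P) (scl Q) (scl B) r F"
  shows "sw3 P Q B (split1of2 A B P Q f t) F = sw A B t (\<lambda>x y. sw P Q (tap A f x) (\<lambda>p q. F p q y))"
proof -
  have f': "f x \<in> carrier (P \<boxtimes> Q)" if "x \<in> carrier A" for x
    using f that by (auto simp: kalg_hom_def klin_def)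
  note s1 = sw3_sw[OF k5(3) k5(4) k5(2) F] and s2 = sw3_sw[OF k5(3) k5(4) k5(2) F t]
  have "sw3 P Q B (split1of2 A B P Q f t) F =
    sw A B t (\<lambda>x y. sw3 P Q B (sw P Q (f x) (\<lambda>p q. pt3 P Q B p q y)) F)"
    unfolding split1of2_def by (rule s2) (intro sw_closed kspace_tensor[OF kspace_tensor[OF k5(3)]] pt3_closed f')
  also have "\<dots> = sw A B t (\<lambda>x y. sw P Q (tap A f x) (\<lambda>p q. F p q y))"
    by (intro sw_cong[OF t])
      (subst s1[OF f'], (assumption | rule pt3_closed)+, simp add: tap_eq k5, rule sw_cong[OF f'],
        assumption, rule sw3_pt3[OF k5(3) k5(4) k5(2) F], assumption+)
  finally show ?thesis .
qed

lemma split2of2_closed: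
  assumes "f \<in> kalg_hom B (P \<boxtimes> Q)" "t \<in> carrier (A \<boxtimes> B)"
  shows "split2of2 A B P Q f t \<in> carrier (A \<boxtimes> P \<boxtimes> Q)"
  unfolding split2of2_def
  by (intro sw_closed sw_closed kspace_tensor[OF kspace_tensor[OF k5(1)]] pt3_closed assms tap_closed[OF assms(1), unfolded tap_def])
    (use assms in \<open>auto simp: kalg_hom_def klin_def\<close>)

lemma sw3_split2of2:
  assumes f: "f \<in> kalg_hom B (P \<boxtimes> Q)" and t: "t \<in> carrier (A \<boxtimes> B)" and F: "trilin (scl A) (scl P) (scl Q) r F"
  shows "sw3 A P Q (split2of2 A B P Q f t) F = sw A B t (\<lambda>x y. sw P Q (tap B f y) (\<lambda>p q. F x p q))"
proof -
  have f': "f y \<in> carrier (P \<boxtimes> Q)" if "y \<in> carrier B" for y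
    using f that by (auto simp: kalg_hom_def klin_def)
  note s1 = sw3_sw[OF k5(1) k5(3) k5(4) F] and s2 = sw3_sw[OF k5(1) k5(3) k5(4) F t]
  have "sw3 A P Q (split2of2 A B P Q f t) F =
    sw A B t (\<lambda>x y. sw3 A P Q (sw P Q (f y) (\<lambda>p q. pt3 A P Q x p q)) F)"
    unfolding split2of2_def by (rule s2) (intro sw_closed kspace_tensor[OF kspace_tensor[OF k5(1)]] pt3_closed f')
  also have "\<dots> = sw A B t (\<lambda>x y. sw P Q (tap B f y) (\<lambda>p q. F x p q))"
    by (intro sw_cong[OF t])
      (subst s1[OF f'], (assumption | rule pt3_closed)+, simp add: tap_eq k5, rule sw_cong[OF f'],
        assumption, rule sw3_pt3[OF k5(1) k5(3) k5(4) F], assumption+)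
  finally show ?thesis .
qed

end

text \<open>
  The functional \<open>K x y z\<close> evaluates multilinear maps on the image of a pure tensor under \<open>m\<close>.
\<close>

lemma tens4_hom:
  assumes A: "kalgebra A" and B: "kalgebra B" and C: "kalgebra C"
    and W: "kalgebra W" and X: "kalgebra X" and Y: "kalgebra Y" and Z: "kalgebra Z"
    and c: "\<And>t. t \<in> carrier (A \<boxtimes> B \<boxtimes> C) \<Longrightarrow> m t \<in> carrier (W \<boxtimes> X \<boxtimes> Y \<boxtimes> Z)"
    and ev: "\<And>t F. t \<in> carrier (A \<boxtimes> B \<boxtimes> C) \<Longrightarrow>
      quadlin (scl W) (scl X) (scl Y) (scl Z) (scl (W \<boxtimes> X \<boxtimes> Y \<boxtimes> Z)) F \<Longrightarrow>
      sw4 W X Y Z (m t) F = sw3 A B C t (\<lambda>x y z. K x y z F)"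
    and K_lin: "\<And>F. quadlin (scl W) (scl X) (scl Y) (scl Z) (scl (W \<boxtimes> X \<boxtimes> Y \<boxtimes> Z)) F \<Longrightarrow>
      trilin (scl A) (scl B) (scl C) (scl (W \<boxtimes> X \<boxtimes> Y \<boxtimes> Z)) (\<lambda>x y z. K x y z F)"
    and K_mult: "\<And>F x y z x' y' z'. quadlin (scl W) (scl X) (scl Y) (scl Z) (scl (W \<boxtimes> X \<boxtimes> Y \<boxtimes> Z)) F \<Longrightarrow>
      K (x \<odot>\<^bsub>A\<^esub> x') (y \<odot>\<^bsub>B\<^esub> y') (z \<odot>\<^bsub>C\<^esub> z') F = K x y z (\<lambda>p q r u. K x' y' z' (\<lambda>p' q' r' u'.
        F (p \<odot>\<^bsub>W\<^esub> p') (q \<odot>\<^bsub>X\<^esub> q') (r \<odot>\<^bsub>Y\<^esub> r') (u \<odot>\<^bsub>Z\<^esub> u')))"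
    and K_one: "\<And>F. quadlin (scl W) (scl X) (scl Y) (scl Z) (scl (W \<boxtimes> X \<boxtimes> Y \<boxtimes> Z)) F \<Longrightarrow>
      K \<one>\<^bsub>A\<^esub> \<one>\<^bsub>B\<^esub> \<one>\<^bsub>C\<^esub> F = F \<one>\<^bsub>W\<^esub> \<one>\<^bsub>X\<^esub> \<one>\<^bsub>Y\<^esub> \<one>\<^bsub>Z\<^esub>"
    and K_sw3: "\<And>x y z t G. K x y z (\<lambda>p q r u. sw3 A B C t (\<lambda>x' y' z'. G p q r u x' y' z')) =
      sw3 A B C t (\<lambda>x' y' z'. K x y z (\<lambda>p q r u. G p q r u x' y' z'))"
  shows "s \<in> carrier (A \<boxtimes> B \<boxtimes> C) \<Longrightarrow> t \<in> carrier (A \<boxtimes> B \<boxtimes> C) \<Longrightarrow>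
      m (s \<otimes>\<^bsub>A \<boxtimes> B \<boxtimes> C\<^esub> t) = m s \<otimes>\<^bsub>W \<boxtimes> X \<boxtimes> Y \<boxtimes> Z\<^esub> m t"
    and "m \<one>\<^bsub>A \<boxtimes> B \<boxtimes> C\<^esub> = \<one>\<^bsub>W \<boxtimes> X \<boxtimes> Y \<boxtimes> Z\<^esub>"
proof -
  note k = kspace_kalgebra[OF W] kspace_kalgebra[OF X] kspace_kalgebra[OF Y] kspace_kalgebra[OF Z]
  note AB = kalgebra_tensor[OF A B] and WXY = kalgebra_tensor[OF kalgebra_tensor[OF W X] Y]
  note F = tpt4_quadlin[OF k]
  note l = lin_quad[OF F] k W X Y Z lins
  have q: "quadlin (scl W) (scl X) (scl Y) (scl Z) (scl (W \<boxtimes> X \<boxtimes> Y \<boxtimes> Z)) (\<lambda>p q r u. sw4 W X Y Z t (\<lambda>p' q' r' u'.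
      tpt4 W X Y Z (p \<odot>\<^bsub>W\<^esub> p') (q \<odot>\<^bsub>X\<^esub> q') (r \<odot>\<^bsub>Y\<^esub> r') (u \<odot>\<^bsub>Z\<^esub> u')))"
    "quadlin (scl W) (scl X) (scl Y) (scl Z) (scl (W \<boxtimes> X \<boxtimes> Y \<boxtimes> Z)) (\<lambda>p' q' r' u'.
      tpt4 W X Y Z (p \<odot>\<^bsub>W\<^esub> p') (q \<odot>\<^bsub>X\<^esub> q') (r \<odot>\<^bsub>Y\<^esub> r') (u \<odot>\<^bsub>Z\<^esub> u'))" for t p q r u
    by (rule l)+
  show "m (s \<otimes>\<^bsub>A \<boxtimes> B \<boxtimes> C\<^esub> t) = m s \<otimes>\<^bsub>W \<boxtimes> X \<boxtimes> Y \<boxtimes> Z\<^esub> m t"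
    if s: "s \<in> carrier (A \<boxtimes> B \<boxtimes> C)" and t: "t \<in> carrier (A \<boxtimes> B \<boxtimes> C)"
  proof (rule tens4_eqI[OF k])
    note st = tensor_mult_closed[OF AB C s t]
    show "m (s \<otimes>\<^bsub>A \<boxtimes> B \<boxtimes> C\<^esub> t) \<in> carrier (W \<boxtimes> X \<boxtimes> Y \<boxtimes> Z)" by (rule c[OF st])
    show "m s \<otimes>\<^bsub>W \<boxtimes> X \<boxtimes> Y \<boxtimes> Z\<^esub> m t \<in> carrier (W \<boxtimes> X \<boxtimes> Y \<boxtimes> Z)"
      by (rule tensor_mult_closed[OF WXY Z c[OF s] c[OF t]])
    show "sw4 W X Y Z (m (s \<otimes>\<^bsub>A \<boxtimes> B \<boxtimes> C\<^esub> t)) (tpt4 W X Y Z) =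
        sw4 W X Y Z (m s \<otimes>\<^bsub>W \<boxtimes> X \<boxtimes> Y \<boxtimes> Z\<^esub> m t) (tpt4 W X Y Z)"
      by (simp only: sw4_mult[OF W X Y Z c[OF s] c[OF t] F], simp only: ev[OF s q(1)],
          simp only: ev[OF t q(2)] K_sw3 ev[OF st F] sw3_mult[OF A B C s t K_lin[OF F]] K_mult[OF F])
  qed
  show "m \<one>\<^bsub>A \<boxtimes> B \<boxtimes> C\<^esub> = \<one>\<^bsub>W \<boxtimes> X \<boxtimes> Y \<boxtimes> Z\<^esub>"
  proof (rule tens4_eqI[OF k])
    note o = one_tensor_closed[OF AB C]
    show "m \<one>\<^bsub>A \<boxtimes> B \<boxtimes> C\<^esub> \<in> carrier (W \<boxtimes> X \<boxtimes> Y \<boxtimes> Z)" by (rule c[OF o])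
    show "\<one>\<^bsub>W \<boxtimes> X \<boxtimes> Y \<boxtimes> Z\<^esub> \<in> carrier (W \<boxtimes> X \<boxtimes> Y \<boxtimes> Z)" by (rule one_tensor_closed[OF WXY Z])
    show "sw4 W X Y Z (m \<one>\<^bsub>A \<boxtimes> B \<boxtimes> C\<^esub>) (tpt4 W X Y Z) = sw4 W X Y Z \<one>\<^bsub>W \<boxtimes> X \<boxtimes> Y \<boxtimes> Z\<^esub> (tpt4 W X Y Z)"
      by (simp only: ev[OF o F] sw3_one[OF A B C K_lin[OF F]] K_one[OF F] sw4_one[OF W X Y Z F])
  qed
qed

context
  fixes A :: "('k::field, 'a::ab_group_add, 'm) kalg_scheme" and B :: "('k, 'b::ab_group_add, 'n) kalg_scheme"
    and C :: "('k, 'c::ab_group_add, 'o) kalg_scheme"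
    and P :: "('k, 'p::ab_group_add, 'q) kalg_scheme" and Q :: "('k, 'r::ab_group_add, 's) kalg_scheme"
  assumes A: "kalgebra A" and B: "kalgebra B" and C: "kalgebra C" and P: "kalgebra P" and Q: "kalgebra Q"
begin

private lemmas k6 = kspace_kalgebra[OF A] kspace_kalgebra[OF B] kspace_kalgebra[OF C]
  kspace_kalgebra[OF P] kspace_kalgebra[OF Q]

lemma split1of3_closed:
  assumes "f \<in> kalg_hom A (P \<boxtimes> Q)" "t \<in> carrier (A \<boxtimes> B \<boxtimes> C)"
  shows "split1of3 A B C P Q f t \<in> carrier (P \<boxtimes> Q \<boxtimes> B \<boxtimes> C)"
  unfolding split1of3_def
  by (intro sw3_closed sw_closed kspace_tensor[OF kspace_tensor[OF kspace_tensor[OF k6(4)]]] pt4_closed assms tap_closed[OF assms(1), unfolded tap_def])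
    (use assms in \<open>auto simp: kalg_hom_def klin_def\<close>)

lemma sw4_split1of3:
  assumes f: "f \<in> kalg_hom A (P \<boxtimes> Q)" and t: "t \<in> carrier (A \<boxtimes> B \<boxtimes> C)" and F: "quadlin (scl P) (scl Q) (scl B) (scl C) r F"
  shows "sw4 P Q B C (split1of3 A B C P Q f t) F = sw3 A B C t (\<lambda>x y z. sw P Q (tap A f x) (\<lambda>p q. F p q y z))"
proof -
  have f': "f x \<in> carrier (P \<boxtimes> Q)" if "x \<in> carrier A" for x
    using f that by (auto simp: kalg_hom_def klin_def)
  note s1 = sw4_sw[OF k6(4) k6(5) k6(2) k6(3) F] and s2 = sw4_sw3[OF k6(4) k6(5) k6(2) k6(3) F t]
  have "sw4 P Q B C (split1of3 A B C P Q f t) F =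
    sw3 A B C t (\<lambda>x y z. sw4 P Q B C (sw P Q (f x) (\<lambda>p q. pt4 P Q B C p q y z)) F)"
    unfolding split1of3_def by (rule s2) (intro sw_closed kspace_tensor[OF kspace_tensor[OF kspace_tensor[OF k6(4)]]] pt4_closed f')
  also have "\<dots> = sw3 A B C t (\<lambda>x y z. sw P Q (tap A f x) (\<lambda>p q. F p q y z))"
    by (intro sw3_cong[OF t])
      (subst s1[OF f'], (assumption | rule pt4_closed)+, simp add: tap_eq k6, rule sw_cong[OF f'],
        assumption, rule sw4_pt4[OF k6(4) k6(5) k6(2) k6(3) F], assumption+)
  finally show ?thesis .
qed

text \<open>An algebra map carries the inverse of a reassociator to an inverse of its image. The
  pentagon can therefore be inverted factor by factor.\<close>

lemma split1of3_hom:
  assumes f: "f \<in> kalg_hom A (P \<boxtimes> Q)"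
  shows "s \<in> carrier (A \<boxtimes> B \<boxtimes> C) \<Longrightarrow> t \<in> carrier (A \<boxtimes> B \<boxtimes> C) \<Longrightarrow>
      split1of3 A B C P Q f (s \<otimes>\<^bsub>A \<boxtimes> B \<boxtimes> C\<^esub> t) =
      split1of3 A B C P Q f s \<otimes>\<^bsub>P \<boxtimes> Q \<boxtimes> B \<boxtimes> C\<^esub> split1of3 A B C P Q f t" (is "PROP ?mult")
    and "split1of3 A B C P Q f \<one>\<^bsub>A \<boxtimes> B \<boxtimes> C\<^esub> = \<one>\<^bsub>P \<boxtimes> Q \<boxtimes> B \<boxtimes> C\<^esub>" (is ?one)
proof -
  have l: "trilin (scl A) (scl B) (scl C) r (\<lambda>x y z. sw P Q (tap A f x) (\<lambda>p q. F p q y z))"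
    and b: "bilin (scl P) (scl Q) r (\<lambda>p q. F p q y z)" if F: "quadlin (scl P) (scl Q) (scl B) (scl C) r F" for F r y z
    by (rule k6 A B C P Q f lin_quad[OF F] lins)+
  note h = tens4_hom[where m = "split1of3 A B C P Q f" and K = "\<lambda>x y z F. sw P Q (tap A f x) (\<lambda>p q. F p q y z)",
      OF A B C P Q B C split1of3_closed[OF f] sw4_split1of3[OF f] l]
  note r = sw_sw3_swap sw_tap_mult[OF f A P Q] sw_tap_one[OF f A P Q]
  show "PROP ?mult" ?one
    by (rule h; (assumption | rule r | erule b)+)+
qed

lemma split2of3_closed:
  assumes "f \<in> kalg_hom B (P \<boxtimes> Q)" "t \<in> carrier (A \<boxtimes> B \<boxtimes> C)"
  shows "split2of3 A B C P Q f t \<in> carrier (A \<boxtimes> P \<boxtimes> Q \<boxtimes> C)"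
  unfolding split2of3_def
  by (intro sw3_closed sw_closed kspace_tensor[OF kspace_tensor[OF kspace_tensor[OF k6(1)]]] pt4_closed assms tap_closed[OF assms(1), unfolded tap_def])
    (use assms in \<open>auto simp: kalg_hom_def klin_def\<close>)

lemma sw4_split2of3:
  assumes f: "f \<in> kalg_hom B (P \<boxtimes> Q)" and t: "t \<in> carrier (A \<boxtimes> B \<boxtimes> C)" and F: "quadlin (scl A) (scl P) (scl Q) (scl C) r F"
  shows "sw4 A P Q C (split2of3 A B C P Q f t) F = sw3 A B C t (\<lambda>x y z. sw P Q (tap B f y) (\<lambda>p q. F x p q z))"
proof -
  have f': "f y \<in> carrier (P \<boxtimes> Q)" if "y \<in> carrier B" for y
    using f that by (auto simp: kalg_hom_def klin_def)
  note s1 = sw4_sw[OF k6(1) k6(4) k6(5) k6(3) F] and s2 = sw4_sw3[OF k6(1) k6(4) k6(5) k6(3) F t]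
  have "sw4 A P Q C (split2of3 A B C P Q f t) F =
    sw3 A B C t (\<lambda>x y z. sw4 A P Q C (sw P Q (f y) (\<lambda>p q. pt4 A P Q C x p q z)) F)"
    unfolding split2of3_def by (rule s2) (intro sw_closed kspace_tensor[OF kspace_tensor[OF kspace_tensor[OF k6(1)]]] pt4_closed f')
  also have "\<dots> = sw3 A B C t (\<lambda>x y z. sw P Q (tap B f y) (\<lambda>p q. F x p q z))"
    by (intro sw3_cong[OF t])
      (subst s1[OF f'], (assumption | rule pt4_closed)+, simp add: tap_eq k6, rule sw_cong[OF f'],
        assumption, rule sw4_pt4[OF k6(1) k6(4) k6(5) k6(3) F], assumption+)
  finally show ?thesis .
qed

lemma split2of3_hom:
  assumes f: "f \<in> kalg_hom B (P \<boxtimes> Q)"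
  shows "s \<in> carrier (A \<boxtimes> B \<boxtimes> C) \<Longrightarrow> t \<in> carrier (A \<boxtimes> B \<boxtimes> C) \<Longrightarrow>
      split2of3 A B C P Q f (s \<otimes>\<^bsub>A \<boxtimes> B \<boxtimes> C\<^esub> t) =
      split2of3 A B C P Q f s \<otimes>\<^bsub>A \<boxtimes> P \<boxtimes> Q \<boxtimes> C\<^esub> split2of3 A B C P Q f t" (is "PROP ?mult")
    and "split2of3 A B C P Q f \<one>\<^bsub>A \<boxtimes> B \<boxtimes> C\<^esub> = \<one>\<^bsub>A \<boxtimes> P \<boxtimes> Q \<boxtimes> C\<^esub>" (is ?one)
proof -
  have l: "trilin (scl A) (scl B) (scl C) r (\<lambda>x y z. sw P Q (tap B f y) (\<lambda>p q. F x p q z))"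
    and b: "bilin (scl P) (scl Q) r (\<lambda>p q. F x p q z)" if F: "quadlin (scl A) (scl P) (scl Q) (scl C) r F" for F r x z
    by (rule k6 A B C P Q f lin_quad[OF F] lins)+
  note h = tens4_hom[where m = "split2of3 A B C P Q f" and K = "\<lambda>x y z F. sw P Q (tap B f y) (\<lambda>p q. F x p q z)",
      OF A B C A P Q C split2of3_closed[OF f] sw4_split2of3[OF f] l]
  note r = sw_sw3_swap sw_tap_mult[OF f B P Q] sw_tap_one[OF f B P Q]
  show "PROP ?mult" ?one
    by (rule h; (assumption | rule r | erule b)+)+
qed

lemma split3of3_closed:
  assumes "f \<in> kalg_hom C (P \<boxtimes> Q)" "t \<in> carrier (A \<boxtimes> B \<boxtimes> C)"
  shows "split3of3 A B C P Q f t \<in> carrier (A \<boxtimes> B \<boxtimes> P \<boxtimes> Q)"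
  unfolding split3of3_def
  by (intro sw3_closed sw_closed kspace_tensor[OF kspace_tensor[OF kspace_tensor[OF k6(1)]]] pt4_closed assms tap_closed[OF assms(1), unfolded tap_def])
    (use assms in \<open>auto simp: kalg_hom_def klin_def\<close>)

lemma sw4_split3of3:
  assumes f: "f \<in> kalg_hom C (P \<boxtimes> Q)" and t: "t \<in> carrier (A \<boxtimes> B \<boxtimes> C)" and F: "quadlin (scl A) (scl B) (scl P) (scl Q) r F"
  shows "sw4 A B P Q (split3of3 A B C P Q f t) F = sw3 A B C t (\<lambda>x y z. sw P Q (tap C f z) (\<lambda>p q. F x y p q))"
proof -
  have f': "f z \<in> carrier (P \<boxtimes> Q)" if "z \<in> carrier C" for z
    using f that by (auto simp: kalg_hom_def klin_def)
  note s1 = sw4_sw[OF k6(1) k6(2) k6(4) k6(5) F] and s2 = sw4_sw3[OF k6(1) k6(2) k6(4) k6(5) F t]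
  have "sw4 A B P Q (split3of3 A B C P Q f t) F =
    sw3 A B C t (\<lambda>x y z. sw4 A B P Q (sw P Q (f z) (\<lambda>p q. pt4 A B P Q x y p q)) F)"
    unfolding split3of3_def by (rule s2) (intro sw_closed kspace_tensor[OF kspace_tensor[OF kspace_tensor[OF k6(1)]]] pt4_closed f')
  also have "\<dots> = sw3 A B C t (\<lambda>x y z. sw P Q (tap C f z) (\<lambda>p q. F x y p q))"
    by (intro sw3_cong[OF t])
      (subst s1[OF f'], (assumption | rule pt4_closed)+, simp add: tap_eq k6, rule sw_cong[OF f'],
        assumption, rule sw4_pt4[OF k6(1) k6(2) k6(4) k6(5) F], assumption+)
  finally show ?thesis .
qed

lemma split3of3_hom:
  assumes f: "f \<in> kalg_hom C (P \<boxtimes> Q)"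
  shows "s \<in> carrier (A \<boxtimes> B \<boxtimes> C) \<Longrightarrow> t \<in> carrier (A \<boxtimes> B \<boxtimes> C) \<Longrightarrow>
      split3of3 A B C P Q f (s \<otimes>\<^bsub>A \<boxtimes> B \<boxtimes> C\<^esub> t) =
      split3of3 A B C P Q f s \<otimes>\<^bsub>A \<boxtimes> B \<boxtimes> P \<boxtimes> Q\<^esub> split3of3 A B C P Q f t" (is "PROP ?mult")
    and "split3of3 A B C P Q f \<one>\<^bsub>A \<boxtimes> B \<boxtimes> C\<^esub> = \<one>\<^bsub>A \<boxtimes> B \<boxtimes> P \<boxtimes> Q\<^esub>" (is ?one)
proof -
  have l: "trilin (scl A) (scl B) (scl C) r (\<lambda>x y z. sw P Q (tap C f z) (\<lambda>p q. F x y p q))"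
    and b: "bilin (scl P) (scl Q) r (\<lambda>p q. F x y p q)" if F: "quadlin (scl A) (scl B) (scl P) (scl Q) r F" for F r x y
    by (rule k6 A B C P Q f lin_quad[OF F] lins)+
  note h = tens4_hom[where m = "split3of3 A B C P Q f" and K = "\<lambda>x y z F. sw P Q (tap C f z) (\<lambda>p q. F x y p q)",
      OF A B C A B P Q split3of3_closed[OF f] sw4_split3of3[OF f] l]
  note r = sw_sw3_swap sw_tap_mult[OF f C P Q] sw_tap_one[OF f C P Q]
  show "PROP ?mult" ?one
    by (rule h; (assumption | rule r | erule b)+)+
qed

end

section \<open>Tensors padded with a unit leg\<close>

context
  fixes A :: "('k::field, 'a::ab_group_add, 'm) kalg_scheme" and B :: "('k, 'b::ab_group_add, 'n) kalg_scheme"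
    and C :: "('k, 'c::ab_group_add, 'o) kalg_scheme" and D :: "('k, 'd::ab_group_add, 'q) kalg_scheme"
  assumes A: "kalgebra A" and B: "kalgebra B" and C: "kalgebra C" and D: "kalgebra D"
begin

private lemmas k7 = kspace_kalgebra[OF A] kspace_kalgebra[OF B] kspace_kalgebra[OF C] kspace_kalgebra[OF D]
private lemmas o7 = monoid.one_closed[OF kalgebraD(2)[OF A]] monoid.one_closed[OF kalgebraD(2)[OF D]]
private lemmas ABC7 = kalgebra_tensor[OF kalgebra_tensor[OF A B] C]
private lemmas ABCD7 = kalgebra_tensor[OF ABC7 D]

lemma one_l_closed:
  assumes "t \<in> carrier (B \<boxtimes> C \<boxtimes> D)"
  shows "one_l A B C D t \<in> carrier (A \<boxtimes> B \<boxtimes> C \<boxtimes> D)"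
  unfolding one_l_def by (rule sw3_closed[OF kspace_kalgebra[OF ABCD7] assms]) (simp add: pt4_closed o7)

lemma sw4_one_l:
  assumes t: "t \<in> carrier (B \<boxtimes> C \<boxtimes> D)" and F: "quadlin (scl A) (scl B) (scl C) (scl D) r F"
  shows "sw4 A B C D (one_l A B C D t) F = sw3 B C D t (\<lambda>x y z. F \<one>\<^bsub>A\<^esub> x y z)"
  unfolding one_l_def
  by (rule trans[OF sw4_sw3[OF k7 F t] sw3_cong[OF t]]) (simp_all add: pt4_closed o7 sw4_pt4[OF k7 F])

lemma one_r_closed:
  assumes "t \<in> carrier (A \<boxtimes> B \<boxtimes> C)"
  shows "one_r A B C D t \<in> carrier (A \<boxtimes> B \<boxtimes> C \<boxtimes> D)"
  unfolding one_r_def by (simp add: pt_closed assms o7)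

text \<open>Here the tensor itself is the first leg of a pure tensor, so the evaluation goes through
  the rule for two legs, applied to a threefold sum that \<open>pr\<close> has made linear in that
  leg.\<close>

lemma sw4_one_r:
  assumes t: "t \<in> carrier (A \<boxtimes> B \<boxtimes> C)" and F: "quadlin (scl A) (scl B) (scl C) (scl D) r F"
  shows "sw4 A B C D (one_r A B C D t) F = sw3 A B C t (\<lambda>x y z. F x y z \<one>\<^bsub>D\<^esub>)"
proof -
  let ?T = "A \<boxtimes> B \<boxtimes> C"
  have kT: "kspace ?T" by (rule kspace_kalgebra[OF ABC7])
  have "trilin (scl A) (scl B) (scl C) r (\<lambda>x y z. F x y z u)" for u
    using F by (simp add: trilin_def quadlin_def)
  note tl = lin_sw3_arg[OF k7(1,2,3) pr_spec(1)[OF kT] pr_spec(2)[OF kT] this]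
  have b: "bilin (scl ?T) (scl D) r (\<lambda>r u. sw3 A B C (pr ?T r) (\<lambda>x y z. F x y z u))"
    by (rule bilinI, rule lin_sw3, rule quadlinD(2)[OF k7 F], rule tl)
  have "sw4 A B C D (one_r A B C D t) F =
    sw ?T D (pt ?T D t \<one>\<^bsub>D\<^esub>) (\<lambda>r u. sw3 A B C (pr ?T r) (\<lambda>x y z. F x y z u))"
    unfolding sw4_def one_r_def
    by (rule sw_cong[OF pt_closed[OF t o7(2)]]) (simp add: pr_spec[OF kT])
  then show ?thesis by (simp add: sw_pt[OF kT k7(4) b t o7(2)] pr_spec[OF kT] t)
qed

lemma one_l_hom:
  shows "s \<in> carrier (B \<boxtimes> C \<boxtimes> D) \<Longrightarrow> t \<in> carrier (B \<boxtimes> C \<boxtimes> D) \<Longrightarrow>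
      one_l A B C D (s \<otimes>\<^bsub>B \<boxtimes> C \<boxtimes> D\<^esub> t) = one_l A B C D s \<otimes>\<^bsub>A \<boxtimes> B \<boxtimes> C \<boxtimes> D\<^esub> one_l A B C D t" (is "PROP ?mult")
    and "one_l A B C D \<one>\<^bsub>B \<boxtimes> C \<boxtimes> D\<^esub> = \<one>\<^bsub>A \<boxtimes> B \<boxtimes> C \<boxtimes> D\<^esub>" (is ?one)
proof -
  have l: "trilin (scl B) (scl C) (scl D) r (\<lambda>x y z. F \<one>\<^bsub>A\<^esub> x y z)" if F: "quadlin (scl A) (scl B) (scl C) (scl D) r F" for F r
    by (rule k7 lin_quad[OF F] lins)+
  note h = tens4_hom[where m = "one_l A B C D" and K = "\<lambda>x y z F. F \<one>\<^bsub>A\<^esub> x y z",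
      OF B C D A B C D]
  show "PROP ?mult" ?one
    by (rule h; (assumption | rule one_l_closed sw4_one_l refl | erule l | simp only: tmul_one[OF A] pr_one[OF A])+)+
qed

lemma one_r_hom:
  shows "s \<in> carrier (A \<boxtimes> B \<boxtimes> C) \<Longrightarrow> t \<in> carrier (A \<boxtimes> B \<boxtimes> C) \<Longrightarrow>
      one_r A B C D (s \<otimes>\<^bsub>A \<boxtimes> B \<boxtimes> C\<^esub> t) = one_r A B C D s \<otimes>\<^bsub>A \<boxtimes> B \<boxtimes> C \<boxtimes> D\<^esub> one_r A B C D t" (is "PROP ?mult")
    and "one_r A B C D \<one>\<^bsub>A \<boxtimes> B \<boxtimes> C\<^esub> = \<one>\<^bsub>A \<boxtimes> B \<boxtimes> C \<boxtimes> D\<^esub>" (is ?one)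
proof -
  have l: "trilin (scl A) (scl B) (scl C) r (\<lambda>x y z. F x y z \<one>\<^bsub>D\<^esub>)" if F: "quadlin (scl A) (scl B) (scl C) (scl D) r F" for F r
    by (rule k7 lin_quad[OF F] lins)+
  note h = tens4_hom[where m = "one_r A B C D" and K = "\<lambda>x y z F. F x y z \<one>\<^bsub>D\<^esub>",
      OF A B C A B C D]
  show "PROP ?mult" ?one
    by (rule h; (assumption | rule one_r_closed sw4_one_r refl | erule l | simp only: tmul_one[OF D] pr_one[OF D])+)+
qed

end

text \<open>
  The axioms for a reassociator have the form \<open>a b c = d e\<close>.
\<close>

lemma (in monoid) pentagon_moves:
  assumes "a \<in> carrier G" "b \<in> carrier G" "c \<in> carrier G" "d \<in> carrier G" "e \<in> carrier G"
    "a' \<in> carrier G" "b' \<in> carrier G" "c' \<in> carrier G" "d' \<in> carrier G" "e' \<in> carrier G"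
    and eq: "a \<otimes> b \<otimes> c = d \<otimes> e"
    and i: "a' \<otimes> a = \<one>" "b' \<otimes> b = \<one>" "c \<otimes> c' = \<one>" "d' \<otimes> d = \<one>" "e \<otimes> e' = \<one>" "e' \<otimes> e = \<one>" "b \<otimes> b' = \<one>"
  shows "c \<otimes> e' = b' \<otimes> a' \<otimes> d" "e \<otimes> c' = d' \<otimes> a \<otimes> b" "e' \<otimes> d' \<otimes> a = c' \<otimes> b'"
proof -
  note cl = assms(1-10)
  have cancel: "x' \<otimes> (x \<otimes> y) = y" if "x' \<otimes> x = \<one>" "x \<in> carrier G" "x' \<in> carrier G" "y \<in> carrier G" for x x' y
    using that by (simp add: m_assoc[symmetric])
  have "c \<otimes> e' = b' \<otimes> (a' \<otimes> (a \<otimes> b \<otimes> c)) \<otimes> e'"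
    using cl i by (simp add: m_assoc cancel)
  also have "\<dots> = b' \<otimes> a' \<otimes> d"
    unfolding eq using cl i by (simp add: m_assoc)
  finally show "c \<otimes> e' = b' \<otimes> a' \<otimes> d" .
  have "e \<otimes> c' = d' \<otimes> (d \<otimes> e) \<otimes> c'"
    using cl i by (simp add: m_assoc cancel)
  also have "\<dots> = d' \<otimes> a \<otimes> b"
    unfolding eq[symmetric] using cl i by (simp add: m_assoc)
  finally show "e \<otimes> c' = d' \<otimes> a \<otimes> b" .
  have "e' \<otimes> d' \<otimes> a = e' \<otimes> d' \<otimes> (a \<otimes> b \<otimes> c) \<otimes> c' \<otimes> b'"
    using cl i by (simp add: m_assoc cancel)
  also have "\<dots> = c' \<otimes> b'"
    unfolding eq using cl i by (simp add: m_assoc cancel)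
  finally show "e' \<otimes> d' \<otimes> a = c' \<otimes> b'" .
qed

section \<open>Quasi-bialgebras and comodule algebras\<close>

locale qbialg =
  fixes H :: "('k::field, 'h::ab_group_add, 'm) qbialg_scheme"
  assumes qb: "quasi_bialgebra H"
begin

lemma kH [lins]: "kalgebra H"
  and comul_hom [lins]: "comul H \<in> kalg_hom H (H \<boxtimes> H)"
  and counit_hom: "counit H \<in> kalg_hom H base_field"
  and reassoc_unit: "reassoc H \<in> Units (H \<boxtimes> H \<boxtimes> H)"
  using qb by (simp_all add: quasi_bialgebra_def Let_def)

lemmas sH [lins] = kspace_kalgebra[OF kH]

abbreviation hm (infixl "\<cdot>" 70) where "x \<cdot> y \<equiv> x \<odot>\<^bsub>H\<^esub> y"
abbreviation uH where "uH \<equiv> \<one>\<^bsub>H\<^esub>"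
abbreviation \<Delta> where "\<Delta> \<equiv> tap H (comul H)"
abbreviation \<epsilon> where "\<epsilon> \<equiv> tap H (counit H)"
abbreviation \<Phi> where "\<Phi> \<equiv> reassoc H"
abbreviation \<Phi>' where "\<Phi>' \<equiv> inv\<^bsub>H \<boxtimes> H \<boxtimes> H\<^esub> \<Phi>"

lemmas \<Delta>_pr = tap_pr[OF sH, of "comul H"] and \<epsilon>_pr = tap_pr[OF sH, of "counit H"]
lemmas \<Delta>_closed = tap_closed[OF comul_hom sH]

lemmas mH3 = monoid_tensor[OF kalgebra_tensor[OF kH kH] kH]
lemmas P_closed = monoid.Units_closed[OF mH3 reassoc_unit] monoid.Units_inv_closed[OF mH3 reassoc_unit]

lemma \<epsilon>_lin [lins]: "lin s (scl H) g \<Longrightarrow> lin s (*) (\<lambda>x. \<epsilon> (g x))"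
  using tap_lin[OF counit_hom sH kspace_base_field] by simp

lemma \<epsilon>_mult: "\<epsilon> (x \<cdot> y) = \<epsilon> x * \<epsilon> y"
proof -
  have "\<epsilon> (x \<cdot> y) = counit H (pr H x \<otimes>\<^bsub>H\<^esub> pr H y)"
    by (simp add: tap_def tmul_pr[OF kH]) (simp add: tmul_def)
  then show ?thesis using counit_hom pr_spec(2)[OF sH] by (simp add: kalg_hom_def hom_def tap_def)
qed

lemma \<epsilon>_one: "\<epsilon> uH = 1"
  using counit_hom by (simp add: tap_def pr_one[OF kH] kalg_hom_def)

lemmas \<Delta>_mult = sw_tap_mult[OF comul_hom kH kH kH]
lemmas \<Delta>_one = sw_tap_one[OF comul_hom kH kH kH]

text \<open>The counit axiom transported along a linear map \<open>f\<close>, which stands for the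
  expression surrounding the coproduct.\<close>

lemma \<Delta>_counit:
  assumes "lin (scl H) s f"
  shows "sw H H (\<Delta> h) (\<lambda>a b. s (\<epsilon> b) (f a)) = f (pr H h)"
    and "sw H H (\<Delta> h) (\<lambda>a b. s (\<epsilon> a) (f b)) = f (pr H h)"
proof -
  have "sw H H (comul H (pr H h)) (\<lambda>a b. scl H (counit H b) a) = pr H h"
    "sw H H (comul H (pr H h)) (\<lambda>a b. scl H (counit H a) b) = pr H h"
    using qb pr_spec(2)[OF sH, of h] by (simp_all add: quasi_bialgebra_def Let_def)
  then have "f (pr H h) = sw H H (\<Delta> h) (\<lambda>a b. f (scl H (counit H b) a))"
    "f (pr H h) = sw H H (\<Delta> h) (\<lambda>a b. f (scl H (counit H a) b))"
    by (simp_all add: tap_def lin_out[OF assms, symmetric])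
  moreover have "sw H H (\<Delta> h) (\<lambda>a b. f (scl H (counit H b) a)) = sw H H (\<Delta> h) (\<lambda>a b. s (\<epsilon> b) (f a))"
    "sw H H (\<Delta> h) (\<lambda>a b. f (scl H (counit H a) b)) = sw H H (\<Delta> h) (\<lambda>a b. s (\<epsilon> a) (f b))"
    by (rule sw_cong[OF \<Delta>_closed]; simp add: tap_eq[OF sH] linD(4)[OF assms])+
  ultimately show "sw H H (\<Delta> h) (\<lambda>a b. s (\<epsilon> b) (f a)) = f (pr H h)"
    "sw H H (\<Delta> h) (\<lambda>a b. s (\<epsilon> a) (f b)) = f (pr H h)"
    by simp_all
qed

text \<open>Stated for an arbitrary tensor over \<open>A\<close>, because it serves both for
  \<Phi>\<rho> and, with \<open>H\<close> in place of \<open>A\<close>, for \<Phi>.\<close>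

lemma counit_eval:
  assumes A: "kalgebra A" and t: "t \<in> carrier (A \<boxtimes> H \<boxtimes> H)" and F: "bilin (scl A) (scl H) s F"
  shows "sw3 A H H t (\<lambda>x y z. scl (A \<boxtimes> H) (counit H y) (pt A H x z)) = \<one>\<^bsub>A \<boxtimes> H\<^esub> \<Longrightarrow>
      sw3 A H H t (\<lambda>x y z. s (\<epsilon> y) (F x z)) = F \<one>\<^bsub>A\<^esub> uH"
    and "sw3 A H H t (\<lambda>x y z. scl (A \<boxtimes> H) (counit H z) (pt A H x y)) = \<one>\<^bsub>A \<boxtimes> H\<^esub> \<Longrightarrow>
      sw3 A H H t (\<lambda>x y z. s (\<epsilon> z) (F x y)) = F \<one>\<^bsub>A\<^esub> uH"
proof -
  note sA = kspace_kalgebra[OF A]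
  have lF: "lin (scl (A \<boxtimes> H)) s (\<lambda>t. sw A H (pr (A \<boxtimes> H) t) F)"
    by (rule lin_sw_arg[OF sA sH pr_spec(1) pr_spec(2) F]) (rule kspace_tensor sA)+
  have v: "sw A H (pr (A \<boxtimes> H) (scl (A \<boxtimes> H) c (pt A H x y))) F = s c (F x y)"
    if "x \<in> carrier A" "y \<in> carrier H" for c x y
    using linD(4)[OF lF, of c "pt A H x y"] that
    by (simp add: pr_spec kspace_tensor sA pt_closed sw_pt[OF sA sH F])
  have o: "sw A H (pr (A \<boxtimes> H) \<one>\<^bsub>A \<boxtimes> H\<^esub>) F = F \<one>\<^bsub>A\<^esub> uH"
    by (simp add: pr_one[OF kalgebra_tensor[OF A kH]] sw_one[OF A kH F])
  have e: "sw A H (pr (A \<boxtimes> H) (sw3 A H H t (\<lambda>x y z. scl (A \<boxtimes> H) (counit H y) (pt A H x z)))) F =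
      sw3 A H H t (\<lambda>x y z. s (\<epsilon> y) (F x z))"
    "sw A H (pr (A \<boxtimes> H) (sw3 A H H t (\<lambda>x y z. scl (A \<boxtimes> H) (counit H z) (pt A H x y)))) F =
      sw3 A H H t (\<lambda>x y z. s (\<epsilon> z) (F x y))"
    by (rule trans[OF lin_out3[OF lF] sw3_cong[OF t]]; simp add: v tap_eq[OF sH])+
  show "sw3 A H H t (\<lambda>x y z. scl (A \<boxtimes> H) (counit H y) (pt A H x z)) = \<one>\<^bsub>A \<boxtimes> H\<^esub> \<Longrightarrow>
      sw3 A H H t (\<lambda>x y z. s (\<epsilon> y) (F x z)) = F \<one>\<^bsub>A\<^esub> uH"
    "sw3 A H H t (\<lambda>x y z. scl (A \<boxtimes> H) (counit H z) (pt A H x y)) = \<one>\<^bsub>A \<boxtimes> H\<^esub> \<Longrightarrow>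
      sw3 A H H t (\<lambda>x y z. s (\<epsilon> z) (F x y)) = F \<one>\<^bsub>A\<^esub> uH"
    by (simp_all only: o e[symmetric])
qed

end

section \<open>Right comodule algebras\<close>

locale rcomod = qbialg H for H :: "('k::field, 'h::ab_group_add, 'm) qbialg_scheme" +
  fixes A :: "('k, 'a::ab_group_add, 'n) kalg_scheme" and \<rho> and \<Phi>\<rho>
  assumes rc: "right_comodule_algebra H A \<rho> \<Phi>\<rho>"
begin

lemma kA [lins]: "kalgebra A"
  and \<rho>_hom [lins]: "\<rho> \<in> kalg_hom A (A \<boxtimes> H)"
  and \<Phi>\<rho>_unit: "\<Phi>\<rho> \<in> Units (A \<boxtimes> H \<boxtimes> H)"
  using rc by (simp_all add: right_comodule_algebra_def Let_def)

lemmas sA [lins] = kspace_kalgebra[OF kA]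

abbreviation am (infixl "\<bullet>" 70) where "x \<bullet> y \<equiv> x \<odot>\<^bsub>A\<^esub> y"
abbreviation R where "R \<equiv> tap A \<rho>"
abbreviation \<Phi>\<rho>' where "\<Phi>\<rho>' \<equiv> inv\<^bsub>A \<boxtimes> H \<boxtimes> H\<^esub> \<Phi>\<rho>"

lemmas R_pr = tap_pr[OF sA, of "\<rho>"]
lemmas R_closed = tap_closed[OF \<rho>_hom sA]
lemmas R_mult = sw_tap_mult[OF \<rho>_hom kA kA kH]
lemmas R_one = sw_tap_one[OF \<rho>_hom kA kA kH]

lemmas mT3 = monoid_tensor[OF kalgebra_tensor[OF kA kH] kH]

lemmas X_closed = monoid.Units_closed[OF mT3 \<Phi>\<rho>_unit] monoid.Units_inv_closed[OF mT3 \<Phi>\<rho>_unit]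

lemma R_counit:
  assumes "lin (scl A) s f"
  shows "sw A H (R h) (\<lambda>a b. s (\<epsilon> b) (f a)) = f (pr A h)"
proof -
  have "sw A H (\<rho> (pr A h)) (\<lambda>a b. scl A (counit H b) a) = pr A h"
    using rc pr_spec(2)[OF sA, of h] by (simp_all add: right_comodule_algebra_def Let_def)
  then have "f (pr A h) = sw A H (R h) (\<lambda>a b. f (scl A (counit H b) a))"
    by (simp_all add: tap_def lin_out[OF assms, symmetric])
  also have "\<dots> = sw A H (R h) (\<lambda>a b. s (\<epsilon> b) (f a))"
    by (rule sw_cong[OF R_closed]) (simp add: tap_eq[OF sH] linD(4)[OF assms])
  finally show ?thesis by simp
qed

lemma X_inv:
  assumes "trilin (scl A) (scl H) (scl H) s F"
  shows "sw3 A H H \<Phi>\<rho> (\<lambda>a b c. sw3 A H H \<Phi>\<rho>' (\<lambda>a' b' c'. F (a \<bullet> a') (b \<cdot> b') (c \<cdot> c'))) = F \<one>\<^bsub>A\<^esub> uH uH"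
    and "sw3 A H H \<Phi>\<rho>' (\<lambda>a b c. sw3 A H H \<Phi>\<rho> (\<lambda>a' b' c'. F (a \<bullet> a') (b \<cdot> b') (c \<cdot> c'))) = F \<one>\<^bsub>A\<^esub> uH uH"
  using sw3_mult[OF kA kH kH X_closed assms] sw3_mult[OF kA kH kH X_closed(2,1) assms]
    sw3_one[OF kA kH kH assms] monoid.Units_r_inv[OF mT3 \<Phi>\<rho>_unit] monoid.Units_l_inv[OF mT3 \<Phi>\<rho>_unit]
  by simp_all

lemma coassoc:
  assumes F: "trilin (scl A) (scl H) (scl H) s F"
  shows "sw3 A H H \<Phi>\<rho> (\<lambda>x y z. sw A H (R a) (\<lambda>a0 a1. sw A H (R a0) (\<lambda>a00 a01.
      F (x \<bullet> a00) (y \<cdot> a01) (z \<cdot> a1)))) =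
    sw A H (R a) (\<lambda>a0 a1. sw H H (\<Delta> a1) (\<lambda>c d. sw3 A H H \<Phi>\<rho> (\<lambda>x y z.
      F (a0 \<bullet> x) (c \<cdot> y) (d \<cdot> z))))" (is ?th1)
  and "sw3 A H H \<Phi>\<rho>' (\<lambda>x y z. sw A H (R a) (\<lambda>a0 a1. sw H H (\<Delta> a1) (\<lambda>c d.
      F (x \<bullet> a0) (y \<cdot> c) (z \<cdot> d)))) =
    sw A H (R a) (\<lambda>a0 a1. sw A H (R a0) (\<lambda>a00 a01. sw3 A H H \<Phi>\<rho>' (\<lambda>x y z.
      F (a00 \<bullet> x) (a01 \<cdot> y) (a1 \<cdot> z))))" (is ?th2)
proof -
  let ?T = "A \<boxtimes> H \<boxtimes> H"
  interpret T: monoid ?T by (rule mT3)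
  define s1 s2 where s1: "s1 = split1of2 A H A H \<rho> (R a)" and s2: "s2 = split2of2 A H H H (comul H) (R a)"
  have c: "s1 \<in> carrier ?T" "s2 \<in> carrier ?T"
    unfolding s1 s2 by (rule split1of2_closed split2of2_closed kA kH \<rho>_hom comul_hom R_closed)+
  have e: "\<Phi>\<rho> \<otimes>\<^bsub>?T\<^esub> s1 = s2 \<otimes>\<^bsub>?T\<^esub> \<Phi>\<rho>"
    using rc pr_spec(2)[OF sA, of a] unfolding s1 s2
    by (simp add: right_comodule_algebra_def Let_def tap_def)
  \<comment> \<open>Coassociativity for the inverse: the axiom is multiplied by the inverse of
    \<Phi>\<rho> from both sides.\<close>
  have e': "\<Phi>\<rho>' \<otimes>\<^bsub>?T\<^esub> s2 = s1 \<otimes>\<^bsub>?T\<^esub> \<Phi>\<rho>'"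
  proof -
    have "\<Phi>\<rho>' \<otimes>\<^bsub>?T\<^esub> s2 = \<Phi>\<rho>' \<otimes>\<^bsub>?T\<^esub> (s2 \<otimes>\<^bsub>?T\<^esub> \<Phi>\<rho>) \<otimes>\<^bsub>?T\<^esub> \<Phi>\<rho>'"
      using c X_closed \<Phi>\<rho>_unit by (simp add: T.m_assoc)
    also have "\<dots> = s1 \<otimes>\<^bsub>?T\<^esub> \<Phi>\<rho>'"
      unfolding e[symmetric] using c X_closed \<Phi>\<rho>_unit by (simp add: T.m_assoc[symmetric])
    finally show ?thesis .
  qed
  note l = lin_tri[OF F] lins
  note m = sw3_mult[OF kA kH kH _ _ F]
  note v1 = sw3_split1of2[OF kA kH kA kH \<rho>_hom R_closed, of _ _ a, folded s1]
  note v2 = sw3_split2of2[OF kA kH kH kH comul_hom R_closed, of _ _ a, folded s2]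
  have t1: "trilin (scl A) (scl H) (scl H) s (\<lambda>x' y' z'. F (x \<bullet> x') (y \<cdot> y') (z \<cdot> z'))" for x y z
    by (rule l)+
  have t2: "trilin (scl A) (scl H) (scl H) s (\<lambda>x y z. sw3 A H H t (\<lambda>x' y' z'. F (x \<bullet> x') (y \<cdot> y') (z \<cdot> z')))" for t
    by (rule l)+
  have "sw3 A H H (\<Phi>\<rho> \<otimes>\<^bsub>?T\<^esub> s1) F = sw3 A H H (s2 \<otimes>\<^bsub>?T\<^esub> \<Phi>\<rho>) F" by (simp add: e)
  then show ?th1 by (simp only: m X_closed c v1[OF t1] v2[OF t2])
  have "sw3 A H H (\<Phi>\<rho>' \<otimes>\<^bsub>?T\<^esub> s2) F = sw3 A H H (s1 \<otimes>\<^bsub>?T\<^esub> \<Phi>\<rho>') F" by (simp add: e')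
  then show ?th2 by (simp only: m X_closed c v2[OF t1] v1[OF t2])
qed

lemma X_counit:
  assumes F: "bilin (scl A) (scl H) s F"
  shows "sw3 A H H \<Phi>\<rho> (\<lambda>x y z. s (\<epsilon> y) (F x z)) = F \<one>\<^bsub>A\<^esub> uH"
    "sw3 A H H \<Phi>\<rho> (\<lambda>x y z. s (\<epsilon> z) (F x y)) = F \<one>\<^bsub>A\<^esub> uH"
    "sw3 A H H \<Phi>\<rho>' (\<lambda>x y z. s (\<epsilon> y) (F x z)) = F \<one>\<^bsub>A\<^esub> uH"
    "sw3 A H H \<Phi>\<rho>' (\<lambda>x y z. s (\<epsilon> z) (F x y)) = F \<one>\<^bsub>A\<^esub> uH"
proof -
  interpret vector_space s by (rule bilinD(3)[OF F])
  note l = lin_bilin[OF F] vector_space_axioms lins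
  have *: "sw3 A H H \<Phi>\<rho> (\<lambda>x y z. s (\<epsilon> y) (F x z)) = F \<one>\<^bsub>A\<^esub> uH"
    "sw3 A H H \<Phi>\<rho> (\<lambda>x y z. s (\<epsilon> z) (F x y)) = F \<one>\<^bsub>A\<^esub> uH"
    if F: "bilin (scl A) (scl H) s F" for F
    by (rule counit_eval[OF kA X_closed(1) F]; use rc in \<open>simp add: right_comodule_algebra_def Let_def\<close>)+
  show "sw3 A H H \<Phi>\<rho> (\<lambda>x y z. s (\<epsilon> y) (F x z)) = F \<one>\<^bsub>A\<^esub> uH"
    "sw3 A H H \<Phi>\<rho> (\<lambda>x y z. s (\<epsilon> z) (F x y)) = F \<one>\<^bsub>A\<^esub> uH"
    by (rule *[OF F])+
  have t: "trilin (scl A) (scl H) (scl H) s (\<lambda>x y z. s (\<epsilon> y) (F x z))"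
    "trilin (scl A) (scl H) (scl H) s (\<lambda>x y z. s (\<epsilon> z) (F x y))"
    by (rule l)+
  have b: "bilin (scl A) (scl H) s (\<lambda>x y. s c (F (a \<bullet> x) (b \<cdot> y)))" for a b c
    by (rule l)+
  \<comment> \<open>Apply \<epsilon> to the second leg of the product of the inverse of \<Phi>\<rho>
    with \<Phi>\<rho>. As \<epsilon> is multiplicative, the counit axiom removes the factor
    \<Phi>\<rho> and leaves the claim for its inverse. The third leg is treated alike.\<close>
  have "sw3 A H H \<Phi>\<rho>' (\<lambda>a b c. sw3 A H H \<Phi>\<rho> (\<lambda>a' b' c'. s (\<epsilon> b') (s (\<epsilon> b) (F (a \<bullet> a') (c \<cdot> c'))))) = F \<one>\<^bsub>A\<^esub> uH"
    using X_inv(2)[OF t(1)] by (simp add: \<epsilon>_mult \<epsilon>_one mult.commute)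
  then have "sw3 A H H \<Phi>\<rho>' (\<lambda>a b c. s (\<epsilon> b) (F (a \<bullet> \<one>\<^bsub>A\<^esub>) (c \<cdot> uH))) = F \<one>\<^bsub>A\<^esub> uH"
    by (simp only: *(1)[OF b])
  moreover have "sw3 A H H \<Phi>\<rho>' (\<lambda>a b c. s (\<epsilon> b) (F (a \<bullet> \<one>\<^bsub>A\<^esub>) (c \<cdot> uH))) = sw3 A H H \<Phi>\<rho>' (\<lambda>x y z. s (\<epsilon> y) (F x z))"
    by (rule sw3_cong[OF X_closed(2)]) (simp add: tmul_one kA kH pr_spec sA sH)
  ultimately show "sw3 A H H \<Phi>\<rho>' (\<lambda>x y z. s (\<epsilon> y) (F x z)) = F \<one>\<^bsub>A\<^esub> uH" by simp
  have "sw3 A H H \<Phi>\<rho>' (\<lambda>a b c. sw3 A H H \<Phi>\<rho> (\<lambda>a' b' c'. s (\<epsilon> c') (s (\<epsilon> c) (F (a \<bullet> a') (b \<cdot> b'))))) = F \<one>\<^bsub>A\<^esub> uH"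
    using X_inv(2)[OF t(2)] by (simp add: \<epsilon>_mult \<epsilon>_one mult.commute)
  then have "sw3 A H H \<Phi>\<rho>' (\<lambda>a b c. s (\<epsilon> c) (F (a \<bullet> \<one>\<^bsub>A\<^esub>) (b \<cdot> uH))) = F \<one>\<^bsub>A\<^esub> uH"
    by (simp only: *(2)[OF b])
  moreover have "sw3 A H H \<Phi>\<rho>' (\<lambda>a b c. s (\<epsilon> c) (F (a \<bullet> \<one>\<^bsub>A\<^esub>) (b \<cdot> uH))) = sw3 A H H \<Phi>\<rho>' (\<lambda>x y z. s (\<epsilon> z) (F x y))"
    by (rule sw3_cong[OF X_closed(2)]) (simp add: tmul_one kA kH pr_spec sA sH)
  ultimately show "sw3 A H H \<Phi>\<rho>' (\<lambda>x y z. s (\<epsilon> z) (F x y)) = F \<one>\<^bsub>A\<^esub> uH" by simp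
qed

end

lemma trilin_vs: "trilin s1 s2 s3 s F \<Longrightarrow> vector_space s"
  using linD(2)[of s3 s "F undefined undefined"] by (simp add: trilin_def)

section \<open>The counit on the legs of the reassociator\<close>

context qbialg
begin

abbreviation "sP \<equiv> sw3 H H H \<Phi>"
abbreviation "sP' \<equiv> sw3 H H H \<Phi>'"
abbreviation "sD h \<equiv> sw H H (\<Delta> h)"

lemma P_inv:
  assumes "trilin (scl H) (scl H) (scl H) s F"
  shows "sP (\<lambda>a b c. sP' (\<lambda>a' b' c'. F (a \<cdot> a') (b \<cdot> b') (c \<cdot> c'))) = F uH uH uH"
    and "sP' (\<lambda>a b c. sP (\<lambda>a' b' c'. F (a \<cdot> a') (b \<cdot> b') (c \<cdot> c'))) = F uH uH uH"
  using sw3_mult[OF kH kH kH P_closed assms] sw3_mult[OF kH kH kH P_closed(2,1) assms]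
    sw3_one[OF kH kH kH assms] monoid.Units_r_inv[OF mH3 reassoc_unit] monoid.Units_l_inv[OF mH3 reassoc_unit]
  by simp_all

text \<open>Read off directly from the axiom for \<open>H\<close>. The general form for comodule
  algebras is not yet available, since a comodule algebra must satisfy the counit condition on its
  third leg, and for \<Phi> this condition is derived from the present identity.\<close>

lemma pentagon_H:
  assumes F: "quadlin (scl H) (scl H) (scl H) (scl H) s F"
  shows "sP (\<lambda>a b c. sP (\<lambda>x y z. sD y (\<lambda>p q. sP (\<lambda>a' b' c'.
      F (uH \<cdot> x \<cdot> a') (a \<cdot> p \<cdot> b') (b \<cdot> q \<cdot> c') (c \<cdot> z \<cdot> uH))))) =
    sP (\<lambda>x y z. sD z (\<lambda>p q. sP (\<lambda>x' y' z'. sD x' (\<lambda>p' q'.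
      F (x \<cdot> p') (y \<cdot> q') (p \<cdot> y') (q \<cdot> z')))))"
proof -
  let ?T = "H \<boxtimes> H \<boxtimes> H \<boxtimes> H"
  note l = lin_quad[OF F] lins
  note cl = one_l_closed[OF kH kH kH kH P_closed(1)] one_r_closed[OF kH kH kH kH P_closed(1)]
    split1of3_closed[OF kH kH kH kH kH comul_hom P_closed(1)]
    split2of3_closed[OF kH kH kH kH kH comul_hom P_closed(1)]
    split3of3_closed[OF kH kH kH kH kH comul_hom P_closed(1)]
  note mc = tensor_mult_closed[OF kalgebra_tensor[OF kalgebra_tensor[OF kH kH] kH] kH]
  note ev = sw4_one_l[OF kH kH kH kH P_closed(1)] sw4_one_r[OF kH kH kH kH P_closed(1)]
    sw4_split1of3[OF kH kH kH kH kH comul_hom P_closed(1)]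
    sw4_split2of3[OF kH kH kH kH kH comul_hom P_closed(1)]
    sw4_split3of3[OF kH kH kH kH kH comul_hom P_closed(1)]
  have e: "one_l H H H H \<Phi> \<otimes>\<^bsub>?T\<^esub> split2of3 H H H H H (comul H) \<Phi> \<otimes>\<^bsub>?T\<^esub> one_r H H H H \<Phi> =
        split3of3 H H H H H (comul H) \<Phi> \<otimes>\<^bsub>?T\<^esub> split1of3 H H H H H (comul H) \<Phi>"
    using qb by (simp add: quasi_bialgebra_def Let_def)
  have q: "quadlin (scl H) (scl H) (scl H) (scl H) s (\<lambda>x y z w. F (a \<cdot> x) (b \<cdot> y) (c \<cdot> z) (d \<cdot> w))" for a b c d
    by (rule l)+
  have q4: "quadlin (scl H) (scl H) (scl H) (scl H) s (\<lambda>x y z w. sw4 H H H H t (\<lambda>x' y' z' w'.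
      F (a \<cdot> x \<cdot> x') (b \<cdot> y \<cdot> y') (c \<cdot> z \<cdot> z') (d \<cdot> w \<cdot> w')))" for a b c d t
    by (rule l)+
  have q4': "quadlin (scl H) (scl H) (scl H) (scl H) s (\<lambda>x y z w. sw4 H H H H t (\<lambda>x' y' z' w'.
      F (x \<cdot> x') (y \<cdot> y') (z \<cdot> z') (w \<cdot> w')))" for t
    by (rule l)+
  have q44: "quadlin (scl H) (scl H) (scl H) (scl H) s (\<lambda>x y z w. sw4 H H H H t (\<lambda>x' y' z' w'. sw4 H H H H t' (\<lambda>x'' y'' z'' w''.
      F (x \<cdot> x' \<cdot> x'') (y \<cdot> y' \<cdot> y'') (z \<cdot> z' \<cdot> z'') (w \<cdot> w' \<cdot> w''))))" for t t'
    by (rule l)+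
  note m = sw4_mult[OF kH kH kH kH]
  show ?thesis
    using arg_cong[OF e, of "\<lambda>t. sw4 H H H H t F"]
    by (simp only: m[OF mc[OF cl(1,4)] cl(2) F] m[OF cl(1,4) q4'] m[OF cl(5,3) F],
        simp only: ev(1)[OF q44] ev(5)[OF q4'], simp only: ev(4)[OF q4] ev(3)[OF q], simp only: ev(2)[OF q])
qed

lemma P_counit2:
  assumes F: "bilin (scl H) (scl H) s F"
  shows "sP (\<lambda>x y z. s (\<epsilon> y) (F x z)) = F uH uH"
  by (rule counit_eval(1)[OF kH P_closed(1) F]) (use qb in \<open>simp add: quasi_bialgebra_def Let_def\<close>)

text \<open>
  That \<open>\<epsilon>\<close> on the first or third leg of \<open>\<Phi>\<close> gives 1 is not among the axioms: it follows by
  applying \<open>\<epsilon>\<close> to an inner leg of the pentagon and cancelling \<open>\<Phi>\<close>.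
\<close>

lemma P_absorb3:
  assumes F: "trilin (scl H) (scl H) (scl H) s F"
  shows "sP (\<lambda>x y z. sP (\<lambda>a b c. s (\<epsilon> c) (F (x \<cdot> a) (y \<cdot> b) (pr H z)))) =
    sP (\<lambda>x y z. F (pr H x) (pr H y) (pr H z))"
proof -
  have vs: "vector_space s" by (rule trilin_vs[OF F])
  interpret vector_space s by (rule vs)
  note l = lin_tri[OF F] vs lins
  have q: "quadlin (scl H) (scl H) (scl H) (scl H) s (\<lambda>x y z w. s (\<epsilon> z) (F x y w))"
    by (rule l)+
  have "sP (\<lambda>a b c. sP (\<lambda>x y z. sD y (\<lambda>p q. sP (\<lambda>a' b' c'.
      s (\<epsilon> (b \<cdot> q \<cdot> c')) (F (uH \<cdot> x \<cdot> a') (a \<cdot> p \<cdot> b') (c \<cdot> z \<cdot> uH)))))) =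
    sP (\<lambda>a b c. s (\<epsilon> b) (sP (\<lambda>x y z. sD y (\<lambda>p q. s (\<epsilon> q) (sP (\<lambda>a' b' c'.
      s (\<epsilon> c') (F (uH \<cdot> x \<cdot> a') (a \<cdot> p \<cdot> b') (c \<cdot> z \<cdot> uH)))))))) "
    by (simp only: scale_sw[OF vs] scale_sw3[OF vs] scale_scale \<epsilon>_mult mult.assoc)
  also have "\<dots> = sP (\<lambda>x y z. sD y (\<lambda>p q. s (\<epsilon> q) (sP (\<lambda>a' b' c'.
      s (\<epsilon> c') (F (uH \<cdot> x \<cdot> a') (uH \<cdot> p \<cdot> b') (uH \<cdot> z \<cdot> uH))))))"
    by (subst P_counit2[where s = s]) ((rule l)+, rule refl)
  also have "\<dots> = sP (\<lambda>x y z. sP (\<lambda>a' b' c'.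
      s (\<epsilon> c') (F (uH \<cdot> x \<cdot> a') (uH \<cdot> pr H y \<cdot> b') (uH \<cdot> z \<cdot> uH))))"
    by (subst \<Delta>_counit(1)[where s = s]) ((rule l)+, rule refl)
  finally have L: "sP (\<lambda>a b c. sP (\<lambda>x y z. sD y (\<lambda>p q. sP (\<lambda>a' b' c'.
      s (\<epsilon> (b \<cdot> q \<cdot> c')) (F (uH \<cdot> x \<cdot> a') (a \<cdot> p \<cdot> b') (c \<cdot> z \<cdot> uH)))))) =
      sP (\<lambda>x y z. sP (\<lambda>a b c. s (\<epsilon> c) (F (x \<cdot> a) (y \<cdot> b) (pr H z))))"
    by (simp add: tmul_one kH tmul_pr pr_pr sH)
  have "sP (\<lambda>x y z. sD z (\<lambda>p q. sP (\<lambda>x' y' z'. sD x' (\<lambda>p' q'.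
      s (\<epsilon> (p \<cdot> y')) (F (x \<cdot> p') (y \<cdot> q') (q \<cdot> z')))))) =
    sP (\<lambda>x y z. sD z (\<lambda>p q. s (\<epsilon> p) (sP (\<lambda>x' y' z'. s (\<epsilon> y') (sD x' (\<lambda>p' q'.
      (F (x \<cdot> p') (y \<cdot> q') (q \<cdot> z'))))))))"
    by (simp only: scale_sw[OF vs] scale_sw3[OF vs] scale_scale \<epsilon>_mult mult.assoc)
  also have "\<dots> = sP (\<lambda>x y z. sD z (\<lambda>p q. s (\<epsilon> p) (sD uH (\<lambda>p' q'.
      (F (x \<cdot> p') (y \<cdot> q') (q \<cdot> uH))))))"
    by (subst P_counit2[where s = s]) ((rule l)+, rule refl)
  also have "\<dots> = sP (\<lambda>x y z. sD uH (\<lambda>p' q'. F (x \<cdot> p') (y \<cdot> q') (pr H z \<cdot> uH)))"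
    by (subst \<Delta>_counit(2)[where s = s]) ((rule l)+, rule refl)
  also have "\<dots> = sP (\<lambda>x y z. F (x \<cdot> uH) (y \<cdot> uH) (pr H z \<cdot> uH))"
    by (subst \<Delta>_one[where s = s]) ((rule l)+, rule refl)
  finally have R: "sP (\<lambda>x y z. sD z (\<lambda>p q. sP (\<lambda>x' y' z'. sD x' (\<lambda>p' q'.
      s (\<epsilon> (p \<cdot> y')) (F (x \<cdot> p') (y \<cdot> q') (q \<cdot> z')))))) = sP (\<lambda>x y z. F (pr H x) (pr H y) (pr H z))"
    by (simp add: tmul_one kH tmul_pr pr_pr sH)
  show ?thesis using pentagon_H[OF q] by (simp only: L R)
qed

text \<open>Now \<epsilon> sits on the second leg of the pentagon. All coproducts and all but one
  copy of \<Phi> collapse on the right; on the left a second copy survives, with \<epsilon> on its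
  first leg.\<close>

lemma P_absorb1:
  assumes F: "trilin (scl H) (scl H) (scl H) s F"
  shows "sP (\<lambda>a b c. s (\<epsilon> a) (sP (\<lambda>x y z. F (pr H x) (b \<cdot> y) (c \<cdot> z)))) =
    sP (\<lambda>x y z. F (pr H x) (pr H y) (pr H z))"
proof -
  have vs: "vector_space s" by (rule trilin_vs[OF F])
  interpret vector_space s by (rule vs)
  note l = lin_tri[OF F] vs lins
  have q: "quadlin (scl H) (scl H) (scl H) (scl H) s (\<lambda>x y z w. s (\<epsilon> y) (F x z w))"
    by (rule l)+
  have "sP (\<lambda>a b c. sP (\<lambda>x y z. sD y (\<lambda>p q. sP (\<lambda>a' b' c'.
      s (\<epsilon> (a \<cdot> p \<cdot> b')) (F (uH \<cdot> x \<cdot> a') (b \<cdot> q \<cdot> c') (c \<cdot> z \<cdot> uH)))))) =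
    sP (\<lambda>a b c. s (\<epsilon> a) (sP (\<lambda>x y z. sD y (\<lambda>p q. s (\<epsilon> p) (sP (\<lambda>a' b' c'.
      s (\<epsilon> b') (F (uH \<cdot> x \<cdot> a') (b \<cdot> q \<cdot> c') (c \<cdot> z \<cdot> uH))))))))"
    by (simp only: scale_sw[OF vs] scale_sw3[OF vs] scale_scale \<epsilon>_mult mult.assoc)
  also have "\<dots> = sP (\<lambda>a b c. s (\<epsilon> a) (sP (\<lambda>x y z. sD y (\<lambda>p q. s (\<epsilon> p) (
      F (uH \<cdot> x \<cdot> uH) (b \<cdot> q \<cdot> uH) (c \<cdot> z \<cdot> uH))))))"
    by (subst P_counit2[where s = s]) ((rule l)+, rule refl)
  also have "\<dots> = sP (\<lambda>a b c. s (\<epsilon> a) (sP (\<lambda>x y z.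
      F (uH \<cdot> x \<cdot> uH) (b \<cdot> pr H y \<cdot> uH) (c \<cdot> z \<cdot> uH))))"
    by (subst \<Delta>_counit(2)[where s = s]) ((rule l)+, rule refl)
  finally have L: "sP (\<lambda>a b c. sP (\<lambda>x y z. sD y (\<lambda>p q. sP (\<lambda>a' b' c'.
      s (\<epsilon> (a \<cdot> p \<cdot> b')) (F (uH \<cdot> x \<cdot> a') (b \<cdot> q \<cdot> c') (c \<cdot> z \<cdot> uH)))))) =
      sP (\<lambda>a b c. s (\<epsilon> a) (sP (\<lambda>x y z. F (pr H x) (b \<cdot> y) (c \<cdot> z))))"
    by (simp add: tmul_one kH tmul_pr pr_pr sH)
  have "sP (\<lambda>x y z. sD z (\<lambda>p q. sP (\<lambda>x' y' z'. sD x' (\<lambda>p' q'.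
      s (\<epsilon> (y \<cdot> q')) (F (x \<cdot> p') (p \<cdot> y') (q \<cdot> z')))))) =
    sP (\<lambda>x y z. s (\<epsilon> y) (sD z (\<lambda>p q. sP (\<lambda>x' y' z'. sD x' (\<lambda>p' q'. s (\<epsilon> q')
      (F (x \<cdot> p') (p \<cdot> y') (q \<cdot> z')))))))"
    by (simp only: scale_sw[OF vs] scale_sw3[OF vs] scale_scale \<epsilon>_mult mult.assoc)
  also have "\<dots> = sD uH (\<lambda>p q. sP (\<lambda>x' y' z'. sD x' (\<lambda>p' q'. s (\<epsilon> q')
      (F (uH \<cdot> p') (p \<cdot> y') (q \<cdot> z')))))"
    by (subst P_counit2[where s = s]) ((rule l)+, rule refl)
  also have "\<dots> = sD uH (\<lambda>p q. sP (\<lambda>x' y' z'. F (uH \<cdot> pr H x') (p \<cdot> y') (q \<cdot> z')))"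
    by (subst \<Delta>_counit(1)[where s = s]) ((rule l)+, rule refl)
  also have "\<dots> = sP (\<lambda>x' y' z'. F (uH \<cdot> pr H x') (uH \<cdot> y') (uH \<cdot> z'))"
    by (subst \<Delta>_one[where s = s]) ((rule l)+, rule refl)
  finally have R: "sP (\<lambda>x y z. sD z (\<lambda>p q. sP (\<lambda>x' y' z'. sD x' (\<lambda>p' q'.
      s (\<epsilon> (y \<cdot> q')) (F (x \<cdot> p') (p \<cdot> y') (q \<cdot> z')))))) = sP (\<lambda>x y z. F (pr H x) (pr H y) (pr H z))"
    by (simp add: tmul_one kH tmul_pr pr_pr sH)
  show ?thesis using pentagon_H[OF q] by (simp only: L R)
qed

lemma P_counit3:
  assumes F: "bilin (scl H) (scl H) s F"
  shows "sP (\<lambda>x y z. s (\<epsilon> z) (F x y)) = F uH uH"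
proof -
  have vs: "vector_space s" by (rule bilinD(3)[OF F])
  interpret vector_space s by (rule vs)
  note l = lin_bilin[OF F] vs lins
  \<comment> \<open>Precomposing the test map with left multiplication by the inverse of \<Phi>
    cancels the copy of \<Phi> that \<open>P_absorb3\<close> has on the left of both sides.\<close>
  have t: "trilin (scl H) (scl H) (scl H) s (\<lambda>x y z. sP' (\<lambda>k l m. s (\<epsilon> (m \<cdot> z)) (F (k \<cdot> x) (l \<cdot> y))))"
    and t1: "trilin (scl H) (scl H) (scl H) s (\<lambda>x y z. sP (\<lambda>a b c. s (\<epsilon> c) (s (\<epsilon> z) (F (x \<cdot> a) (y \<cdot> b)))))"
    and t2: "trilin (scl H) (scl H) (scl H) s (\<lambda>x y z. s (\<epsilon> z) (F x y))"
    by (rule l)+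
  have "sP (\<lambda>x y z. sP (\<lambda>a b c. s (\<epsilon> c) (sP' (\<lambda>k l m. s (\<epsilon> (m \<cdot> pr H z)) (F (k \<cdot> (x \<cdot> a)) (l \<cdot> (y \<cdot> b))))))) =
    sP (\<lambda>x y z. sP' (\<lambda>k l m. sP (\<lambda>a b c. s (\<epsilon> c) (s (\<epsilon> (m \<cdot> z)) (F (k \<cdot> x \<cdot> a) (l \<cdot> y \<cdot> b))))))"
    by (simp only: scale_sw3[OF vs] tmul_pr[OF kH] tmul_assoc[OF kH])
      (rule arg_cong[of _ _ sP], intro ext, rule sw3_swap)
  also have "\<dots> = sP' (\<lambda>k l m. sP (\<lambda>x y z. sP (\<lambda>a b c. s (\<epsilon> c) (s (\<epsilon> (m \<cdot> z)) (F (k \<cdot> x \<cdot> a) (l \<cdot> y \<cdot> b))))))"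
    by (rule sw3_swap)
  also have "\<dots> = sP (\<lambda>a b c. s (\<epsilon> c) (s (\<epsilon> uH) (F (uH \<cdot> a) (uH \<cdot> b))))"
    by (rule P_inv(2)[OF t1])
  also have "\<dots> = sP (\<lambda>a b c. s (\<epsilon> c) (F a b))"
    by (rule sw3_cong[OF P_closed(1)]) (simp add: \<epsilon>_one tmul_one kH pr_spec sH)
  finally have L: "sP (\<lambda>x y z. sP (\<lambda>a b c. s (\<epsilon> c) (sP' (\<lambda>k l m. s (\<epsilon> (m \<cdot> pr H z)) (F (k \<cdot> (x \<cdot> a)) (l \<cdot> (y \<cdot> b))))))) =
    sP (\<lambda>a b c. s (\<epsilon> c) (F a b))" .
  have "sP (\<lambda>x y z. sP' (\<lambda>k l m. s (\<epsilon> (m \<cdot> pr H z)) (F (k \<cdot> pr H x) (l \<cdot> pr H y)))) =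
    sP' (\<lambda>k l m. sP (\<lambda>x y z. s (\<epsilon> (m \<cdot> z)) (F (k \<cdot> x) (l \<cdot> y))))"
    by (simp only: tmul_pr[OF kH]) (rule sw3_swap)
  also have "\<dots> = s (\<epsilon> uH) (F uH uH)" by (rule P_inv(2)[OF t2])
  finally show ?thesis using P_absorb3[OF t] by (simp add: L \<epsilon>_one)
qed

lemma P_counit1:
  assumes F: "bilin (scl H) (scl H) s F"
  shows "sP (\<lambda>x y z. s (\<epsilon> x) (F y z)) = F uH uH"
proof -
  have vs: "vector_space s" by (rule bilinD(3)[OF F])
  interpret vector_space s by (rule vs)
  note l = lin_bilin[OF F] vs lins
  \<comment> \<open>This time the inverse of \<Phi> is multiplied from the right, since the common
    factor in \<open>P_absorb1\<close> stands there.\<close>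
  have t: "trilin (scl H) (scl H) (scl H) s (\<lambda>x y z. sP' (\<lambda>k l m. s (\<epsilon> (x \<cdot> k)) (F (y \<cdot> l) (z \<cdot> m))))"
    and t1: "trilin (scl H) (scl H) (scl H) s (\<lambda>x y z. s (\<epsilon> x) (F (b \<cdot> y) (c \<cdot> z)))"
    and t2: "trilin (scl H) (scl H) (scl H) s (\<lambda>x y z. s (\<epsilon> x) (F y z))" for b c
    by (rule l)+
  have "sP (\<lambda>a b c. s (\<epsilon> a) (sP (\<lambda>x y z. sP' (\<lambda>k l m. s (\<epsilon> (pr H x \<cdot> k)) (F (b \<cdot> y \<cdot> l) (c \<cdot> z \<cdot> m)))))) =
    sP (\<lambda>a b c. s (\<epsilon> a) (s (\<epsilon> uH) (F (b \<cdot> uH) (c \<cdot> uH))))"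
    by (simp only: P_inv(1)[OF t1, symmetric] tmul_pr[OF kH] tmul_assoc[OF kH])
  also have "\<dots> = sP (\<lambda>x y z. s (\<epsilon> x) (F y z))"
    by (rule sw3_cong[OF P_closed(1)]) (simp add: \<epsilon>_one tmul_one kH pr_spec sH)
  finally have L: "sP (\<lambda>a b c. s (\<epsilon> a) (sP (\<lambda>x y z. sP' (\<lambda>k l m. s (\<epsilon> (pr H x \<cdot> k)) (F (b \<cdot> y \<cdot> l) (c \<cdot> z \<cdot> m)))))) =
    sP (\<lambda>x y z. s (\<epsilon> x) (F y z))" .
  have "sP (\<lambda>x y z. sP' (\<lambda>k l m. s (\<epsilon> (pr H x \<cdot> k)) (F (pr H y \<cdot> l) (pr H z \<cdot> m)))) = s (\<epsilon> uH) (F uH uH)"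
    by (simp only: tmul_pr[OF kH] P_inv(1)[OF t2])
  then show ?thesis using P_absorb1[OF t] by (simp add: L \<epsilon>_one)
qed

text \<open>The comodule version \<open>X_counit\<close> covers the second and third legs of the
  inverse; the first leg lies in \<open>A\<close> there, where no counit exists. For
  \<open>H\<close> the argument is the same: \<epsilon> is applied to the product of \<Phi> with its
  inverse.\<close>

lemma P'_counit1:
  assumes F: "bilin (scl H) (scl H) s F"
  shows "sP' (\<lambda>x y z. s (\<epsilon> x) (F y z)) = F uH uH"
proof -
  have vs: "vector_space s" by (rule bilinD(3)[OF F])
  interpret vector_space s by (rule vs)
  note l = lin_bilin[OF F] vs lins
  have t: "trilin (scl H) (scl H) (scl H) s (\<lambda>x y z. s (\<epsilon> x) (F y z))"
    by (rule l)+
  have "sP (\<lambda>a b c. s (\<epsilon> a) (sP' (\<lambda>x y z. s (\<epsilon> x) (F (b \<cdot> y) (c \<cdot> z))))) =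
    sP (\<lambda>a b c. sP' (\<lambda>x y z. s (\<epsilon> (a \<cdot> x)) (F (b \<cdot> y) (c \<cdot> z))))"
    by (simp only: \<epsilon>_mult scale_sw3[OF vs] scale_scale)
  also have "\<dots> = s (\<epsilon> uH) (F uH uH)"
    by (rule P_inv(1)[OF t])
  also have "sP (\<lambda>a b c. s (\<epsilon> a) (sP' (\<lambda>x y z. s (\<epsilon> x) (F (b \<cdot> y) (c \<cdot> z))))) =
    sP' (\<lambda>x y z. s (\<epsilon> x) (F (uH \<cdot> y) (uH \<cdot> z)))"
    by (rule P_counit1) (rule l)+
  also have "\<dots> = sP' (\<lambda>x y z. s (\<epsilon> x) (F y z))"
    by (rule sw3_cong[OF P_closed(2)]) (simp add: tmul_one kH pr_spec sH)
  finally show ?thesis by (simp add: \<epsilon>_one)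
qed

text \<open>Every identity for comodule algebras now specializes to \<open>H\<close>, which yields
  those behind the Drinfeld twist. The condition on the third leg is \<open>P_counit3\<close>, and
  coassociativity only needs the inverse of \<Phi> moved to the other side.\<close>

lemma rcomod_self: "rcomod H H (comul H) \<Phi>"
proof
  interpret T: monoid "H \<boxtimes> H \<boxtimes> H" by (rule mH3)
  have "\<Phi> \<otimes>\<^bsub>H \<boxtimes> H \<boxtimes> H\<^esub> split1of2 H H H H (comul H) (comul H a) =
      split2of2 H H H H (comul H) (comul H a) \<otimes>\<^bsub>H \<boxtimes> H \<boxtimes> H\<^esub> \<Phi>" if a: "a \<in> carrier H" for a
  proof -
    have "split1of2 H H H H (comul H) (comul H a) \<in> carrier (H \<boxtimes> H \<boxtimes> H)"
      using a \<Delta>_closed[of a] by (intro split1of2_closed kH comul_hom) (simp add: tap_eq sH)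
    then show ?thesis
      using qb a P_closed reassoc_unit by (simp add: quasi_bialgebra_def Let_def T.m_assoc)
  qed
  moreover have "sP (\<lambda>x y z. scl (H \<boxtimes> H) (counit H z) (pt H H x y)) = \<one>\<^bsub>H \<boxtimes> H\<^esub>"
  proof -
    have "sP (\<lambda>x y z. scl (H \<boxtimes> H) (counit H z) (pt H H x y)) =
        sP (\<lambda>x y z. scl (H \<boxtimes> H) (\<epsilon> z) (tpt H H x y))"
      by (rule sw3_cong[OF P_closed(1)]) (simp add: tap_eq sH tpt_pt)
    also have "\<dots> = tpt H H uH uH" by (rule P_counit3[OF tpt_bilin[OF sH sH]])
    also have "\<dots> = \<one>\<^bsub>H \<boxtimes> H\<^esub>" by (simp add: tpt_def pr_one[OF kH] tensor_def)
    finally show ?thesis .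
  qed
  ultimately show "right_comodule_algebra H H (comul H) \<Phi>"
    using qb by (simp add: quasi_bialgebra_def right_comodule_algebra_def Let_def)
qed

end

section \<open>The pentagon solved for its factors\<close>

context rcomod
begin

abbreviation "sX \<equiv> sw3 A H H \<Phi>\<rho>"
abbreviation "sX' \<equiv> sw3 A H H \<Phi>\<rho>'"
abbreviation "sR a \<equiv> sw A H (R a)"

text \<open>The three forms differ in which factors are brought to one side. After contraction with
  \<open>S\<close>, \<alpha> and \<beta>, the left side of the first contains q multiplied by the
  coaction of p, that of the second the coaction of q multiplied by p; in the third, with \<delta>
  inserted, it is a coproduct of p.\<close>

lemma pentagon:
  assumes F: "quadlin (scl A) (scl H) (scl H) (scl H) s F"
  shows "sX (\<lambda>a b c. sX' (\<lambda>x y z. sR x (\<lambda>p q. F (a \<bullet> p) (b \<cdot> q) (c \<cdot> y) (pr H z)))) =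
    sX' (\<lambda>x y z. sD y (\<lambda>p q. sP' (\<lambda>a b c. sX (\<lambda>k l m. sD m (\<lambda>m1 m2.
      F (x \<bullet> k) (p \<cdot> a \<cdot> l) (q \<cdot> b \<cdot> m1) (z \<cdot> c \<cdot> m2))))))" (is ?th1)
  and "sX (\<lambda>x y z. sR x (\<lambda>p q. sX' (\<lambda>a b c. F (p \<bullet> a) (q \<cdot> b) (y \<cdot> c) (pr H z)))) =
    sX' (\<lambda>x y z. sD z (\<lambda>z1 z2. sP (\<lambda>a b c. sX (\<lambda>k l m. sD l (\<lambda>l1 l2.
      F (x \<bullet> k) (y \<cdot> a \<cdot> l1) (z1 \<cdot> b \<cdot> l2) (z2 \<cdot> c \<cdot> m))))))" (is ?th2)
  and "sX' (\<lambda>x y z. sR x (\<lambda>p q. sX' (\<lambda>k l m. sD m (\<lambda>m1 m2. sP (\<lambda>a b c.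
      F (p \<bullet> k) (q \<cdot> l \<cdot> a) (y \<cdot> m1 \<cdot> b) (z \<cdot> m2 \<cdot> c)))))) =
    sX' (\<lambda>a b c. sX' (\<lambda>x y z. sD y (\<lambda>p q. F (a \<bullet> x) (b \<cdot> p) (c \<cdot> q) (pr H z))))" (is ?th3)
proof -
  let ?T = "A \<boxtimes> H \<boxtimes> H \<boxtimes> H"
  let ?A = "one_l A H H H" and ?C = "one_r A H H H"
  let ?B = "split2of3 A H H H H (comul H)" and ?D = "split3of3 A H H H H (comul H)"
  let ?E = "split1of3 A H H A H \<rho>"
  interpret T: monoid ?T
    by (rule monoid_tensor[OF kalgebra_tensor[OF kalgebra_tensor[OF kA kH] kH] kH])
  note ac = one_l_closed[OF kA kH kH kH] and cc = one_r_closed[OF kA kH kH kH]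
    and bc = split2of3_closed[OF kA kH kH kH kH comul_hom]
    and dc = split3of3_closed[OF kA kH kH kH kH comul_hom]
    and ec = split1of3_closed[OF kA kH kH kA kH \<rho>_hom]
  note cl = ac[OF P_closed(1)] ac[OF P_closed(2)] bc[OF X_closed(1)] bc[OF X_closed(2)]
    cc[OF X_closed(1)] cc[OF X_closed(2)] dc[OF X_closed(1)] dc[OF X_closed(2)] ec[OF X_closed(1)] ec[OF X_closed(2)]
  note hm = one_l_hom(1)[OF kA kH kH kH, symmetric] one_r_hom(1)[OF kA kH kH kH, symmetric]
    split2of3_hom(1)[OF kA kH kH kH kH comul_hom, symmetric]
    split3of3_hom(1)[OF kA kH kH kH kH comul_hom, symmetric]
    split1of3_hom(1)[OF kA kH kH kA kH \<rho>_hom, symmetric]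
  note ho = one_l_hom(2)[OF kA kH kH kH] one_r_hom(2)[OF kA kH kH kH]
    split2of3_hom(2)[OF kA kH kH kH kH comul_hom] split3of3_hom(2)[OF kA kH kH kH kH comul_hom]
    split1of3_hom(2)[OF kA kH kH kA kH \<rho>_hom]
  note iv = monoid.Units_r_inv[OF mT3 \<Phi>\<rho>_unit] monoid.Units_l_inv[OF mT3 \<Phi>\<rho>_unit]
    monoid.Units_r_inv[OF mH3 reassoc_unit] monoid.Units_l_inv[OF mH3 reassoc_unit]
  have e: "?A \<Phi> \<otimes>\<^bsub>?T\<^esub> ?B \<Phi>\<rho> \<otimes>\<^bsub>?T\<^esub> ?C \<Phi>\<rho> = ?D \<Phi>\<rho> \<otimes>\<^bsub>?T\<^esub> ?E \<Phi>\<rho>"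
    using rc by (simp add: right_comodule_algebra_def Let_def)
  have i: "?A \<Phi>' \<otimes>\<^bsub>?T\<^esub> ?A \<Phi> = \<one>\<^bsub>?T\<^esub>" "?B \<Phi>\<rho>' \<otimes>\<^bsub>?T\<^esub> ?B \<Phi>\<rho> = \<one>\<^bsub>?T\<^esub>" "?C \<Phi>\<rho> \<otimes>\<^bsub>?T\<^esub> ?C \<Phi>\<rho>' = \<one>\<^bsub>?T\<^esub>"
     "?D \<Phi>\<rho>' \<otimes>\<^bsub>?T\<^esub> ?D \<Phi>\<rho> = \<one>\<^bsub>?T\<^esub>" "?E \<Phi>\<rho> \<otimes>\<^bsub>?T\<^esub> ?E \<Phi>\<rho>' = \<one>\<^bsub>?T\<^esub>" "?E \<Phi>\<rho>' \<otimes>\<^bsub>?T\<^esub> ?E \<Phi>\<rho> = \<one>\<^bsub>?T\<^esub>"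
     "?B \<Phi>\<rho> \<otimes>\<^bsub>?T\<^esub> ?B \<Phi>\<rho>' = \<one>\<^bsub>?T\<^esub>"
    by (simp_all only: hm P_closed X_closed iv ho)
  note mv = T.pentagon_moves[OF cl(1,3,5,7,9,2,4,6,8,10) e i]
  note l = lin_quad[OF F] lins
  have q: "quadlin (scl A) (scl H) (scl H) (scl H) s (\<lambda>x y z w. F (a \<bullet> x) (b \<cdot> y) (c \<cdot> z) (d \<cdot> w))" for a b c d
    by (rule l)+
  have q4: "quadlin (scl A) (scl H) (scl H) (scl H) s (\<lambda>x y z w. sw4 A H H H t (\<lambda>x' y' z' w'.
      F (a \<bullet> x \<bullet> x') (b \<cdot> y \<cdot> y') (c \<cdot> z \<cdot> z') (d \<cdot> w \<cdot> w')))" for a b c d t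
    by (rule l)+
  have q4': "quadlin (scl A) (scl H) (scl H) (scl H) s (\<lambda>x y z w. sw4 A H H H t (\<lambda>x' y' z' w'.
      F (x \<bullet> x') (y \<cdot> y') (z \<cdot> z') (w \<cdot> w')))" for t
    by (rule l)+
  have q44: "quadlin (scl A) (scl H) (scl H) (scl H) s (\<lambda>x y z w. sw4 A H H H t (\<lambda>x' y' z' w'. sw4 A H H H t' (\<lambda>x'' y'' z'' w''.
      F (x \<bullet> x' \<bullet> x'') (y \<cdot> y' \<cdot> y'') (z \<cdot> z' \<cdot> z'') (w \<cdot> w' \<cdot> w''))))" for t t'
    by (rule l)+
  note m = sw4_mult[OF kA kH kH kH]
  have m2: "sw4 A H H H (t \<otimes>\<^bsub>?T\<^esub> t') F = sw4 A H H H t (\<lambda>x y z w. sw4 A H H H t' (\<lambda>x' y' z' w'.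
      F (x \<bullet> x') (y \<cdot> y') (z \<cdot> z') (w \<cdot> w')))" if "t \<in> carrier ?T" "t' \<in> carrier ?T" for t t'
    by (rule m[OF that F])
  have m3: "sw4 A H H H (t \<otimes>\<^bsub>?T\<^esub> t' \<otimes>\<^bsub>?T\<^esub> t'') F = sw4 A H H H t (\<lambda>x y z w. sw4 A H H H t' (\<lambda>x' y' z' w'.
      sw4 A H H H t'' (\<lambda>x'' y'' z'' w''. F (x \<bullet> x' \<bullet> x'') (y \<cdot> y' \<cdot> y'') (z \<cdot> z' \<cdot> z'') (w \<cdot> w' \<cdot> w''))))"
    if "t \<in> carrier ?T" "t' \<in> carrier ?T" "t'' \<in> carrier ?T" for t t' t''
    by (simp only: m[OF T.m_closed[OF that(1,2)] that(3) F] m[OF that(1,2) q4'])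
  note ea = sw4_one_l[OF kA kH kH kH P_closed(1)] sw4_one_l[OF kA kH kH kH P_closed(2)]
  note ec = sw4_one_r[OF kA kH kH kH X_closed(1)] sw4_one_r[OF kA kH kH kH X_closed(2)]
  note eb = sw4_split2of3[OF kA kH kH kH kH comul_hom X_closed(1)]
    sw4_split2of3[OF kA kH kH kH kH comul_hom X_closed(2)]
  note ed = sw4_split3of3[OF kA kH kH kH kH comul_hom X_closed(1)]
    sw4_split3of3[OF kA kH kH kH kH comul_hom X_closed(2)]
  note ee = sw4_split1of3[OF kA kH kH kA kH \<rho>_hom X_closed(1)]
    sw4_split1of3[OF kA kH kH kA kH \<rho>_hom X_closed(2)]
  note cln = tmul_one[OF kA] tmul_one[OF kH] tmul_pr[OF kA] tmul_pr[OF kH]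
  \<comment> \<open>The factors are evaluated from the outermost inwards. Each of
    \<open>q44\<close>, \<open>q4\<close> and \<open>q\<close> states the multilinearity of what
    remains after the preceding evaluation.\<close>
  show ?th1
    using arg_cong[OF mv(1), of "\<lambda>t. sw4 A H H H t F"]
    by (simp only: m2 m3 cl, simp only: ec(1)[OF q4'] eb(2)[OF q44], simp only: ea(2)[OF q4] ee(2)[OF q],
        simp only: ed(1)[OF q], simp only: cln)
  show ?th2
    using arg_cong[OF mv(2), of "\<lambda>t. sw4 A H H H t F"]
    by (simp only: m2 m3 cl, simp only: ee(1)[OF q4'] ed(2)[OF q44], simp only: ea(1)[OF q4] ec(2)[OF q],
        simp only: eb(1)[OF q], simp only: cln)
  show ?th3
    using arg_cong[OF mv(3), of "\<lambda>t. sw4 A H H H t F"]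
    by (simp only: m2 m3 cl, simp only: ec(2)[OF q4'] ee(2)[OF q44], simp only: ed(2)[OF q4] eb(2)[OF q],
        simp only: ea(1)[OF q], simp only: cln)
qed

end

context
  fixes E :: "('k::field, 'e::ab_group_add, 'm) kalg_scheme"
  assumes E: "kalgebra E"
begin

private lemma lE: "lin (scl E) (scl E) (\<lambda>z. z \<odot>\<^bsub>E\<^esub> y)" "lin (scl E) (scl E) (\<lambda>z. y \<odot>\<^bsub>E\<^esub> z)"
  by (intro lins E kspace_kalgebra)+

lemma tmul_sw:
  "sw A B t F \<odot>\<^bsub>E\<^esub> y = sw A B t (\<lambda>a b. F a b \<odot>\<^bsub>E\<^esub> y)"
  "y \<odot>\<^bsub>E\<^esub> sw A B t F = sw A B t (\<lambda>a b. y \<odot>\<^bsub>E\<^esub> F a b)"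
  "sw3 A B C r G \<odot>\<^bsub>E\<^esub> y = sw3 A B C r (\<lambda>a b c. G a b c \<odot>\<^bsub>E\<^esub> y)"
  "y \<odot>\<^bsub>E\<^esub> sw3 A B C r G = sw3 A B C r (\<lambda>a b c. y \<odot>\<^bsub>E\<^esub> G a b c)"
  by (rule lin_out[OF lE(1)] lin_out[OF lE(2)] lin_out3[OF lE(1)] lin_out3[OF lE(2)])+

lemma tmul_scale:
  "scl E c x \<odot>\<^bsub>E\<^esub> y = scl E c (x \<odot>\<^bsub>E\<^esub> y)" "y \<odot>\<^bsub>E\<^esub> scl E c x = scl E c (y \<odot>\<^bsub>E\<^esub> x)"
  by (rule linD(4)[OF lE(1)] linD(4)[OF lE(2)])+

end

lemma tpt_mult:
  assumes "kalgebra A" "kalgebra B"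
  shows "tpt A B a b \<odot>\<^bsub>A \<boxtimes> B\<^esub> tpt A B c d = tpt A B (a \<odot>\<^bsub>A\<^esub> c) (b \<odot>\<^bsub>B\<^esub> d)"
proof -
  note k = kspace_kalgebra[OF assms(1)] kspace_kalgebra[OF assms(2)]
  have b1: "bilin (scl A) (scl B) (scl (A \<boxtimes> B)) (\<lambda>x y. tpt A B (x \<odot>\<^bsub>A\<^esub> p) (y \<odot>\<^bsub>B\<^esub> q))"
    and b2: "bilin (scl A) (scl B) (scl (A \<boxtimes> B)) (\<lambda>x y. tpt A B (p \<odot>\<^bsub>A\<^esub> x) (q \<odot>\<^bsub>B\<^esub> y))" for p q
    by (rule k assms lins)+
  show ?thesis
    by (simp add: tmul_mult[OF kalgebra_tensor[OF assms] tpt_closed[OF k] tpt_closed[OF k], symmetric]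
        tensor_mult[OF assms tpt_closed[OF k] tpt_closed[OF k]] sw_tpt[OF k b2] sw_tpt[OF k b1] tmul_pr assms)
qed

section \<open>The Drinfeld twist\<close>

locale qhopf =
  fixes H :: "('k::field, 'h::ab_group_add, 'm) qhopf_scheme"
  assumes qh: "quasi_hopf_algebra H"

sublocale qhopf \<subseteq> qbialg H
  using qh by unfold_locales (simp add: quasi_hopf_algebra_def Let_def)

context qhopf
begin

abbreviation S where "S \<equiv> tap H (antipode H)"
abbreviation al where "al \<equiv> alpha H"
abbreviation be where "be \<equiv> beta H"

lemma S_klin: "klin H H (antipode H)" and S_bij: "bij_betw (antipode H) (carrier H) (carrier H)"
  and al_closed: "al \<in> carrier H" and be_closed: "be \<in> carrier H"
  using qh by (simp_all add: quasi_hopf_algebra_def Let_def)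

lemma S_closed: "S x \<in> carrier H"
  using S_klin pr_spec(2)[OF sH] by (auto simp: klin_def tap_def)

lemma S_lin [lins]: "lin s (scl H) g \<Longrightarrow> lin s (scl H) (\<lambda>x. S (g x))"
  unfolding tap_def by (rule klin_tot[OF sH sH S_klin])

lemma S_eq: "x \<in> carrier H \<Longrightarrow> antipode H x = S x"
  by (simp add: tap_eq[OF sH])

lemma S_mult: "S (x \<cdot> y) = S y \<cdot> S x"
proof -
  have "S (x \<cdot> y) = antipode H (pr H x \<otimes>\<^bsub>H\<^esub> pr H y)"
    by (simp add: tap_def tmul_pr[OF kH]) (simp add: tmul_def)
  then show ?thesis using qh pr_spec(2)[OF sH] S_closed tmul_mult[OF kH]
    by (simp add: quasi_hopf_algebra_def Let_def tap_def)
qed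

lemma S_one: "S uH = uH"
  using qh by (simp add: tap_def pr_one[OF kH] quasi_hopf_algebra_def Let_def)

lemmas S_pr = tap_pr[OF sH, of "antipode H"]

lemma pr_fix: "pr H (S x) = S x" "pr H al = al" "pr H be = be" "pr H uH = uH"
  by (simp_all add: pr_spec sH S_closed al_closed be_closed pr_one kH)

lemmas one_simps = tmul_one[OF kH] tmul_pr[OF kH] pr_fix pr_pr[OF sH] S_one S_pr \<epsilon>_one \<epsilon>_pr \<Delta>_pr
lemmas assoc = tmul_assoc[OF kH]

text \<open>The map \<open>f\<close> is the surrounding expression as a function of the place where
  \<alpha> stands. In later applications the main task is to bracket an expression such that the two
  components of \<open>h\<close> meet around \<alpha>.\<close>

lemma alpha:
  assumes "lin (scl H) s f"
  shows "sD h (\<lambda>a b. f (S a \<cdot> al \<cdot> b)) = s (\<epsilon> h) (f al)"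
proof -
  have "sw H H (comul H (pr H h)) (\<lambda>h1 h2. antipode H h1 \<otimes>\<^bsub>H\<^esub> al \<otimes>\<^bsub>H\<^esub> h2) = scl H (counit H (pr H h)) al"
    using qh pr_spec(2)[OF sH, of h] by (simp add: quasi_hopf_algebra_def Let_def)
  also have "sw H H (comul H (pr H h)) (\<lambda>h1 h2. antipode H h1 \<otimes>\<^bsub>H\<^esub> al \<otimes>\<^bsub>H\<^esub> h2) =
      sD h (\<lambda>a b. S a \<cdot> al \<cdot> b)"
    unfolding tap_def[of _ "comul H"]
    by (rule sw_cong[OF \<Delta>_closed[unfolded tap_def]])
      (use S_closed in \<open>simp add: S_eq tmul_mult[OF kH] al_closed tmul_closed[OF kH]\<close>)
  finally have "sD h (\<lambda>a b. S a \<cdot> al \<cdot> b) = scl H (\<epsilon> h) al" by (simp add: tap_def)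
  then show ?thesis using lin_out[OF assms, of H H "\<Delta> h" "\<lambda>a b. S a \<cdot> al \<cdot> b"] linD(4)[OF assms] by simp
qed

lemma beta:
  assumes "lin (scl H) s f"
  shows "sD h (\<lambda>a b. f (a \<cdot> be \<cdot> S b)) = s (\<epsilon> h) (f be)"
proof -
  have "sw H H (comul H (pr H h)) (\<lambda>h1 h2. h1 \<otimes>\<^bsub>H\<^esub> be \<otimes>\<^bsub>H\<^esub> antipode H h2) = scl H (counit H (pr H h)) be"
    using qh pr_spec(2)[OF sH, of h] by (simp add: quasi_hopf_algebra_def Let_def)
  also have "sw H H (comul H (pr H h)) (\<lambda>h1 h2. h1 \<otimes>\<^bsub>H\<^esub> be \<otimes>\<^bsub>H\<^esub> antipode H h2) =
      sD h (\<lambda>a b. a \<cdot> be \<cdot> S b)"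
    unfolding tap_def[of _ "comul H"]
    by (rule sw_cong[OF \<Delta>_closed[unfolded tap_def]])
      (use S_closed in \<open>simp add: S_eq tmul_mult[OF kH] be_closed tmul_closed[OF kH]\<close>)
  finally have "sD h (\<lambda>a b. a \<cdot> be \<cdot> S b) = scl H (\<epsilon> h) be" by (simp add: tap_def)
  then show ?thesis using lin_out[OF assms, of H H "\<Delta> h" "\<lambda>a b. a \<cdot> be \<cdot> S b"] linD(4)[OF assms] by simp
qed

lemma alpha_beta:
  assumes "lin (scl H) s f"
  shows "sP (\<lambda>a b c. f (a \<cdot> be \<cdot> S b \<cdot> al \<cdot> c)) = f uH"
    and "sP' (\<lambda>a b c. f (S a \<cdot> al \<cdot> b \<cdot> be \<cdot> S c)) = f uH"
proof -
  have "sP (\<lambda>X1 X2 X3. X1 \<otimes>\<^bsub>H\<^esub> be \<otimes>\<^bsub>H\<^esub> antipode H X2 \<otimes>\<^bsub>H\<^esub> al \<otimes>\<^bsub>H\<^esub> X3) = uH"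
    "sP' (\<lambda>X1 X2 X3. antipode H X1 \<otimes>\<^bsub>H\<^esub> al \<otimes>\<^bsub>H\<^esub> X2 \<otimes>\<^bsub>H\<^esub> be \<otimes>\<^bsub>H\<^esub> antipode H X3) = uH"
    using qh by (simp_all add: quasi_hopf_algebra_def Let_def)
  moreover have "sP (\<lambda>X1 X2 X3. X1 \<otimes>\<^bsub>H\<^esub> be \<otimes>\<^bsub>H\<^esub> antipode H X2 \<otimes>\<^bsub>H\<^esub> al \<otimes>\<^bsub>H\<^esub> X3) =
      sP (\<lambda>a b c. a \<cdot> be \<cdot> S b \<cdot> al \<cdot> c)"
    "sP' (\<lambda>X1 X2 X3. antipode H X1 \<otimes>\<^bsub>H\<^esub> al \<otimes>\<^bsub>H\<^esub> X2 \<otimes>\<^bsub>H\<^esub> be \<otimes>\<^bsub>H\<^esub> antipode H X3) =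
      sP' (\<lambda>a b c. S a \<cdot> al \<cdot> b \<cdot> be \<cdot> S c)"
    by ((rule sw3_cong[OF P_closed(1)] sw3_cong[OF P_closed(2)]),
        use S_closed in \<open>simp add: S_eq tmul_mult[OF kH] al_closed be_closed tmul_closed[OF kH]\<close>)+
  ultimately show "sP (\<lambda>a b c. f (a \<cdot> be \<cdot> S b \<cdot> al \<cdot> c)) = f uH"
    "sP' (\<lambda>a b c. f (S a \<cdot> al \<cdot> b \<cdot> be \<cdot> S c)) = f uH"
    by (simp_all add: lin_out3[OF assms, symmetric])
qed

section \<open>The elements \<gamma> and \<delta>\<close>

abbreviation HH where "HH \<equiv> H \<boxtimes> H"
abbreviation hhm (infixl "\<star>" 60) where "x \<star> y \<equiv> x \<odot>\<^bsub>HH\<^esub> y"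
abbreviation tp (infix "\<sharp>" 65) where "x \<sharp> y \<equiv> tpt H H x y"

lemma kHH [lins]: "kalgebra HH" by (rule kalgebra_tensor[OF kH kH])
lemmas sHH = kspace_kalgebra[OF kHH]
lemmas assocE = tmul_assoc[OF kHH]
lemmas tp_mult = tpt_mult[OF kH kH]
lemmas tp_pr = tpt_pr(1)[OF sH, of H] tpt_pr(2)[OF sH, of H]

lemma \<Delta>_sum: "\<Delta> h = sD h (\<lambda>a b. a \<sharp> b)"
  by (simp add: sw_tpt_id[OF sH sH \<Delta>_closed])

lemma \<Delta>_star:
  "\<Delta> k \<star> e = sD k (\<lambda>c d. (c \<sharp> d) \<star> e)" "e \<star> \<Delta> k = sD k (\<lambda>c d. e \<star> (c \<sharp> d))"
  by (subst (1) \<Delta>_sum, rule tmul_sw[OF kHH])+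

lemma \<Delta>_lin [lins]: "lin s (scl H) g \<Longrightarrow> lin s (scl HH) (\<lambda>x. \<Delta> (g x))"
  by (rule tap_lin[OF comul_hom sH sHH])

lemma \<Delta>_multE: "\<Delta> (x \<cdot> y) = \<Delta> x \<star> \<Delta> y"
  by (rule tap_mult[OF comul_hom sH kH kHH])

lemma \<Delta>_oneE: "\<Delta> uH = \<one>\<^bsub>HH\<^esub>"
  by (rule tap_one[OF comul_hom sH kH])

text \<open>This is (S \<otimes> S)(\<Delta>^cop(h)). Being anti-multiplicative, it plays for H
  \<otimes> H, together with \<Delta>, the role that S plays for H.\<close>

definition S1 where "S1 h = sD h (\<lambda>a b. S b \<sharp> S a)"

lemma S1_lin [lins]: "lin s (scl H) g \<Longrightarrow> lin s (scl HH) (\<lambda>x. S1 (g x))"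
  unfolding S1_def by (rule lins | assumption)+

lemma S1_mult: "S1 (x \<cdot> y) = S1 y \<star> S1 x"
proof -
  have "S1 (x \<cdot> y) = sD x (\<lambda>a b. sD y (\<lambda>c d. S (b \<cdot> d) \<sharp> S (a \<cdot> c)))"
    unfolding S1_def by (subst \<Delta>_mult[where s = "scl HH"]) ((rule lins)+, rule refl)
  also have "\<dots> = S1 y \<star> S1 x"
    by (simp only: S1_def tmul_sw[OF kHH] tp_mult S_mult)
  finally show ?thesis .
qed

lemma one_HH: "\<one>\<^bsub>HH\<^esub> = uH \<sharp> uH"
  by (simp add: tpt_def pr_one[OF kH] tensor_def)

lemma S1_one: "S1 uH = \<one>\<^bsub>HH\<^esub>"
  unfolding S1_def by (subst \<Delta>_one[where s = "scl HH"]) ((rule lins)+, simp add: S_one one_HH)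

lemma S1_pr: "S1 (pr H x) = S1 x" by (simp add: S1_def \<Delta>_pr)

lemma S1_closed: "S1 h \<in> carrier HH"
  unfolding S1_def by (intro sw_closed[OF sHH \<Delta>_closed] tpt_closed sH)

text \<open>
  \<open>gam\<close> is Drinfeld's \<open>\<gamma>\<close> and \<open>del\<close> is \<open>\<delta>\<close>. In \<open>gaux p q r\<close> and \<open>daux p q r\<close> the tensor
  \<open>p \<otimes> q \<otimes> r\<close> stands in for \<open>\<Phi>\<^sup>-\<^sup>1\<close> in \<open>A\<close> and for \<open>\<Phi>\<close> in \<open>B\<close>.
\<close>

definition gaux where
  "gaux p q r = sP (\<lambda>X1 X2 X3. sD p (\<lambda>a b. S (X2 \<cdot> b) \<cdot> al \<cdot> (X3 \<cdot> q) \<sharp> S (X1 \<cdot> a) \<cdot> al \<cdot> r))"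

definition gam where "gam = sP' gaux"

definition daux where
  "daux p q r = sP' (\<lambda>x1 x2 x3. sD p (\<lambda>a b. a \<cdot> x1 \<cdot> be \<cdot> S r \<sharp> b \<cdot> x2 \<cdot> be \<cdot> S (q \<cdot> x3)))"

definition del where "del = sP daux"

lemma gaux_lin [lins]:
  "lin s (scl H) f \<Longrightarrow> lin s (scl HH) (\<lambda>x. gaux (f x) q r)"
  "lin s (scl H) f \<Longrightarrow> lin s (scl HH) (\<lambda>x. gaux p (f x) r)"
  "lin s (scl H) f \<Longrightarrow> lin s (scl HH) (\<lambda>x. gaux p q (f x))"
  unfolding gaux_def by (rule lins | assumption)+

lemma daux_lin [lins]:
  "lin s (scl H) f \<Longrightarrow> lin s (scl HH) (\<lambda>x. daux (f x) q r)"
  "lin s (scl H) f \<Longrightarrow> lin s (scl HH) (\<lambda>x. daux p (f x) r)"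
  "lin s (scl H) f \<Longrightarrow> lin s (scl HH) (\<lambda>x. daux p q (f x))"
  unfolding daux_def by (rule lins | assumption)+

text \<open>Multiplication by \<open>S1 h\<close> and by a pure tensor affects only the parameters
  of \<open>gaux\<close>. Identities for \<gamma> are thus reduced to identities for the inverse of
  \<Phi>, whose legs these parameters are.\<close>

lemma gaux_mult: "S1 h \<star> gaux p q r \<star> (c \<sharp> d) = gaux (p \<cdot> h) (q \<cdot> c) (r \<cdot> d)"
proof -
  have "gaux (p \<cdot> h) (q \<cdot> c) (r \<cdot> d) = sP (\<lambda>X1 X2 X3. sD p (\<lambda>a b. sD h (\<lambda>a' b'.
     S (X2 \<cdot> (b \<cdot> b')) \<cdot> al \<cdot> (X3 \<cdot> (q \<cdot> c)) \<sharp> S (X1 \<cdot> (a \<cdot> a')) \<cdot> al \<cdot> (r \<cdot> d))))"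
    unfolding gaux_def by (subst \<Delta>_mult[where s = "scl HH"]) ((rule lins)+, rule refl)
  also have "\<dots> = S1 h \<star> gaux p q r \<star> (c \<sharp> d)"
    unfolding gaux_def tmul_sw[OF kHH]
    by (simp only: S1_def tmul_sw[OF kHH] tp_mult S_mult assoc)
  finally show ?thesis by simp
qed

lemma daux_mult': "\<Delta> k \<star> daux p q r = daux (k \<cdot> p) q r"
proof -
  have "daux (k \<cdot> p) q r = sP' (\<lambda>x1 x2 x3. sD k (\<lambda>c d. sD p (\<lambda>a b.
     c \<cdot> a \<cdot> x1 \<cdot> be \<cdot> S r \<sharp> d \<cdot> b \<cdot> x2 \<cdot> be \<cdot> S (q \<cdot> x3))))"
    unfolding daux_def by (subst \<Delta>_mult[where s = "scl HH"]) ((rule lins)+, rule refl)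
  also have "\<dots> = sP' (\<lambda>x1 x2 x3. sD k (\<lambda>c d. (c \<sharp> d) \<star> sD p (\<lambda>a b.
     a \<cdot> x1 \<cdot> be \<cdot> S r \<sharp> b \<cdot> x2 \<cdot> be \<cdot> S (q \<cdot> x3))))"
    by (simp only: tmul_sw[OF kHH] tp_mult S_mult assoc)
  also have "\<dots> = \<Delta> k \<star> daux p q r"
    unfolding daux_def tmul_sw(4)[OF kHH] by (simp only: \<Delta>_star(1))
  finally show ?thesis by simp
qed

lemma daux_mult_r: "daux p q r \<star> (S k \<sharp> S h) = daux p (h \<cdot> q) (k \<cdot> r)"
  unfolding daux_def by (simp only: tmul_sw[OF kHH] tp_mult S_mult assoc)

lemma daux_S1: "\<Delta> k \<star> daux p q r \<star> S1 h = sD h (\<lambda>c d. daux (k \<cdot> p) (c \<cdot> q) (d \<cdot> r))"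
  by (simp only: daux_mult' S1_def tmul_sw[OF kHH] daux_mult_r)

lemma gaux_\<Delta>: "S1 h \<star> gaux p q r \<star> \<Delta> k = sD k (\<lambda>c d. gaux (p \<cdot> h) (q \<cdot> c) (r \<cdot> d))"
  by (simp only: \<Delta>_star(2) gaux_mult)

lemmas H_coassoc = rcomod.coassoc[OF rcomod_self]
lemmas H_pentagon = rcomod.pentagon[OF rcomod_self]
lemmas H_counit = rcomod.X_counit[OF rcomod_self]
lemmas vHH = vs_scl[OF sHH]

text \<open>Coassociativity of \<Phi> rearranges the components of \<open>g\<close> so that two of
  them meet around the first \<alpha> and contract to \<epsilon>. The remaining one, restored to
  \<open>g\<close> by the counit, ends up in the second leg, next to the other \<alpha>.\<close>

lemma gaux_comul:
  "sD g (\<lambda>g1 g2. gaux (g1 \<cdot> p) (g2 \<cdot> q) r) =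
    sP (\<lambda>X1 X2 X3. sD p (\<lambda>a b. S (X2 \<cdot> b) \<cdot> al \<cdot> (X3 \<cdot> q) \<sharp> S (g \<cdot> X1 \<cdot> a) \<cdot> al \<cdot> r))"
proof -
  define K where "K = (\<lambda>y z w. sD p (\<lambda>a b. S (z \<cdot> b) \<cdot> al \<cdot> (w \<cdot> q) \<sharp> S (y \<cdot> a) \<cdot> al \<cdot> r))"
  define M where "M = (\<lambda>y. sP (\<lambda>X1 X2 X3. sD p (\<lambda>a b. S (X2 \<cdot> b) \<cdot> al \<cdot> (X3 \<cdot> q) \<sharp> S (y \<cdot> X1 \<cdot> a) \<cdot> al \<cdot> r)))"
  have Kl: "trilin (scl H) (scl H) (scl H) (scl HH) K" unfolding K_def by (rule lins)+
  have Ml: "lin (scl H) (scl HH) M" unfolding M_def by (rule lins)+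
  have "sD g (\<lambda>g1 g2. gaux (g1 \<cdot> p) (g2 \<cdot> q) r) = sD g (\<lambda>g1 g2. sP (\<lambda>X1 X2 X3. sD g1 (\<lambda>c d. sD p (\<lambda>a b.
      S (X2 \<cdot> (d \<cdot> b)) \<cdot> al \<cdot> (X3 \<cdot> (g2 \<cdot> q)) \<sharp> S (X1 \<cdot> (c \<cdot> a)) \<cdot> al \<cdot> r))))"
    unfolding gaux_def by (subst \<Delta>_mult[where s = "scl HH"]) ((rule lins)+, rule refl)
  also have "\<dots> = sP (\<lambda>X1 X2 X3. sD g (\<lambda>g1 g2. sD g1 (\<lambda>c d. K (X1 \<cdot> c) (X2 \<cdot> d) (X3 \<cdot> g2))))"
    by (simp only: K_def assoc) (rule sw_sw3_swap)
  also have "\<dots> = sD g (\<lambda>a0 a1. sD a1 (\<lambda>c d. sP (\<lambda>X1 X2 X3. K (a0 \<cdot> X1) (c \<cdot> X2) (d \<cdot> X3))))"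
    by (rule H_coassoc(1)[OF Kl])
  also have "\<dots> = sD g (\<lambda>a0 a1. scl HH (\<epsilon> a1) (M a0))"
  proof (rule arg_cong[of _ _ "sD g"], intro ext)
    fix y h
    have al: "sD h (\<lambda>c d. x \<cdot> (S c \<cdot> al \<cdot> d) \<cdot> x' \<sharp> z) = scl HH (\<epsilon> h) (x \<cdot> al \<cdot> x' \<sharp> z)" for x x' z
      by (rule alpha[where f = "\<lambda>w. x \<cdot> w \<cdot> x' \<sharp> z"]) (rule lins)+
    have "sD h (\<lambda>c d. sP (\<lambda>X1 X2 X3. K (y \<cdot> X1) (c \<cdot> X2) (d \<cdot> X3))) = sP (\<lambda>X1 X2 X3. sD p (\<lambda>a b. sD h (\<lambda>c d.
        S (X2 \<cdot> b) \<cdot> (S c \<cdot> al \<cdot> d) \<cdot> (X3 \<cdot> q) \<sharp> S (y \<cdot> X1 \<cdot> a) \<cdot> al \<cdot> r)))"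
      by (simp only: K_def S_mult assoc sw_sw3_swap) (rule arg_cong[of _ _ sP], intro ext, rule sw_swap)
    also have "\<dots> = scl HH (\<epsilon> h) (M y)"
      by (simp only: al M_def scale_sw[OF vHH] scale_sw3[OF vHH])
    finally show "sD h (\<lambda>c d. sP (\<lambda>X1 X2 X3. K (y \<cdot> X1) (c \<cdot> X2) (d \<cdot> X3))) = scl HH (\<epsilon> h) (M y)" .
  qed
  also have "\<dots> = M (pr H g)" by (rule \<Delta>_counit(1)[OF Ml])
  finally show ?thesis by (simp only: M_def one_simps)
qed

text \<open>For \<gamma> this is what S(h_1) \<alpha> h_2 = \<epsilon>(h) \<alpha> is for \<alpha>.
  The components of \<open>h\<close> are moved past the inverse of \<Phi> by coassociativity; the
  two copies of \<alpha> inside \<gamma> then absorb them in turn, the first through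
  \<open>gaux_comul\<close>.\<close>

lemma gam_S1: "sD h (\<lambda>h1 h2. S1 h1 \<star> gam \<star> \<Delta> h2) = scl HH (\<epsilon> h) gam"
proof -
  have tl: "trilin (scl H) (scl H) (scl H) (scl HH) gaux" by (rule lins)+
  have "sD h (\<lambda>h1 h2. S1 h1 \<star> gam \<star> \<Delta> h2) =
    sD h (\<lambda>h1 h2. sP' (\<lambda>x1 x2 x3. sD h2 (\<lambda>c d. gaux (x1 \<cdot> h1) (x2 \<cdot> c) (x3 \<cdot> d))))"
    by (simp only: gam_def tmul_sw[OF kHH] gaux_\<Delta>)
  also have "\<dots> = sP' (\<lambda>x1 x2 x3. sD h (\<lambda>h1 h2. sD h2 (\<lambda>c d. gaux (x1 \<cdot> h1) (x2 \<cdot> c) (x3 \<cdot> d))))"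
    by (rule sw_sw3_swap)
  also have "\<dots> = sD h (\<lambda>a0 a1. sD a0 (\<lambda>a00 a01. sP' (\<lambda>x1 x2 x3. gaux (a00 \<cdot> x1) (a01 \<cdot> x2) (a1 \<cdot> x3))))"
    by (rule H_coassoc(2)[OF tl])
  also have "\<dots> = sP' (\<lambda>x1 x2 x3. sD h (\<lambda>a0 a1. sD a0 (\<lambda>a00 a01. gaux (a00 \<cdot> x1) (a01 \<cdot> x2) (a1 \<cdot> x3))))"
    by (simp only: sw_sw3_swap)
  also have "\<dots> = sP' (\<lambda>p q r. scl HH (\<epsilon> h) (gaux p q r))"
  proof (rule arg_cong[of _ _ sP'], intro ext)
    fix p q r
    have al: "sD h (\<lambda>c d. z \<sharp> x \<cdot> (S c \<cdot> al \<cdot> d) \<cdot> x') = scl HH (\<epsilon> h) (z \<sharp> x \<cdot> al \<cdot> x')" for x x' z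
      by (rule alpha[where f = "\<lambda>w. z \<sharp> x \<cdot> w \<cdot> x'"]) (rule lins)+
    have "sD h (\<lambda>a0 a1. sD a0 (\<lambda>a00 a01. gaux (a00 \<cdot> p) (a01 \<cdot> q) (a1 \<cdot> r))) =
      sP (\<lambda>X1 X2 X3. sD p (\<lambda>a b. sD h (\<lambda>c d.
        S (X2 \<cdot> b) \<cdot> al \<cdot> (X3 \<cdot> q) \<sharp> S (X1 \<cdot> a) \<cdot> (S c \<cdot> al \<cdot> d) \<cdot> r)))"
      by (simp only: gaux_comul S_mult assoc sw_sw3_swap) (rule arg_cong[of _ _ sP], intro ext, rule sw_swap)
    also have "\<dots> = scl HH (\<epsilon> h) (gaux p q r)"
      by (simp only: al gaux_def scale_sw[OF vHH] scale_sw3[OF vHH])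
    finally show "sD h (\<lambda>a0 a1. sD a0 (\<lambda>a00 a01. gaux (a00 \<cdot> p) (a01 \<cdot> q) (a1 \<cdot> r))) =
      scl HH (\<epsilon> h) (gaux p q r)" .
  qed
  also have "\<dots> = scl HH (\<epsilon> h) gam" by (simp only: gam_def scale_sw3[OF vHH])
  finally show ?thesis .
qed

text \<open>The mirror image of \<open>gaux_comul\<close>: two components of \<open>g\<close>
  contract around the \<beta> of the second leg, and the remaining one stands before the \<beta> of
  the first leg.\<close>

lemma daux_comul:
  "sD g (\<lambda>g1 g2. daux (p \<cdot> g1) (q \<cdot> g2) r) =
    sP' (\<lambda>x1 x2 x3. sD p (\<lambda>a b. a \<cdot> x1 \<cdot> g \<cdot> be \<cdot> S r \<sharp> b \<cdot> x2 \<cdot> be \<cdot> S (q \<cdot> x3)))"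
proof -
  define K where "K = (\<lambda>y z w. sD p (\<lambda>a b. a \<cdot> y \<cdot> be \<cdot> S r \<sharp> b \<cdot> z \<cdot> be \<cdot> S (q \<cdot> w)))"
  define M where "M = (\<lambda>y. sP' (\<lambda>x1 x2 x3. sD p (\<lambda>a b. a \<cdot> x1 \<cdot> y \<cdot> be \<cdot> S r \<sharp> b \<cdot> x2 \<cdot> be \<cdot> S (q \<cdot> x3))))"
  have Kl: "trilin (scl H) (scl H) (scl H) (scl HH) K" unfolding K_def by (rule lins)+
  have Ml: "lin (scl H) (scl HH) M" unfolding M_def by (rule lins)+
  have "sD g (\<lambda>g1 g2. daux (p \<cdot> g1) (q \<cdot> g2) r) = sD g (\<lambda>g1 g2. sP' (\<lambda>x1 x2 x3. sD p (\<lambda>a b. sD g1 (\<lambda>c d.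
      a \<cdot> c \<cdot> x1 \<cdot> be \<cdot> S r \<sharp> b \<cdot> d \<cdot> x2 \<cdot> be \<cdot> S (q \<cdot> g2 \<cdot> x3)))))"
    unfolding daux_def by (subst \<Delta>_mult[where s = "scl HH"]) ((rule lins)+, rule refl)
  also have "\<dots> = sD g (\<lambda>a0 a1. sD a0 (\<lambda>c d. sP' (\<lambda>x1 x2 x3. K (c \<cdot> x1) (d \<cdot> x2) (a1 \<cdot> x3))))"
    by (simp only: K_def assoc sw_sw3_swap) (intro arg_cong[of _ _ sP'] arg_cong[of _ _ "sD g"] ext, rule sw_swap)
  also have "\<dots> = sP' (\<lambda>x1 x2 x3. sD g (\<lambda>a0 a1. sD a1 (\<lambda>c d. K (x1 \<cdot> a0) (x2 \<cdot> c) (x3 \<cdot> d))))"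
    by (rule H_coassoc(2)[OF Kl, symmetric])
  also have "\<dots> = sD g (\<lambda>a0 a1. sP' (\<lambda>x1 x2 x3. sD a1 (\<lambda>c d. K (x1 \<cdot> a0) (x2 \<cdot> c) (x3 \<cdot> d))))"
    by (rule sw_sw3_swap[symmetric])
  also have "\<dots> = sD g (\<lambda>a0 a1. scl HH (\<epsilon> a1) (M a0))"
  proof (rule arg_cong[of _ _ "sD g"], intro ext)
    fix y h
    have be: "sD h (\<lambda>c d. z \<sharp> x \<cdot> (c \<cdot> be \<cdot> S d) \<cdot> x') = scl HH (\<epsilon> h) (z \<sharp> x \<cdot> be \<cdot> x')" for x x' z
      by (rule beta[where f = "\<lambda>w. z \<sharp> x \<cdot> w \<cdot> x'"]) (rule lins)+
    have "sP' (\<lambda>x1 x2 x3. sD h (\<lambda>c d. K (x1 \<cdot> y) (x2 \<cdot> c) (x3 \<cdot> d))) = sP' (\<lambda>x1 x2 x3. sD p (\<lambda>a b. sD h (\<lambda>c d.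
        a \<cdot> x1 \<cdot> y \<cdot> be \<cdot> S r \<sharp> b \<cdot> x2 \<cdot> (c \<cdot> be \<cdot> S d) \<cdot> S (q \<cdot> x3))))"
      by (simp only: K_def S_mult assoc) (rule arg_cong[of _ _ sP'], intro ext, rule sw_swap)
    also have "\<dots> = scl HH (\<epsilon> h) (M y)"
      by (simp only: be M_def scale_sw[OF vHH] scale_sw3[OF vHH])
    finally show "sP' (\<lambda>x1 x2 x3. sD h (\<lambda>c d. K (x1 \<cdot> y) (x2 \<cdot> c) (x3 \<cdot> d))) = scl HH (\<epsilon> h) (M y)" .
  qed
  also have "\<dots> = M (pr H g)" by (rule \<Delta>_counit(1)[OF Ml])
  finally show ?thesis by (simp only: M_def one_simps assoc)
qed

text \<open>For \<delta> this is what h_1 \<beta> S(h_2) = \<epsilon>(h) \<beta> is for \<beta>; the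
  two copies of \<beta> inside \<delta> absorb the components of \<open>h\<close> in turn.\<close>

lemma del_S1: "sD h (\<lambda>h1 h2. \<Delta> h1 \<star> del \<star> S1 h2) = scl HH (\<epsilon> h) del"
proof -
  have tl: "trilin (scl H) (scl H) (scl H) (scl HH) daux" by (rule lins)+
  have "sD h (\<lambda>h1 h2. \<Delta> h1 \<star> del \<star> S1 h2) =
    sD h (\<lambda>h1 h2. sD h2 (\<lambda>c d. sP (\<lambda>x1 x2 x3. daux (h1 \<cdot> x1) (c \<cdot> x2) (d \<cdot> x3))))"
    by (simp only: del_def tmul_sw[OF kHH] daux_S1 sw_sw3_swap)
  also have "\<dots> = sP (\<lambda>x y z. sD h (\<lambda>a0 a1. sD a0 (\<lambda>a00 a01. daux (x \<cdot> a00) (y \<cdot> a01) (z \<cdot> a1))))"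
    by (rule H_coassoc(1)[OF tl, symmetric])
  also have "\<dots> = sP (\<lambda>p q r. scl HH (\<epsilon> h) (daux p q r))"
  proof (rule arg_cong[of _ _ sP], intro ext)
    fix p q r
    have be: "sD h (\<lambda>c d. x \<cdot> (c \<cdot> be \<cdot> S d) \<cdot> x' \<sharp> z) = scl HH (\<epsilon> h) (x \<cdot> be \<cdot> x' \<sharp> z)" for x x' z
      by (rule beta[where f = "\<lambda>w. x \<cdot> w \<cdot> x' \<sharp> z"]) (rule lins)+
    have "sD h (\<lambda>a0 a1. sD a0 (\<lambda>a00 a01. daux (p \<cdot> a00) (q \<cdot> a01) (r \<cdot> a1))) =
      sP' (\<lambda>x1 x2 x3. sD p (\<lambda>a b. sD h (\<lambda>c d. a \<cdot> x1 \<cdot> (c \<cdot> be \<cdot> S d) \<cdot> S r \<sharp> b \<cdot> x2 \<cdot> be \<cdot> S (q \<cdot> x3))))"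
      by (simp only: daux_comul S_mult assoc sw_sw3_swap) (rule arg_cong[of _ _ sP'], intro ext, rule sw_swap)
    also have "\<dots> = scl HH (\<epsilon> h) (daux p q r)"
      by (simp only: be daux_def scale_sw[OF vHH] scale_sw3[OF vHH])
    finally show "sD h (\<lambda>a0 a1. sD a0 (\<lambda>a00 a01. daux (p \<cdot> a00) (q \<cdot> a01) (r \<cdot> a1))) =
      scl HH (\<epsilon> h) (daux p q r)" .
  qed
  also have "\<dots> = scl HH (\<epsilon> h) del" by (simp only: del_def scale_sw3[OF vHH])
  finally show ?thesis .
qed

end

section \<open>The elements p and q of a comodule algebra\<close>

locale qhcomod = qhopf H + rcomod H A \<rho> \<Phi>\<rho>
  for H :: "('k::field, 'h::ab_group_add, 'm) qhopf_scheme"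
    and A :: "('k, 'a::ab_group_add, 'n) kalg_scheme" and \<rho> and \<Phi>\<rho>
begin

lemmas oneA_simps = tmul_one[OF kA] tmul_pr[OF kA] pr_pr[OF sA]

text \<open>
  The coproduct of \<open>p\<close>, with \<open>\<delta>\<close> in place of \<open>\<Delta>(\<beta>)\<close>, expressed through two copies of \<open>p\<close>.
\<close>

lemma twist_pq:
  assumes F: "bilin (scl A) (scl HH) s F"
  shows "sX' (\<lambda>r1 r2 r3. sX' (\<lambda>t1 t2 t3. sR r1 (\<lambda>p q.
      F (p \<bullet> t1) (\<Delta> (q \<cdot> t2) \<star> del \<star> S1 t3 \<star> (S r3 \<sharp> S r2))))) =
    sX (\<lambda>X1 X2 X3. sX' (\<lambda>t1 t2 t3. sR t1 (\<lambda>p q. sX' (\<lambda>s1 s2 s3.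
      F (X1 \<bullet> p \<bullet> s1) (X2 \<cdot> q \<cdot> s2 \<cdot> be \<cdot> S s3 \<sharp> X3 \<cdot> t2 \<cdot> be \<cdot> S t3)))))"
proof -
  have vs: "vector_space s" by (rule bilinD(3)[OF F])
  note l = lin_bilin[OF F] vs lins
  note Fo = lin_out3[OF bilinD(4)[OF F]] lin_out[OF bilinD(4)[OF F]]
  \<comment> \<open>\<open>K\<close> is the summand with \<delta> opened and the legs of its \<Phi>
    as variables, the form to which the pentagon applies. \<open>K2\<close> is what it becomes once
    \<open>daux_comul\<close> has consumed a coproduct.\<close>
  define K where "K = (\<lambda>m a b c. F m (daux a b c))"
  define K2 where "K2 = (\<lambda>x y z m a b c. F (m \<bullet> x) (a \<cdot> y \<cdot> be \<cdot> S z \<sharp> b \<cdot> be \<cdot> S c))"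
  have Kq: "quadlin (scl A) (scl H) (scl H) (scl H) s K" unfolding K_def by (rule l)+
  have K2q: "quadlin (scl A) (scl H) (scl H) (scl H) s (K2 x y z)" for x y z unfolding K2_def by (rule l)+
  have "sX' (\<lambda>r1 r2 r3. sX' (\<lambda>t1 t2 t3. sR r1 (\<lambda>p q.
      F (p \<bullet> t1) (\<Delta> (q \<cdot> t2) \<star> del \<star> S1 t3 \<star> (S r3 \<sharp> S r2))))) =
    sX' (\<lambda>r1 r2 r3. sR r1 (\<lambda>p q. sX' (\<lambda>t1 t2 t3. sD t3 (\<lambda>c d. sP (\<lambda>X1 X2 X3.
      K (p \<bullet> t1) (q \<cdot> t2 \<cdot> X1) (r2 \<cdot> c \<cdot> X2) (r3 \<cdot> d \<cdot> X3))))))"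
    by (simp only: K_def del_def tmul_sw[OF kHH] daux_S1 daux_mult_r assoc Fo sw_sw3_swap)
  also have "\<dots> = sX' (\<lambda>a b c. sX' (\<lambda>x y z. sD y (\<lambda>p q. K (a \<bullet> x) (b \<cdot> p) (c \<cdot> q) (pr H z))))"
    by (rule pentagon(3)[OF Kq])
  also have "\<dots> = sX' (\<lambda>a b c. sX' (\<lambda>x y z. sD b (\<lambda>p q. sP' (\<lambda>k1 k2 k3. K2 x y z a (p \<cdot> k1) (q \<cdot> k2) (c \<cdot> k3)))))"
    by (simp only: K_def Fo[symmetric] daux_comul) (simp only: K2_def Fo one_simps sw_sw3_swap)
  also have "\<dots> = sX' (\<lambda>x y z. sX' (\<lambda>a b c. sD b (\<lambda>p q. sP' (\<lambda>k1 k2 k3. K2 x y z a (p \<cdot> k1) (q \<cdot> k2) (c \<cdot> k3)))))"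
    by (rule sw3_swap)
  also have "\<dots> = sX' (\<lambda>x y z. sX (\<lambda>a b c. sX' (\<lambda>t1 t2 t3. sR t1 (\<lambda>p q. K2 x y z (a \<bullet> p) (b \<cdot> q) (c \<cdot> t2) (pr H t3)))))"
  proof (rule arg_cong[of _ _ "sX'"], intro ext)
    fix x y z
    have bb: "sD n (\<lambda>n1 n2. F m (e \<sharp> v \<cdot> (n1 \<cdot> be \<cdot> S n2) \<cdot> w)) = s (\<epsilon> n) (F m (e \<sharp> v \<cdot> be \<cdot> w))" for n m e v w
      by (rule beta[where f = "\<lambda>i. F m (e \<sharp> v \<cdot> i \<cdot> w)"]) (rule l)+
    have b: "sD n (\<lambda>n1 n2. K2 x y z m a (b \<cdot> n1) (c \<cdot> n2)) = s (\<epsilon> n) (K2 x y z m a b c)" for m a b c n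
      unfolding K2_def using bb[of n "m \<bullet> x" "a \<cdot> y \<cdot> be \<cdot> S z" b "S c"] by (simp only: S_mult assoc)
    have c: "sX (\<lambda>k l m. s (\<epsilon> m) (K2 x y z (d \<bullet> k) (a \<cdot> l) b c)) = K2 x y z (d \<bullet> \<one>\<^bsub>A\<^esub>) (a \<cdot> uH) b c" for a b c d
      by (rule X_counit(2)) (unfold K2_def, (rule l)+)
    have e: "K2 x y z (d \<bullet> \<one>\<^bsub>A\<^esub>) (a \<cdot> uH) b c = K2 x y z d a b c" for a b c d
      by (simp only: K2_def oneA_simps one_simps)
    \<comment> \<open>Expanded by the pentagon, the right side carries one more \<Phi>\<rho>. It
      disappears, because \<beta> contracts the coproduct of its third leg to \<epsilon>, after
      which the counit axiom removes the rest.\<close>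
    show "sX' (\<lambda>a b c. sD b (\<lambda>p q. sP' (\<lambda>k1 k2 k3. K2 x y z a (p \<cdot> k1) (q \<cdot> k2) (c \<cdot> k3)))) =
      sX (\<lambda>a b c. sX' (\<lambda>t1 t2 t3. sR t1 (\<lambda>p q. K2 x y z (a \<bullet> p) (b \<cdot> q) (c \<cdot> t2) (pr H t3))))"
      by (simp only: pentagon(1)[OF K2q] b c e)
  qed
  also have "\<dots> = sX (\<lambda>a b c. sX' (\<lambda>x y z. sX' (\<lambda>t1 t2 t3. sR t1 (\<lambda>p q. K2 x y z (a \<bullet> p) (b \<cdot> q) (c \<cdot> t2) (pr H t3)))))"
    by (rule sw3_swap)
  also have "\<dots> = sX (\<lambda>a b c. sX' (\<lambda>t1 t2 t3. sX' (\<lambda>x y z. sR t1 (\<lambda>p q. K2 x y z (a \<bullet> p) (b \<cdot> q) (c \<cdot> t2) (pr H t3)))))"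
    by (rule arg_cong[of _ _ sX], intro ext, rule sw3_swap)
  finally show ?thesis by (simp only: K2_def one_simps assoc sw_sw3_swap)
qed

text \<open>Contract three legs of the first pentagon to S(a) \<alpha> b \<beta> S(c). On the other
  side \<beta> and \<alpha> contract both coproducts, the counits remove \<Phi>\<rho> and its
  inverse, and what is left is S(x^1) \<alpha> x^2 \<beta> S(x^3) = 1.\<close>

lemma q_p_one:
  assumes G: "bilin (scl A) (scl H) s G"
  shows "sX (\<lambda>X1 X2 X3. sX' (\<lambda>t1 t2 t3. sR t1 (\<lambda>p q.
      G (X1 \<bullet> p) (S (X2 \<cdot> q) \<cdot> al \<cdot> (X3 \<cdot> t2) \<cdot> be \<cdot> S t3)))) = G \<one>\<^bsub>A\<^esub> uH"
proof -
  have vs: "vector_space s" by (rule bilinD(3)[OF G])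
  note l = lin_bilin[OF G] vs lins
  have "sX (\<lambda>X1 X2 X3. sX' (\<lambda>t1 t2 t3. sR t1 (\<lambda>p q.
      G (X1 \<bullet> p) (S (X2 \<cdot> q) \<cdot> al \<cdot> (X3 \<cdot> t2) \<cdot> be \<cdot> S (pr H t3))))) =
    sX' (\<lambda>x y z. sD y (\<lambda>p q. sP' (\<lambda>a b c. sX (\<lambda>k l m. sD m (\<lambda>m1 m2.
      G (x \<bullet> k) (S (p \<cdot> a \<cdot> l) \<cdot> al \<cdot> (q \<cdot> b \<cdot> m1) \<cdot> be \<cdot> S (z \<cdot> c \<cdot> m2)))))))"
    by (rule pentagon(1)[where s = s and F = "\<lambda>m a b c. G m (S a \<cdot> al \<cdot> b \<cdot> be \<cdot> S c)"]) (rule l)+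
  also have "\<dots> = sX' (\<lambda>x y z. sD y (\<lambda>p q. sP' (\<lambda>a b c. sX (\<lambda>k l m. s (\<epsilon> m)
      (G (x \<bullet> k) (S (p \<cdot> a \<cdot> l) \<cdot> al \<cdot> (q \<cdot> b) \<cdot> be \<cdot> S (z \<cdot> c)))))))"
  proof -
    have "sD m (\<lambda>m1 m2. G z (x \<cdot> (m1 \<cdot> be \<cdot> S m2) \<cdot> y)) = s (\<epsilon> m) (G z (x \<cdot> be \<cdot> y))" for m x y z
      by (rule beta[where f = "\<lambda>w. G z (x \<cdot> w \<cdot> y)"]) (rule l)+
    from this[of _ _ "S l \<cdot> S a \<cdot> S p \<cdot> al \<cdot> q \<cdot> b" "S c \<cdot> S z" for l a p q b c z]
    show ?thesis by (simp only: S_mult assoc)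
  qed
  also have "\<dots> = sX' (\<lambda>x y z. sD y (\<lambda>p q. sP' (\<lambda>a b c.
      G (x \<bullet> \<one>\<^bsub>A\<^esub>) (S (p \<cdot> a \<cdot> uH) \<cdot> al \<cdot> (q \<cdot> b) \<cdot> be \<cdot> S (z \<cdot> c)))))"
    by (subst X_counit(2)[where s = s]) ((rule l)+, rule refl)
  also have "\<dots> = sX' (\<lambda>x y z. sP' (\<lambda>a b c. sD y (\<lambda>p q.
      G (x \<bullet> \<one>\<^bsub>A\<^esub>) (S a \<cdot> (S p \<cdot> al \<cdot> q) \<cdot> (b \<cdot> be \<cdot> S (z \<cdot> c))))))"
    by (simp only: sw_sw3_swap one_simps assoc S_mult)
  also have "\<dots> = sX' (\<lambda>x y z. s (\<epsilon> y) (sP' (\<lambda>a b c. G (x \<bullet> \<one>\<^bsub>A\<^esub>) (S a \<cdot> al \<cdot> (b \<cdot> be \<cdot> S (z \<cdot> c))))))"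
  proof -
    have "sD m (\<lambda>c d. G z (x \<cdot> (S c \<cdot> al \<cdot> d) \<cdot> y)) = s (\<epsilon> m) (G z (x \<cdot> al \<cdot> y))" for m x y z
      by (rule alpha[where f = "\<lambda>w. G z (x \<cdot> w \<cdot> y)"]) (rule l)+
    then show ?thesis by (simp only: scale_sw3[OF vs])
  qed
  also have "\<dots> = sP' (\<lambda>a b c. G (\<one>\<^bsub>A\<^esub> \<bullet> \<one>\<^bsub>A\<^esub>) (S a \<cdot> al \<cdot> (b \<cdot> be \<cdot> S (uH \<cdot> c))))"
    by (subst X_counit(3)[where s = s]) ((rule l)+, rule refl)
  also have "\<dots> = sP' (\<lambda>a b c. G \<one>\<^bsub>A\<^esub> (S a \<cdot> al \<cdot> b \<cdot> be \<cdot> S c))"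
    by (simp only: one_simps oneA_simps pr_one[OF kA] assoc)
  also have "\<dots> = G \<one>\<^bsub>A\<^esub> uH"
    by (rule alpha_beta(2)[where s = s and f = "\<lambda>w. G \<one>\<^bsub>A\<^esub> w"]) (rule l)+
  finally show ?thesis by (simp only: one_simps)
qed

text \<open>The counterpart of \<open>q_p_one\<close> for the second pentagon and the contraction a
  \<beta> S(b) \<alpha> c; here X^1 \<beta> S(X^2) \<alpha> X^3 = 1 remains.\<close>

lemma p_q_one:
  assumes G: "bilin (scl A) (scl H) s G"
  shows "sX (\<lambda>X1 X2 X3. sR X1 (\<lambda>p q. sX' (\<lambda>t1 t2 t3.
      G (p \<bullet> t1) (q \<cdot> t2 \<cdot> be \<cdot> S (X2 \<cdot> t3) \<cdot> al \<cdot> X3)))) = G \<one>\<^bsub>A\<^esub> uH"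
proof -
  have vs: "vector_space s" by (rule bilinD(3)[OF G])
  note l = lin_bilin[OF G] vs lins
  have "sX (\<lambda>X1 X2 X3. sR X1 (\<lambda>p q. sX' (\<lambda>t1 t2 t3.
      G (p \<bullet> t1) (q \<cdot> t2 \<cdot> be \<cdot> S (X2 \<cdot> t3) \<cdot> al \<cdot> pr H X3)))) =
    sX' (\<lambda>x y z. sD z (\<lambda>z1 z2. sP (\<lambda>a b c. sX (\<lambda>k l m. sD l (\<lambda>l1 l2.
      G (x \<bullet> k) (y \<cdot> a \<cdot> l1 \<cdot> be \<cdot> S (z1 \<cdot> b \<cdot> l2) \<cdot> al \<cdot> (z2 \<cdot> c \<cdot> m)))))))"
    by (rule pentagon(2)[where s = s and F = "\<lambda>m a b c. G m (a \<cdot> be \<cdot> S b \<cdot> al \<cdot> c)"]) (rule l)+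
  also have "\<dots> = sX' (\<lambda>x y z. sD z (\<lambda>z1 z2. sP (\<lambda>a b c. sX (\<lambda>k l m. s (\<epsilon> l)
      (G (x \<bullet> k) (y \<cdot> a \<cdot> be \<cdot> S (z1 \<cdot> b) \<cdot> al \<cdot> (z2 \<cdot> c \<cdot> m)))))))"
  proof -
    have "sD m (\<lambda>m1 m2. G z (x \<cdot> (m1 \<cdot> be \<cdot> S m2) \<cdot> y)) = s (\<epsilon> m) (G z (x \<cdot> be \<cdot> y))" for m x y z
      by (rule beta[where f = "\<lambda>w. G z (x \<cdot> w \<cdot> y)"]) (rule l)+
    from this[of _ _ "y \<cdot> a" "S b \<cdot> S z \<cdot> al \<cdot> w" for y a b z w]
    show ?thesis by (simp only: S_mult assoc)
  qed
  also have "\<dots> = sX' (\<lambda>x y z. sD z (\<lambda>z1 z2. sP (\<lambda>a b c.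
      G (x \<bullet> \<one>\<^bsub>A\<^esub>) (y \<cdot> a \<cdot> be \<cdot> S (z1 \<cdot> b) \<cdot> al \<cdot> (z2 \<cdot> c \<cdot> uH)))))"
    by (subst X_counit(1)[where s = s]) ((rule l)+, rule refl)
  also have "\<dots> = sX' (\<lambda>x y z. sP (\<lambda>a b c. sD z (\<lambda>z1 z2.
      G (x \<bullet> \<one>\<^bsub>A\<^esub>) (y \<cdot> a \<cdot> be \<cdot> S b \<cdot> (S z1 \<cdot> al \<cdot> z2) \<cdot> c))))"
    by (simp only: sw_sw3_swap one_simps assoc S_mult)
  also have "\<dots> = sX' (\<lambda>x y z. s (\<epsilon> z) (sP (\<lambda>a b c. G (x \<bullet> \<one>\<^bsub>A\<^esub>) (y \<cdot> a \<cdot> be \<cdot> S b \<cdot> al \<cdot> c))))"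
  proof -
    have "sD m (\<lambda>c d. G z (x \<cdot> (S c \<cdot> al \<cdot> d) \<cdot> y)) = s (\<epsilon> m) (G z (x \<cdot> al \<cdot> y))" for m x y z
      by (rule alpha[where f = "\<lambda>w. G z (x \<cdot> w \<cdot> y)"]) (rule l)+
    then show ?thesis by (simp only: scale_sw3[OF vs])
  qed
  also have "\<dots> = sP (\<lambda>a b c. G (\<one>\<^bsub>A\<^esub> \<bullet> \<one>\<^bsub>A\<^esub>) (uH \<cdot> a \<cdot> be \<cdot> S b \<cdot> al \<cdot> c))"
    by (subst X_counit(4)[where s = s]) ((rule l)+, rule refl)
  also have "\<dots> = sP (\<lambda>a b c. G \<one>\<^bsub>A\<^esub> (a \<cdot> be \<cdot> S b \<cdot> al \<cdot> c))"
    by (simp only: one_simps oneA_simps pr_one[OF kA] assoc)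
  also have "\<dots> = G \<one>\<^bsub>A\<^esub> uH"
    by (rule alpha_beta(1)[where s = s and f = "\<lambda>w. G \<one>\<^bsub>A\<^esub> w"]) (rule l)+
  finally show ?thesis by (simp only: one_simps)
qed

end

section \<open>The relation between \<gamma> and \<delta>\<close>

context qhopf
begin

lemma qhcomod_self: "qhcomod H H (comul H) \<Phi>"
  using rcomod_self qhopf_axioms by (simp add: qhcomod_def)

lemmas H_twist_pq = qhcomod.twist_pq[OF qhcomod_self]

lemma gam_S1': "sD h (\<lambda>a b. x \<star> (S1 a \<star> gam \<star> \<Delta> b) \<star> y) = scl HH (\<epsilon> h) (x \<star> gam \<star> y)"
  by (simp only: tmul_sw[OF kHH, symmetric] gam_S1 tmul_scale[OF kHH])

lemma del_S1': "sD h (\<lambda>a b. x \<star> (\<Delta> a \<star> del \<star> S1 b) \<star> y) = scl HH (\<epsilon> h) (x \<star> del \<star> y)"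
  by (simp only: tmul_sw[OF kHH, symmetric] del_S1 tmul_scale[OF kHH])

lemma S1_star: "S1 h \<star> e = sD h (\<lambda>c d. (S d \<sharp> S c) \<star> e)"
  unfolding S1_def by (rule tmul_sw[OF kHH])

text \<open>By \<open>gaux_mult\<close> the legs of \<Phi> meet the inverse of \<Phi> hidden in
  \<gamma> and cancel it. Only the copy of \<Phi> inside \<open>gaux\<close> survives.\<close>

lemma gam_Phi: "sP (\<lambda>X1 X2 X3. S1 X1 \<star> gam \<star> (X2 \<sharp> X3)) = sP (\<lambda>X1 X2 X3. S X2 \<cdot> al \<cdot> X3 \<sharp> S X1 \<cdot> al)"
proof -
  have tl: "trilin (scl H) (scl H) (scl H) (scl HH) gaux" by (rule lins)+
  have "sP (\<lambda>X1 X2 X3. S1 X1 \<star> gam \<star> (X2 \<sharp> X3)) =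
    sP (\<lambda>X1 X2 X3. sP' (\<lambda>x1 x2 x3. gaux (x1 \<cdot> X1) (x2 \<cdot> X2) (x3 \<cdot> X3)))"
    by (simp only: gam_def tmul_sw[OF kHH] gaux_mult)
  also have "\<dots> = sP' (\<lambda>x1 x2 x3. sP (\<lambda>X1 X2 X3. gaux (x1 \<cdot> X1) (x2 \<cdot> X2) (x3 \<cdot> X3)))"
    by (rule sw3_swap)
  also have "\<dots> = gaux uH uH uH" by (rule P_inv(2)[OF tl])
  also have "\<dots> = sP (\<lambda>X1 X2 X3. S (X2 \<cdot> uH) \<cdot> al \<cdot> (X3 \<cdot> uH) \<sharp> S (X1 \<cdot> uH) \<cdot> al \<cdot> uH)"
    unfolding gaux_def by (subst \<Delta>_one[where s = "scl HH"]) ((rule lins)+, rule refl)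
  also have "\<dots> = sP (\<lambda>X1 X2 X3. S X2 \<cdot> al \<cdot> X3 \<sharp> S X1 \<cdot> al)"
    by (simp only: one_simps tp_pr)
  finally show ?thesis .
qed

text \<open>
  An analogue for \<open>\<gamma>\<close> and \<open>\<delta>\<close> of \<open>S(x\<^sup>1) \<alpha> x\<^sup>2 \<beta> S(x\<^sup>3) = 1\<close>. A redundant factor \<open>\<Phi>\<^sup>-\<^sup>1\<close>, invisible
  by the counit axioms, makes \<open>H_twist_pq\<close> applicable.
\<close>

lemma gam_del: "sP' (\<lambda>x1 x2 x3. S1 x1 \<star> gam \<star> \<Delta> x2 \<star> del \<star> S1 x3) = \<one>\<^bsub>HH\<^esub>"
proof -
  define M where "M = (\<lambda>a e. S1 a \<star> gam \<star> e)"
  have Mb: "bilin (scl H) (scl HH) (scl HH) M" unfolding M_def by (rule lins)+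
  define T where "T = (\<lambda>b c. sP' (\<lambda>t1 t2 t3. S1 t1 \<star> gam \<star> (\<Delta> t2 \<star> del \<star> S1 t3 \<star> (S c \<sharp> S b))))"
  have Tb: "bilin (scl H) (scl H) (scl HH) T" unfolding T_def by (rule lins)+
  \<comment> \<open>The summand as a function of the three legs of the \<Phi> that
    \<open>gam_Phi\<close> leaves behind; coassociativity will be applied to these legs.\<close>
  define Z where "Z = (\<lambda>s1 s2 s3 t y z w. S1 s1 \<star> (S z \<cdot> al \<cdot> w \<cdot> s2 \<cdot> be \<cdot> S s3 \<sharp> S y \<cdot> al \<cdot> t))"
  have Zl: "trilin (scl H) (scl H) (scl H) (scl HH) (Z s1 s2 s3 t)" for s1 s2 s3 t
    unfolding Z_def by (rule lins)+
  \<comment> \<open>The sum over \<open>r\<close> is the redundant factor: \<open>gam_S1'\<close>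
    contracts the coproduct of its first leg to \<epsilon>, and \<open>P'_counit1\<close> then
    removes it.\<close>
  have "sP' (\<lambda>r1 r2 r3. sP' (\<lambda>t1 t2 t3. sD r1 (\<lambda>p q.
      M (p \<cdot> t1) (\<Delta> (q \<cdot> t2) \<star> del \<star> S1 t3 \<star> (S r3 \<sharp> S r2))))) =
    sP' (\<lambda>r1 r2 r3. sP' (\<lambda>t1 t2 t3. sD r1 (\<lambda>p q.
      S1 t1 \<star> (S1 p \<star> gam \<star> \<Delta> q) \<star> (\<Delta> t2 \<star> del \<star> S1 t3 \<star> (S r3 \<sharp> S r2)))))"
    by (simp only: M_def S1_mult \<Delta>_multE assocE)
  also have "\<dots> = sP' (\<lambda>r1 r2 r3. scl HH (\<epsilon> r1) (T r2 r3))"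
    by (simp only: gam_S1' T_def scale_sw3[OF vHH])
  also have "\<dots> = T uH uH" by (rule P'_counit1[OF Tb])
  also have "\<dots> = sP' (\<lambda>x1 x2 x3. S1 x1 \<star> gam \<star> \<Delta> x2 \<star> del \<star> S1 x3)"
    by (simp only: T_def S_one one_HH[symmetric] tmul_one[OF kHH] tmul_pr[OF kHH] assocE)
  finally have "sP' (\<lambda>x1 x2 x3. S1 x1 \<star> gam \<star> \<Delta> x2 \<star> del \<star> S1 x3) =
    sP (\<lambda>X1 X2 X3. sP' (\<lambda>t1 t2 t3. sD t1 (\<lambda>p q. sP' (\<lambda>s1 s2 s3.
      M (X1 \<cdot> p \<cdot> s1) (X2 \<cdot> q \<cdot> s2 \<cdot> be \<cdot> S s3 \<sharp> X3 \<cdot> t2 \<cdot> be \<cdot> S t3)))))"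
    by (simp only: H_twist_pq[OF Mb])
  also have "\<dots> = sP (\<lambda>X1 X2 X3. sP' (\<lambda>t1 t2 t3. sP' (\<lambda>s1 s2 s3. sD t1 (\<lambda>p q.
      (S1 s1 \<star> S1 p) \<star> (S1 X1 \<star> gam \<star> (X2 \<sharp> X3)) \<star> (q \<cdot> s2 \<cdot> be \<cdot> S s3 \<sharp> t2 \<cdot> be \<cdot> S t3)))))"
    by (simp only: M_def S1_mult assocE tp_mult assoc sw_sw3_swap)
  also have "\<dots> = sP' (\<lambda>t1 t2 t3. sP (\<lambda>X1 X2 X3. sP' (\<lambda>s1 s2 s3. sD t1 (\<lambda>p q.
      (S1 s1 \<star> S1 p) \<star> (S1 X1 \<star> gam \<star> (X2 \<sharp> X3)) \<star> (q \<cdot> s2 \<cdot> be \<cdot> S s3 \<sharp> t2 \<cdot> be \<cdot> S t3)))))"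
    by (rule sw3_swap)
  also have "\<dots> = sP' (\<lambda>t1 t2 t3. sP' (\<lambda>s1 s2 s3. sP (\<lambda>X1 X2 X3. sD t1 (\<lambda>p q.
      (S1 s1 \<star> S1 p) \<star> (S1 X1 \<star> gam \<star> (X2 \<sharp> X3)) \<star> (q \<cdot> s2 \<cdot> be \<cdot> S s3 \<sharp> t2 \<cdot> be \<cdot> S t3)))))"
    by (rule arg_cong[of _ _ sP'], intro ext, rule sw3_swap)
  \<comment> \<open>The sum over the legs of \<Phi> is drawn together around \<gamma>, where
    \<open>gam_Phi\<close> eliminates \<gamma>.\<close>
  also have "\<dots> = sP' (\<lambda>t1 t2 t3. sP' (\<lambda>s1 s2 s3. sD t1 (\<lambda>p q.
      (S1 s1 \<star> S1 p) \<star> sP (\<lambda>X1 X2 X3. S1 X1 \<star> gam \<star> (X2 \<sharp> X3)) \<star> (q \<cdot> s2 \<cdot> be \<cdot> S s3 \<sharp> t2 \<cdot> be \<cdot> S t3))))"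
    by (simp only: tmul_sw(3,4)[OF kHH] sw_sw3_swap)
  also have "\<dots> = sP' (\<lambda>t1 t2 t3. sP' (\<lambda>s1 s2 s3. sD t1 (\<lambda>p q. sP (\<lambda>X1 X2 X3.
      S1 s1 \<star> (S1 p \<star> (S X2 \<cdot> al \<cdot> X3 \<cdot> q \<cdot> s2 \<cdot> be \<cdot> S s3 \<sharp> S X1 \<cdot> al \<cdot> t2 \<cdot> be \<cdot> S t3))))))"
    unfolding gam_Phi by (simp only: tmul_sw(3,4)[OF kHH] assocE tp_mult assoc)
  also have "\<dots> = sP' (\<lambda>t1 t2 t3. sP' (\<lambda>s1 s2 s3. sP (\<lambda>X1 X2 X3. sD t1 (\<lambda>p q. sD p (\<lambda>c d.
      Z s1 s2 s3 (t2 \<cdot> be \<cdot> S t3) (X1 \<cdot> c) (X2 \<cdot> d) (X3 \<cdot> q))))))"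
    by (simp only: Z_def S1_star[of _ "_ \<sharp> _"] tp_mult tmul_sw(1,2)[OF kHH] S_mult assoc sw_sw3_swap)
  \<comment> \<open>Coassociativity places \<open>c\<close> and \<open>d\<close> around the first
    \<alpha>, where they contract. The counit restores \<open>t1\<close>, which makes S(t^1)
    \<alpha> t^2 \<beta> S(t^3) visible in the second leg, and this sums to 1.\<close>
  also have "\<dots> = sP' (\<lambda>t1 t2 t3. sP' (\<lambda>s1 s2 s3. sD t1 (\<lambda>a0 a1. sD a1 (\<lambda>c d. sP (\<lambda>X1 X2 X3.
      Z s1 s2 s3 (t2 \<cdot> be \<cdot> S t3) (a0 \<cdot> X1) (c \<cdot> X2) (d \<cdot> X3))))))"
    by (simp only: H_coassoc(1)[OF Zl])
  also have "\<dots> = sP' (\<lambda>t1 t2 t3. sP' (\<lambda>s1 s2 s3. sD t1 (\<lambda>a0 a1. scl HH (\<epsilon> a1) (sP (\<lambda>X1 X2 X3.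
      Z s1 s2 s3 (t2 \<cdot> be \<cdot> S t3) (a0 \<cdot> X1) X2 X3)))))"
  proof -
    have a: "sD h (\<lambda>c d. e \<star> (x \<cdot> (S c \<cdot> al \<cdot> d) \<cdot> y \<sharp> z)) = scl HH (\<epsilon> h) (e \<star> (x \<cdot> al \<cdot> y \<sharp> z))" for h e x y z
      by (rule alpha[where f = "\<lambda>w. e \<star> (x \<cdot> w \<cdot> y \<sharp> z)"]) (rule lins)+
    have "sD h (\<lambda>c d. Z s1 s2 s3 t y (c \<cdot> z) (d \<cdot> w)) = scl HH (\<epsilon> h) (Z s1 s2 s3 t y z w)" for h s1 s2 s3 t y z w
      unfolding Z_def using a[of h "S1 s1" "S z" "w \<cdot> s2 \<cdot> be \<cdot> S s3" "S y \<cdot> al \<cdot> t"] by (simp only: S_mult assoc)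
    then show ?thesis by (simp only: sw_sw3_swap scale_sw3[OF vHH])
  qed
  also have "\<dots> = sP' (\<lambda>t1 t2 t3. sP' (\<lambda>s1 s2 s3. sP (\<lambda>X1 X2 X3.
      Z s1 s2 s3 (t2 \<cdot> be \<cdot> S t3) (t1 \<cdot> X1) X2 X3)))"
  proof -
    have "sD h (\<lambda>a0 a1. scl HH (\<epsilon> a1) (sP (\<lambda>X1 X2 X3. Z s1 s2 s3 t (a0 \<cdot> X1) X2 X3))) =
      sP (\<lambda>X1 X2 X3. Z s1 s2 s3 t (pr H h \<cdot> X1) X2 X3)" for h s1 s2 s3 t
      by (rule \<Delta>_counit(1)) (unfold Z_def, (rule lins)+)
    then show ?thesis by (simp only: one_simps)
  qed
  also have "\<dots> = sP' (\<lambda>s1 s2 s3. sP' (\<lambda>t1 t2 t3. sP (\<lambda>X1 X2 X3.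
      Z s1 s2 s3 (t2 \<cdot> be \<cdot> S t3) (t1 \<cdot> X1) X2 X3)))"
    by (rule sw3_swap)
  also have "\<dots> = sP' (\<lambda>s1 s2 s3. sP (\<lambda>X1 X2 X3. sP' (\<lambda>t1 t2 t3.
      S1 s1 \<star> (S X2 \<cdot> al \<cdot> X3 \<cdot> s2 \<cdot> be \<cdot> S s3 \<sharp> S X1 \<cdot> (S t1 \<cdot> al \<cdot> t2 \<cdot> be \<cdot> S t3)))))"
    by (simp only: Z_def S_mult assoc) (rule arg_cong[of _ _ sP'], intro ext, rule sw3_swap)
  also have "\<dots> = sP' (\<lambda>s1 s2 s3. sP (\<lambda>X1 X2 X3.
      S1 s1 \<star> (S X2 \<cdot> al \<cdot> X3 \<cdot> s2 \<cdot> be \<cdot> S s3 \<sharp> S X1 \<cdot> uH)))"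
  proof -
    have w: "sP' (\<lambda>t1 t2 t3. e \<star> (x \<sharp> y \<cdot> (S t1 \<cdot> al \<cdot> t2 \<cdot> be \<cdot> S t3))) = e \<star> (x \<sharp> y \<cdot> uH)" for e x y
      by (rule alpha_beta(2)[where s = "scl HH" and f = "\<lambda>w. e \<star> (x \<sharp> y \<cdot> w)"]) (rule lins)+
    show ?thesis by (simp only: w)
  qed
  \<comment> \<open>What is left is q multiplied by the coaction of p for the comodule algebra
    \<open>H\<close>, with the algebra leg mapped by \<open>S\<close> into the second tensor
    leg.\<close>
  also have "\<dots> = sP' (\<lambda>s1 s2 s3. sP (\<lambda>X1 X2 X3. sD s1 (\<lambda>p q.
      S (X2 \<cdot> q) \<cdot> al \<cdot> (X3 \<cdot> s2) \<cdot> be \<cdot> S s3 \<sharp> S (X1 \<cdot> p))))"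
    by (simp only: S1_star tp_mult S_mult assoc one_simps)
  also have "\<dots> = sP (\<lambda>X1 X2 X3. sP' (\<lambda>s1 s2 s3. sD s1 (\<lambda>p q.
      S (X2 \<cdot> q) \<cdot> al \<cdot> (X3 \<cdot> s2) \<cdot> be \<cdot> S s3 \<sharp> S (X1 \<cdot> p))))"
    by (rule sw3_swap)
  also have "\<dots> = uH \<sharp> S uH"
    by (rule qhcomod.q_p_one[OF qhcomod_self, where s = "scl HH" and G = "\<lambda>m h. h \<sharp> S m"]) (rule lins)+
  finally show ?thesis by (simp only: one_HH S_one)
qed

section \<open>The inverse antipode and the relations of the Drinfeld twist\<close>

abbreviation Si where "Si \<equiv> tap H (antipode_inv H)"

lemma antipode_inv_closed: "x \<in> carrier H \<Longrightarrow> antipode_inv H x \<in> carrier H"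
  and antipode_inv_right: "x \<in> carrier H \<Longrightarrow> antipode H (antipode_inv H x) = x"
  and antipode_inv_left: "x \<in> carrier H \<Longrightarrow> antipode_inv H (antipode H x) = x"
  using S_bij unfolding antipode_inv_def
  by (auto simp: bij_betw_def inv_into_into f_inv_into_f)

lemma Si_closed: "Si x \<in> carrier H"
  by (simp add: tap_def antipode_inv_closed pr_spec sH)

lemma S_Si: "S (Si x) = pr H x"
  by (simp add: tap_def antipode_inv_closed antipode_inv_right pr_spec sH)

lemma Si_S: "Si (S x) = pr H x"
  using S_closed[of x] by (simp add: tap_def antipode_inv_left pr_spec sH)

lemma S_inj: "x \<in> carrier H \<Longrightarrow> y \<in> carrier H \<Longrightarrow> S x = S y \<Longrightarrow> x = y"
  by (metis Si_S pr_spec(3)[OF sH])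

lemma Si_klin: "klin H H (antipode_inv H)"
proof -
  note k = kspaceD(3,4)[OF sH] antipode_inv_closed antipode_inv_right
  have i: "x = y" if "x \<in> carrier H" "y \<in> carrier H" "antipode H x = antipode H y" for x y
    using S_bij that by (auto simp: bij_betw_def inj_on_def)
  show ?thesis
    unfolding klin_def
  proof (intro conjI ballI allI Pi_I)
    fix x y c assume x: "x \<in> carrier H" and y: "y \<in> carrier H"
    show "antipode_inv H (x + y) = antipode_inv H x + antipode_inv H y"
      by (rule i) (use S_klin x y in \<open>simp_all add: klin_def k\<close>)
  next
    fix c x assume x: "x \<in> carrier H"
    show "antipode_inv H (scl H c x) = scl H c (antipode_inv H x)"
      by (rule i) (use S_klin x in \<open>simp_all add: klin_def k\<close>)
  qed (rule antipode_inv_closed)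
qed

lemma Si_lin [lins]: "lin s (scl H) g \<Longrightarrow> lin s (scl H) (\<lambda>x. Si (g x))"
  unfolding tap_def by (rule klin_tot[OF sH sH Si_klin])

lemma Si_mult: "Si (x \<cdot> y) = Si y \<cdot> Si x"
  by (rule S_inj[OF Si_closed tmul_closed[OF kH]]) (simp only: S_mult S_Si one_simps)

lemma Si_pr: "Si (pr H x) = Si x" "pr H (Si x) = Si x"
  by (simp_all add: tap_pr[OF sH] pr_spec sH Si_closed)

text \<open>This is (S \<otimes> S)(\<Delta>^cop(S^{-1}(h))). The two reversals cancel, so it is
  multiplicative; by \<open>twist_\<Delta>\<close> it is intertwined with \<Delta> by f. It arises
  when S^{-1} of an element acts on a product.\<close>

definition S2 where "S2 h = S1 (Si h)"

lemma S2_lin [lins]: "lin s (scl H) g \<Longrightarrow> lin s (scl HH) (\<lambda>x. S2 (g x))"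
  unfolding S2_def by (rule lins | assumption)+

lemma S2_mult: "S2 (x \<cdot> y) = S2 x \<star> S2 y"
  by (simp only: S2_def Si_mult S1_mult)

lemma S2_S: "S2 (S x) = S1 x"
  by (simp only: S2_def Si_S S1_pr)

text \<open>The twist f in terms of the total operations; \<open>drinfeld_twist_eq\<close>
  identifies it with the element that occurs in \<Omega>.\<close>

definition twist where "twist = sP' (\<lambda>x1 x2 x3. S1 x1 \<star> gam \<star> \<Delta> (x2 \<cdot> be \<cdot> S x3))"

lemma pr_gam: "pr HH gam = gam" and pr_del: "pr HH del = del" and pr_S1: "pr HH (S1 h) = S1 h"
  and pr_twist: "pr HH twist = twist"
proof -
  have g: "gaux p q r \<in> carrier HH" and d: "daux p q r \<in> carrier HH" for p q r
    unfolding gaux_def daux_def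
    by (intro sw3_closed[OF sHH] sw_closed[OF sHH] P_closed \<Delta>_closed tpt_closed sH)+
  show "pr HH gam = gam"
    unfolding gam_def by (intro pr_spec(3)[OF sHH] sw3_closed[OF sHH] P_closed g)
  show "pr HH del = del"
    unfolding del_def by (intro pr_spec(3)[OF sHH] sw3_closed[OF sHH] P_closed d)
  show "pr HH (S1 h) = S1 h" by (rule pr_spec(3)[OF sHH S1_closed])
  show "pr HH twist = twist"
    unfolding twist_def by (intro pr_spec(3)[OF sHH] sw3_closed[OF sHH] P_closed tmul_closed[OF kHH])
qed

lemmas oneE_simps = tmul_one[OF kHH] tmul_pr[OF kHH] pr_gam pr_del pr_S1 pr_twist S1_one \<Delta>_oneE S1_pr

text \<open>In f the inverse of \<Phi> separates \<gamma> from \<beta>. Feed in three components of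
  \<open>h\<close>: in one bracketing \<beta> contracts two of them, and \<open>S1 h\<close> comes
  out on the left; in the other \<gamma> contracts two of them, and \<Delta>(S(h)) comes out on the
  right. Coassociativity equates the bracketings.\<close>

lemma twist_S: "twist \<star> \<Delta> (S h) = S1 h \<star> twist"
proof -
  define F where "F = (\<lambda>x y z. S1 x \<star> gam \<star> \<Delta> (y \<cdot> be \<cdot> S z))"
  have Ft: "trilin (scl H) (scl H) (scl H) (scl HH) F" unfolding F_def by (rule lins)+
  have "sP' (\<lambda>x y z. sD h (\<lambda>a0 a1. sD a1 (\<lambda>c d. F (x \<cdot> a0) (y \<cdot> c) (z \<cdot> d)))) =
    sP' (\<lambda>x y z. sD h (\<lambda>a0 a1. scl HH (\<epsilon> a1) (F (x \<cdot> a0) y z)))"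
  proof -
    have "sD h (\<lambda>c d. e \<star> \<Delta> (x \<cdot> (c \<cdot> be \<cdot> S d) \<cdot> y)) = scl HH (\<epsilon> h) (e \<star> \<Delta> (x \<cdot> be \<cdot> y))" for h e x y
      by (rule beta[where f = "\<lambda>w. e \<star> \<Delta> (x \<cdot> w \<cdot> y)"]) (rule lins)+
    then show ?thesis by (simp only: F_def S_mult assoc)
  qed
  also have "\<dots> = sP' (\<lambda>x y z. F (x \<cdot> pr H h) y z)"
    by (subst \<Delta>_counit(1)[where s = "scl HH"]) (unfold F_def, (rule lins)+, rule refl)
  also have "\<dots> = S1 h \<star> twist"
    by (simp only: F_def twist_def one_simps S1_mult tmul_sw(3,4)[OF kHH] assocE)
  finally have "S1 h \<star> twist = sP' (\<lambda>x y z. sD h (\<lambda>a0 a1. sD a1 (\<lambda>c d. F (x \<cdot> a0) (y \<cdot> c) (z \<cdot> d))))" ..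
  also have "\<dots> = sP' (\<lambda>x y z. sD h (\<lambda>a0 a1. sD a0 (\<lambda>a b. F (a \<cdot> x) (b \<cdot> y) (a1 \<cdot> z))))"
    by (simp only: H_coassoc(2)[OF Ft] sw_sw3_swap)
  also have "\<dots> = sP' (\<lambda>x y z. sD h (\<lambda>a0 a1. sD a0 (\<lambda>a b.
      S1 x \<star> (S1 a \<star> gam \<star> \<Delta> b) \<star> \<Delta> (y \<cdot> be \<cdot> S (a1 \<cdot> z)))))"
    by (simp only: F_def S1_mult \<Delta>_multE assocE)
  also have "\<dots> = sP' (\<lambda>x y z. S1 x \<star> gam \<star> \<Delta> (y \<cdot> be \<cdot> S (pr H h \<cdot> z)))"
    unfolding gam_S1' by (subst \<Delta>_counit(2)[where s = "scl HH"]) ((rule lins)+, rule refl)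
  also have "\<dots> = twist \<star> \<Delta> (S h)"
    by (simp only: twist_def tmul_sw(3,4)[OF kHH] one_simps S_mult \<Delta>_multE assocE)
  finally show ?thesis ..
qed

lemma twist_\<Delta>: "twist \<star> \<Delta> h = S2 h \<star> twist"
  using twist_S[of "Si h"] by (simp only: S_Si S2_def \<Delta>_pr)

text \<open>The pentagon replaces the reassociators between \<gamma>, \<beta> and \<alpha> by an
  arrangement in which \<beta> and \<alpha> contract the coproducts. Then X^1 \<beta> S(X^2)
  \<alpha> X^3 = 1 leaves \<gamma> alone.\<close>

lemma twist_alpha: "twist \<star> \<Delta> al = gam"
proof -
  let ?F = "\<lambda>a b c d. S1 a \<star> gam \<star> \<Delta> (b \<cdot> be \<cdot> S c \<cdot> al \<cdot> d)"
  \<comment> \<open>A redundant factor \<Phi>, whose first leg \<gamma> turns into \<epsilon>, gives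
    f \<Delta>(\<alpha>) the shape of one side of the second pentagon.\<close>
  have "sP (\<lambda>x y z. sD x (\<lambda>p q. sP' (\<lambda>a b c. ?F (p \<cdot> a) (q \<cdot> b) (y \<cdot> c) (pr H z)))) =
    sP (\<lambda>x y z. sP' (\<lambda>a b c. sD x (\<lambda>p q. S1 a \<star> (S1 p \<star> gam \<star> \<Delta> q) \<star> \<Delta> (b \<cdot> be \<cdot> S (y \<cdot> c) \<cdot> al \<cdot> z))))"
    by (simp only: sw_sw3_swap S1_mult \<Delta>_multE assocE assoc one_simps)
  also have "\<dots> = sP (\<lambda>x y z. scl HH (\<epsilon> x) (sP' (\<lambda>a b c. S1 a \<star> gam \<star> \<Delta> (b \<cdot> be \<cdot> S (y \<cdot> c) \<cdot> al \<cdot> z))))"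
    by (simp only: gam_S1' scale_sw3[OF vHH])
  also have "\<dots> = sP' (\<lambda>a b c. S1 a \<star> gam \<star> \<Delta> (b \<cdot> be \<cdot> S (uH \<cdot> c) \<cdot> al \<cdot> uH))"
    by (subst P_counit1[where s = "scl HH"]) ((rule lins)+, rule refl)
  also have "\<dots> = twist \<star> \<Delta> al"
    by (simp only: twist_def tmul_sw(3)[OF kHH] one_simps \<Delta>_multE assocE)
  finally have "twist \<star> \<Delta> al =
    sP (\<lambda>x y z. sD x (\<lambda>p q. sP' (\<lambda>a b c. ?F (p \<cdot> a) (q \<cdot> b) (y \<cdot> c) (pr H z))))" ..
  also have "\<dots> = sP' (\<lambda>x y z. sD z (\<lambda>z1 z2. sP (\<lambda>a b c. sP (\<lambda>k l m. sD l (\<lambda>l1 l2.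
      ?F (x \<cdot> k) (y \<cdot> a \<cdot> l1) (z1 \<cdot> b \<cdot> l2) (z2 \<cdot> c \<cdot> m))))))"
    by (rule H_pentagon(2)[where s = "scl HH" and F = "?F"]) (rule lins)+
  also have "\<dots> = sP' (\<lambda>x y z. sD z (\<lambda>z1 z2. sP (\<lambda>a b c. sP (\<lambda>k l m. scl HH (\<epsilon> l)
      (S1 (x \<cdot> k) \<star> gam \<star> \<Delta> (y \<cdot> a \<cdot> be \<cdot> S (z1 \<cdot> b) \<cdot> al \<cdot> (z2 \<cdot> c \<cdot> m)))))))"
  proof -
    have "sD h (\<lambda>c d. e \<star> \<Delta> (x \<cdot> (c \<cdot> be \<cdot> S d) \<cdot> y)) = scl HH (\<epsilon> h) (e \<star> \<Delta> (x \<cdot> be \<cdot> y))" for h e x y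
      by (rule beta[where f = "\<lambda>w. e \<star> \<Delta> (x \<cdot> w \<cdot> y)"]) (rule lins)+
    from this[of _ "S1 x \<star> gam" "y \<cdot> a" "S b \<cdot> S z \<cdot> al \<cdot> w" for x y a b z w]
    show ?thesis by (simp only: S_mult assoc)
  qed
  also have "\<dots> = sP' (\<lambda>x y z. sD z (\<lambda>z1 z2. sP (\<lambda>a b c.
      S1 (x \<cdot> uH) \<star> gam \<star> \<Delta> (y \<cdot> a \<cdot> be \<cdot> S (z1 \<cdot> b) \<cdot> al \<cdot> (z2 \<cdot> c \<cdot> uH)))))"
    by (subst H_counit(1)[where s = "scl HH"]) ((rule lins)+, rule refl)
  also have "\<dots> = sP' (\<lambda>x y z. sP (\<lambda>a b c. sD z (\<lambda>z1 z2.
      S1 x \<star> gam \<star> \<Delta> (y \<cdot> a \<cdot> be \<cdot> S b \<cdot> (S z1 \<cdot> al \<cdot> z2) \<cdot> c))))"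
    by (simp only: sw_sw3_swap one_simps oneE_simps S_mult assoc)
  also have "\<dots> = sP' (\<lambda>x y z. scl HH (\<epsilon> z) (sP (\<lambda>a b c. S1 x \<star> gam \<star> \<Delta> (y \<cdot> a \<cdot> be \<cdot> S b \<cdot> al \<cdot> c))))"
  proof -
    have "sD h (\<lambda>c d. e \<star> \<Delta> (x \<cdot> (S c \<cdot> al \<cdot> d) \<cdot> y)) = scl HH (\<epsilon> h) (e \<star> \<Delta> (x \<cdot> al \<cdot> y))" for h e x y
      by (rule alpha[where f = "\<lambda>w. e \<star> \<Delta> (x \<cdot> w \<cdot> y)"]) (rule lins)+
    then show ?thesis by (simp only: scale_sw3[OF vHH])
  qed
  also have "\<dots> = sP (\<lambda>a b c. S1 uH \<star> gam \<star> \<Delta> (uH \<cdot> a \<cdot> be \<cdot> S b \<cdot> al \<cdot> c))"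
    by (subst H_counit(4)[where s = "scl HH"]) ((rule lins)+, rule refl)
  also have "\<dots> = sP (\<lambda>a b c. gam \<star> \<Delta> (a \<cdot> be \<cdot> S b \<cdot> al \<cdot> c))"
    by (simp only: one_simps oneE_simps assoc)
  also have "\<dots> = gam \<star> \<Delta> uH"
    by (rule alpha_beta(1)[where s = "scl HH" and f = "\<lambda>w. gam \<star> \<Delta> w"]) (rule lins)+
  finally show ?thesis by (simp only: oneE_simps)
qed

text \<open>Once f is written in terms of \<gamma>, the pentagon separates \<beta> from the rest:
  the rest is the sum in \<open>gam_del\<close>, hence 1, and only \<open>S2 be\<close>
  remains.\<close>

lemma twist_beta: "twist \<star> del = S2 be"
proof -
  let ?F = "\<lambda>a b c d. S2 (a \<cdot> be \<cdot> S b) \<star> gam \<star> \<Delta> c \<star> del \<star> S1 d"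
  \<comment> \<open>Write 1 as X^1 \<beta> S(X^2) \<alpha> X^3 behind f and move f up to \<alpha>.
    There \<open>twist_alpha\<close> turns f \<Delta>(\<alpha>) into \<gamma>, which gives the
    formula \<open>tw\<close>.\<close>
  have "twist = twist \<star> \<Delta> uH"
    by (simp only: oneE_simps)
  also have "\<dots> = sP (\<lambda>a b c. twist \<star> \<Delta> (a \<cdot> be \<cdot> S b \<cdot> al \<cdot> c))"
    by (rule alpha_beta(1)[where s = "scl HH" and f = "\<lambda>w. twist \<star> \<Delta> w", symmetric]) (rule lins)+
  also have "\<dots> = sP (\<lambda>a b c. (twist \<star> \<Delta> (a \<cdot> be \<cdot> S b)) \<star> \<Delta> al \<star> \<Delta> c)"
    by (simp only: \<Delta>_multE assocE)
  also have "\<dots> = sP (\<lambda>a b c. S2 (a \<cdot> be \<cdot> S b) \<star> (twist \<star> \<Delta> al) \<star> \<Delta> c)"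
    by (simp only: twist_\<Delta> assocE)
  finally have tw: "twist = sP (\<lambda>a b c. S2 (a \<cdot> be \<cdot> S b) \<star> gam \<star> \<Delta> c)"
    by (simp only: twist_alpha assocE)
  \<comment> \<open>A redundant inverse of \<Phi>, whose first leg \<beta> contracts to \<epsilon>,
    produces one side of the first pentagon.\<close>
  have "sP (\<lambda>a b c. sP' (\<lambda>x y z. sD x (\<lambda>p q. ?F (a \<cdot> p) (b \<cdot> q) (c \<cdot> y) (pr H z)))) =
    sP (\<lambda>a b c. sP' (\<lambda>x y z. scl HH (\<epsilon> x) (S2 (a \<cdot> be \<cdot> S b) \<star> gam \<star> \<Delta> (c \<cdot> y) \<star> del \<star> S1 z)))"
  proof -
    have "sD h (\<lambda>c d. S2 (x \<cdot> (c \<cdot> be \<cdot> S d) \<cdot> y) \<star> e) = scl HH (\<epsilon> h) (S2 (x \<cdot> be \<cdot> y) \<star> e)" for h e x y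
      by (rule beta[where f = "\<lambda>w. S2 (x \<cdot> w \<cdot> y) \<star> e"]) (rule lins)+
    then show ?thesis by (simp only: S_mult assoc assocE oneE_simps)
  qed
  also have "\<dots> = sP (\<lambda>a b c. S2 (a \<cdot> be \<cdot> S b) \<star> gam \<star> \<Delta> (c \<cdot> uH) \<star> del \<star> S1 uH)"
    by (subst P'_counit1[where s = "scl HH"]) ((rule lins)+, rule refl)
  also have "\<dots> = sP (\<lambda>a b c. S2 (a \<cdot> be \<cdot> S b) \<star> gam \<star> \<Delta> c \<star> del)"
    by (simp only: one_simps oneE_simps assocE)
  also have "\<dots> = twist \<star> del"
    by (subst tw) (simp only: tmul_sw(3)[OF kHH] assocE)
  finally have "twist \<star> del = sP (\<lambda>a b c. sP' (\<lambda>x y z. sD x (\<lambda>p q. ?F (a \<cdot> p) (b \<cdot> q) (c \<cdot> y) (pr H z))))" ..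
  also have "\<dots> = sP' (\<lambda>x y z. sD y (\<lambda>p q. sP' (\<lambda>a b c. sP (\<lambda>k l m. sD m (\<lambda>m1 m2.
      ?F (x \<cdot> k) (p \<cdot> a \<cdot> l) (q \<cdot> b \<cdot> m1) (z \<cdot> c \<cdot> m2))))))"
    by (rule H_pentagon(1)[where s = "scl HH" and F = "?F"]) (rule lins)+
  \<comment> \<open>On the other side of the pentagon \<delta> absorbs the coproduct of
    \<open>m\<close> and afterwards \<gamma> that of \<open>y\<close>; each contraction lets the
    counit axiom delete one reassociator.\<close>
  also have "\<dots> = sP' (\<lambda>x y z. sD y (\<lambda>p q. sP' (\<lambda>a b c. sP (\<lambda>k l m. sD m (\<lambda>m1 m2.
      (S2 (x \<cdot> k \<cdot> be \<cdot> S (p \<cdot> a \<cdot> l)) \<star> gam \<star> \<Delta> (q \<cdot> b)) \<star> (\<Delta> m1 \<star> del \<star> S1 m2) \<star> S1 (z \<cdot> c))))))"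
    by (simp only: S1_mult \<Delta>_multE assocE)
  also have "\<dots> = sP' (\<lambda>x y z. sD y (\<lambda>p q. sP' (\<lambda>a b c.
      (S2 (x \<cdot> uH \<cdot> be \<cdot> S (p \<cdot> a \<cdot> uH)) \<star> gam \<star> \<Delta> (q \<cdot> b)) \<star> del \<star> S1 (z \<cdot> c))))"
    unfolding del_S1' by (subst H_counit(2)[where s = "scl HH"]) ((rule lins)+, rule refl)
  also have "\<dots> = sP' (\<lambda>x y z. sP' (\<lambda>a b c. sD y (\<lambda>p q.
      (S2 (x \<cdot> be) \<star> S1 a) \<star> (S1 p \<star> gam \<star> \<Delta> q) \<star> (\<Delta> b \<star> del \<star> S1 (z \<cdot> c)))))"
    by (simp only: sw_sw3_swap one_simps S_mult S2_mult S2_S \<Delta>_multE assocE)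
  also have "\<dots> = sP' (\<lambda>x y z. scl HH (\<epsilon> y) (sP' (\<lambda>a b c.
      (S2 (x \<cdot> be) \<star> S1 a) \<star> gam \<star> (\<Delta> b \<star> del \<star> S1 (z \<cdot> c)))))"
    by (simp only: gam_S1' scale_sw3[OF vHH])
  also have "\<dots> = sP' (\<lambda>a b c. (S2 (uH \<cdot> be) \<star> S1 a) \<star> gam \<star> (\<Delta> b \<star> del \<star> S1 (uH \<cdot> c)))"
    by (subst H_counit(3)[where s = "scl HH"]) ((rule lins)+, rule refl)
  also have "\<dots> = S2 be \<star> sP' (\<lambda>a b c. S1 a \<star> gam \<star> \<Delta> b \<star> del \<star> S1 c)"
    by (simp only: tmul_sw(4)[OF kHH] one_simps S1_pr assocE)
  finally show ?thesis by (simp only: gam_del S2_def oneE_simps)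
qed

end

section \<open>Multiplicativity reduced to A and H\<close>

context qhcomod
begin

text \<open>This is \<open>twist_pq\<close> multiplied by f from the left. On its way f turns
  \<Delta> into \<open>S2\<close> and \<delta> into \<open>S2 be\<close>, so that the left side
  assembles to \<open>S2\<close> of the second leg of p.\<close>

lemma twist_main:
  assumes F: "bilin (scl A) (scl HH) s F"
  shows "sX' (\<lambda>r1 r2 r3. sX' (\<lambda>t1 t2 t3. sR r1 (\<lambda>p q.
      F (p \<bullet> t1) (S2 (q \<cdot> t2 \<cdot> be \<cdot> S t3) \<star> (S r3 \<sharp> S r2))))) =
    sX (\<lambda>X1 X2 X3. sX' (\<lambda>t1 t2 t3. sR t1 (\<lambda>p q. sX' (\<lambda>s1 s2 s3.
      F (X1 \<bullet> p \<bullet> s1) (twist \<star> (X2 \<cdot> q \<cdot> s2 \<cdot> be \<cdot> S s3 \<sharp> X3 \<cdot> t2 \<cdot> be \<cdot> S t3))))))"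
proof -
  have e: "S2 (q \<cdot> t2 \<cdot> be \<cdot> S t3) \<star> e = twist \<star> (\<Delta> (q \<cdot> t2) \<star> del \<star> S1 t3 \<star> e)" for q t2 t3 e
  proof -
    have "S2 (q \<cdot> t2 \<cdot> be \<cdot> S t3) = (S2 (q \<cdot> t2) \<star> twist) \<star> del \<star> S1 t3"
      by (simp only: S2_mult S2_S assocE twist_beta[symmetric])
    also have "\<dots> = twist \<star> (\<Delta> (q \<cdot> t2) \<star> del \<star> S1 t3)"
      by (simp only: twist_\<Delta>[symmetric] assocE)
    finally show ?thesis by (simp only: assocE)
  qed
  show ?thesis
    unfolding e
    by (rule twist_pq[where s = s and F = "\<lambda>m e. F m (twist \<star> e)"]) (rule lin_bilin[OF F] lins)+
qed

text \<open>Coassociativity brings two components of \<open>a\<close> around \<beta>, where they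
  contract to \<epsilon>. In terms of p the result reads \<rho>(a_0) p (1 \<otimes> S(a_1)) = p (a
  \<otimes> 1).\<close>

lemma p_rel:
  assumes G: "bilin (scl A) (scl H) s G"
  shows "sR a (\<lambda>a0 a1. sR a0 (\<lambda>b0 b1. sX' (\<lambda>t1 t2 t3. G (b0 \<bullet> t1) (b1 \<cdot> t2 \<cdot> be \<cdot> S t3 \<cdot> S a1)))) =
    sX' (\<lambda>t1 t2 t3. G (t1 \<bullet> a) (t2 \<cdot> be \<cdot> S t3))"
proof -
  have vs: "vector_space s" by (rule bilinD(3)[OF G])
  note l = lin_bilin[OF G] vs lins
  have "sR a (\<lambda>a0 a1. sR a0 (\<lambda>b0 b1. sX' (\<lambda>t1 t2 t3. G (b0 \<bullet> t1) (b1 \<cdot> t2 \<cdot> be \<cdot> S (a1 \<cdot> t3))))) =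
    sX' (\<lambda>x y z. sR a (\<lambda>a0 a1. sD a1 (\<lambda>c d. G (x \<bullet> a0) (y \<cdot> c \<cdot> be \<cdot> S (z \<cdot> d)))))"
    by (rule coassoc(2)[where s = s and F = "\<lambda>x y z. G x (y \<cdot> be \<cdot> S z)", symmetric]) (rule l)+
  also have "\<dots> = sX' (\<lambda>x y z. sR a (\<lambda>a0 a1. s (\<epsilon> a1) (G (x \<bullet> a0) (y \<cdot> be \<cdot> S z))))"
  proof -
    have "sD m (\<lambda>m1 m2. G z (x \<cdot> (m1 \<cdot> be \<cdot> S m2) \<cdot> y)) = s (\<epsilon> m) (G z (x \<cdot> be \<cdot> y))" for m x y z
      by (rule beta[where f = "\<lambda>w. G z (x \<cdot> w \<cdot> y)"]) (rule l)+
    then show ?thesis by (simp only: S_mult assoc)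
  qed
  also have "\<dots> = sX' (\<lambda>x y z. G (x \<bullet> pr A a) (y \<cdot> be \<cdot> S z))"
    by (subst R_counit[where s = s]) ((rule l)+, rule refl)
  finally show ?thesis by (simp only: S_mult assoc oneA_simps)
qed

text \<open>As in \<open>p_rel\<close>, two components of \<open>a\<close> contract, here around
  \<alpha>. It allows an element of \<open>A\<close> to pass from the right of q to its
  left.\<close>

lemma q_rel:
  assumes G: "bilin (scl A) (scl H) s G"
  shows "sX (\<lambda>X1 X2 X3. sR a (\<lambda>a0 a1. sR a0 (\<lambda>b0 b1. G (X1 \<bullet> b0) (S (X2 \<cdot> b1) \<cdot> al \<cdot> X3 \<cdot> a1)))) =
    sX (\<lambda>X1 X2 X3. G (a \<bullet> X1) (S X2 \<cdot> al \<cdot> X3))"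
proof -
  have vs: "vector_space s" by (rule bilinD(3)[OF G])
  note l = lin_bilin[OF G] vs lins
  have "sX (\<lambda>X1 X2 X3. sR a (\<lambda>a0 a1. sR a0 (\<lambda>b0 b1. G (X1 \<bullet> b0) (S (X2 \<cdot> b1) \<cdot> al \<cdot> (X3 \<cdot> a1))))) =
    sR a (\<lambda>a0 a1. sD a1 (\<lambda>c d. sX (\<lambda>X1 X2 X3. G (a0 \<bullet> X1) (S (c \<cdot> X2) \<cdot> al \<cdot> (d \<cdot> X3)))))"
    by (rule coassoc(1)[where s = s and F = "\<lambda>x y z. G x (S y \<cdot> al \<cdot> z)"]) (rule l)+
  also have "\<dots> = sR a (\<lambda>a0 a1. s (\<epsilon> a1) (sX (\<lambda>X1 X2 X3. G (a0 \<bullet> X1) (S X2 \<cdot> al \<cdot> X3))))"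
  proof -
    have "sD m (\<lambda>c d. G z (x \<cdot> (S c \<cdot> al \<cdot> d) \<cdot> y)) = s (\<epsilon> m) (G z (x \<cdot> al \<cdot> y))" for m x y z
      by (rule alpha[where f = "\<lambda>w. G z (x \<cdot> w \<cdot> y)"]) (rule l)+
    then show ?thesis by (simp only: S_mult assoc sw_sw3_swap scale_sw3[OF vs])
  qed
  also have "\<dots> = sX (\<lambda>X1 X2 X3. G (pr A a \<bullet> X1) (S X2 \<cdot> al \<cdot> X3))"
    by (rule R_counit[where s = s]) (rule l)+
  finally show ?thesis by (simp only: assoc oneA_simps)
qed

text \<open>The composite \<open>Ps (Th t)\<close> with \<open>P\<close> and \<open>B\<close>
  stripped off: \<open>q_rel\<close> moves \<open>a\<close> to the front of q, and
  \<open>q_p_one\<close> removes the remaining product of q and p.\<close>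

lemma q_p_coact:
  assumes G: "bilin (scl A) (scl H) s G"
  shows "sR a (\<lambda>a0 a1. sX' (\<lambda>t1 t2 t3. sX (\<lambda>X1 X2 X3. sR (a0 \<bullet> t1) (\<lambda>c0 c1.
      G (X1 \<bullet> c0) (S (X2 \<cdot> c1) \<cdot> al \<cdot> X3 \<cdot> a1 \<cdot> t2 \<cdot> be \<cdot> S t3))))) = G (pr A a) uH"
proof -
  have vs: "vector_space s" by (rule bilinD(3)[OF G])
  note l = lin_bilin[OF G] vs lins
  have "sR a (\<lambda>a0 a1. sX' (\<lambda>t1 t2 t3. sX (\<lambda>X1 X2 X3. sR (a0 \<bullet> t1) (\<lambda>c0 c1.
      G (X1 \<bullet> c0) (S (X2 \<cdot> c1) \<cdot> al \<cdot> X3 \<cdot> a1 \<cdot> t2 \<cdot> be \<cdot> S t3))))) =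
    sR a (\<lambda>a0 a1. sX' (\<lambda>t1 t2 t3. sX (\<lambda>X1 X2 X3. sR a0 (\<lambda>b0 b1. sR t1 (\<lambda>p q.
      G (X1 \<bullet> (b0 \<bullet> p)) (S (X2 \<cdot> (b1 \<cdot> q)) \<cdot> al \<cdot> X3 \<cdot> a1 \<cdot> t2 \<cdot> be \<cdot> S t3))))))"
    by (subst R_mult[where s = s]) ((rule l)+, rule refl)
  also have "\<dots> = sX' (\<lambda>t1 t2 t3. sX (\<lambda>X1 X2 X3. sR t1 (\<lambda>p q. sR a (\<lambda>a0 a1. sR a0 (\<lambda>b0 b1.
      G (X1 \<bullet> b0 \<bullet> p) (S q \<cdot> (S (X2 \<cdot> b1) \<cdot> al \<cdot> X3 \<cdot> a1) \<cdot> t2 \<cdot> be \<cdot> S t3))))))"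
  proof -
    have sw: "sR a (\<lambda>a0 a1. sR a0 (\<lambda>b0 b1. sR t (\<lambda>p q. f a0 a1 b0 b1 p q))) =
      sR t (\<lambda>p q. sR a (\<lambda>a0 a1. sR a0 (\<lambda>b0 b1. f a0 a1 b0 b1 p q)))" for t f
      by (rule trans[OF _ sw_swap]) (rule arg_cong[of _ _ "sR a"], intro ext, rule sw_swap)
    show ?thesis
      by (simp only: sw_sw3_swap S_mult assoc tmul_assoc[OF kA])
        (intro arg_cong[of _ _ sX'] arg_cong[of _ _ sX] ext, rule sw)
  qed
  also have "\<dots> = sX' (\<lambda>t1 t2 t3. sR t1 (\<lambda>p q. sX (\<lambda>X1 X2 X3. sR a (\<lambda>a0 a1. sR a0 (\<lambda>b0 b1.
      G (X1 \<bullet> b0 \<bullet> p) (S q \<cdot> (S (X2 \<cdot> b1) \<cdot> al \<cdot> X3 \<cdot> a1) \<cdot> t2 \<cdot> be \<cdot> S t3))))))"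
    by (rule arg_cong[of _ _ sX'], intro ext, rule sw_sw3_swap[symmetric])
  also have "\<dots> = sX' (\<lambda>t1 t2 t3. sR t1 (\<lambda>p q. sX (\<lambda>X1 X2 X3.
      G (a \<bullet> X1 \<bullet> p) (S q \<cdot> (S X2 \<cdot> al \<cdot> X3) \<cdot> t2 \<cdot> be \<cdot> S t3))))"
  proof -
    have "sX (\<lambda>X1 X2 X3. sR a (\<lambda>a0 a1. sR a0 (\<lambda>b0 b1.
      G (X1 \<bullet> b0 \<bullet> p) (S q \<cdot> (S (X2 \<cdot> b1) \<cdot> al \<cdot> X3 \<cdot> a1) \<cdot> t2 \<cdot> be \<cdot> S t3)))) =
      sX (\<lambda>X1 X2 X3. G (a \<bullet> X1 \<bullet> p) (S q \<cdot> (S X2 \<cdot> al \<cdot> X3) \<cdot> t2 \<cdot> be \<cdot> S t3))" for p q t2 t3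
      by (rule q_rel[where s = s and G = "\<lambda>m h. G (m \<bullet> p) (S q \<cdot> h \<cdot> t2 \<cdot> be \<cdot> S t3)"]) (rule l)+
    then show ?thesis by (simp only:)
  qed
  also have "\<dots> = sX (\<lambda>X1 X2 X3. sX' (\<lambda>t1 t2 t3. sR t1 (\<lambda>p q.
      G (a \<bullet> (X1 \<bullet> p)) (S (X2 \<cdot> q) \<cdot> al \<cdot> (X3 \<cdot> t2) \<cdot> be \<cdot> S t3))))"
    by (simp only: sw_sw3_swap S_mult assoc tmul_assoc[OF kA]) (rule sw3_swap)
  also have "\<dots> = G (a \<bullet> \<one>\<^bsub>A\<^esub>) uH"
    by (rule q_p_one[where s = s and G = "\<lambda>m h. G (a \<bullet> m) h"]) (rule l)+
  finally show ?thesis by (simp only: oneA_simps)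
qed

text \<open>The composite \<open>Th (Ps t)\<close> with \<open>P\<close> and \<open>B\<close>
  stripped off, by \<open>p_rel\<close> and \<open>p_q_one\<close>.\<close>

lemma p_q_coact:
  assumes G: "bilin (scl A) (scl H) s G"
  shows "sX (\<lambda>X1 X2 X3. sR a (\<lambda>a0 a1. sR (X1 \<bullet> a0) (\<lambda>c0 c1. sX' (\<lambda>t1 t2 t3.
      G (c0 \<bullet> t1) (c1 \<cdot> t2 \<cdot> be \<cdot> S t3 \<cdot> S (X2 \<cdot> a1) \<cdot> al \<cdot> X3))))) = G (pr A a) uH"
proof -
  have vs: "vector_space s" by (rule bilinD(3)[OF G])
  note l = lin_bilin[OF G] vs lins
  have "sX (\<lambda>X1 X2 X3. sR a (\<lambda>a0 a1. sR (X1 \<bullet> a0) (\<lambda>c0 c1. sX' (\<lambda>t1 t2 t3.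
      G (c0 \<bullet> t1) (c1 \<cdot> t2 \<cdot> be \<cdot> S t3 \<cdot> S (X2 \<cdot> a1) \<cdot> al \<cdot> X3))))) =
    sX (\<lambda>X1 X2 X3. sR a (\<lambda>a0 a1. sR X1 (\<lambda>p q. sR a0 (\<lambda>b0 b1. sX' (\<lambda>t1 t2 t3.
      G (p \<bullet> b0 \<bullet> t1) (q \<cdot> b1 \<cdot> t2 \<cdot> be \<cdot> S t3 \<cdot> S (X2 \<cdot> a1) \<cdot> al \<cdot> X3))))))"
    by (subst R_mult[where s = s]) ((rule l)+, rule refl)
  also have "\<dots> = sX (\<lambda>X1 X2 X3. sR X1 (\<lambda>p q. sR a (\<lambda>a0 a1. sR a0 (\<lambda>b0 b1. sX' (\<lambda>t1 t2 t3.
      G (p \<bullet> (b0 \<bullet> t1)) (q \<cdot> (b1 \<cdot> t2 \<cdot> be \<cdot> S t3 \<cdot> S a1) \<cdot> S X2 \<cdot> al \<cdot> X3))))))"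
    by (simp only: S_mult assoc tmul_assoc[OF kA]) (rule arg_cong[of _ _ sX], intro ext, rule sw_swap)
  also have "\<dots> = sX (\<lambda>X1 X2 X3. sR X1 (\<lambda>p q. sX' (\<lambda>t1 t2 t3.
      G (p \<bullet> (t1 \<bullet> a)) (q \<cdot> (t2 \<cdot> be \<cdot> S t3) \<cdot> S X2 \<cdot> al \<cdot> X3))))"
  proof -
    have "sR a (\<lambda>a0 a1. sR a0 (\<lambda>b0 b1. sX' (\<lambda>t1 t2 t3.
      G (p \<bullet> (b0 \<bullet> t1)) (q \<cdot> (b1 \<cdot> t2 \<cdot> be \<cdot> S t3 \<cdot> S a1) \<cdot> S X2 \<cdot> al \<cdot> X3)))) =
      sX' (\<lambda>t1 t2 t3. G (p \<bullet> (t1 \<bullet> a)) (q \<cdot> (t2 \<cdot> be \<cdot> S t3) \<cdot> S X2 \<cdot> al \<cdot> X3))" for p q X2 X3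
      by (rule p_rel[where s = s and G = "\<lambda>m h. G (p \<bullet> m) (q \<cdot> h \<cdot> S X2 \<cdot> al \<cdot> X3)"]) (rule l)+
    then show ?thesis by (simp only:)
  qed
  also have "\<dots> = sX (\<lambda>X1 X2 X3. sR X1 (\<lambda>p q. sX' (\<lambda>t1 t2 t3.
      G (p \<bullet> t1 \<bullet> a) (q \<cdot> t2 \<cdot> be \<cdot> S (X2 \<cdot> t3) \<cdot> al \<cdot> X3))))"
    by (simp only: S_mult assoc tmul_assoc[OF kA])
  also have "\<dots> = G (\<one>\<^bsub>A\<^esub> \<bullet> a) uH"
    by (rule p_q_one[where s = s and G = "\<lambda>m h. G (m \<bullet> a) h"]) (rule l)+
  finally show ?thesis by (simp only: oneA_simps)
qed

text \<open>Carries the components of \<open>a\<close> from the outside of a product of two copies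
  of p to the place between them. Coassociativity takes them past \<Phi>\<rho>, and
  \<open>p_rel\<close>, applied to the outer copy, absorbs the factor \<open>S a1\<close>.\<close>

lemma transl_right:
  assumes F: "bilin (scl A) (scl HH) s F"
  shows "sR a (\<lambda>a0 a1. sR a0 (\<lambda>b0 b1. sX (\<lambda>X1 X2 X3. sX' (\<lambda>t1 t2 t3. sR t1 (\<lambda>p q. sX' (\<lambda>s1 s2 s3.
      F (b0 \<bullet> (X1 \<bullet> p \<bullet> s1)) (\<Delta> b1 \<star> (X2 \<cdot> q \<cdot> s2 \<cdot> be \<cdot> S s3 \<sharp> X3 \<cdot> t2 \<cdot> be \<cdot> S t3) \<star> (uH \<sharp> S a1)))))))) =
    sX (\<lambda>X1 X2 X3. sX' (\<lambda>t1 t2 t3. sR t1 (\<lambda>p q. sR a (\<lambda>a0 a1. sX' (\<lambda>s1 s2 s3.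
      F (X1 \<bullet> p \<bullet> (a0 \<bullet> s1)) (X2 \<cdot> q \<cdot> (a1 \<cdot> s2 \<cdot> be \<cdot> S s3) \<sharp> X3 \<cdot> t2 \<cdot> be \<cdot> S t3))))))"
proof -
  have vs: "vector_space s" by (rule bilinD(3)[OF F])
  note l = lin_bilin[OF F] vs lins
  note Fo = lin_out[OF bilinD(4)[OF F]]
  note nrm = assoc tmul_assoc[OF kA] sw_sw3_swap
  define K where "K = (\<lambda>a1 m y z. sX' (\<lambda>t1 t2 t3. sR t1 (\<lambda>p q. sX' (\<lambda>s1 s2 s3.
      F (m \<bullet> p \<bullet> s1) (y \<cdot> q \<cdot> s2 \<cdot> be \<cdot> S s3 \<sharp> z \<cdot> t2 \<cdot> be \<cdot> S t3 \<cdot> S a1)))))"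
  have Kt: "trilin (scl A) (scl H) (scl H) s (K a1)" for a1 unfolding K_def by (rule l)+
  \<comment> \<open>\<open>G\<close> is the context of the outer copy of p; its algebra argument
    enters through its coaction, so that \<open>Gm\<close> can split the product
    \<open>t1 \<bullet> a\<close> left by \<open>p_rel\<close>.\<close>
  define G where "G = (\<lambda>X1 X2 X3 m h. sR m (\<lambda>p q. sX' (\<lambda>s1 s2 s3.
      F (X1 \<bullet> p \<bullet> s1) (X2 \<cdot> q \<cdot> s2 \<cdot> be \<cdot> S s3 \<sharp> X3 \<cdot> h))))"
  have Gb: "bilin (scl A) (scl H) s (G X1 X2 X3)" for X1 X2 X3 unfolding G_def by (rule l)+
  have Gm: "G X1 X2 X3 (m \<bullet> n) h = sR m (\<lambda>c0 c1. sR n (\<lambda>p q. sX' (\<lambda>s1 s2 s3.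
      F (X1 \<bullet> (c0 \<bullet> p) \<bullet> s1) (X2 \<cdot> (c1 \<cdot> q) \<cdot> s2 \<cdot> be \<cdot> S s3 \<sharp> X3 \<cdot> h))))" for X1 X2 X3 m n h
    unfolding G_def by (rule R_mult[where s = s]) (rule l)+
  have "sR a (\<lambda>a0 a1. sR a0 (\<lambda>b0 b1. sX (\<lambda>X1 X2 X3. sX' (\<lambda>t1 t2 t3. sR t1 (\<lambda>p q. sX' (\<lambda>s1 s2 s3.
      F (b0 \<bullet> (X1 \<bullet> p \<bullet> s1)) (\<Delta> b1 \<star> (X2 \<cdot> q \<cdot> s2 \<cdot> be \<cdot> S s3 \<sharp> X3 \<cdot> t2 \<cdot> be \<cdot> S t3) \<star> (uH \<sharp> S a1)))))))) =
    sR a (\<lambda>a0 a1. sR a0 (\<lambda>b0 b1. sD b1 (\<lambda>c d. sX (\<lambda>X1 X2 X3. K a1 (b0 \<bullet> X1) (c \<cdot> X2) (d \<cdot> X3)))))"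
    by (simp only: \<Delta>_star tmul_sw(1)[OF kHH] assocE tp_mult Fo K_def one_simps nrm)
      (intro arg_cong[of _ _ "sX"] arg_cong[of _ _ "sX'"] arg_cong[of _ _ "sR _"] ext, rule sw_swap)
  also have "\<dots> = sR a (\<lambda>a0 a1. sX (\<lambda>X1 X2 X3. sR a0 (\<lambda>b0 b1. sR b0 (\<lambda>c0 c1.
      K a1 (X1 \<bullet> c0) (X2 \<cdot> c1) (X3 \<cdot> b1)))))"
    by (simp only: coassoc(1)[OF Kt])
  also have "\<dots> = sX (\<lambda>X1 X2 X3. sR a (\<lambda>a0 a1. sR a0 (\<lambda>b0 b1. sX' (\<lambda>t1 t2 t3.
      G X1 X2 X3 (b0 \<bullet> t1) (b1 \<cdot> t2 \<cdot> be \<cdot> S t3 \<cdot> S a1)))))"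
    by (simp only: Gm K_def nrm)
  also have "\<dots> = sX (\<lambda>X1 X2 X3. sX' (\<lambda>t1 t2 t3. G X1 X2 X3 (t1 \<bullet> a) (t2 \<cdot> be \<cdot> S t3)))"
    by (simp only: p_rel[OF Gb])
  finally show ?thesis by (simp only: Gm nrm)
qed

text \<open>No antipode of a component of \<open>a\<close> occurs here, and coassociativity alone
  takes the components past \<Phi>\<rho>.\<close>

lemma transl_left:
  assumes F: "bilin (scl A) (scl HH) s F"
  shows "sR a (\<lambda>a0 a1. sX (\<lambda>X1 X2 X3. sX' (\<lambda>t1 t2 t3. sR t1 (\<lambda>p q.
      F (a0 \<bullet> (X1 \<bullet> p)) (\<Delta> a1 \<star> (X2 \<cdot> q \<sharp> X3 \<cdot> t2 \<cdot> be \<cdot> S t3)))))) =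
    sR a (\<lambda>a0 a1. sX' (\<lambda>t1 t2 t3. sX (\<lambda>X1 X2 X3. sR (a0 \<bullet> t1) (\<lambda>c0 c1.
      F (X1 \<bullet> c0) (X2 \<cdot> c1 \<sharp> X3 \<cdot> (a1 \<cdot> t2 \<cdot> be \<cdot> S t3))))))"
proof -
  have vs: "vector_space s" by (rule bilinD(3)[OF F])
  note l = lin_bilin[OF F] vs lins
  note Fo = lin_out[OF bilinD(4)[OF F]]
  note nrm = assoc tmul_assoc[OF kA] sw_sw3_swap
  define K where "K = (\<lambda>m y z. sX' (\<lambda>t1 t2 t3. sR t1 (\<lambda>p q.
      F (m \<bullet> p) (y \<cdot> q \<sharp> z \<cdot> t2 \<cdot> be \<cdot> S t3))))"
  have Kt: "trilin (scl A) (scl H) (scl H) s K" unfolding K_def by (rule l)+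
  have "sR a (\<lambda>a0 a1. sX (\<lambda>X1 X2 X3. sX' (\<lambda>t1 t2 t3. sR t1 (\<lambda>p q.
      F (a0 \<bullet> (X1 \<bullet> p)) (\<Delta> a1 \<star> (X2 \<cdot> q \<sharp> X3 \<cdot> t2 \<cdot> be \<cdot> S t3)))))) =
    sR a (\<lambda>a0 a1. sD a1 (\<lambda>c d. sX (\<lambda>X1 X2 X3. K (a0 \<bullet> X1) (c \<cdot> X2) (d \<cdot> X3))))"
    by (simp only: \<Delta>_star tp_mult Fo K_def nrm)
      (intro arg_cong[of _ _ "sX"] arg_cong[of _ _ "sX'"] arg_cong[of _ _ "sR _"] ext, rule sw_swap)
  also have "\<dots> = sX (\<lambda>X1 X2 X3. sR a (\<lambda>a0 a1. sR a0 (\<lambda>b0 b1. K (X1 \<bullet> b0) (X2 \<cdot> b1) (X3 \<cdot> a1))))"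
    by (rule coassoc(1)[OF Kt, symmetric])
  also have "\<dots> = sR a (\<lambda>a0 a1. sX' (\<lambda>t1 t2 t3. sX (\<lambda>X1 X2 X3. sR a0 (\<lambda>b0 b1. sR t1 (\<lambda>p q.
      F (X1 \<bullet> (b0 \<bullet> p)) (X2 \<cdot> (b1 \<cdot> q) \<sharp> X3 \<cdot> (a1 \<cdot> t2 \<cdot> be \<cdot> S t3)))))))"
    by (simp only: K_def nrm) (rule sw3_swap)
  also have "\<dots> = sR a (\<lambda>a0 a1. sX' (\<lambda>t1 t2 t3. sX (\<lambda>X1 X2 X3. sR (a0 \<bullet> t1) (\<lambda>c0 c1.
      F (X1 \<bullet> c0) (X2 \<cdot> c1 \<sharp> X3 \<cdot> (a1 \<cdot> t2 \<cdot> be \<cdot> S t3))))))"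
    by (subst R_mult[where s = s]) ((rule l)+, rule refl)
  finally show ?thesis .
qed

text \<open>The core of multiplicativity: the left side arises from the two-sided product followed
  by the isomorphism, the right side from the diagonal product of two images. With a and a' split
  off, \<open>twist_main\<close> settles the part that contains only p, and the two translations put
  a' and a where the diagonal product has them.\<close>

lemma twist_mult:
  assumes F: "bilin (scl A) (scl HH) s F"
  shows "sR a' (\<lambda>a'0 a'1. sX' (\<lambda>r1 r2 r3. sR (a \<bullet> a'0 \<bullet> r1) (\<lambda>c0 c1. sX' (\<lambda>t1 t2 t3.
      F (c0 \<bullet> t1) (S2 (c1 \<cdot> t2 \<cdot> be \<cdot> S t3) \<star> (S r3 \<sharp> S (a'1 \<cdot> r2))))))) =
    sR a (\<lambda>a0 a1. sX' (\<lambda>t1 t2 t3. sX (\<lambda>X1 X2 X3. sR (a0 \<bullet> t1) (\<lambda>c0 c1. sR a' (\<lambda>a'0 a'1. sX' (\<lambda>s1 s2 s3.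
      F (X1 \<bullet> c0 \<bullet> (a'0 \<bullet> s1))
        (twist \<star> (X2 \<cdot> c1 \<cdot> (a'1 \<cdot> s2 \<cdot> be \<cdot> S s3) \<sharp> X3 \<cdot> (a1 \<cdot> t2 \<cdot> be \<cdot> S t3)))))))))"
proof -
  have vs: "vector_space s" by (rule bilinD(3)[OF F])
  note l = lin_bilin[OF F] vs lins
  note nrm = assoc tmul_assoc[OF kA] sw_sw3_swap
  have "sR a' (\<lambda>a'0 a'1. sX' (\<lambda>r1 r2 r3. sR (a \<bullet> a'0 \<bullet> r1) (\<lambda>c0 c1. sX' (\<lambda>t1 t2 t3.
      F (c0 \<bullet> t1) (S2 (c1 \<cdot> t2 \<cdot> be \<cdot> S t3) \<star> (S r3 \<sharp> S (a'1 \<cdot> r2))))))) =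
    sR a' (\<lambda>a'0 a'1. sX' (\<lambda>r1 r2 r3. sR (a \<bullet> a'0) (\<lambda>b0 b1. sR r1 (\<lambda>p q. sX' (\<lambda>t1 t2 t3.
      F (b0 \<bullet> p \<bullet> t1) (S2 (b1 \<cdot> q \<cdot> t2 \<cdot> be \<cdot> S t3) \<star> (S r3 \<sharp> S (a'1 \<cdot> r2))))))))"
    by (subst R_mult[where s = s]) ((rule l)+, rule refl)
  also have "\<dots> = sR a' (\<lambda>a'0 a'1. sX' (\<lambda>r1 r2 r3. sR a (\<lambda>a0 a1. sR a'0 (\<lambda>b0 b1. sR r1 (\<lambda>p q. sX' (\<lambda>t1 t2 t3.
      F (a0 \<bullet> b0 \<bullet> p \<bullet> t1) (S2 (a1 \<cdot> b1 \<cdot> q \<cdot> t2 \<cdot> be \<cdot> S t3) \<star> (S r3 \<sharp> S (a'1 \<cdot> r2)))))))))"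
    by (subst R_mult[where s = s]) ((rule l)+, rule refl)
  also have "\<dots> = sR a (\<lambda>a0 a1. sR a' (\<lambda>a'0 a'1. sR a'0 (\<lambda>b0 b1. sX' (\<lambda>r1 r2 r3. sX' (\<lambda>t1 t2 t3. sR r1 (\<lambda>p q.
      F (a0 \<bullet> (b0 \<bullet> (p \<bullet> t1)))
        (S2 (a1 \<cdot> b1) \<star> (S2 (q \<cdot> t2 \<cdot> be \<cdot> S t3) \<star> (S r3 \<sharp> S r2)) \<star> (uH \<sharp> S a'1))))))))"
    by (simp only: S2_mult assocE tp_mult S_mult one_simps nrm)
      (intro arg_cong[of _ _ "sX'"] ext, rule sw_swap)
  also have "\<dots> = sR a (\<lambda>a0 a1. sR a' (\<lambda>a'0 a'1. sR a'0 (\<lambda>b0 b1. sX (\<lambda>X1 X2 X3. sX' (\<lambda>t1 t2 t3. sR t1 (\<lambda>p q. sX' (\<lambda>s1 s2 s3.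
      F (a0 \<bullet> (b0 \<bullet> (X1 \<bullet> p \<bullet> s1)))
        (S2 (a1 \<cdot> b1) \<star> (twist \<star> (X2 \<cdot> q \<cdot> s2 \<cdot> be \<cdot> S s3 \<sharp> X3 \<cdot> t2 \<cdot> be \<cdot> S t3)) \<star> (uH \<sharp> S a'1)))))))))"
  proof -
    have "bilin (scl A) (scl HH) s (\<lambda>m e. F (a0 \<bullet> (b0 \<bullet> m)) (S2 (a1 \<cdot> b1) \<star> e \<star> (uH \<sharp> S a'1)))" for a0 b0 a1 b1 a'1
      by (rule l)+
    from twist_main[OF this] show ?thesis by (simp only:)
  qed
  also have "\<dots> = sR a (\<lambda>a0 a1. sR a' (\<lambda>a'0 a'1. sR a'0 (\<lambda>b0 b1. sX (\<lambda>X1 X2 X3. sX' (\<lambda>t1 t2 t3. sR t1 (\<lambda>p q. sX' (\<lambda>s1 s2 s3.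
      F (a0 \<bullet> (b0 \<bullet> (X1 \<bullet> p \<bullet> s1)))
        (twist \<star> (\<Delta> a1 \<star> (\<Delta> b1 \<star> (X2 \<cdot> q \<cdot> s2 \<cdot> be \<cdot> S s3 \<sharp> X3 \<cdot> t2 \<cdot> be \<cdot> S t3) \<star> (uH \<sharp> S a'1)))))))))))"
  proof -
    \<comment> \<open>Moving f to the front changes \<open>S2\<close> back into \<Delta>; the
      coproducts coming from a and from a' then stand side by side and can be translated one after
      the other.\<close>
    have "S2 (x \<cdot> y) \<star> (twist \<star> e) \<star> g = twist \<star> (\<Delta> x \<star> (\<Delta> y \<star> e \<star> g))" for x y e g
    proof -
      have "S2 (x \<cdot> y) \<star> (twist \<star> e) \<star> g = (S2 (x \<cdot> y) \<star> twist) \<star> e \<star> g" by (simp only: assocE)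
      then show ?thesis by (simp only: twist_\<Delta>[symmetric] \<Delta>_multE assocE)
    qed
    then show ?thesis by (simp only:)
  qed
  also have "\<dots> = sR a (\<lambda>a0 a1. sX (\<lambda>X1 X2 X3. sX' (\<lambda>t1 t2 t3. sR t1 (\<lambda>p q. sR a' (\<lambda>a'0 a'1. sX' (\<lambda>s1 s2 s3.
      F (a0 \<bullet> (X1 \<bullet> p \<bullet> (a'0 \<bullet> s1)))
        (twist \<star> (\<Delta> a1 \<star> (X2 \<cdot> q \<cdot> (a'1 \<cdot> s2 \<cdot> be \<cdot> S s3) \<sharp> X3 \<cdot> t2 \<cdot> be \<cdot> S t3)))))))))"
  proof -
    have "bilin (scl A) (scl HH) s (\<lambda>m e. F (a0 \<bullet> m) (twist \<star> (\<Delta> a1 \<star> e)))" for a0 a1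
      by (rule l)+
    from transl_right[OF this] show ?thesis by (simp only:)
  qed
  \<comment> \<open>What belongs to a' is split off as a right factor, so that it becomes part of
    the test map to which \<open>transl_left\<close> is applied.\<close>
  also have "\<dots> = sR a (\<lambda>a0 a1. sX (\<lambda>X1 X2 X3. sX' (\<lambda>t1 t2 t3. sR t1 (\<lambda>p q. sR a' (\<lambda>a'0 a'1. sX' (\<lambda>s1 s2 s3.
      F (a0 \<bullet> (X1 \<bullet> p) \<bullet> (a'0 \<bullet> s1))
        (twist \<star> (\<Delta> a1 \<star> (X2 \<cdot> q \<sharp> X3 \<cdot> t2 \<cdot> be \<cdot> S t3) \<star> (a'1 \<cdot> s2 \<cdot> be \<cdot> S s3 \<sharp> uH)))))))))"
    by (simp only: assocE tp_mult nrm one_simps)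
  also have "\<dots> = sR a (\<lambda>a0 a1. sX' (\<lambda>t1 t2 t3. sX (\<lambda>X1 X2 X3. sR (a0 \<bullet> t1) (\<lambda>c0 c1. sR a' (\<lambda>a'0 a'1. sX' (\<lambda>s1 s2 s3.
      F (X1 \<bullet> c0 \<bullet> (a'0 \<bullet> s1))
        (twist \<star> ((X2 \<cdot> c1 \<sharp> X3 \<cdot> (a1 \<cdot> t2 \<cdot> be \<cdot> S t3)) \<star> (a'1 \<cdot> s2 \<cdot> be \<cdot> S s3 \<sharp> uH)))))))))"
    by (rule transl_left[where s = s and F = "\<lambda>m e. sR a' (\<lambda>a'0 a'1. sX' (\<lambda>s1 s2 s3.
      F (m \<bullet> (a'0 \<bullet> s1)) (twist \<star> (e \<star> (a'1 \<cdot> s2 \<cdot> be \<cdot> S s3 \<sharp> uH)))))"]) (rule l)+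
  finally show ?thesis by (simp only: tp_mult assoc one_simps)
qed

text \<open>The same identity before the passage to H \<otimes> H, in the shape in which the action
  on a product in \<open>P\<close> delivers it.\<close>

lemma twist_mult_inv:
  assumes F: "trilin (scl A) (scl H) (scl H) s F"
  shows "sR a' (\<lambda>a'0 a'1. sX' (\<lambda>r1 r2 r3. sR (a \<bullet> a'0 \<bullet> r1) (\<lambda>c0 c1. sX' (\<lambda>t1 t2 t3.
      sD (Si (c1 \<cdot> t2 \<cdot> be \<cdot> S t3)) (\<lambda>h1 h2. F (c0 \<bullet> t1) (a'1 \<cdot> r2 \<cdot> h1) (r3 \<cdot> h2)))))) =
    sR a (\<lambda>a0 a1. sX' (\<lambda>t1 t2 t3. sX (\<lambda>X1 X2 X3. sR (a0 \<bullet> t1) (\<lambda>c0 c1. sR a' (\<lambda>a'0 a'1. sX' (\<lambda>s1 s2 s3.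
      sw H H twist (\<lambda>f1 f2. F (X1 \<bullet> c0 \<bullet> (a'0 \<bullet> s1)) (Si (f2 \<cdot> X3 \<cdot> (a1 \<cdot> t2 \<cdot> be \<cdot> S t3)))
        (Si (f1 \<cdot> X2 \<cdot> c1 \<cdot> (a'1 \<cdot> s2 \<cdot> be \<cdot> S s3))))))))))"
proof -
  have vs: "vector_space s" by (rule trilin_vs[OF F])
  note l = lin_tri[OF F] vs lins
  \<comment> \<open>\<open>F'\<close> applies S^{-1} to both legs and flips them, undoing the S
    \<otimes> S and the opposite coproduct in \<open>S2\<close>.\<close>
  define F' where "F' = (\<lambda>m e. sw H H (pr HH e) (\<lambda>y z. F m (Si z) (Si y)))"
  have b: "bilin (scl H) (scl H) s (\<lambda>y z. F m (Si z) (Si y))" for m by (rule l)+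
  have F'b: "bilin (scl A) (scl HH) s F'"
    unfolding F'_def
    by (rule bilinI, rule lin_sw_arg[OF sH sH pr_spec(1)[OF sHH] pr_spec(2)[OF sHH] b], (rule l)+)
  note Fo = lin_out[OF bilinD(4)[OF F'b]]
  have F't: "F' m (y \<sharp> z) = F m (Si z) (Si y)" for m y z
    by (simp add: F'_def pr_spec(3)[OF sHH] tpt_closed sH sw_tpt[OF sH sH b] Si_pr)
  have tw: "twist \<star> e = sw H H twist (\<lambda>f1 f2. (f1 \<sharp> f2) \<star> e)" for e
  proof -
    have "twist \<in> carrier HH" using pr_spec(2)[OF sHH, of twist] by (simp only: pr_twist)
    from tmul_sw(1)[OF kHH, of H H twist "tpt H H" e]
    show ?thesis by (simp only: sw_tpt_id[OF sH sH \<open>twist \<in> carrier HH\<close>])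
  qed
  have "sD (Si k) (\<lambda>h1 h2. F m (x \<cdot> h1) (y \<cdot> h2)) = F' m (S2 k \<star> (S y \<sharp> S x))" for k m x y
    by (simp only: S2_def S1_star tp_mult S_mult[symmetric] Fo F't Si_S one_simps)
  then show ?thesis
    by (simp only: twist_mult[OF F'b]) (simp only: tw tp_mult Fo F't assoc)
qed

end

section \<open>Agreement with Drinfeld's \<gamma> and f\<close>

context qhopf
begin

lemma drinfeld_gamma_eq: "drinfeld_gamma H = gam"
proof -
  let ?T = "H \<boxtimes> H \<boxtimes> H \<boxtimes> H"
  let ?F = "\<lambda>a b c d. S b \<cdot> al \<cdot> c \<sharp> S a \<cdot> al \<cdot> d"
  have q: "quadlin (scl H) (scl H) (scl H) (scl H) (scl HH) ?F" by (rule lins)+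
  have q1: "quadlin (scl H) (scl H) (scl H) (scl H) (scl HH) (\<lambda>x y z w. ?F (a \<cdot> x) (b \<cdot> y) (c \<cdot> z) (d \<cdot> w))" for a b c d
    by (rule lins)+
  have q2: "quadlin (scl H) (scl H) (scl H) (scl H) (scl HH) (\<lambda>x y z w. sw4 H H H H t (\<lambda>x' y' z' w'. ?F (x \<cdot> x') (y \<cdot> y') (z \<cdot> z') (w \<cdot> w')))" for t
    by (rule lins)+
  note c = one_r_closed[OF kH kH kH kH P_closed(1)] split1of3_closed[OF kH kH kH kH kH comul_hom P_closed(2)]
  note tc = tensor_mult_closed[OF kalgebra_tensor[OF kalgebra_tensor[OF kH kH] kH] kH c]
  have "drinfeld_gamma H =
    sw4 H H H H (one_r H H H H \<Phi> \<otimes>\<^bsub>?T\<^esub> split1of3 H H H H H (comul H) \<Phi>') ?F"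
    unfolding drinfeld_gamma_def Let_def sw4_def
    by (intro sw_cong[OF tc] sw3_cong)
      (use S_closed in \<open>simp_all add: S_eq tmul_mult[OF kH] al_closed tmul_closed[OF kH] tpt_pt[OF sH sH]\<close>)
  also have "\<dots> = sP (\<lambda>X1 X2 X3. sP' (\<lambda>x y z. sD x (\<lambda>a b. ?F (X1 \<cdot> a) (X2 \<cdot> b) (X3 \<cdot> y) (uH \<cdot> z))))"
    by (simp only: sw4_mult[OF kH kH kH kH c q], simp only: sw4_one_r[OF kH kH kH kH P_closed(1) q2],
        simp only: sw4_split1of3[OF kH kH kH kH kH comul_hom P_closed(2) q1])
  also have "\<dots> = sP' (\<lambda>x y z. sP (\<lambda>X1 X2 X3. sD x (\<lambda>a b. ?F (X1 \<cdot> a) (X2 \<cdot> b) (X3 \<cdot> y) (uH \<cdot> z))))"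
    by (rule sw3_swap)
  finally show ?thesis by (simp only: gam_def[unfolded gaux_def[abs_def]] one_simps)
qed

lemma drinfeld_twist_eq: "drinfeld_twist H = twist"
  unfolding drinfeld_twist_def Let_def twist_def drinfeld_gamma_eq
proof (rule sw3_cong[OF P_closed(2)])
  fix x y z assume xyz: "x \<in> carrier H" "y \<in> carrier H" "z \<in> carrier H"
  have 1: "sw H H (comul H x) (\<lambda>h1 h2. pt H H (antipode H h2) (antipode H h1)) = S1 x"
    unfolding S1_def tap_eq[OF sH xyz(1)]
    by (rule sw_cong[OF \<Delta>_closed[of x, unfolded tap_eq[OF sH xyz(1)]]])
      (simp add: S_eq S_closed tpt_pt[OF sH sH])
  have 2: "comul H (y \<otimes>\<^bsub>H\<^esub> be \<otimes>\<^bsub>H\<^esub> antipode H z) = \<Delta> (y \<cdot> be \<cdot> S z)"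
    using xyz S_closed
    by (simp add: S_eq tmul_mult[OF kH] be_closed tmul_closed[OF kH] tap_eq[OF sH, where f = "comul H"])
  have g: "gam \<in> carrier HH" using pr_spec(2)[OF sHH, of gam] by (simp only: pr_gam)
  show "sw H H (comul H x) (\<lambda>h1 h2. pt H H (antipode H h2) (antipode H h1)) \<otimes>\<^bsub>HH\<^esub> gam \<otimes>\<^bsub>HH\<^esub>
      comul H (y \<otimes>\<^bsub>H\<^esub> be \<otimes>\<^bsub>H\<^esub> antipode H z) = S1 x \<star> gam \<star> \<Delta> (y \<cdot> be \<cdot> S z)"
    unfolding 1 2 by (simp add: tmul_mult[OF kHH] S1_closed g \<Delta>_closed tmul_closed[OF kHH])
qed

end

section \<open>Fivefold tensor products\<close>

definition quintlin where
  "quintlin s1 s2 s3 s4 s5 s f \<longleftrightarrow> (\<forall>x y z u. lin s5 s (f x y z u)) \<and> (\<forall>x y z v. lin s4 s (\<lambda>u. f x y z u v)) \<and>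
     (\<forall>x y u v. lin s3 s (\<lambda>z. f x y z u v)) \<and> (\<forall>x z u v. lin s2 s (\<lambda>y. f x y z u v)) \<and>
     (\<forall>y z u v. lin s1 s (\<lambda>x. f x y z u v))"

lemma quintlinI [lins]:
  assumes "\<And>x y z u. lin s5 s (f x y z u)" "\<And>x y z v. lin s4 s (\<lambda>u. f x y z u v)"
    "\<And>x y u v. lin s3 s (\<lambda>z. f x y z u v)" "\<And>x z u v. lin s2 s (\<lambda>y. f x y z u v)"
    "\<And>y z u v. lin s1 s (\<lambda>x. f x y z u v)"
  shows "quintlin s1 s2 s3 s4 s5 s f"
  using assms by (simp add: quintlin_def)

lemma sw5_eq: "sw5 A B C D E t F = sw4 (A \<boxtimes> B) C D E t (\<lambda>r z u v. sw A B r (\<lambda>x y. F x y z u v))"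
  by (simp add: sw5_def sw4_def sw3_def)

lemma sw4_cong:
  assumes "t \<in> carrier (A \<boxtimes> B \<boxtimes> C \<boxtimes> D)"
    "\<And>x y z u. x \<in> carrier A \<Longrightarrow> y \<in> carrier B \<Longrightarrow> z \<in> carrier C \<Longrightarrow> u \<in> carrier D \<Longrightarrow> F x y z u = G x y z u"
  shows "sw4 A B C D t F = sw4 A B C D t G"
  unfolding sw4_def by (intro sw_cong[OF assms(1)] sw3_cong assms(2))

lemma pt5_closed:
  "x \<in> carrier A \<Longrightarrow> y \<in> carrier B \<Longrightarrow> z \<in> carrier C \<Longrightarrow> u \<in> carrier D \<Longrightarrow> v \<in> carrier E \<Longrightarrow>
   pt5 A B C D E x y z u v \<in> carrier (A \<boxtimes> B \<boxtimes> C \<boxtimes> D \<boxtimes> E)"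
  by (simp add: pt5_def pt_closed pt4_closed)

lemma sw5_cong:
  assumes "t \<in> carrier (A \<boxtimes> B \<boxtimes> C \<boxtimes> D \<boxtimes> E)"
    "\<And>x y z u v. x \<in> carrier A \<Longrightarrow> y \<in> carrier B \<Longrightarrow> z \<in> carrier C \<Longrightarrow> u \<in> carrier D \<Longrightarrow> v \<in> carrier E \<Longrightarrow>
      F x y z u v = G x y z u v"
  shows "sw5 A B C D E t F = sw5 A B C D E t G"
  unfolding sw5_def by (intro sw_cong[OF assms(1)] sw4_cong assms(2))

context
  fixes A :: "('k::field, 'a::ab_group_add, 'm) kalg_scheme" and B :: "('k, 'b::ab_group_add, 'n) kalg_scheme"
    and C :: "('k, 'c::ab_group_add, 'o) kalg_scheme" and D :: "('k, 'd::ab_group_add, 'q) kalg_scheme"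
    and E :: "('k, 'e::ab_group_add, 'r) kalg_scheme" and s F
  assumes A: "kspace A" and B: "kspace B" and C: "kspace C" and D: "kspace D" and E: "kspace E"
    and F: "quintlin (scl A) (scl B) (scl C) (scl D) (scl E) s F"
begin

private lemmas AB8 = kspace_tensor[OF A, of B]

private lemma sw5_eq':
  assumes "t \<in> carrier (A \<boxtimes> B \<boxtimes> C \<boxtimes> D \<boxtimes> E)"
  shows "sw5 A B C D E t F = sw4 (A \<boxtimes> B) C D E t (\<lambda>r z u v. sw A B (pr (A \<boxtimes> B) r) (\<lambda>x y. F x y z u v))"
  unfolding sw5_eq by (rule sw4_cong[OF assms]) (simp add: pr_spec[OF AB8])

private lemma bil: "bilin (scl A) (scl B) s (\<lambda>x y. F x y z u v)"
  using F by (simp add: quintlin_def bilin_def)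

private lemma quad: "quadlin (scl (A \<boxtimes> B)) (scl C) (scl D) (scl E) s
    (\<lambda>r z u v. sw A B (pr (A \<boxtimes> B) r) (\<lambda>x y. F x y z u v))"
proof (rule quadlinI)
  show "lin (scl (A \<boxtimes> B)) s (\<lambda>r. sw A B (pr (A \<boxtimes> B) r) (\<lambda>x y. F x y z u v))" for z u v
    by (rule lin_sw_arg[OF A B pr_spec(1)[OF AB8] pr_spec(2)[OF AB8] bil])
qed (rule lin_sw, use F in \<open>simp add: quintlin_def\<close>)+

private lemmas T5 = kspace_tensor[OF kspace_tensor[OF kspace_tensor[OF AB8]]]

lemma sw5_sw:
  assumes "t \<in> carrier (P \<boxtimes> Q)"
    "\<And>x y. x \<in> carrier P \<Longrightarrow> y \<in> carrier Q \<Longrightarrow> G x y \<in> carrier (A \<boxtimes> B \<boxtimes> C \<boxtimes> D \<boxtimes> E)"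
  shows "sw5 A B C D E (sw P Q t G) F = sw P Q t (\<lambda>x y. sw5 A B C D E (G x y) F)"
proof -
  have c: "sw P Q t G \<in> carrier (A \<boxtimes> B \<boxtimes> C \<boxtimes> D \<boxtimes> E)" by (rule sw_closed[OF T5 assms])
  show ?thesis
    unfolding sw5_eq'[OF c]
    by (rule trans[OF sw4_sw[OF AB8 C D E quad assms] sw_cong[OF assms(1)]]) (simp_all add: sw5_eq' assms(2))
qed

lemma sw5_sw3:
  assumes "t \<in> carrier (P \<boxtimes> Q \<boxtimes> R)"
    "\<And>x y z. x \<in> carrier P \<Longrightarrow> y \<in> carrier Q \<Longrightarrow> z \<in> carrier R \<Longrightarrow> G x y z \<in> carrier (A \<boxtimes> B \<boxtimes> C \<boxtimes> D \<boxtimes> E)"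
  shows "sw5 A B C D E (sw3 P Q R t G) F = sw3 P Q R t (\<lambda>x y z. sw5 A B C D E (G x y z) F)"
proof -
  have c: "sw3 P Q R t G \<in> carrier (A \<boxtimes> B \<boxtimes> C \<boxtimes> D \<boxtimes> E)" by (rule sw3_closed[OF T5 assms])
  show ?thesis
    unfolding sw5_eq'[OF c]
    by (rule trans[OF sw4_sw3[OF AB8 C D E quad assms] sw3_cong[OF assms(1)]]) (simp_all add: sw5_eq' assms(2))
qed

lemma sw5_pt5:
  assumes "x \<in> carrier A" "y \<in> carrier B" "z \<in> carrier C" "u \<in> carrier D" "v \<in> carrier E"
  shows "sw5 A B C D E (pt5 A B C D E x y z u v) F = F x y z u v"
proof -
  have "pt5 A B C D E x y z u v = pt4 (A \<boxtimes> B) C D E (pt A B x y) z u v"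
    by (simp add: pt5_def pt4_def pt3_def)
  then show ?thesis
    using sw4_pt4[OF AB8 C D E quad pt_closed[OF assms(1,2)] assms(3-)] sw_pt[OF A B bil assms(1,2)] assms
      pt4_closed[OF pt_closed[OF assms(1,2)] assms(3-)]
    by (simp add: sw5_eq' pr_spec[OF AB8] pt_closed)
qed

end

section \<open>The two crossed products\<close>

locale crossed = qhcomod H A \<rho> \<Phi>\<rho>
  for H :: "('k::field, 'h::ab_group_add, 'm) qhopf_scheme"
    and A :: "('k, 'a::ab_group_add, 'n) kalg_scheme" and \<rho> and \<Phi>\<rho> +
  fixes P :: "('k, 'p::ab_group_add, 'h, 'o) bimod_alg_scheme"
    and B :: "('k, 'b::ab_group_add, 'q) kalg_scheme" and lam and \<Phi>l
  assumes bm: "bimodule_algebra H P" and lc: "left_comodule_algebra H B lam \<Phi>l"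
begin

lemma kB [lins]: "kalgebra B"
  and lam_hom [lins]: "lam \<in> kalg_hom B (H \<boxtimes> B)"
  and \<Phi>l_unit: "\<Phi>l \<in> Units (H \<boxtimes> H \<boxtimes> B)"
  using lc by (simp_all add: left_comodule_algebra_def Let_def)

lemmas sB [lins] = kspace_kalgebra[OF kB]

lemma sPP [lins]: "kspace P"
  and lact_kbilin: "kbilin H P P (lact P)" and ract_kbilin: "kbilin P H P (ract P)"
  and mult_kbilin: "kbilin P P P (mult P)" and oneP_closed: "\<one>\<^bsub>P\<^esub> \<in> carrier P"
  using bm by (simp_all add: bimodule_algebra_def Let_def)

definition L where "L h x = lact P (pr H h) (pr P x)"
definition Ra where "Ra x h = ract P (pr P x) (pr H h)"
definition pm (infixl "\<ast>" 70) where "x \<ast> y = pr P x \<otimes>\<^bsub>P\<^esub> pr P y"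

lemma act_bilin: "bilin (scl H) (scl P) (scl P) L" "bilin (scl P) (scl H) (scl P) Ra"
  "bilin (scl P) (scl P) (scl P) pm"
  using kbilin_tot[OF sH sPP sPP lact_kbilin] kbilin_tot[OF sPP sH sPP ract_kbilin]
    kbilin_tot[OF sPP sPP sPP mult_kbilin]
  by (simp_all add: L_def[abs_def] Ra_def[abs_def] pm_def[abs_def])

lemmas [lins] = lin_bilin[OF act_bilin(1)] lin_bilin[OF act_bilin(2)] lin_bilin[OF act_bilin(3)]

lemma act_closed: "L h x \<in> carrier P" "Ra x h \<in> carrier P" "x \<ast> y \<in> carrier P"
  using lact_kbilin ract_kbilin mult_kbilin pr_spec(2)[OF sH] pr_spec(2)[OF sPP]
  by (auto simp: L_def Ra_def pm_def kbilin_def klin_def Pi_def)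

lemma act_eq:
  "h \<in> carrier H \<Longrightarrow> x \<in> carrier P \<Longrightarrow> lact P h x = L h x"
  "h \<in> carrier H \<Longrightarrow> x \<in> carrier P \<Longrightarrow> ract P x h = Ra x h"
  "x \<in> carrier P \<Longrightarrow> y \<in> carrier P \<Longrightarrow> x \<otimes>\<^bsub>P\<^esub> y = x \<ast> y"
  by (simp_all add: L_def Ra_def pm_def pr_spec sH sPP)

lemma act_pr:
  "L (pr H h) x = L h x" "L h (pr P x) = L h x" "Ra (pr P x) h = Ra x h" "Ra x (pr H h) = Ra x h"
  "pr P x \<ast> y = x \<ast> y" "x \<ast> pr P y = x \<ast> y" "pr P (Ra x h) = Ra x h"
  by (simp_all add: L_def Ra_def pm_def pr_pr sH sPP)
    (metis act_closed(2) Ra_def pr_spec(3)[OF sPP])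

lemma Ra_one: "Ra x uH = pr P x"
  using bm pr_spec(2)[OF sPP, of x] by (simp add: Ra_def pr_fix bimodule_algebra_def Let_def)

lemma act_act: "L g (Ra x h) = Ra (L g x) h" "Ra (Ra x g) h = Ra x (g \<cdot> h)"
proof -
  note c = pr_spec(2)[OF sH] pr_spec(2)[OF sPP]
  have r: "ract P (lact P g x) h = lact P g (ract P x h)" "ract P (ract P x g) h = ract P x (g \<otimes>\<^bsub>H\<^esub> h)"
    if "g \<in> carrier H" "h \<in> carrier H" "x \<in> carrier P" for g h x
    using bm that by (simp_all add: bimodule_algebra_def Let_def)
  show "L g (Ra x h) = Ra (L g x) h" "Ra (Ra x g) h = Ra x (g \<cdot> h)"
    using r[of "pr H g" "pr H h" "pr P x"] c act_closed pr_spec(3)[OF sPP]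
    by (simp_all add: L_def Ra_def tmul_pr[OF kH]) (simp_all add: tmul_def)
qed

lemma Ra_mult: "Ra (x \<ast> y) h = sD h (\<lambda>a b. Ra x a \<ast> Ra y b)"
proof -
  note c = pr_spec(2)[OF sH] pr_spec(2)[OF sPP]
  have "Ra (x \<ast> y) h = ract P (pr P x \<otimes>\<^bsub>P\<^esub> pr P y) (pr H h)"
    using act_closed(3)[of x y] by (simp add: Ra_def pr_spec(3)[OF sPP]) (simp add: pm_def)
  also have "\<dots> = sw H H (comul H (pr H h)) (\<lambda>h1 h2. ract P (pr P x) h1 \<otimes>\<^bsub>P\<^esub> ract P (pr P y) h2)"
    using bm c by (simp add: bimodule_algebra_def Let_def)
  also have "\<dots> = sD h (\<lambda>a b. Ra x a \<ast> Ra y b)"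
    unfolding tap_def[of _ "comul H"]
    by (rule sw_cong[OF \<Delta>_closed[unfolded tap_def]]) (simp add: act_eq c act_closed act_pr)
  finally show ?thesis .
qed

lemma Ra_oneP: "Ra \<one>\<^bsub>P\<^esub> h = scl P (\<epsilon> h) \<one>\<^bsub>P\<^esub>"
  using bm pr_spec(2)[OF sH, of h] by (simp add: Ra_def pr_spec(3)[OF sPP oneP_closed] tap_def bimodule_algebra_def Let_def)

abbreviation bmul (infixl "\<circ>\<^sub>B" 70) where "x \<circ>\<^sub>B y \<equiv> x \<odot>\<^bsub>B\<^esub> y"
abbreviation "sL b \<equiv> sw H B (tap B lam b)"
abbreviation \<Phi>l' where "\<Phi>l' \<equiv> inv\<^bsub>H \<boxtimes> H \<boxtimes> B\<^esub> \<Phi>l"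
abbreviation "sl \<equiv> sw3 H H B \<Phi>l'"

lemmas lam_closed = tap_closed[OF lam_hom sB]
lemmas mB3 = monoid_tensor[OF kalgebra_tensor[OF kH kH] kB]
lemmas l_closed = monoid.Units_closed[OF mB3 \<Phi>l_unit] monoid.Units_inv_closed[OF mB3 \<Phi>l_unit]

section \<open>The bicomodule algebra A \<otimes> B\<close>

abbreviation U where "U \<equiv> A \<boxtimes> B"
abbreviation tAB (infix "\<natural>" 65) where "a \<natural> b \<equiv> tpt A B a b"
abbreviation um (infixl "\<circ>\<^sub>U" 60) where "x \<circ>\<^sub>U y \<equiv> x \<odot>\<^bsub>U\<^esub> y"

lemma kU [lins]: "kalgebra U" by (rule kalgebra_tensor[OF kA kB])
lemmas sU = kspace_kalgebra[OF kU]
lemmas U_mult = tpt_mult[OF kA kB]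
lemmas HU = kspace_tensor[OF sH, of U] and UH = kspace_tensor[OF sU, of H]

lemma oneU: "\<one>\<^bsub>U\<^esub> = \<one>\<^bsub>A\<^esub> \<natural> \<one>\<^bsub>B\<^esub>"
  by (simp add: tpt_def pr_one[OF kA] pr_one[OF kB] tensor_def)

lemma prU: "pr U (a \<natural> b) = a \<natural> b"
  by (rule pr_spec(3)[OF sU tpt_closed[OF sA sB]])

definition LU where "LU w = tensor_lcoact H A B lam (pr U w)"
definition RU where "RU w = tensor_rcoact H A B \<rho> (pr U w)"

lemma LU_eq: "LU w = sw A B (pr U w) (\<lambda>a b. sL b (\<lambda>b1 b0. tpt H U b1 (a \<natural> b0)))"
proof -
  have l: "lam b \<in> carrier (H \<boxtimes> B)" if "b \<in> carrier B" for b
    using lam_hom that by (auto simp: kalg_hom_def klin_def)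
  show ?thesis
    unfolding LU_def tensor_lcoact_def
    by (rule sw_cong[OF pr_spec(2)[OF sU]], simp add: tap_eq[OF sB], rule sw_cong[OF l], assumption)
      (simp add: tpt_pt sA sB sH sU tpt_closed)
qed

lemma RU_eq: "RU w = sw A B (pr U w) (\<lambda>a b. sR a (\<lambda>a0 a1. tpt U H (a0 \<natural> b) a1))"
proof -
  have r: "\<rho> a \<in> carrier (A \<boxtimes> H)" if "a \<in> carrier A" for a
    using \<rho>_hom that by (auto simp: kalg_hom_def klin_def)
  show ?thesis
    unfolding RU_def tensor_rcoact_def
    by (rule sw_cong[OF pr_spec(2)[OF sU]], simp add: tap_eq[OF sA], rule sw_cong[OF r], assumption)
      (simp add: tpt_pt sA sB sH sU tpt_closed)
qed

lemma LU_closed: "LU w \<in> carrier (H \<boxtimes> U)"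
  unfolding LU_eq by (intro sw_closed[OF HU] pr_spec(2)[OF sU] lam_closed tpt_closed sH sU)

lemma RU_closed: "RU w \<in> carrier (U \<boxtimes> H)"
  unfolding RU_eq by (intro sw_closed[OF UH] pr_spec(2)[OF sU] R_closed tpt_closed sH sU)

lemma LU_lin: "lin s (scl U) g \<Longrightarrow> lin s (scl (H \<boxtimes> U)) (\<lambda>x. LU (g x))"
  unfolding LU_eq
  by (rule lin_sw_arg[OF sA sB pr_lin[OF sU] pr_spec(2)[OF sU]], assumption) (rule sU lins)+

lemma RU_lin: "lin s (scl U) g \<Longrightarrow> lin s (scl (U \<boxtimes> H)) (\<lambda>x. RU (g x))"
  unfolding RU_eq
  by (rule lin_sw_arg[OF sA sB pr_lin[OF sU] pr_spec(2)[OF sU]], assumption) (rule sU lins)+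

lemma sw_LU_lin [lins]: "lin r (scl U) g \<Longrightarrow> bilin (scl H) (scl U) s F \<Longrightarrow> lin r s (\<lambda>x. sw H U (LU (g x)) F)"
  by (rule lin_sw_arg[OF sH sU LU_lin LU_closed])

lemma sw_RU_lin [lins]: "lin r (scl U) g \<Longrightarrow> bilin (scl U) (scl H) s F \<Longrightarrow> lin r s (\<lambda>x. sw U H (RU (g x)) F)"
  by (rule lin_sw_arg[OF sU sH RU_lin RU_closed])

text \<open>The coaction refers to a chosen representation of its argument in
  \<open>A \<boxtimes> B\<close>. As its formula is bilinear in the two legs, it can be evaluated on
  a pure tensor without knowing that choice.\<close>

lemma sw_LU:
  assumes F: "bilin (scl H) (scl U) s F"
  shows "sw H U (LU (a \<natural> b)) F = sL b (\<lambda>b1 b0. F b1 (a \<natural> b0))"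
proof -
  have b: "bilin (scl A) (scl B) (scl (H \<boxtimes> U)) (\<lambda>a b. sL b (\<lambda>b1 b0. tpt H U b1 (a \<natural> b0)))"
    by (rule sU lins)+
  have "LU (a \<natural> b) = sL b (\<lambda>b1 b0. tpt H U b1 (a \<natural> b0))"
    unfolding LU_eq prU sw_tpt[OF sA sB b] by (simp only: tap_pr[OF sB] tpt_pr(1)[OF sA])
  then have "sw H U (LU (a \<natural> b)) F = sL b (\<lambda>b1 b0. F (pr H b1) (a \<natural> b0))"
    using sw_sw[OF sH sU F lam_closed[of b] tpt_closed[OF sH sU], of "\<lambda>b1 b0. b1" "\<lambda>b1 b0. a \<natural> b0"]
    by (simp add: sw_tpt[OF sH sU F] prU)
  also have "\<dots> = sL b (\<lambda>b1 b0. F b1 (a \<natural> b0))"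
    by (rule sw_cong[OF lam_closed]) (simp add: pr_spec sH)
  finally show ?thesis .
qed

lemma sw_RU:
  assumes F: "bilin (scl U) (scl H) s F"
  shows "sw U H (RU (a \<natural> b)) F = sR a (\<lambda>a0 a1. F (a0 \<natural> b) a1)"
proof -
  have b: "bilin (scl A) (scl B) (scl (U \<boxtimes> H)) (\<lambda>a b. sR a (\<lambda>a0 a1. tpt U H (a0 \<natural> b) a1))"
    by (rule sU lins)+
  have "RU (a \<natural> b) = sR a (\<lambda>a0 a1. tpt U H (a0 \<natural> b) a1)"
    unfolding RU_eq prU sw_tpt[OF sA sB b] by (simp only: tap_pr[OF sA] tpt_pr(2)[OF sB])
  then have "sw U H (RU (a \<natural> b)) F = sR a (\<lambda>a0 a1. F (a0 \<natural> b) (pr H a1))"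
    using sw_sw[OF sU sH F R_closed[of a] tpt_closed[OF sU sH], of "\<lambda>a0 a1. a0 \<natural> b" "\<lambda>a0 a1. a1"]
    by (simp add: sw_tpt[OF sU sH F] prU)
  also have "\<dots> = sR a (\<lambda>a0 a1. F (a0 \<natural> b) a1)"
    by (rule sw_cong[OF R_closed]) (simp add: pr_spec sH)
  finally show ?thesis .
qed

abbreviation \<Phi>\<rho>U where "\<Phi>\<rho>U \<equiv> tensor_rreassoc H A B \<Phi>\<rho>"
abbreviation \<Phi>lU where "\<Phi>lU \<equiv> tensor_lreassoc H A B \<Phi>l"

lemma rreassoc_closed: "t \<in> carrier (A \<boxtimes> H \<boxtimes> H) \<Longrightarrow> tensor_rreassoc H A B t \<in> carrier (U \<boxtimes> H \<boxtimes> H)"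
  unfolding tensor_rreassoc_def
  by (rule sw3_closed[OF kspace_tensor[OF UH]], assumption)
    (simp add: pt3_closed pt_closed monoid.one_closed[OF kalgebraD(2)[OF kB]])

lemma lreassoc_closed: "t \<in> carrier (H \<boxtimes> H \<boxtimes> B) \<Longrightarrow> tensor_lreassoc H A B t \<in> carrier (H \<boxtimes> H \<boxtimes> U)"
  unfolding tensor_lreassoc_def
  by (rule sw3_closed[OF kspace_tensor[OF sHH]], assumption)
    (simp add: pt3_closed pt_closed monoid.one_closed[OF kalgebraD(2)[OF kA]])

lemma sw3_rreassoc:
  assumes t: "t \<in> carrier (A \<boxtimes> H \<boxtimes> H)" and F: "trilin (scl U) (scl H) (scl H) s F"
  shows "sw3 U H H (tensor_rreassoc H A B t) F = sw3 A H H t (\<lambda>x y z. F (x \<natural> \<one>\<^bsub>B\<^esub>) y z)"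
  unfolding tensor_rreassoc_def
  by (rule trans[OF sw3_sw3[OF sU sH sH F t] sw3_cong[OF t]])
    (simp_all add: pt3_closed pt_closed monoid.one_closed[OF kalgebraD(2)[OF kB]] sw3_pt3[OF sU sH sH F] tpt_pt[OF sA sB]
      tpt_closed[OF sA sB])

lemma sw3_lreassoc:
  assumes t: "t \<in> carrier (H \<boxtimes> H \<boxtimes> B)" and F: "trilin (scl H) (scl H) (scl U) s F"
  shows "sw3 H H U (tensor_lreassoc H A B t) F = sw3 H H B t (\<lambda>x y z. F x y (\<one>\<^bsub>A\<^esub> \<natural> z))"
  unfolding tensor_lreassoc_def
  by (rule trans[OF sw3_sw3[OF sH sH sU F t] sw3_cong[OF t]])
    (simp_all add: pt3_closed pt_closed monoid.one_closed[OF kalgebraD(2)[OF kA]] sw3_pt3[OF sH sH sU F] tpt_pt[OF sA sB]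
      tpt_closed[OF sA sB])

text \<open>\<Omega> contains the inverse of the left reassociator of \<open>U\<close>. Since
  inserting the unit of \<open>A\<close> is an algebra map, that inverse is obtained by inserting
  the unit into the inverse of \<Phi>l.\<close>

lemma lreassoc_mult:
  assumes s: "s \<in> carrier (H \<boxtimes> H \<boxtimes> B)" and t: "t \<in> carrier (H \<boxtimes> H \<boxtimes> B)"
  shows "tensor_lreassoc H A B s \<otimes>\<^bsub>H \<boxtimes> H \<boxtimes> U\<^esub> tensor_lreassoc H A B t =
    tensor_lreassoc H A B (s \<otimes>\<^bsub>H \<boxtimes> H \<boxtimes> B\<^esub> t)"
proof (rule tens3_eqI[OF sH sH sU])
  let ?f = "tensor_lreassoc H A B"
  note F = tpt3_trilin[OF sH sH sU]
  note l = sU lin_tri[OF F] lins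
  note st = tensor_mult_closed[OF kHH kB s t]
  show "?f s \<otimes>\<^bsub>H \<boxtimes> H \<boxtimes> U\<^esub> ?f t \<in> carrier (H \<boxtimes> H \<boxtimes> U)"
    by (rule tensor_mult_closed[OF kHH kU lreassoc_closed[OF s] lreassoc_closed[OF t]])
  show "?f (s \<otimes>\<^bsub>H \<boxtimes> H \<boxtimes> B\<^esub> t) \<in> carrier (H \<boxtimes> H \<boxtimes> U)"
    by (rule lreassoc_closed[OF st])
  have q1: "trilin (scl H) (scl H) (scl U) (scl (H \<boxtimes> H \<boxtimes> U)) (\<lambda>x' y' z'. tpt3 H H U (x \<cdot> x') (y \<cdot> y') (z \<circ>\<^sub>U z'))" for x y z
    by (rule l)+
  have q2: "trilin (scl H) (scl H) (scl U) (scl (H \<boxtimes> H \<boxtimes> U)) (\<lambda>x y z. sw3 H H B t (\<lambda>x' y' z'. tpt3 H H U (x \<cdot> x') (y \<cdot> y') (z \<circ>\<^sub>U (\<one>\<^bsub>A\<^esub> \<natural> z'))))"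
    by (rule l)+
  have q3: "trilin (scl H) (scl H) (scl B) (scl (H \<boxtimes> H \<boxtimes> U)) (\<lambda>x y z. tpt3 H H U x y (\<one>\<^bsub>A\<^esub> \<natural> z))"
    by (rule l)+
  show "sw3 H H U (?f s \<otimes>\<^bsub>H \<boxtimes> H \<boxtimes> U\<^esub> ?f t) (tpt3 H H U) = sw3 H H U (?f (s \<otimes>\<^bsub>H \<boxtimes> H \<boxtimes> B\<^esub> t)) (tpt3 H H U)"
    by (simp only: sw3_mult[OF kH kH kU lreassoc_closed[OF s] lreassoc_closed[OF t] F],
        simp only: sw3_lreassoc[OF t q1], simp only: sw3_lreassoc[OF s q2],
        simp only: sw3_lreassoc[OF st F] sw3_mult[OF kH kH kB s t q3] U_mult tmul_one[OF kA] pr_one[OF kA])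
qed

lemma lreassoc_one: "tensor_lreassoc H A B \<one>\<^bsub>H \<boxtimes> H \<boxtimes> B\<^esub> = \<one>\<^bsub>H \<boxtimes> H \<boxtimes> U\<^esub>"
proof (rule tens3_eqI[OF sH sH sU])
  note F = tpt3_trilin[OF sH sH sU]
  note l = sU lin_tri[OF F] lins
  note o = one_tensor_closed[OF kHH kB]
  have q3: "trilin (scl H) (scl H) (scl B) (scl (H \<boxtimes> H \<boxtimes> U)) (\<lambda>x y z. tpt3 H H U x y (\<one>\<^bsub>A\<^esub> \<natural> z))"
    by (rule l)+
  show "tensor_lreassoc H A B \<one>\<^bsub>H \<boxtimes> H \<boxtimes> B\<^esub> \<in> carrier (H \<boxtimes> H \<boxtimes> U)" by (rule lreassoc_closed[OF o])
  show "\<one>\<^bsub>H \<boxtimes> H \<boxtimes> U\<^esub> \<in> carrier (H \<boxtimes> H \<boxtimes> U)" by (rule one_tensor_closed[OF kHH kU])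
  show "sw3 H H U (tensor_lreassoc H A B \<one>\<^bsub>H \<boxtimes> H \<boxtimes> B\<^esub>) (tpt3 H H U) = sw3 H H U \<one>\<^bsub>H \<boxtimes> H \<boxtimes> U\<^esub> (tpt3 H H U)"
    by (simp only: sw3_lreassoc[OF o F] sw3_one[OF kH kH kB q3] sw3_one[OF kH kH kU F] oneU)
qed

lemma lreassoc_inv: "inv\<^bsub>H \<boxtimes> H \<boxtimes> U\<^esub> \<Phi>lU = tensor_lreassoc H A B \<Phi>l'"
proof -
  interpret T: monoid "H \<boxtimes> H \<boxtimes> U" by (rule monoid_tensor[OF kHH kU])
  show ?thesis
    by (rule T.inv_unique'[symmetric])
      (simp_all only: lreassoc_closed l_closed lreassoc_mult lreassoc_one
        monoid.Units_r_inv[OF mB3 \<Phi>l_unit] monoid.Units_l_inv[OF mB3 \<Phi>l_unit])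
qed

lemma lrreassoc_inv: "inv\<^bsub>H \<boxtimes> U \<boxtimes> H\<^esub> (tensor_lrreassoc H A B) = \<one>\<^bsub>H \<boxtimes> U \<boxtimes> H\<^esub>"
proof -
  interpret T: monoid "H \<boxtimes> U \<boxtimes> H" by (rule monoid_tensor[OF kalgebra_tensor[OF kH kU] kH])
  have "tensor_lrreassoc H A B = \<one>\<^bsub>H \<boxtimes> U \<boxtimes> H\<^esub>"
    by (simp add: tensor_lrreassoc_def pt3_def tensor_def)
  then show ?thesis by simp
qed

end

lemma lin_quint:
  assumes "quintlin s1 s2 s3 s4 s5 s F"
  shows "lin r s1 f \<Longrightarrow> lin r s (\<lambda>x. F (f x) b c d e)" "lin r s2 g \<Longrightarrow> lin r s (\<lambda>x. F a (g x) c d e)"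
    "lin r s3 h \<Longrightarrow> lin r s (\<lambda>x. F a b (h x) d e)" "lin r s4 i \<Longrightarrow> lin r s (\<lambda>x. F a b c (i x) e)"
    "lin r s5 j \<Longrightarrow> lin r s (\<lambda>x. F a b c d (j x))"
  using assms lin_comp[of s1 s "\<lambda>x. F x b c d e" r f] lin_comp[of s2 s "\<lambda>y. F a y c d e" r g]
    lin_comp[of s3 s "\<lambda>z. F a b z d e" r h] lin_comp[of s4 s "\<lambda>u. F a b c u e" r i]
    lin_comp[of s5 s "F a b c d" r j] by (simp_all add: quintlin_def)

section \<open>Evaluation of \<Omega> and of the diagonal product\<close>

context crossed
begin

abbreviation Om where
  "Om \<equiv> diag_Omega H U (tensor_lcoact H A B lam) (tensor_rcoact H A B \<rho>) \<Phi>lU \<Phi>\<rho>U (tensor_lrreassoc H A B)"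

lemma LU_conv: "w \<in> carrier U \<Longrightarrow> tensor_lcoact H A B lam w = LU w"
  and RU_conv: "w \<in> carrier U \<Longrightarrow> tensor_rcoact H A B \<rho> w = RU w"
  by (simp_all add: LU_def RU_def pr_spec sU)

lemma \<Delta>_conv: "h \<in> carrier H \<Longrightarrow> comul H h = \<Delta> h"
  by (simp add: tap_def pr_spec sH)

lemma Si_conv: "h \<in> carrier H \<Longrightarrow> antipode_inv H h = Si h"
  by (simp add: tap_def pr_spec sH)

lemma twist_closed: "twist \<in> carrier HH"
  using pr_spec(2)[OF sHH, of twist] by (simp only: pr_twist)

lemmas conv = tmul_mult[OF kH] tmul_mult[OF kU] tmul_closed[OF kH] tmul_closed[OF kU] Si_conv Si_closed

context
  fixes s :: "'k \<Rightarrow> 'z::ab_group_add \<Rightarrow> 'z" and F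
  assumes F: "quintlin (scl H) (scl H) (scl U) (scl H) (scl H) s F"
begin

text \<open>
  Keeping membership and value together allows the nested sum \<open>\<Omega>\<close> to be evaluated with one rule
  per summation sign.
\<close>

private definition ok where
  "ok e v \<longleftrightarrow> e \<in> carrier (H \<boxtimes> H \<boxtimes> U \<boxtimes> H \<boxtimes> H) \<and> sw5 H H U H H e F = v"

private lemmas T5k = kspace_tensor[OF kspace_tensor[OF kspace_tensor[OF sHH, of U], of H], of H]
private lemmas F5 = sH sH sU sH sH F

private lemma ok_sw:
  assumes "t = t'" "t' \<in> carrier (C \<boxtimes> D)" "\<And>x y. x \<in> carrier C \<Longrightarrow> y \<in> carrier D \<Longrightarrow> ok (G x y) (G' x y)"
  shows "ok (sw C D t G) (sw C D t' G')"
  unfolding ok_def assms(1)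
  by (intro conjI sw_closed[OF T5k assms(2)] trans[OF sw5_sw[OF F5 assms(2)] sw_cong[OF assms(2)]])
    (use assms(3) in \<open>simp_all add: ok_def\<close>)

private lemma ok_sw3:
  assumes "t = t'" "t' \<in> carrier (C \<boxtimes> D \<boxtimes> E)"
    "\<And>x y z. x \<in> carrier C \<Longrightarrow> y \<in> carrier D \<Longrightarrow> z \<in> carrier E \<Longrightarrow> ok (G x y z) (G' x y z)"
  shows "ok (sw3 C D E t G) (sw3 C D E t' G')"
  unfolding ok_def assms(1)
  by (intro conjI sw3_closed[OF T5k assms(2)] trans[OF sw5_sw3[OF F5 assms(2)] sw3_cong[OF assms(2)]])
    (use assms(3) in \<open>simp_all add: ok_def\<close>)

private lemma ok_pt5:
  assumes "a = a' \<and> a' \<in> carrier H" "b = b' \<and> b' \<in> carrier H" "c = c' \<and> c' \<in> carrier U"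
    "d = d' \<and> d' \<in> carrier H" "e = e' \<and> e' \<in> carrier H"
  shows "ok (pt5 H H U H H a b c d e) (F a' b' c' d' e')"
  using assms by (simp add: ok_def pt5_closed sw5_pt5[OF F5])

private lemma ok_Omega: "ok Om (sw3 U H H \<Phi>\<rho>U (\<lambda>X1 X2 X3. sw H U (LU X1) (\<lambda>h v. sD h (\<lambda>h1 h2.
    sw3 H H U (tensor_lreassoc H A B \<Phi>l') (\<lambda>x1 x2 x3. sw3 H U H \<one>\<^bsub>H \<boxtimes> U \<boxtimes> H\<^esub> (\<lambda>t1 t2 t3.
    sw H U (LU t2) (\<lambda>g w. sw H H twist (\<lambda>f1 f2. F (h1 \<cdot> x1 \<cdot> t1) (h2 \<cdot> x2 \<cdot> g) (v \<circ>\<^sub>U x3 \<circ>\<^sub>U w)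
      (Si (f1 \<cdot> X2 \<cdot> t3)) (Si (f2 \<cdot> X3))))))))))"
  unfolding diag_Omega_def Let_def
  by (rule ok_sw3[OF refl rreassoc_closed[OF X_closed(1)]], rule ok_sw[OF LU_conv LU_closed], assumption,
      rule ok_sw[OF \<Delta>_conv \<Delta>_closed], assumption,
      rule ok_sw3[OF lreassoc_inv lreassoc_closed[OF l_closed(2)]],
      rule ok_sw3[OF lrreassoc_inv one_tensor_closed[OF kalgebra_tensor[OF kH kU] kH]],
      rule ok_sw[OF LU_conv LU_closed], assumption, rule ok_sw[OF drinfeld_twist_eq twist_closed],
      rule ok_pt5)
    (simp_all add: conv)

lemma Omega_closed: "Om \<in> carrier (H \<boxtimes> H \<boxtimes> U \<boxtimes> H \<boxtimes> H)"
  using ok_Omega by (simp add: ok_def)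

text \<open>The left coaction of X^1 \<otimes> 1 sees only the unit of B, and the mixed reassociator
  is 1. All sums in \<Omega> except those over \<Phi>\<rho>, over the inverse of \<Phi>l and over f
  therefore run over units.\<close>

lemma sw5_Omega:
  "sw5 H H U H H Om F = sX (\<lambda>X1 X2 X3. sl (\<lambda>l1 l2 l3. sw H H twist (\<lambda>f1 f2.
    F (pr H l1) (pr H l2) (X1 \<natural> l3) (Si (f1 \<cdot> X2)) (Si (f2 \<cdot> X3)))))"
proof -
  have vs: "vector_space s" using F linD(2)[of "scl H" s "F undefined undefined undefined undefined"]
    by (simp add: quintlin_def)
  note l = lin_quint[OF F] kU sU vs lins
  note lam_one = sw_tap_one[OF lam_hom kB kH kB]
  have "sw5 H H U H H Om F = sw3 U H H \<Phi>\<rho>U (\<lambda>X1 X2 X3. sw H U (LU X1) (\<lambda>h v. sD h (\<lambda>h1 h2.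
    sw3 H H U (tensor_lreassoc H A B \<Phi>l') (\<lambda>x1 x2 x3. sw3 H U H \<one>\<^bsub>H \<boxtimes> U \<boxtimes> H\<^esub> (\<lambda>t1 t2 t3.
    sw H U (LU t2) (\<lambda>g w. sw H H twist (\<lambda>f1 f2. F (h1 \<cdot> x1 \<cdot> t1) (h2 \<cdot> x2 \<cdot> g) (v \<circ>\<^sub>U x3 \<circ>\<^sub>U w)
      (Si (f1 \<cdot> X2 \<cdot> t3)) (Si (f2 \<cdot> X3)))))))))"
    using ok_Omega by (simp add: ok_def)
  also have "\<dots> = sX (\<lambda>X1 X2 X3. sl (\<lambda>x1 x2 x3. sw H H twist (\<lambda>f1 f2.
    F (uH \<cdot> x1 \<cdot> uH) (uH \<cdot> x2 \<cdot> uH) ((X1 \<natural> \<one>\<^bsub>B\<^esub>) \<circ>\<^sub>U (\<one>\<^bsub>A\<^esub> \<natural> x3) \<circ>\<^sub>U (\<one>\<^bsub>A\<^esub> \<natural> \<one>\<^bsub>B\<^esub>))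
      (Si (f1 \<cdot> X2 \<cdot> uH)) (Si (f2 \<cdot> X3)))))"
    \<comment> \<open>The order is forced by \<open>sw_LU\<close>, which needs a pure tensor:
      \<open>t2\<close> becomes one through the unit of the mixed reassociator, \<open>X1\<close>
      only after the right reassociator of \<open>U\<close> has been opened.\<close>
    apply (subst sw3_one[OF kH kU kH, where s = s], (rule l)+, unfold oneU)
    apply (subst sw_LU[where s = s], (rule l)+)
    apply (subst lam_one[where s = s], (rule l)+)
    apply (subst sw3_lreassoc[OF l_closed(2), where s = s], (rule l)+)
    apply (subst sw3_rreassoc[OF X_closed(1), where s = s], (rule l)+)
    apply (subst sw_LU[where s = s], (rule l)+)
    apply (subst lam_one[where s = s], (rule l)+)
    apply (subst \<Delta>_one[where s = s], (rule l)+)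
    apply (rule refl)
    done
  finally show ?thesis
    by (simp only: U_mult tmul_one[OF kA] tmul_pr[OF kA] pr_pr[OF sA] tmul_one[OF kB] tmul_pr[OF kB] pr_pr[OF sB]
        tpt_pr(1)[OF sA, of B] tpt_pr(2)[OF sB, of A] one_simps Si_pr)
qed

end

text \<open>The diagonal product of two pure tensors in which \<Omega> has already been evaluated;
  \<open>w\<close> and \<open>w'\<close> are still arbitrary elements of \<open>U\<close>.\<close>

definition N where
  "N x w x' w' = sX (\<lambda>X1 X2 X3. sl (\<lambda>l1 l2 l3. sw H H twist (\<lambda>f1 f2.
    sw U H (RU w) (\<lambda>u0 u1. sw H U (LU u0) (\<lambda>m u00. tpt P U
      (Ra (L l1 x) (Si (f2 \<cdot> X3)) \<ast> Ra (L (l2 \<cdot> m) x') (Si u1 \<cdot> Si (f1 \<cdot> X2)))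
      ((X1 \<natural> l3) \<circ>\<^sub>U u00 \<circ>\<^sub>U w'))))))"

lemma N_lin [lins]:
  "lin r (scl P) f \<Longrightarrow> lin r (scl (P \<boxtimes> U)) (\<lambda>y. N (f y) w x' w')"
  "lin r (scl U) g \<Longrightarrow> lin r (scl (P \<boxtimes> U)) (\<lambda>y. N x (g y) x' w')"
  "lin r (scl P) f \<Longrightarrow> lin r (scl (P \<boxtimes> U)) (\<lambda>y. N x w (f y) w')"
  "lin r (scl U) g \<Longrightarrow> lin r (scl (P \<boxtimes> U)) (\<lambda>y. N x w x' (g y))"
  unfolding N_def by (rule sU lins | assumption)+

lemma N_tpt:
  "N x (a \<natural> b) x' (a' \<natural> b') = sX (\<lambda>X1 X2 X3. sl (\<lambda>l1 l2 l3. sw H H twist (\<lambda>f1 f2.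
    sR a (\<lambda>a0 a1. sL b (\<lambda>b1 b0. tpt P U
      (Ra (L l1 x) (Si (f2 \<cdot> X3)) \<ast> Ra (L (l2 \<cdot> b1) x') (Si (f1 \<cdot> X2 \<cdot> a1)))
      (X1 \<bullet> a0 \<bullet> a' \<natural> l3 \<circ>\<^sub>B b0 \<circ>\<^sub>B b'))))))"
proof -
  have "N x (a \<natural> b) x' (a' \<natural> b') = sX (\<lambda>X1 X2 X3. sl (\<lambda>l1 l2 l3. sw H H twist (\<lambda>f1 f2.
    sR a (\<lambda>a0 a1. sw H U (LU (a0 \<natural> b)) (\<lambda>m u00. tpt P U
      (Ra (L l1 x) (Si (f2 \<cdot> X3)) \<ast> Ra (L (l2 \<cdot> m) x') (Si a1 \<cdot> Si (f1 \<cdot> X2)))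
      ((X1 \<natural> l3) \<circ>\<^sub>U u00 \<circ>\<^sub>U (a' \<natural> b')))))))"
    unfolding N_def by (subst sw_RU[where s = "scl (P \<boxtimes> U)"]) ((rule sU lins)+, rule refl)
  also have "\<dots> = sX (\<lambda>X1 X2 X3. sl (\<lambda>l1 l2 l3. sw H H twist (\<lambda>f1 f2.
    sR a (\<lambda>a0 a1. sL b (\<lambda>b1 b0. tpt P U
      (Ra (L l1 x) (Si (f2 \<cdot> X3)) \<ast> Ra (L (l2 \<cdot> b1) x') (Si a1 \<cdot> Si (f1 \<cdot> X2)))
      ((X1 \<natural> l3) \<circ>\<^sub>U (a0 \<natural> b0) \<circ>\<^sub>U (a' \<natural> b')))))))"
    by (subst sw_LU[where s = "scl (P \<boxtimes> U)"]) ((rule sU lins)+, rule refl)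
  finally show ?thesis by (simp only: U_mult Si_mult[symmetric])
qed

abbreviation C2 where
  "C2 \<equiv> diag_crossed_product H P U (tensor_lcoact H A B lam) (tensor_rcoact H A B \<rho>) \<Phi>lU \<Phi>\<rho>U (tensor_lrreassoc H A B)"

lemma C2_simps: "carrier C2 = carrier (P \<boxtimes> U)" "scl C2 = scl (P \<boxtimes> U)" "one C2 = pt P U \<one>\<^bsub>P\<^esub> \<one>\<^bsub>U\<^esub>"
  by (simp_all add: diag_crossed_product_def)

lemma C2_mult:
  assumes s: "s \<in> carrier (P \<boxtimes> U)" and t: "t \<in> carrier (P \<boxtimes> U)"
  shows "s \<otimes>\<^bsub>C2\<^esub> t = sw P U s (\<lambda>x w. sw P U t (\<lambda>x' w'. N x w x' w'))"
proof -
  have "s \<otimes>\<^bsub>C2\<^esub> t = sw P U s (\<lambda>x w. sw P U t (\<lambda>x' w'. sw5 H H U H H Om (\<lambda>o1 o2 o3 o4 o5.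
         sw U H (tensor_rcoact H A B \<rho> w) (\<lambda>u0 u1. sw H U (tensor_lcoact H A B lam u0) (\<lambda>u0m u00.
           pt P U (ract P (lact P o1 x) o5 \<otimes>\<^bsub>P\<^esub> ract P (lact P (o2 \<otimes>\<^bsub>H\<^esub> u0m) x') (antipode_inv H u1 \<otimes>\<^bsub>H\<^esub> o4))
             (o3 \<otimes>\<^bsub>U\<^esub> u00 \<otimes>\<^bsub>U\<^esub> w'))))))"
    by (simp add: diag_crossed_product_def)
  also have "\<dots> = sw P U s (\<lambda>x w. sw P U t (\<lambda>x' w'. sw5 H H U H H Om (\<lambda>o1 o2 o3 o4 o5.
         sw U H (RU w) (\<lambda>u0 u1. sw H U (LU u0) (\<lambda>u0m u00.
           tpt P U (Ra (L o1 x) o5 \<ast> Ra (L (o2 \<cdot> u0m) x') (Si u1 \<cdot> o4)) (o3 \<circ>\<^sub>U u00 \<circ>\<^sub>U w'))))))"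
  proof (rule sw_cong[OF s], rule sw_cong[OF t], rule sw5_cong[OF Omega_closed])
    \<comment> \<open>\<open>Omega_closed\<close> asks for some multilinear map, although its statement does not mention one\<close>
    show "quintlin (scl H) (scl H) (scl U) (scl H) (scl H) (*) (\<lambda>_ _ _ _ _. 0 :: 'k)"
    proof -
      have v: "vector_space ((*) :: 'k \<Rightarrow> 'k \<Rightarrow> 'k)" using vs_scl[OF kspace_base_field] by simp
      have "lin (scl H) (*) (\<lambda>_. 0 :: 'k)" by (rule linI[OF vs_scl[OF sH] v]) simp_all
      moreover have "lin (scl U) (*) (\<lambda>_. 0 :: 'k)" by (rule linI[OF vs_scl[OF sU] v]) simp_all
      ultimately show ?thesis by (simp add: quintlin_def)
    qed
  next
    fix x w x' w' o1 o2 o3 o4 o5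
    assume m: "x \<in> carrier P" "w \<in> carrier U" "x' \<in> carrier P" "w' \<in> carrier U" "o1 \<in> carrier H" "o2 \<in> carrier H"
      "o3 \<in> carrier U" "o4 \<in> carrier H" "o5 \<in> carrier H"
    show "sw U H (tensor_rcoact H A B \<rho> w) (\<lambda>u0 u1. sw H U (tensor_lcoact H A B lam u0) (\<lambda>u0m u00.
           pt P U (ract P (lact P o1 x) o5 \<otimes>\<^bsub>P\<^esub> ract P (lact P (o2 \<otimes>\<^bsub>H\<^esub> u0m) x') (antipode_inv H u1 \<otimes>\<^bsub>H\<^esub> o4))
             (o3 \<otimes>\<^bsub>U\<^esub> u00 \<otimes>\<^bsub>U\<^esub> w'))) = sw U H (RU w) (\<lambda>u0 u1. sw H U (LU u0) (\<lambda>u0m u00.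
           tpt P U (Ra (L o1 x) o5 \<ast> Ra (L (o2 \<cdot> u0m) x') (Si u1 \<cdot> o4)) (o3 \<circ>\<^sub>U u00 \<circ>\<^sub>U w')))"
      unfolding RU_conv[OF m(2)]
    proof (rule sw_cong[OF RU_closed])
      fix u0 u1 assume u: "u0 \<in> carrier U" "u1 \<in> carrier H"
      show "sw H U (tensor_lcoact H A B lam u0) (\<lambda>u0m u00.
           pt P U (ract P (lact P o1 x) o5 \<otimes>\<^bsub>P\<^esub> ract P (lact P (o2 \<otimes>\<^bsub>H\<^esub> u0m) x') (antipode_inv H u1 \<otimes>\<^bsub>H\<^esub> o4))
             (o3 \<otimes>\<^bsub>U\<^esub> u00 \<otimes>\<^bsub>U\<^esub> w')) = sw H U (LU u0) (\<lambda>u0m u00.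
           tpt P U (Ra (L o1 x) o5 \<ast> Ra (L (o2 \<cdot> u0m) x') (Si u1 \<cdot> o4)) (o3 \<circ>\<^sub>U u00 \<circ>\<^sub>U w'))"
        unfolding LU_conv[OF u(1)]
        by (rule sw_cong[OF LU_closed]) (use m u in \<open>simp add: conv act_eq act_closed tpt_pt[OF sPP sU]\<close>)
    qed
  qed
  also have "\<dots> = sw P U s (\<lambda>x w. sw P U t (\<lambda>x' w'. N x w x' w'))"
  proof -
    have q: "quintlin (scl H) (scl H) (scl U) (scl H) (scl H) (scl (P \<boxtimes> U)) (\<lambda>o1 o2 o3 o4 o5.
         sw U H (RU w) (\<lambda>u0 u1. sw H U (LU u0) (\<lambda>u0m u00.
           tpt P U (Ra (L o1 x) o5 \<ast> Ra (L (o2 \<cdot> u0m) x') (Si u1 \<cdot> o4)) (o3 \<circ>\<^sub>U u00 \<circ>\<^sub>U w'))))" for x w x' w'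
      by (rule sU lins)+
    show ?thesis by (simp only: sw5_Omega[OF q] act_pr tmul_pr[OF kH] N_def)
  qed
  finally show ?thesis .
qed

section \<open>Evaluation of the two-sided product\<close>

abbreviation C1 where "C1 \<equiv> two_sided_crossed_product H A \<rho> \<Phi>\<rho> P B lam \<Phi>l"

lemma C1_simps: "carrier C1 = carrier (A \<boxtimes> P \<boxtimes> B)" "scl C1 = scl (A \<boxtimes> P \<boxtimes> B)"
  "one C1 = pt3 A P B \<one>\<^bsub>A\<^esub> \<one>\<^bsub>P\<^esub> \<one>\<^bsub>B\<^esub>"
  by (simp_all add: two_sided_crossed_product_def)

definition M where
  "M a x b a' x' b' = sR a' (\<lambda>a'0 a'1. sL b (\<lambda>b1 b0. sX' (\<lambda>r1 r2 r3. sl (\<lambda>l1 l2 l3.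
    tpt3 A P B (a \<bullet> a'0 \<bullet> r1) (Ra (L l1 x) (a'1 \<cdot> r2) \<ast> Ra (L (l2 \<cdot> b1) x') r3) (l3 \<circ>\<^sub>B b0 \<circ>\<^sub>B b')))))"

lemma M_closed: "M a x b a' x' b' \<in> carrier (A \<boxtimes> P \<boxtimes> B)"
  unfolding M_def
  by (intro sw_closed sw3_closed kspace_tensor sA R_closed lam_closed X_closed l_closed tpt3_closed sPP sB)

lemma C1_mult:
  assumes s: "s \<in> carrier (A \<boxtimes> P \<boxtimes> B)" and t: "t \<in> carrier (A \<boxtimes> P \<boxtimes> B)"
  shows "s \<otimes>\<^bsub>C1\<^esub> t = sw3 A P B s (\<lambda>a x b. sw3 A P B t (\<lambda>a' x' b'. M a x b a' x' b'))"
proof -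
  have "s \<otimes>\<^bsub>C1\<^esub> t = sw3 A P B s (\<lambda>a x b. sw3 A P B t (\<lambda>a' x' b'.
         sw A H (\<rho> a') (\<lambda>a'0 a'1. sw H B (lam b) (\<lambda>b1 b0. sX' (\<lambda>r1 r2 r3. sl (\<lambda>l1 l2 l3.
           pt3 A P B (a \<otimes>\<^bsub>A\<^esub> a'0 \<otimes>\<^bsub>A\<^esub> r1)
             (ract P (lact P l1 x) (a'1 \<otimes>\<^bsub>H\<^esub> r2) \<otimes>\<^bsub>P\<^esub> ract P (lact P (l2 \<otimes>\<^bsub>H\<^esub> b1) x') r3)
             (l3 \<otimes>\<^bsub>B\<^esub> b0 \<otimes>\<^bsub>B\<^esub> b')))))))"
    by (simp add: two_sided_crossed_product_def)
  also have "\<dots> = sw3 A P B s (\<lambda>a x b. sw3 A P B t (\<lambda>a' x' b'. M a x b a' x' b'))"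
  proof (rule sw3_cong[OF s], rule sw3_cong[OF t])
    fix a x b a' x' b'
    assume m: "a \<in> carrier A" "x \<in> carrier P" "b \<in> carrier B" "a' \<in> carrier A" "x' \<in> carrier P" "b' \<in> carrier B"
    have e: "\<rho> a' = R a'" "lam b = tap B lam b" using m by (simp_all add: tap_def pr_spec sA sB)
    show "sw A H (\<rho> a') (\<lambda>a'0 a'1. sw H B (lam b) (\<lambda>b1 b0. sX' (\<lambda>r1 r2 r3. sl (\<lambda>l1 l2 l3.
           pt3 A P B (a \<otimes>\<^bsub>A\<^esub> a'0 \<otimes>\<^bsub>A\<^esub> r1)
             (ract P (lact P l1 x) (a'1 \<otimes>\<^bsub>H\<^esub> r2) \<otimes>\<^bsub>P\<^esub> ract P (lact P (l2 \<otimes>\<^bsub>H\<^esub> b1) x') r3)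
             (l3 \<otimes>\<^bsub>B\<^esub> b0 \<otimes>\<^bsub>B\<^esub> b'))))) = M a x b a' x' b'"
      unfolding M_def e
      by (intro sw_cong[OF R_closed] sw_cong[OF lam_closed] sw3_cong[OF X_closed(2)] sw3_cong[OF l_closed(2)])
        (use m in \<open>simp add: tmul_mult kA kB kH tmul_closed act_eq act_closed pt3_def tpt3_def tpt_pt
          tpt_closed kspace_tensor sA sPP sB\<close>)
  qed
  finally show ?thesis .
qed

section \<open>The isomorphism\<close>

abbreviation T where "T \<equiv> A \<boxtimes> P \<boxtimes> B"
lemmas sT = kspace_tensor[OF kspace_tensor[OF sA, of P], of B]
lemmas sPU = kspace_tensor[OF sPP, of U]

definition th where
  "th a x b = sR a (\<lambda>a0 a1. sX' (\<lambda>t1 t2 t3.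
    tpt P U (Ra x (Si (a1 \<cdot> t2 \<cdot> be \<cdot> S t3))) (a0 \<bullet> t1 \<natural> b)))"

definition ps where
  "ps x a b = sX (\<lambda>X1 X2 X3. sR a (\<lambda>a0 a1.
    tpt3 A P B (X1 \<bullet> a0) (Ra x (Si (S (X2 \<cdot> a1) \<cdot> al \<cdot> X3))) b))"

definition Th where "Th t = sw3 A P B t th"
text \<open>The leg in \<open>U\<close> must itself be resolved into pure tensors;
  \<open>pr U\<close> makes this inner sum linear in \<open>w\<close> on the whole type.\<close>

definition Ps where "Ps t = sw P U t (\<lambda>x w. sw A B (pr U w) (\<lambda>a b. ps x a b))"

lemma tpt3_lin [lins]:
  "lin s (scl A) f \<Longrightarrow> lin s (scl T) (\<lambda>y. tpt3 A P B (f y) x b)"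
  "lin s (scl P) g \<Longrightarrow> lin s (scl T) (\<lambda>y. tpt3 A P B a (g y) b)"
  "lin s (scl B) h \<Longrightarrow> lin s (scl T) (\<lambda>y. tpt3 A P B a x (h y))"
  unfolding tpt3_def by (rule kspace_tensor sA sPP sB lins | assumption)+

lemma th_trilin: "trilin (scl A) (scl P) (scl B) (scl (P \<boxtimes> U)) th"
  unfolding th_def by (rule sU lins)+

lemma ps_lin [lins]:
  "lin s (scl P) f \<Longrightarrow> lin s (scl T) (\<lambda>y. ps (f y) a b)"
  "lin s (scl A) g \<Longrightarrow> lin s (scl T) (\<lambda>y. ps x (g y) b)"
  "lin s (scl B) h \<Longrightarrow> lin s (scl T) (\<lambda>y. ps x a (h y))"
  unfolding ps_def by (rule sT lins | assumption)+

lemma th_closed: "th a x b \<in> carrier (P \<boxtimes> U)"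
  unfolding th_def by (intro sw_closed[OF sPU] sw3_closed[OF sPU] R_closed X_closed tpt_closed sPP sU)

lemma ps_closed: "ps x a b \<in> carrier T"
  unfolding ps_def by (intro sw_closed[OF sT] sw3_closed[OF sT] R_closed X_closed tpt3_closed sA sPP sB)

lemma ps_bilin: "bilin (scl A) (scl B) (scl T) (ps x)"
  by (rule lins sA sB vs_scl)+

lemma sw_ps_bilin: "bilin (scl P) (scl U) (scl T) (\<lambda>x w. sw A B (pr U w) (\<lambda>a b. ps x a b))"
proof (rule bilinI)
  show "lin (scl U) (scl T) (\<lambda>w. sw A B (pr U w) (\<lambda>a b. ps x a b))" for x
    by (rule lin_sw_arg[OF sA sB pr_spec(1)[OF sU] pr_spec(2)[OF sU] ps_bilin])
qed (rule sT lins)+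

lemma Th_closed: "t \<in> carrier T \<Longrightarrow> Th t \<in> carrier (P \<boxtimes> U)"
  unfolding Th_def by (rule sw3_closed[OF sPU]) (assumption | rule th_closed)+

lemma Ps_closed: "t \<in> carrier (P \<boxtimes> U) \<Longrightarrow> Ps t \<in> carrier T"
  unfolding Ps_def by (rule sw_closed[OF sT], assumption, rule sw_closed[OF sT pr_spec(2)[OF sU] ps_closed])

section \<open>The two maps are mutually inverse\<close>

lemma sw_th:
  assumes F: "bilin (scl P) (scl U) s F"
  shows "sw P U (th a x b) F = sR a (\<lambda>a0 a1. sX' (\<lambda>t1 t2 t3.
    F (Ra x (Si (a1 \<cdot> t2 \<cdot> be \<cdot> S t3))) (a0 \<bullet> t1 \<natural> b)))"
proof -
  note c = tpt_closed[OF sPP sU]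
  show ?thesis
    unfolding th_def
    by (subst sw_sw[OF sPP sU F R_closed sw3_closed[OF sPU X_closed(2) c]])
      (simp only: sw_sw3[OF sPP sU F X_closed(2) c] sw_tpt[OF sPP sU F] act_pr prU)
qed

lemma th_pr: "th (pr A a) x b = th a x b" "th a (pr P x) b = th a x b" "th a x (pr B b) = th a x b"
  unfolding th_def by (simp_all only: R_pr act_pr tpt_pr(2)[OF sB, of A])

lemma sw3_tpt3_th: "sw3 A P B (tpt3 A P B a x b) th = th a x b"
  by (simp only: sw3_tpt3[OF sA sPP sB th_trilin] th_pr)

lemma sw3_ps_th: "sw3 A P B (ps x a b) th = tpt P U x (a \<natural> b)"
proof -
  note c = tpt3_closed[OF sA sPP sB]
  have "sw3 A P B (ps x a b) th = sX (\<lambda>X1 X2 X3. sR a (\<lambda>a0 a1.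
      th (X1 \<bullet> a0) (Ra x (Si (S (X2 \<cdot> a1) \<cdot> al \<cdot> X3))) b))"
    unfolding ps_def
    by (subst sw3_sw3[OF sA sPP sB th_trilin X_closed(1) sw_closed[OF sT R_closed c]])
      (simp only: sw3_sw[OF sA sPP sB th_trilin R_closed c] sw3_tpt3_th)
  \<comment> \<open>Two successive right actions through S^{-1} combine into one, whose argument is
    the later element times the earlier one. This order puts p before q, as in
    \<open>p_q_coact\<close>.\<close>
  also have "\<dots> = sX (\<lambda>X1 X2 X3. sR a (\<lambda>a0 a1. sR (X1 \<bullet> a0) (\<lambda>c0 c1. sX' (\<lambda>t1 t2 t3.
      tpt P U (Ra x (Si (c1 \<cdot> t2 \<cdot> be \<cdot> S t3 \<cdot> S (X2 \<cdot> a1) \<cdot> al \<cdot> X3))) (c0 \<bullet> t1 \<natural> b)))))"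
    by (simp only: th_def act_act Si_mult[symmetric] assoc)
  also have "\<dots> = tpt P U (Ra x (Si uH)) (pr A a \<natural> b)"
    by (rule p_q_coact[where s = "scl (P \<boxtimes> U)" and G = "\<lambda>m h. tpt P U (Ra x (Si h)) (m \<natural> b)"]) (rule sU lins)+
  also have "\<dots> = tpt P U x (a \<natural> b)"
    using Si_S[of uH] by (simp only: S_one pr_fix Ra_one tpt_pr(1)[OF sPP, of U] tpt_pr(1)[OF sA, of B])
  finally show ?thesis .
qed

lemma Th_Ps: "t \<in> carrier (P \<boxtimes> U) \<Longrightarrow> Th (Ps t) = t"
proof -
  assume t: "t \<in> carrier (P \<boxtimes> U)"
  have "Th (Ps t) = sw P U t (\<lambda>x w. sw A B (pr U w) (\<lambda>a b. tpt P U x (a \<natural> b)))"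
    unfolding Th_def Ps_def
    by (subst sw3_sw[OF sA sPP sB th_trilin t sw_closed[OF sT pr_spec(2)[OF sU] ps_closed]])
      (simp only: sw3_sw[OF sA sPP sB th_trilin pr_spec(2)[OF sU] ps_closed] sw3_ps_th)
  also have "\<dots> = sw P U t (tpt P U)"
  proof -
    have "sw A B (pr U w) (\<lambda>a b. tpt P U x (a \<natural> b)) = tpt P U x w" for x w
    proof -
      have l: "lin (scl U) (scl (P \<boxtimes> U)) (\<lambda>w. tpt P U x w)" by (rule sU lins)+
      have "sw A B (pr U w) (\<lambda>a b. tpt P U x (a \<natural> b)) = tpt P U x (sw A B (pr U w) (\<lambda>a b. a \<natural> b))"
        by (rule lin_out[OF l, symmetric])
      then show ?thesis
        by (simp only: sw_tpt_id[OF sA sB pr_spec(2)[OF sU]] tpt_pr(2)[OF sU])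
    qed
    then show ?thesis by (simp only:)
  qed
  finally show ?thesis by (simp only: sw_tpt_id[OF sPP sU t])
qed

lemma sw_ps: "sw A B (pr U (a \<natural> b)) (\<lambda>a b. ps x a b) = ps x a b"
proof -
  have "sw A B (pr U (a \<natural> b)) (\<lambda>a b. ps x a b) = ps x (pr A a) (pr B b)"
    by (simp only: prU sw_tpt[OF sA sB ps_bilin])
  then show ?thesis by (simp only: ps_def R_pr tpt3_def tpt_pr(2)[OF sB])
qed

lemma Ps_Th: "t \<in> carrier T \<Longrightarrow> Ps (Th t) = t"
proof -
  assume t: "t \<in> carrier T"
  have "sw P U (th a x b) (\<lambda>x w. sw A B (pr U w) (\<lambda>a b. ps x a b)) = tpt3 A P B a x b" for a x b
  proof -
    have "sw P U (th a x b) (\<lambda>x w. sw A B (pr U w) (\<lambda>a b. ps x a b)) =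
      sR a (\<lambda>a0 a1. sX' (\<lambda>t1 t2 t3. ps (Ra x (Si (a1 \<cdot> t2 \<cdot> be \<cdot> S t3))) (a0 \<bullet> t1) b))"
      by (simp only: sw_th[OF sw_ps_bilin] sw_ps)
    also have "\<dots> = sR a (\<lambda>a0 a1. sX' (\<lambda>t1 t2 t3. sX (\<lambda>X1 X2 X3. sR (a0 \<bullet> t1) (\<lambda>c0 c1.
      tpt3 A P B (X1 \<bullet> c0) (Ra x (Si (S (X2 \<cdot> c1) \<cdot> al \<cdot> X3 \<cdot> a1 \<cdot> t2 \<cdot> be \<cdot> S t3))) b))))"
      by (simp only: ps_def act_act Si_mult[symmetric] assoc)
    also have "\<dots> = tpt3 A P B (pr A a) (Ra x (Si uH)) b"
      by (rule q_p_coact[where s = "scl T" and G = "\<lambda>m h. tpt3 A P B m (Ra x (Si h)) b"]) (rule sT lins)+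
    also have "\<dots> = tpt3 A P B a x b"
      using Si_S[of uH]
      by (simp only: S_one pr_fix Ra_one tpt3_def tpt_pr(1)[OF sA, of P] tpt_pr(2)[OF sPP, of A])
    finally show ?thesis .
  qed
  then have "Ps (Th t) = sw3 A P B t (tpt3 A P B)"
    unfolding Ps_def Th_def
    by (subst sw_sw3[OF sPP sU sw_ps_bilin t th_closed]) simp
  then show ?thesis by (simp only: sw3_tpt3_id[OF sA sPP sB t])
qed

section \<open>Compatibility with products and units\<close>

lemma Th_M: "sw3 A P B (M a x b a' x' b') th =
  sR a' (\<lambda>a'0 a'1. sL b (\<lambda>b1 b0. sX' (\<lambda>r1 r2 r3. sl (\<lambda>l1 l2 l3.
    th (a \<bullet> a'0 \<bullet> r1) (Ra (L l1 x) (a'1 \<cdot> r2) \<ast> Ra (L (l2 \<cdot> b1) x') r3) (l3 \<circ>\<^sub>B b0 \<circ>\<^sub>B b')))))"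
proof -
  note c = tpt3_closed[OF sA sPP sB] and q = sA sPP sB th_trilin
  note c1 = sw3_closed[OF sT l_closed(2) c]
  note c2 = sw3_closed[OF sT X_closed(2) c1]
  note c3 = sw_closed[OF sT lam_closed c2]
  show ?thesis
    unfolding M_def
    by (simp only: sw3_sw[OF q R_closed c3] sw3_sw[OF q lam_closed c2] sw3_sw3[OF q X_closed(2) c1]
        sw3_sw3[OF q l_closed(2) c] sw3_tpt3_th)
qed

text \<open>Both sides are the same sum over \<Phi>l^{-1} and the coaction of \<open>b\<close>,
  wrapped around the two sides of \<open>twist_mult_inv\<close>. The work lies in reordering sums
  until this becomes visible.\<close>

lemma Th_mult_pure: "sw3 A P B (M a x b a' x' b') th =
  sw P U (th a x b) (\<lambda>y w. sw P U (th a' x' b') (\<lambda>y' w'. N y w y' w'))"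
proof -
  \<comment> \<open>Everything that concerns \<open>P\<close> and \<open>B\<close>, as a function of
    the element of \<open>A\<close> and of the two elements of \<open>H\<close> acting from the
    right on the factors in \<open>P\<close>.\<close>
  define F where "F = (\<lambda>m g h. sl (\<lambda>l1 l2 l3. sL b (\<lambda>b1 b0.
    tpt P U (Ra (L l1 x) g \<ast> Ra (L (l2 \<cdot> b1) x') h) (m \<natural> l3 \<circ>\<^sub>B b0 \<circ>\<^sub>B b'))))"
  have Ft: "trilin (scl A) (scl H) (scl H) (scl (P \<boxtimes> U)) F" unfolding F_def by (rule sU lins)+
  have Nb: "bilin (scl P) (scl U) (scl (P \<boxtimes> U)) (\<lambda>y w. sw P U t (\<lambda>y' w'. N y w y' w'))"
    "bilin (scl P) (scl U) (scl (P \<boxtimes> U)) (\<lambda>y' w'. N y w y' w')" for t y w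
    by (rule sU sPP vs_scl lins)+
  have "sw3 A P B (M a x b a' x' b') th =
    sR a' (\<lambda>a'0 a'1. sL b (\<lambda>b1 b0. sX' (\<lambda>r1 r2 r3. sl (\<lambda>l1 l2 l3. sR (a \<bullet> a'0 \<bullet> r1) (\<lambda>c0 c1. sX' (\<lambda>t1 t2 t3.
      sD (Si (c1 \<cdot> t2 \<cdot> be \<cdot> S t3)) (\<lambda>h1 h2. tpt P U
        (Ra (L l1 x) (a'1 \<cdot> r2 \<cdot> h1) \<ast> Ra (L (l2 \<cdot> b1) x') (r3 \<cdot> h2)) (c0 \<bullet> t1 \<natural> l3 \<circ>\<^sub>B b0 \<circ>\<^sub>B b'))))))))"
  proof -
    have o: "tpt P U (sw H H t f) w = sw H H t (\<lambda>h1 h2. tpt P U (f h1 h2) w)" for t f w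
      by (rule lin_out[where h = "\<lambda>z. tpt P U z w" and ?s1.0 = "scl P" and ?s2.0 = "scl (P \<boxtimes> U)"]) (rule sU lins)+
    show ?thesis by (simp only: Th_M th_def Ra_mult o act_act assoc)
  qed
  \<comment> \<open>From here the sums over \<Phi>l^{-1} and over the coaction of \<open>b\<close>
    travel inwards until they form \<open>F\<close>.\<close>
  also have "\<dots> = sX' (\<lambda>r1 r2 r3. sX' (\<lambda>t1 t2 t3. sl (\<lambda>l1 l2 l3. sR a' (\<lambda>a'0 a'1. sL b (\<lambda>b1 b0. sR (a \<bullet> a'0 \<bullet> r1) (\<lambda>c0 c1.
      sD (Si (c1 \<cdot> t2 \<cdot> be \<cdot> S t3)) (\<lambda>h1 h2. tpt P U
        (Ra (L l1 x) (a'1 \<cdot> r2 \<cdot> h1) \<ast> Ra (L (l2 \<cdot> b1) x') (r3 \<cdot> h2)) (c0 \<bullet> t1 \<natural> l3 \<circ>\<^sub>B b0 \<circ>\<^sub>B b'))))))))"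
    by (simp only: sw_sw3_swap) (rule arg_cong[of _ _ sX'], intro ext, rule sw3_swap)
  also have "\<dots> = sX' (\<lambda>r1 r2 r3. sX' (\<lambda>t1 t2 t3. sl (\<lambda>l1 l2 l3. sR a' (\<lambda>a'0 a'1. sR (a \<bullet> a'0 \<bullet> r1) (\<lambda>c0 c1.
      sD (Si (c1 \<cdot> t2 \<cdot> be \<cdot> S t3)) (\<lambda>h1 h2. sL b (\<lambda>b1 b0. tpt P U
        (Ra (L l1 x) (a'1 \<cdot> r2 \<cdot> h1) \<ast> Ra (L (l2 \<cdot> b1) x') (r3 \<cdot> h2)) (c0 \<bullet> t1 \<natural> l3 \<circ>\<^sub>B b0 \<circ>\<^sub>B b'))))))))"
  proof -
    \<comment> \<open>The tensor of the inner sum depends on \<open>c1\<close>, so the sum over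
      \<open>b\<close> has to pass the two sums one at a time, the second time under the
      binder.\<close>
    have "sL b (\<lambda>b1 b0. sR c (\<lambda>c0 c1. sD (k c1) (\<lambda>h1 h2. f b1 b0 c0 c1 h1 h2))) =
      sR c (\<lambda>c0 c1. sD (k c1) (\<lambda>h1 h2. sL b (\<lambda>b1 b0. f b1 b0 c0 c1 h1 h2)))" for c k f
      by (rule trans[OF sw_swap]) (rule arg_cong[of _ _ "sR c"], intro ext, rule sw_swap)
    note sw = this
    show ?thesis
      by (intro arg_cong[of _ _ "sX'"] arg_cong[of _ _ sl] arg_cong[of _ _ "sR a'"] ext, rule sw)
  qed
  also have "\<dots> = sR a' (\<lambda>a'0 a'1. sX' (\<lambda>r1 r2 r3. sR (a \<bullet> a'0 \<bullet> r1) (\<lambda>c0 c1. sX' (\<lambda>t1 t2 t3.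
      sD (Si (c1 \<cdot> t2 \<cdot> be \<cdot> S t3)) (\<lambda>h1 h2. F (c0 \<bullet> t1) (a'1 \<cdot> r2 \<cdot> h1) (r3 \<cdot> h2))))))"
    by (simp only: F_def sw_sw3_swap)
  also have "\<dots> = sR a (\<lambda>a0 a1. sX' (\<lambda>t1 t2 t3. sX (\<lambda>X1 X2 X3. sR (a0 \<bullet> t1) (\<lambda>c0 c1. sR a' (\<lambda>a'0 a'1. sX' (\<lambda>s1 s2 s3.
      sw H H twist (\<lambda>f1 f2. F (X1 \<bullet> c0 \<bullet> (a'0 \<bullet> s1)) (Si (f2 \<cdot> X3 \<cdot> (a1 \<cdot> t2 \<cdot> be \<cdot> S t3)))
        (Si (f1 \<cdot> X2 \<cdot> c1 \<cdot> (a'1 \<cdot> s2 \<cdot> be \<cdot> S s3))))))))))"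
    by (rule twist_mult_inv[OF Ft])
  \<comment> \<open>The reverse rearrangement, towards the order of summation in
    \<open>N_tpt\<close>.\<close>
  also have "\<dots> = sX' (\<lambda>t1 t2 t3. sX' (\<lambda>s1 s2 s3. sX (\<lambda>X1 X2 X3. sl (\<lambda>l1 l2 l3. sR a (\<lambda>a0 a1. sR (a0 \<bullet> t1) (\<lambda>c0 c1. sR a' (\<lambda>a'0 a'1.
      sw H H twist (\<lambda>f1 f2. sL b (\<lambda>b1 b0.
    tpt P U (Ra (L l1 x) (Si (f2 \<cdot> X3 \<cdot> (a1 \<cdot> t2 \<cdot> be \<cdot> S t3))) \<ast>
      Ra (L (l2 \<cdot> b1) x') (Si (f1 \<cdot> X2 \<cdot> c1 \<cdot> (a'1 \<cdot> s2 \<cdot> be \<cdot> S s3))))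
      (X1 \<bullet> c0 \<bullet> (a'0 \<bullet> s1) \<natural> l3 \<circ>\<^sub>B b0 \<circ>\<^sub>B b'))))))))))"
    by (simp only: F_def sw_sw3_swap) (rule arg_cong[of _ _ sX'], intro ext, rule sw3_swap)
  also have "\<dots> = sX' (\<lambda>t1 t2 t3. sX' (\<lambda>s1 s2 s3. sX (\<lambda>X1 X2 X3. sl (\<lambda>l1 l2 l3. sR a (\<lambda>a0 a1. sR a' (\<lambda>a'0 a'1.
      sw H H twist (\<lambda>f1 f2. sR (a0 \<bullet> t1) (\<lambda>c0 c1. sL b (\<lambda>b1 b0.
    tpt P U (Ra (L l1 x) (Si (f2 \<cdot> X3 \<cdot> (a1 \<cdot> t2 \<cdot> be \<cdot> S t3))) \<ast>
      Ra (L (l2 \<cdot> b1) x') (Si (f1 \<cdot> X2 \<cdot> c1 \<cdot> (a'1 \<cdot> s2 \<cdot> be \<cdot> S s3))))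
      (X1 \<bullet> c0 \<bullet> (a'0 \<bullet> s1) \<natural> l3 \<circ>\<^sub>B b0 \<circ>\<^sub>B b'))))))))))"
  proof -
    have "sR c (\<lambda>c0 c1. sR a' (\<lambda>a'0 a'1. sw H H t (\<lambda>f1 f2. f c0 c1 a'0 a'1 f1 f2))) =
      sR a' (\<lambda>a'0 a'1. sw H H t (\<lambda>f1 f2. sR c (\<lambda>c0 c1. f c0 c1 a'0 a'1 f1 f2)))" for c t f
      by (rule trans[OF sw_swap]) (rule arg_cong[of _ _ "sR a'"], intro ext, rule sw_swap)
    note sw = this
    show ?thesis
      by (intro arg_cong[of _ _ "sX'"] arg_cong[of _ _ sX] arg_cong[of _ _ sl] arg_cong[of _ _ "sR a"] ext, rule sw)
  qed
  also have "\<dots> = sR a (\<lambda>a0 a1. sX' (\<lambda>t1 t2 t3. sR a' (\<lambda>a'0 a'1. sX' (\<lambda>s1 s2 s3.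
      N (Ra x (Si (a1 \<cdot> t2 \<cdot> be \<cdot> S t3))) (a0 \<bullet> t1 \<natural> b) (Ra x' (Si (a'1 \<cdot> s2 \<cdot> be \<cdot> S s3))) (a'0 \<bullet> s1 \<natural> b')))))"
    by (simp only: N_tpt act_act Si_mult[symmetric] assoc tmul_assoc[OF kA] sw_sw3_swap)
  also have "\<dots> = sw P U (th a x b) (\<lambda>y w. sw P U (th a' x' b') (\<lambda>y' w'. N y w y' w'))"
    by (subst sw_th[OF Nb(1)]) (simp only: sw_th[OF Nb(2)])
  finally show ?thesis .
qed

lemma Th_mult:
  assumes s: "s \<in> carrier T" and t: "t \<in> carrier T"
  shows "Th (s \<otimes>\<^bsub>C1\<^esub> t) = Th s \<otimes>\<^bsub>C2\<^esub> Th t"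
proof -
  have Nb: "bilin (scl P) (scl U) (scl (P \<boxtimes> U)) (\<lambda>y w. sw P U t (\<lambda>y' w'. N y w y' w'))"
    "bilin (scl P) (scl U) (scl (P \<boxtimes> U)) (\<lambda>y' w'. N y w y' w')" for t y w
    by (rule sU sPP vs_scl lins)+
  have "Th (s \<otimes>\<^bsub>C1\<^esub> t) = sw3 A P B s (\<lambda>a x b. sw3 A P B t (\<lambda>a' x' b'. sw3 A P B (M a x b a' x' b') th))"
    unfolding Th_def C1_mult[OF s t]
    by (subst sw3_sw3[OF sA sPP sB th_trilin s sw3_closed[OF sT t M_closed]])
      (simp only: sw3_sw3[OF sA sPP sB th_trilin t M_closed])
  also have "\<dots> = sw3 A P B s (\<lambda>a x b. sw3 A P B t (\<lambda>a' x' b'.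
      sw P U (th a x b) (\<lambda>y w. sw P U (th a' x' b') (\<lambda>y' w'. N y w y' w'))))"
    by (simp only: Th_mult_pure)
  also have "\<dots> = sw3 A P B s (\<lambda>a x b. sw P U (th a x b) (\<lambda>y w. sw P U (Th t) (\<lambda>y' w'. N y w y' w')))"
    unfolding Th_def by (simp only: sw_sw3[OF sPP sU Nb(2) t th_closed] sw_sw3_swap)
  also have "\<dots> = Th s \<otimes>\<^bsub>C2\<^esub> Th t"
    unfolding C2_mult[OF Th_closed[OF s] Th_closed[OF t]]
    by (subst (2) Th_def) (rule sw_sw3[OF sPP sU Nb(1) s th_closed, symmetric])
  finally show ?thesis .
qed

lemma \<epsilon>_Si: "\<epsilon> (Si h) = \<epsilon> h"
proof -
  have "counit H (antipode H x) = counit H x" if "x \<in> carrier H" for x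
    using qh that by (simp add: quasi_hopf_algebra_def Let_def)
  from this[OF Si_closed[of h]] have "\<epsilon> (S (Si h)) = \<epsilon> (Si h)"
    using S_closed[of "Si h"] Si_closed[of h] by (simp add: tap_eq[OF sH, where f = "counit H"] S_eq)
  then show ?thesis by (simp only: S_Si \<epsilon>_pr)
qed

lemma \<epsilon>_S: "\<epsilon> (S h) = \<epsilon> h"
  using \<epsilon>_Si[of "S h"] by (simp only: Si_S \<epsilon>_pr)

lemma \<epsilon>_be: "\<epsilon> be = 1"
  using qh be_closed by (simp add: tap_eq[OF sH, where f = "counit H"] quasi_hopf_algebra_def Let_def)

text \<open>On the unit of \<open>P\<close> the right action is multiplication by \<epsilon>. As
  \<epsilon> is invariant under S and S^{-1} and \<epsilon>(\<beta>) = 1, the second leg of p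
  contributes \<epsilon>(t^2) \<epsilon>(t^3), and the counit property of the inverse of
  \<Phi>\<rho> leaves units.\<close>

lemma Th_one: "Th \<one>\<^bsub>C1\<^esub> = \<one>\<^bsub>C2\<^esub>"
proof -
  have one_mem: "\<one>\<^bsub>A\<^esub> \<in> carrier A" "\<one>\<^bsub>B\<^esub> \<in> carrier B" "\<one>\<^bsub>U\<^esub> \<in> carrier U"
    by (rule monoid.one_closed[OF kalgebraD(2)[OF kA]] monoid.one_closed[OF kalgebraD(2)[OF kB]]
      monoid.one_closed[OF kalgebraD(2)[OF kU]])+
  interpret V: vector_space "scl (P \<boxtimes> U)" by (rule vs_scl[OF sPU])
  have sc: "tpt P U (scl P c y) w = scl (P \<boxtimes> U) c (tpt P U y w)" for c y w
    using linD(4)[OF tpt_lin(1)[OF sPP sU lin_id[OF vs_scl[OF sPP]]]] .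
  have "Th \<one>\<^bsub>C1\<^esub> = th \<one>\<^bsub>A\<^esub> \<one>\<^bsub>P\<^esub> \<one>\<^bsub>B\<^esub>"
    by (simp only: Th_def C1_simps sw3_pt3[OF sA sPP sB th_trilin one_mem(1) oneP_closed one_mem(2)])
  also have "\<dots> = sX' (\<lambda>t1 t2 t3. tpt P U (Ra \<one>\<^bsub>P\<^esub> (Si (uH \<cdot> t2 \<cdot> be \<cdot> S t3))) (\<one>\<^bsub>A\<^esub> \<bullet> t1 \<natural> \<one>\<^bsub>B\<^esub>))"
    unfolding th_def by (rule R_one[where s = "scl (P \<boxtimes> U)"]) (rule sU lins)+
  also have "\<dots> = sX' (\<lambda>t1 t2 t3. scl (P \<boxtimes> U) (\<epsilon> t2) (scl (P \<boxtimes> U) (\<epsilon> t3) (tpt P U \<one>\<^bsub>P\<^esub> (t1 \<natural> \<one>\<^bsub>B\<^esub>))))"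
    by (simp add: Ra_oneP sc \<epsilon>_Si \<epsilon>_mult \<epsilon>_one \<epsilon>_be \<epsilon>_S tmul_one[OF kA] tpt_pr(1)[OF sA])
  also have "\<dots> = scl (P \<boxtimes> U) (\<epsilon> uH) (tpt P U \<one>\<^bsub>P\<^esub> (\<one>\<^bsub>A\<^esub> \<natural> \<one>\<^bsub>B\<^esub>))"
    by (rule X_counit(3)) (rule sU vs_scl[OF sPU] lins)+
  also have "\<dots> = \<one>\<^bsub>C2\<^esub>"
    by (simp only: \<epsilon>_one V.scale_one C2_simps oneU[symmetric] tpt_pt[OF sPP sU oneP_closed one_mem(3)])
  finally show ?thesis .
qed

lemma Th_klin: "klin T (P \<boxtimes> U) Th"
proof -
  have "klin (A \<boxtimes> P \<boxtimes> B) (tgt (scl (P \<boxtimes> U))) (\<lambda>t. sw (A \<boxtimes> P) B t (\<lambda>r z. sw A P (pr (A \<boxtimes> P) r) (\<lambda>x y. th x y z)))"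
    by (rule sw_klin[OF kspace_tensor[OF sA] sB sw3_bilin[OF sA sPP sB th_trilin]])
  then show ?thesis
    unfolding klin_def using Th_closed kspaceD(3,4)[OF sT]
    by (simp add: Th_def sw3_eq[OF sA sPP sB])
qed

theorem crossed_isomorphic: "kalg_isomorphic C1 C2"
  unfolding kalg_isomorphic_def
proof (rule bexI[of _ Th])
  show "bij_betw Th (carrier C1) (carrier C2)"
    unfolding C1_simps C2_simps
    by (rule bij_betw_byWitness[where f' = Ps]) (use Th_Ps Ps_Th Th_closed Ps_closed in auto)
  have "klin C1 C2 Th" using Th_klin by (simp add: klin_def C1_simps C2_simps)
  moreover have "Th \<in> hom C1 C2" unfolding hom_def C1_simps C2_simps using Th_mult Th_closed by auto
  ultimately show "Th \<in> kalg_hom C1 C2" by (simp add: kalg_hom_def Th_one)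
qed

end

theorem proposition6p1:
  fixes H :: "('k::field, 'h::ab_group_add) qhopf"
    and P :: "('k, 'p::ab_group_add, 'h) bimod_alg"
    and A :: "('k, 'a::ab_group_add) kalg"
    and B :: "('k, 'b::ab_group_add) kalg"
    and \<rho> :: "'a \<Rightarrow> ('a, 'h, 'k) tens" and \<Phi>\<rho> :: "(('a, 'h, 'k) tens, 'h, 'k) tens"
    and lam :: "'b \<Rightarrow> ('h, 'b, 'k) tens" and \<Phi>l :: "(('h, 'h, 'k) tens, 'b, 'k) tens"
  assumes "quasi_hopf_algebra H"
    and "bimodule_algebra H P"
    and "right_comodule_algebra H A \<rho> \<Phi>\<rho>"
    and "left_comodule_algebra H B lam \<Phi>l"
  shows "kalg_isomorphic
    (two_sided_crossed_product H A \<rho> \<Phi>\<rho> P B lam \<Phi>l)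
    (diag_crossed_product H P (A \<boxtimes> B)
       (tensor_lcoact H A B lam) (tensor_rcoact H A B \<rho>)
       (tensor_lreassoc H A B \<Phi>l) (tensor_rreassoc H A B \<Phi>\<rho>) (tensor_lrreassoc H A B))"
proof -
  have "quasi_bialgebra H" using assms(1) by (simp add: quasi_hopf_algebra_def Let_def)
  with assms interpret crossed H A \<rho> \<Phi>\<rho> P B lam \<Phi>l
    by unfold_locales
  show ?thesis by (rule crossed_isomorphic)
qed

end
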